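(* Let $\mathbf{k}$ be a field of characteristic $p>0$. If $\Lambda$ is a symmetric (finite dimensional) $\mathbf{k}$-algebra, then $\mathrm{HK}^0_r(\Lambda)=K_r\Lambda$ for any $r\ge0$. In particular, $\mathrm{HR}^0(\Lambda)=R\Lambda$ is the socle of the algebra $\Lambda$.
   Context: A finite dimensional algebra $\Lambda$ is symmetric if there is a nondegenerate bilinear form $(,):\Lambda\times\Lambda\to\mathbf{k}$ with $(ab,c)=(a,bc)$ and $(a,b)=(b,a)$ for all $a,b,c\in\Lambda$. $[\Lambda,\Lambda]$ is the $\mathbf{k}$-span of the commutators $ab-ba$; $\mathrm{Z}(\Lambda)$ is the center of $\Lambda$. $K_r\Lambda=\{a\in\mathrm{Z}(\Lambda)\mid ab\in[\Lambda,\Lambda]\text{ for all }b\in\Lambda\text{ with }b^{p^r}\in[\Lambda,\Lambda]\}$ and $R\Lambda=\cap_{r\ge0}K_r\Lambda$. Categories are $\mathbf{k}$-linear and (up to the usual set-theoretic conventions) small; $\mathrm{B}_x^y=\mathrm{Hom}_{\mathrm{B}}(x,y)$. $\mathrm{D}\Lambda$ is the derived category of right $\Lambda$-modules, $\mathrm{K}^b_p\Lambda$ its full subcategory of objects isomorphic to bounded complexes of finitely generated projective modules, with the shift automorphism $[1]$. The graded center $\mathrm{Z}^*(\mathrm{K}^b_p\Lambda)$ has in degree $n$ the natural transformations $\eta:\mathrm{Id}\to[n]$ with $\eta_{X[1]}=(-1)^n\eta_X[1]$. Characteristic homomorphism: $\mathrm{HH}^*(\Lambda)\cong\oplus_{n\ge0}\mathrm{Hom}_{\mathrm{D}(\Lambda^{op}\otimes\Lambda)}(\Lambda,\Lambda[n])$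 and $\chi_\Lambda:\mathrm{HH}^*(\Lambda)\to\mathrm{Z}^*(\mathrm{K}^b_p\Lambda)$ is the homomorphism of graded algebras with $\chi_\Lambda(f)_X=\mathrm{Id}_X\otimes^L_\Lambda f:X\cong X\otimes^L_\Lambda\Lambda\to X\otimes^L_\Lambda\Lambda[n]\cong X[n]$. One has $\mathrm{HH}^0(\Lambda)=\mathrm{Z}(\Lambda)$, and $\chi_\Lambda(z)_X$ is multiplication by $z$ for $z\in\mathrm{Z}(\Lambda)$. Orbit category $\mathrm{B}=\mathrm{K}^b_p\Lambda/[1]$: graded category with the objects of $\mathrm{K}^b_p\Lambda$, $(\mathrm{B}_X^Y)_n=\mathrm{Hom}_{\mathrm{K}^b_p\Lambda}(X,Y[n])$, composition $g\circ f=g[n]\,f$ for $f$ of degree $n$. Its center $\mathrm{B}^{\mathrm{B}}$ has $i$-th component the families $(m_X)\in\prod_X(\mathrm{B}_X^X)_i$ with $f\circ m_X=(-1)^{ij}m_Y\circ f$ for $f\in(\mathrm{B}_X^Y)_j$; it is identified with $\mathrm{Z}^*(\mathrm{K}^b_p\Lambda)$ via $\eta\leftrightarrow(\eta_X)_X$. Its abelianization is $\mathrm{B}_{\mathrm{B}}=\oplus_X\mathrm{B}_X^X/[\mathrm{B},\mathrm{B}]$ with $[\mathrm{B},\mathrm{B}]$ spanned by $f\circ u-(-1)^{ij}u\circ f$ for $u\in(\mathrm{B}_X^Y)_i$, $f\in(\mathrm{B}_Y^X)_j$; it is a graded $\mathrm{B}^{\mathrm{B}}$-bimodule. The map $\xi_p(\sum_nf_n)=\sum_nf_n^p$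 ($f_n$ homogeneous of degree $n$) is well defined on $\mathrm{B}_{\mathrm{B}}$; $T_r\mathrm{B}=\ker\xi_p^r$. $K_r\mathrm{B}=\{a\in\mathrm{B}^{\mathrm{B}}\mid a\,T_r\mathrm{B}=T_r\mathrm{B}\,a=0\}$ and $R\mathrm{B}=\cap_{r\ge0}K_r\mathrm{B}$. $\mathrm{HK}^*_r(\Lambda)=\chi_\Lambda^{-1}(K_r\mathrm{B})$ and $\mathrm{HR}^*(\Lambda)=\chi_\Lambda^{-1}(R\mathrm{B})$ with $\mathrm{B}=\mathrm{K}^b_p\Lambda/[1]$; $\mathrm{HK}^0_r(\Lambda)$, $\mathrm{HR}^0(\Lambda)$ are their degree $0$ components, contained in $\mathrm{HH}^0(\Lambda)=\mathrm{Z}(\Lambda)$.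
   Formalization: "RΛ is the socle of Λ" is proved as RΛ = soc(Λ) ∩ Z(Λ); the literal equality fails for Λ = M₂(k), where RΛ = k but soc(Λ) = M₂(k), and it follows from the proved form whenever the socle is central. *)

theory Defs
  imports Complex_Main "HOL-Algebra.AbelCoset" "HOL-Algebra.Module"
begin

section \<open>Symmetric algebras\<close>

text \<open>The algebra is a type of sort \<open>{ring, monoid_mult}\<close>, that is, a unital ring in which
  \<open>1 = 0\<close> is allowed, together with a scalar multiplication by the field.\<close>

locale fd_algebra = vector_space scale
  for scale :: "'k::field \<Rightarrow> 'a::{ring,monoid_mult} \<Rightarrow> 'a" +
  assumes scale_mult_left: "scale c (a * b) = scale c a * b"
    and scale_mult_right: "scale c (a * b) = a * scale c b"
    and finite_dim: "\<exists>S. finite S \<and> span S = UNIV"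

locale symmetric_algebra = fd_algebra scale
  for scale :: "'k::field \<Rightarrow> 'a::{ring,monoid_mult} \<Rightarrow> 'a" +
  assumes symmetrizing_form:
    "\<exists>\<beta> :: 'a \<Rightarrow> 'a \<Rightarrow> 'k.
       (\<forall>a. Vector_Spaces.linear scale (*) (\<lambda>b. \<beta> a b)) \<and>
       (\<forall>b. Vector_Spaces.linear scale (*) (\<lambda>a. \<beta> a b)) \<and>
       (\<forall>a. (\<forall>b. \<beta> a b = 0) \<longrightarrow> a = 0) \<and>
       (\<forall>b. (\<forall>a. \<beta> a b = 0) \<longrightarrow> b = 0) \<and>
       (\<forall>a b c. \<beta> (a * b) c = \<beta> a (b * c)) \<and>
       (\<forall>a b. \<beta> a b = \<beta> b a)"

definition alg_center :: "'a::{ring,monoid_mult} set" where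
  "alg_center = {z. \<forall>a. z * a = a * z}"

definition commutator_space :: "('k::field \<Rightarrow> 'a::{ring,monoid_mult} \<Rightarrow> 'a) \<Rightarrow> 'a set" where
  "commutator_space scale = module.span scale {a * b - b * a | a b. True}"

definition K_alg :: "('k::field \<Rightarrow> 'a::{ring,monoid_mult} \<Rightarrow> 'a) \<Rightarrow> nat \<Rightarrow> nat \<Rightarrow> 'a set" where
  "K_alg scale p r = {a \<in> alg_center.
     \<forall>b. b ^ (p ^ r) \<in> commutator_space scale \<longrightarrow> a * b \<in> commutator_space scale}"

definition R_alg :: "('k::field \<Rightarrow> 'a::{ring,monoid_mult} \<Rightarrow> 'a) \<Rightarrow> nat \<Rightarrow> 'a set" where
  "R_alg scale p = (\<Inter>r. K_alg scale p r)"

definition right_ideal :: "'a::{ring,monoid_mult} set \<Rightarrow> bool" where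
  "right_ideal I \<longleftrightarrow>
     0 \<in> I \<and> (\<forall>x\<in>I. \<forall>y\<in>I. x - y \<in> I) \<and> (\<forall>x\<in>I. \<forall>a. x * a \<in> I)"

definition minimal_right_ideal :: "'a::{ring,monoid_mult} set \<Rightarrow> bool" where
  "minimal_right_ideal I \<longleftrightarrow>
     right_ideal I \<and> I \<noteq> {0} \<and> (\<forall>J. right_ideal J \<and> J \<subseteq> I \<longrightarrow> J = {0} \<or> J = I)"

text \<open>The sum of the minimal right ideals; for a symmetric algebra it agrees with the left socle.\<close>

definition alg_socle :: "('k::field \<Rightarrow> 'a::{ring,monoid_mult} \<Rightarrow> 'a) \<Rightarrow> 'a set" where
  "alg_socle scale = module.span scale (\<Union>{I. minimal_right_ideal I})"


section \<open>Graded linear categories, their center and abelianization\<close>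

text \<open>Hom spaces are given as \<open>module\<close> records, of which the fields \<open>mult\<close> and \<open>one\<close> are junk.
  In \<open>gCmp B X Y Z i j g f\<close> the morphism \<open>f\<close> from \<open>X\<close> to \<open>Y\<close> has degree \<open>i\<close>, the morphism \<open>g\<close>
  from \<open>Y\<close> to \<open>Z\<close> has degree \<open>j\<close>, and the result is \<open>g \<circ> f\<close>.\<close>

record ('o, 'f, 'k) gcat =
  gObj :: "'o set"
  gHom :: "'o \<Rightarrow> 'o \<Rightarrow> int \<Rightarrow> ('k, 'f) module"
  gCmp :: "'o \<Rightarrow> 'o \<Rightarrow> 'o \<Rightarrow> int \<Rightarrow> int \<Rightarrow> 'f \<Rightarrow> 'f \<Rightarrow> 'f"
  gId :: "'o \<Rightarrow> 'f"

text \<open>\<open>sgn_pow M n x\<close> is $(-1)^n x$.\<close>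

definition sgn_pow :: "('r, 'm) module \<Rightarrow> int \<Rightarrow> 'm \<Rightarrow> 'm" where
  "sgn_pow M n x = (if even n then x else \<ominus>\<^bsub>M\<^esub> x)"

definition center_component :: "('o, 'f, 'k) gcat \<Rightarrow> int \<Rightarrow> ('o \<Rightarrow> 'f) set" where
  "center_component B i =
     {m \<in> (\<Pi>\<^sub>E X\<in>gObj B. carrier (gHom B X X i)).
        \<forall>X\<in>gObj B. \<forall>Y\<in>gObj B. \<forall>j. \<forall>f\<in>carrier (gHom B X Y j).
          gCmp B X X Y i j f (m X) =
          sgn_pow (gHom B X Y (i + j)) (i * j) (gCmp B X Y Y j i (m Y) f)}"

text \<open>The center is the direct sum of its components: \<open>a i\<close> is the component of \<open>a\<close> of degree \<open>i\<close>.\<close>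

definition gcenter :: "('o, 'f, 'k) gcat \<Rightarrow> (int \<Rightarrow> 'o \<Rightarrow> 'f) set" where
  "gcenter B = {a. (\<forall>i. a i \<in> center_component B i) \<and>
     finite {i. \<exists>X\<in>gObj B. a i X \<noteq> \<zero>\<^bsub>gHom B X X i\<^esub>}}"

text \<open>The direct sum of the graded spaces of endomorphisms over all objects; \<open>m (X, n)\<close> is the component at
  \<open>X\<close> of degree \<open>n\<close>.\<close>

definition endo_sum :: "('o, 'f, 'k) gcat \<Rightarrow> ('k, 'o \<times> int \<Rightarrow> 'f) module" where
  "endo_sum B = \<lparr>
     carrier = {m \<in> (\<Pi>\<^sub>E (X, n)\<in>gObj B \<times> UNIV. carrier (gHom B X X n)).
       finite {(X, n). X \<in> gObj B \<and> m (X, n) \<noteq> \<zero>\<^bsub>gHom B X X n\<^esub>}},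
     mult = undefined,
     one = undefined,
     zero = (\<lambda>(X, n)\<in>gObj B \<times> UNIV. \<zero>\<^bsub>gHom B X X n\<^esub>),
     add = (\<lambda>m m'. \<lambda>(X, n)\<in>gObj B \<times> UNIV. m (X, n) \<oplus>\<^bsub>gHom B X X n\<^esub> m' (X, n)),
     smult = (\<lambda>c m. \<lambda>(X, n)\<in>gObj B \<times> UNIV. c \<odot>\<^bsub>gHom B X X n\<^esub> m (X, n))\<rparr>"

definition endo_single :: "('o, 'f, 'k) gcat \<Rightarrow> 'o \<Rightarrow> int \<Rightarrow> 'f \<Rightarrow> ('o \<times> int \<Rightarrow> 'f)" where
  "endo_single B X n f = (\<lambda>(Y, k)\<in>gObj B \<times> UNIV.
     if Y = X \<and> k = n then f else \<zero>\<^bsub>gHom B Y Y k\<^esub>)"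

inductive_set gbracket :: "('o, 'f, 'k) gcat \<Rightarrow> ('o \<times> int \<Rightarrow> 'f) set"
  for B :: "('o, 'f, 'k) gcat" where
  commutator: "\<lbrakk>X \<in> gObj B; Y \<in> gObj B; u \<in> carrier (gHom B X Y i); f \<in> carrier (gHom B Y X j)\<rbrakk> \<Longrightarrow>
    endo_single B X (i + j) (gCmp B X Y X i j f u) \<ominus>\<^bsub>endo_sum B\<^esub>
    sgn_pow (endo_sum B) (i * j) (endo_single B Y (i + j) (gCmp B Y X Y j i u f)) \<in> gbracket B"
| zero: "\<zero>\<^bsub>endo_sum B\<^esub> \<in> gbracket B"
| add: "\<lbrakk>m \<in> gbracket B; m' \<in> gbracket B\<rbrakk> \<Longrightarrow> m \<oplus>\<^bsub>endo_sum B\<^esub> m' \<in> gbracket B"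
| smult: "m \<in> gbracket B \<Longrightarrow> c \<odot>\<^bsub>endo_sum B\<^esub> m \<in> gbracket B"

definition abelianization :: "('o, 'f, 'k) gcat \<Rightarrow> ('o \<times> int \<Rightarrow> 'f) set set" where
  "abelianization B = a_rcosets\<^bsub>endo_sum B\<^esub> (gbracket B)"

primrec gpow :: "('o, 'f, 'k) gcat \<Rightarrow> 'o \<Rightarrow> int \<Rightarrow> 'f \<Rightarrow> nat \<Rightarrow> 'f" where
  "gpow B X n f 0 = gId B X"
| "gpow B X n f (Suc q) = gCmp B X X X n (int q * n) (gpow B X n f q) f"

text \<open>For \<open>p > 0\<close>, the component of degree \<open>k\<close> of $\sum_n f_n^p$ is $f_{k/p}^p$ if \<open>p\<close> divides \<open>k\<close>,
  and \<open>0\<close> otherwise.\<close>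

definition endo_power :: "('o, 'f, 'k) gcat \<Rightarrow> nat \<Rightarrow> ('o \<times> int \<Rightarrow> 'f) \<Rightarrow> ('o \<times> int \<Rightarrow> 'f)" where
  "endo_power B p m = (\<lambda>(X, k)\<in>gObj B \<times> UNIV.
     if int p dvd k then gpow B X (k div int p) (m (X, k div int p)) p else \<zero>\<^bsub>gHom B X X k\<^esub>)"

text \<open>Maps induced on cosets are written as unions over the representatives; all the members of such
  a union coincide when the map is well defined.\<close>

definition \<xi> :: "('o, 'f, 'k) gcat \<Rightarrow> nat \<Rightarrow> ('o \<times> int \<Rightarrow> 'f) set \<Rightarrow> ('o \<times> int \<Rightarrow> 'f) set" where
  "\<xi> B p C = (\<Union>m\<in>C. gbracket B +>\<^bsub>endo_sum B\<^esub> endo_power B p m)"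

text \<open>The zero of the abelianization is the coset \<open>gbracket B\<close>.\<close>

definition T_cat :: "('o, 'f, 'k) gcat \<Rightarrow> nat \<Rightarrow> nat \<Rightarrow> ('o \<times> int \<Rightarrow> 'f) set set" where
  "T_cat B p r = {C \<in> abelianization B. (\<xi> B p ^^ r) C = gbracket B}"

definition endo_left :: "('o, 'f, 'k) gcat \<Rightarrow> (int \<Rightarrow> 'o \<Rightarrow> 'f) \<Rightarrow> ('o \<times> int \<Rightarrow> 'f) \<Rightarrow> ('o \<times> int \<Rightarrow> 'f)" where
  "endo_left B a m = (\<lambda>(X, n)\<in>gObj B \<times> UNIV.
     \<Oplus>\<^bsub>gHom B X X n\<^esub>i\<in>{i. a i X \<noteq> \<zero>\<^bsub>gHom B X X i\<^esub>}. gCmp B X X X (n - i) i (a i X) (m (X, n - i)))"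

definition endo_right :: "('o, 'f, 'k) gcat \<Rightarrow> ('o \<times> int \<Rightarrow> 'f) \<Rightarrow> (int \<Rightarrow> 'o \<Rightarrow> 'f) \<Rightarrow> ('o \<times> int \<Rightarrow> 'f)" where
  "endo_right B m a = (\<lambda>(X, n)\<in>gObj B \<times> UNIV.
     \<Oplus>\<^bsub>gHom B X X n\<^esub>i\<in>{i. a i X \<noteq> \<zero>\<^bsub>gHom B X X i\<^esub>}. gCmp B X X X i (n - i) (m (X, n - i)) (a i X))"

definition left_act ::
    "('o, 'f, 'k) gcat \<Rightarrow> (int \<Rightarrow> 'o \<Rightarrow> 'f) \<Rightarrow> ('o \<times> int \<Rightarrow> 'f) set \<Rightarrow> ('o \<times> int \<Rightarrow> 'f) set" where
  "left_act B a C = (\<Union>m\<in>C. gbracket B +>\<^bsub>endo_sum B\<^esub> endo_left B a m)"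

definition right_act ::
    "('o, 'f, 'k) gcat \<Rightarrow> ('o \<times> int \<Rightarrow> 'f) set \<Rightarrow> (int \<Rightarrow> 'o \<Rightarrow> 'f) \<Rightarrow> ('o \<times> int \<Rightarrow> 'f) set" where
  "right_act B C a = (\<Union>m\<in>C. gbracket B +>\<^bsub>endo_sum B\<^esub> endo_right B m a)"

definition K_cat :: "('o, 'f, 'k) gcat \<Rightarrow> nat \<Rightarrow> nat \<Rightarrow> (int \<Rightarrow> 'o \<Rightarrow> 'f) set" where
  "K_cat B p r = {a \<in> gcenter B.
     \<forall>C\<in>T_cat B p r. left_act B a C = gbracket B \<and> right_act B C a = gbracket B}"

definition R_cat :: "('o, 'f, 'k) gcat \<Rightarrow> nat \<Rightarrow> (int \<Rightarrow> 'o \<Rightarrow> 'f) set" where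
  "R_cat B p = (\<Inter>r. K_cat B p r)"


section \<open>Linear categories and orbit categories\<close>

record ('o, 'f, 'k) lincat =
  Obj :: "'o set"
  Hom :: "'o \<Rightarrow> 'o \<Rightarrow> ('k, 'f) module"
  Cmp :: "'o \<Rightarrow> 'o \<Rightarrow> 'o \<Rightarrow> 'f \<Rightarrow> 'f \<Rightarrow> 'f"
  Idt :: "'o \<Rightarrow> 'f"

definition isomorphic_in :: "('o, 'f, 'k) lincat \<Rightarrow> 'o \<Rightarrow> 'o \<Rightarrow> bool" where
  "isomorphic_in C X Y \<longleftrightarrow> (\<exists>f\<in>carrier (Hom C X Y). \<exists>g\<in>carrier (Hom C Y X).
     Cmp C X Y X g f = Idt C X \<and> Cmp C Y X Y f g = Idt C Y)"

text \<open>\<open>sO n\<close> and \<open>sM n\<close> are the \<open>n\<close>-th power of an automorphism on objects and on morphisms.\<close>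

definition orbit_category ::
    "('o, 'f, 'k) lincat \<Rightarrow> (int \<Rightarrow> 'o \<Rightarrow> 'o) \<Rightarrow> (int \<Rightarrow> 'f \<Rightarrow> 'f) \<Rightarrow> ('o, 'f, 'k) gcat" where
  "orbit_category C sO sM = \<lparr>
     gObj = Obj C,
     gHom = (\<lambda>X Y n. Hom C X (sO n Y)),
     gCmp = (\<lambda>X Y Z i j g f. Cmp C X (sO i Y) (sO (i + j) Z) (sM i g) f),
     gId = Idt C\<rparr>"


section \<open>Complexes of right modules\<close>

text \<open>A right module over the ring \<open>'a\<close> is a \<open>module\<close> record over \<open>'a\<close>, with \<open>a \<odot> x\<close> standing for
  $x \cdot a$.\<close>

locale right_module = abelian_group M
  for M :: "('a::{ring,monoid_mult}, 'm) module" (structure) +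
  assumes smult_closed: "x \<in> carrier M \<Longrightarrow> a \<odot> x \<in> carrier M"
    and smult_l_distr: "x \<in> carrier M \<Longrightarrow> (a + b) \<odot> x = a \<odot> x \<oplus> b \<odot> x"
    and smult_r_distr: "\<lbrakk>x \<in> carrier M; y \<in> carrier M\<rbrakk> \<Longrightarrow> a \<odot> (x \<oplus> y) = a \<odot> x \<oplus> a \<odot> y"
    and smult_mult: "x \<in> carrier M \<Longrightarrow> (a * b) \<odot> x = b \<odot> (a \<odot> x)"
    and smult_one: "x \<in> carrier M \<Longrightarrow> 1 \<odot> x = x"

definition rmod_hom :: "('a, 'm) module \<Rightarrow> ('a, 'm) module \<Rightarrow> ('m \<Rightarrow> 'm) set" where
  "rmod_hom M N = {f \<in> carrier M \<rightarrow> carrier N.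
     (\<forall>x\<in>carrier M. \<forall>y\<in>carrier M. f (x \<oplus>\<^bsub>M\<^esub> y) = f x \<oplus>\<^bsub>N\<^esub> f y) \<and>
     (\<forall>a. \<forall>x\<in>carrier M. f (a \<odot>\<^bsub>M\<^esub> x) = a \<odot>\<^bsub>N\<^esub> f x)}"

definition fin_gen :: "('a, 'm) module \<Rightarrow> bool" where
  "fin_gen M \<longleftrightarrow> (\<exists>S. finite S \<and> S \<subseteq> carrier M \<and>
     (\<forall>N. additive_subgroup N M \<and> (\<forall>a. \<forall>x\<in>N. a \<odot>\<^bsub>M\<^esub> x \<in> N) \<and> S \<subseteq> N \<longrightarrow> N = carrier M))"

definition projective :: "('a::{ring,monoid_mult}, 'm) module \<Rightarrow> bool" where
  "projective P \<longleftrightarrow> right_module P \<and>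
     (\<forall>(M :: ('a, 'm) module) (N :: ('a, 'm) module) g h.
        right_module M \<and> right_module N \<and>
        g \<in> rmod_hom M N \<and> g ` carrier M = carrier N \<and> h \<in> rmod_hom P N \<longrightarrow>
        (\<exists>l\<in>rmod_hom P M. \<forall>x\<in>carrier P. g (l x) = h x))"

text \<open>Cochain complexes. The differentials are required to be extensional, so that
  $X[n][m] = X[m + n]$ and $X[0] = X$ hold as equalities.\<close>

record ('a, 'm) cplx =
  cmodule :: "int \<Rightarrow> ('a, 'm) module"
  cdif :: "int \<Rightarrow> 'm \<Rightarrow> 'm"

definition is_complex :: "('a::{ring,monoid_mult}, 'm) cplx \<Rightarrow> bool" where
  "is_complex X \<longleftrightarrow> (\<forall>i. right_module (cmodule X i) \<and>
     cdif X i \<in> rmod_hom (cmodule X i) (cmodule X (i + 1)) \<inter> extensional (carrier (cmodule X i)) \<and>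
     (\<forall>x\<in>carrier (cmodule X i). cdif X (i + 1) (cdif X i x) = \<zero>\<^bsub>cmodule X (i + 2)\<^esub>))"

definition chain_map :: "('a, 'm) cplx \<Rightarrow> ('a, 'm) cplx \<Rightarrow> (int \<Rightarrow> 'm \<Rightarrow> 'm) \<Rightarrow> bool" where
  "chain_map X Y f \<longleftrightarrow> (\<forall>i. f i \<in> rmod_hom (cmodule X i) (cmodule Y i) \<and>
     (\<forall>x\<in>carrier (cmodule X i). f (i + 1) (cdif X i x) = cdif Y i (f i x)))"

definition homotopic_maps ::
    "('a, 'm) cplx \<Rightarrow> ('a, 'm) cplx \<Rightarrow> (int \<Rightarrow> 'm \<Rightarrow> 'm) \<Rightarrow> (int \<Rightarrow> 'm \<Rightarrow> 'm) \<Rightarrow> bool" where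
  "homotopic_maps X Y f g \<longleftrightarrow> (\<exists>h.
     (\<forall>i. h i \<in> rmod_hom (cmodule X i) (cmodule Y (i - 1))) \<and>
     (\<forall>i. \<forall>x\<in>carrier (cmodule X i).
        f i x = g i x \<oplus>\<^bsub>cmodule Y i\<^esub> (cdif Y (i - 1) (h i x) \<oplus>\<^bsub>cmodule Y i\<^esub> h (i + 1) (cdif X i x))))"

definition cocycles :: "('a, 'm) cplx \<Rightarrow> int \<Rightarrow> 'm set" where
  "cocycles X i = {x \<in> carrier (cmodule X i). cdif X i x = \<zero>\<^bsub>cmodule X (i + 1)\<^esub>}"

definition coboundaries :: "('a, 'm) cplx \<Rightarrow> int \<Rightarrow> 'm set" where
  "coboundaries X i = cdif X (i - 1) ` carrier (cmodule X (i - 1))"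

definition cohomology_class :: "('a, 'm) cplx \<Rightarrow> int \<Rightarrow> 'm \<Rightarrow> 'm set" where
  "cohomology_class X i x = coboundaries X i +>\<^bsub>cmodule X i\<^esub> x"

definition cohomology :: "('a, 'm) cplx \<Rightarrow> int \<Rightarrow> 'm set set" where
  "cohomology X i = cohomology_class X i ` cocycles X i"

definition quasi_iso :: "('a, 'm) cplx \<Rightarrow> ('a, 'm) cplx \<Rightarrow> (int \<Rightarrow> 'm \<Rightarrow> 'm) \<Rightarrow> bool" where
  "quasi_iso X Y f \<longleftrightarrow> chain_map X Y f \<and>
     (\<forall>i. bij_betw (\<lambda>C. \<Union>x\<in>C. cohomology_class Y i (f i x)) (cohomology X i) (cohomology Y i))"

definition shift :: "int \<Rightarrow> ('a, 'm) cplx \<Rightarrow> ('a, 'm) cplx" where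
  "shift n X = \<lparr>
     cmodule = (\<lambda>i. cmodule X (i + n)),
     cdif = (\<lambda>i. \<lambda>x\<in>carrier (cmodule X (i + n)). sgn_pow (cmodule X (i + n + 1)) n (cdif X (i + n) x))\<rparr>"

definition strictly_perfect :: "('a::{ring,monoid_mult}, 'm) cplx \<Rightarrow> bool" where
  "strictly_perfect P \<longleftrightarrow> is_complex P \<and>
     (\<forall>i. projective (cmodule P i) \<and> fin_gen (cmodule P i)) \<and>
     finite {i. carrier (cmodule P i) \<noteq> {\<zero>\<^bsub>cmodule P i\<^esub>}}"


section \<open>The derived category\<close>

text \<open>The derived category is the localization of the homotopy category of complexes at the
  quasi-isomorphisms. A morphism from \<open>X\<close> to \<open>Y\<close> is a class of roofs \<open>(W, s, f)\<close>, where \<open>s\<close> is a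
  quasi-isomorphism from \<open>W\<close> to \<open>X\<close> and \<open>f\<close> is a chain map from \<open>W\<close> to \<open>Y\<close>. The modules have their carriers in
  the type \<open>'m\<close>, which plays the role of the universe that makes the category small.\<close>

type_synonym ('a, 'm) roof = "('a, 'm) cplx \<times> (int \<Rightarrow> 'm \<Rightarrow> 'm) \<times> (int \<Rightarrow> 'm \<Rightarrow> 'm)"

definition roofs :: "('a::{ring,monoid_mult}, 'm) cplx \<Rightarrow> ('a, 'm) cplx \<Rightarrow> ('a, 'm) roof set" where
  "roofs X Y = {(W, s, f). is_complex W \<and> quasi_iso W X s \<and> chain_map W Y f}"

definition roof_rel ::
    "('a::{ring,monoid_mult}, 'm) cplx \<Rightarrow> ('a, 'm) cplx \<Rightarrow> ('a, 'm) roof rel" where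
  "roof_rel X Y = {((W1, s1, f1), (W2, s2, f2)).
     (W1, s1, f1) \<in> roofs X Y \<and> (W2, s2, f2) \<in> roofs X Y \<and>
     (\<exists>W a b. is_complex W \<and> chain_map W W1 a \<and> chain_map W W2 b \<and>
        quasi_iso W X (\<lambda>i. s1 i \<circ> a i) \<and>
        homotopic_maps W X (\<lambda>i. s1 i \<circ> a i) (\<lambda>i. s2 i \<circ> b i) \<and>
        homotopic_maps W Y (\<lambda>i. f1 i \<circ> a i) (\<lambda>i. f2 i \<circ> b i))}"

definition roof_class ::
    "('a::{ring,monoid_mult}, 'm) cplx \<Rightarrow> ('a, 'm) cplx \<Rightarrow> ('a, 'm) roof \<Rightarrow> ('a, 'm) roof set" where
  "roof_class X Y \<rho> = roof_rel X Y `` {\<rho>}"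

text \<open>The image in the derived category of a chain map.\<close>

definition chain_class ::
    "('a::{ring,monoid_mult}, 'm) cplx \<Rightarrow> ('a, 'm) cplx \<Rightarrow> (int \<Rightarrow> 'm \<Rightarrow> 'm) \<Rightarrow> ('a, 'm) roof set" where
  "chain_class X Y f = roof_class X Y (X, (\<lambda>i x. x), f)"

text \<open>Two morphisms are added after representing them with a common denominator. The field acts on a right
  module through \<open>c \<mapsto> c \<cdot> 1\<close>.\<close>

definition derived_hom ::
    "('k::field \<Rightarrow> 'a::{ring,monoid_mult} \<Rightarrow> 'a) \<Rightarrow> ('a, 'm) cplx \<Rightarrow> ('a, 'm) cplx \<Rightarrow>
     ('k, ('a, 'm) roof set) module" where
  "derived_hom scale X Y = \<lparr>
     carrier = roofs X Y // roof_rel X Y,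
     mult = undefined,
     one = undefined,
     zero = chain_class X Y (\<lambda>i x. \<zero>\<^bsub>cmodule Y i\<^esub>),
     add = (\<lambda>\<phi> \<psi>. \<Union>{roof_class X Y (W, s, \<lambda>i x. f i x \<oplus>\<^bsub>cmodule Y i\<^esub> g i x) | W s f g.
       (W, s, f) \<in> \<phi> \<and> (W, s, g) \<in> \<psi>}),
     smult = (\<lambda>c \<phi>. \<Union>{roof_class X Y (W, s, \<lambda>i x. scale c 1 \<odot>\<^bsub>cmodule Y i\<^esub> f i x) | W s f.
       (W, s, f) \<in> \<phi>})\<rparr>"

definition derived_comp ::
    "('a::{ring,monoid_mult}, 'm) cplx \<Rightarrow> ('a, 'm) cplx \<Rightarrow> ('a, 'm) cplx \<Rightarrow>
     ('a, 'm) roof set \<Rightarrow> ('a, 'm) roof set \<Rightarrow> ('a, 'm) roof set" where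
  "derived_comp X Y Z \<psi> \<phi> =
     \<Union>{roof_class X Z (U, \<lambda>i. s i \<circ> a i, \<lambda>i. g i \<circ> b i) | U a b W s f V t g.
        (W, s, f) \<in> \<phi> \<and> (V, t, g) \<in> \<psi> \<and>
        is_complex U \<and> quasi_iso U W a \<and> chain_map U V b \<and>
        homotopic_maps U Y (\<lambda>i. f i \<circ> a i) (\<lambda>i. t i \<circ> b i)}"

definition derived_category ::
    "('k::field \<Rightarrow> 'a::{ring,monoid_mult} \<Rightarrow> 'a) \<Rightarrow>
     (('a, 'm) cplx, ('a, 'm) roof set, 'k) lincat" where
  "derived_category scale = \<lparr>
     Obj = {X. is_complex X},
     Hom = derived_hom scale,
     Cmp = derived_comp,
     Idt = (\<lambda>X. chain_class X X (\<lambda>i x. x))\<rparr>"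

definition shift_morphism :: "int \<Rightarrow> ('a, 'm) roof set \<Rightarrow> ('a, 'm) roof set" where
  "shift_morphism n \<phi> = (\<lambda>(W, s, f). (shift n W, \<lambda>i. s (i + n), \<lambda>i. f (i + n))) ` \<phi>"

definition perfect_category ::
    "('k::field \<Rightarrow> 'a::{ring,monoid_mult} \<Rightarrow> 'a) \<Rightarrow>
     (('a, 'm) cplx, ('a, 'm) roof set, 'k) lincat" where
  "perfect_category scale = (derived_category scale)\<lparr>Obj :=
     {X. is_complex X \<and> (\<exists>P. strictly_perfect P \<and> isomorphic_in (derived_category scale) X P)}\<rparr>"

definition perfect_orbit_category ::
    "('k::field \<Rightarrow> 'a::{ring,monoid_mult} \<Rightarrow> 'a) \<Rightarrow>
     (('a, 'm) cplx, ('a, 'm) roof set, 'k) gcat" where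
  "perfect_orbit_category scale = orbit_category (perfect_category scale) shift shift_morphism"


section \<open>The degree 0 part of the characteristic homomorphism\<close>

text \<open>$\mathrm{HH}^0$ is identified with the center of the algebra; the characteristic homomorphism
  sends \<open>z\<close> to the family of the multiplications by \<open>z\<close>, placed in degree \<open>0\<close>.\<close>

definition characteristic_hom0 ::
    "('k::field \<Rightarrow> 'a::{ring,monoid_mult} \<Rightarrow> 'a) \<Rightarrow> 'a \<Rightarrow>
     (int \<Rightarrow> ('a, 'm) cplx \<Rightarrow> ('a, 'm) roof set)" where
  "characteristic_hom0 scale z = (\<lambda>i. \<lambda>X\<in>gObj (perfect_orbit_category scale).
     if i = 0 then chain_class X X (\<lambda>j x. z \<odot>\<^bsub>cmodule X j\<^esub> x)
     else \<zero>\<^bsub>gHom (perfect_orbit_category scale) X X i\<^esub>)"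

definition HK0 ::
    "'m itself \<Rightarrow> ('k::field \<Rightarrow> 'a::{ring,monoid_mult} \<Rightarrow> 'a) \<Rightarrow> nat \<Rightarrow> nat \<Rightarrow> 'a set" where
  "HK0 _ scale p r = {z \<in> alg_center.
     (characteristic_hom0 scale z :: int \<Rightarrow> ('a, 'm) cplx \<Rightarrow> ('a, 'm) roof set)
       \<in> K_cat (perfect_orbit_category scale) p r}"

definition HR0 ::
    "'m itself \<Rightarrow> ('k::field \<Rightarrow> 'a::{ring,monoid_mult} \<Rightarrow> 'a) \<Rightarrow> nat \<Rightarrow> 'a set" where
  "HR0 _ scale p = {z \<in> alg_center.
     (characteristic_hom0 scale z :: int \<Rightarrow> ('a, 'm) cplx \<Rightarrow> ('a, 'm) roof set)
       \<in> R_cat (perfect_orbit_category scale) p}"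

end

theory Submission
  imports Defs "HOL-Library.Function_Algebras" "HOL-Computational_Algebra.Primes"
begin

text \<open>After a choice of resolutions and of dual bases, the perfect derived category becomes a category of complexes
  given by matrices over \<open>\<Lambda>\<close>: idempotents with a differential, with morphisms up to homotopy. The supertrace
  sends an endomorphism to $\Lambda/[\Lambda,\Lambda]$, kills supercommutators and is compatible with \<open>p\<close>-th powers.
  Composing it with the symmetrizing form gives a nondegenerate pairing, so a functional that vanishes on the
  bracket of the orbit category is given by a family that is natural up to homotopy. Hence if a central \<open>z\<close> kills the
  classes \<open>b\<close> with $b^{p^r} \in [\Lambda,\Lambda]$, it kills the elements of the abelianization annihilated by the \<open>r\<close>-th
  power map; the converse is seen on the object \<open>\<Lambda>\<close>.

  If \<open>z\<close> is in \<open>R\<Lambda>\<close> but not in the socle, a functional separating them has the form $(w, \cdot)$ with \<open>w\<close> annihilating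
  the socle; then \<open>w\<close> is nilpotent, so $zw \in [\Lambda,\Lambda]$ and $(w, z) = 0$, a contradiction. Conversely, a central
  element of the socle is a sum of central elements \<open>z\<close> that generate simple bimodules. For these, an idempotent bimodule
  operator \<open>e\<close> onto the center, expanded as $e = e^p$ modulo commutators of operators, shows that some $x^p$ is not a
  commutator modulo the annihilator of \<open>z\<close>; by semilinearity the \<open>p\<close>-th power map is then injective modulo commutators.\<close>

section \<open>Cyclic words and powers modulo commutators\<close>

text \<open>Two obstacles separate the category from the algebra. Morphisms are known only up to
  homotopy; this does no harm, because a boundary is a supercommutator with the differential and the
  supertrace kills it. Powers and commutators carry Koszul signs; the sign of rotating a word of p
  letters of equal degree is a power of (-1)^(p-1), which is trivial in characteristic p, also for p
  = 2. The condition defining \<open>K_alg\<close> concerns single elements b, while a class in the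
  abelianization is spread over objects and degrees. A separating functional selects one degree and
  condenses the class into one element T of the algebra with T^(p^r) a sum of commutators. Terms of
  perfect complexes are projective, not free, so an identity map becomes an idempotent matrix.
  Projectivity is tested only on modules inside \<open>'m\<close>, so free modules of every finite
  rank must fit there; this is why \<open>'m\<close> is infinite and contains the algebra. In the
  socle part, over an algebraically closed field a primitive idempotent would exhibit a p-th power
  that is not a commutator. The field is arbitrary, so a trace with central values takes over this
  role.\<close>

lemma funpow_coprime_fixpoint:
  assumes "(\<rho> ^^ m) w = w" "(\<rho> ^^ n) w = w" "coprime m n" "m > 0" "n > 0"
  shows "\<rho> w = w"
proof -
  have *: "(\<rho> ^^ (k * x)) w = w" if "(\<rho> ^^ k) w = w" for k x
    by (induction x) (use that in \<open>auto simp: funpow_add\<close>)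
  obtain x y where "m * x = n * y + gcd m n"
    using bezout_nat[of m n] assms(4) by auto
  then have "m * x = Suc (n * y)" using assms(3) by simp
  then show ?thesis using *[OF assms(1), of x] *[OF assms(2), of y] by simp
qed

text \<open>As \<open>p\<close> is prime, an orbit of \<open>\<rho>\<close> is a fixed point or has
  exactly \<open>p\<close> elements; in the second case its sum is congruent to \<open>p\<close>
  times one value. The set \<open>S\<close> only has to contain 0 and be closed under addition, so
  that one statement serves the commutators of the algebra, the bracket of the category and
  \<open>{0}\<close>.\<close>

lemma sum_rotation_invariant:
  fixes g :: "'x \<Rightarrow> 'v::ab_group_add"
  assumes "finite W" "prime p"
    and "\<And>w. w \<in> W \<Longrightarrow> \<rho> w \<in> W" "\<And>w. w \<in> W \<Longrightarrow> (\<rho> ^^ p) w = w"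
    and "0 \<in> S" and add: "\<And>x y. x \<in> S \<Longrightarrow> y \<in> S \<Longrightarrow> x + y \<in> S"
    and pS: "\<And>x. (\<Sum>i<p. x) \<in> S"
    and "\<And>w. w \<in> W \<Longrightarrow> g (\<rho> w) - g w \<in> S"
  shows "sum g W - sum g {w \<in> W. \<rho> w = w} \<in> S"
  using assms(1,3,4,8)
proof (induction "card W" arbitrary: W rule: less_induct)
  case less
  show ?case
  proof (cases "\<forall>w\<in>W. \<rho> w = w")
    case True
    then have "{w \<in> W. \<rho> w = w} = W" by blast
    then show ?thesis using assms(5) by simp
  next
    case False
    then obtain w where w: "w \<in> W" "\<rho> w \<noteq> w" by blast
    define C where "C = (\<lambda>i. (\<rho> ^^ i) w) ` {..<p}"
    have p0: "p > 0" using assms(2) prime_gt_0_nat by blast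
    have inW: "(\<rho> ^^ i) w \<in> W" for i
      by (induction i) (use w less.prems in auto)
    have per: "(\<rho> ^^ p) w = w" using less.prems w by blast
    have mod: "(\<rho> ^^ i) w = (\<rho> ^^ (i mod p)) w" for i
      by (metis per funpow_mod_eq)
    \<comment> \<open>A fixed point at position \<open>i\<close> of the orbit stays put for
      \<open>i * p - i\<close> further steps, which lead to position \<open>i * p\<close>, that is,
      back to \<open>w\<close>.\<close>
    have nofix: "\<rho> ((\<rho> ^^ i) w) \<noteq> (\<rho> ^^ i) w" for i
    proof
      assume a: "\<rho> ((\<rho> ^^ i) w) = (\<rho> ^^ i) w"
      have st: "(\<rho> ^^ j) ((\<rho> ^^ i) w) = (\<rho> ^^ i) w" for j
        by (induction j) (use a in auto)
      have "(\<rho> ^^ i) w = (\<rho> ^^ (i * p - i)) ((\<rho> ^^ i) w)" using st by simp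
      also have "\<dots> = (\<rho> ^^ (i * p - i + i)) w" by (simp add: funpow_add)
      also have "\<dots> = (\<rho> ^^ ((i * p) mod p)) w" using mod[of "i * p"] p0 by simp
      finally have "(\<rho> ^^ i) w = w" by simp
      then show False using a w by simp
    qed
    \<comment> \<open>Two equal positions would give a point with the coprime periods
      \<open>j - i\<close> and \<open>p\<close>, hence a fixed point.\<close>
    have inj: "inj_on (\<lambda>i. (\<rho> ^^ i) w) {..<p}"
    proof (rule linorder_inj_onI)
      fix i j assume ij: "i < j" "i \<in> {..<p}" "j \<in> {..<p}"
      show "(\<rho> ^^ i) w \<noteq> (\<rho> ^^ j) w"
      proof
        assume e: "(\<rho> ^^ i) w = (\<rho> ^^ j) w"
        let ?w = "(\<rho> ^^ i) w"
        have "(\<rho> ^^ (j - i)) ?w = ?w"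
          using e ij by (metis (no_types, lifting) comp_apply funpow_add le_add_diff_inverse2 less_imp_le)
        moreover have "(\<rho> ^^ p) ?w = ?w" using less.prems(3)[OF inW] .
        moreover have "coprime (j - i) p"
          using ij assms(2) by (metis coprime_commute dvd_imp_le leD lessThan_iff less_imp_diff_less prime_imp_coprime_nat zero_less_diff)
        ultimately have "\<rho> ?w = ?w" using funpow_coprime_fixpoint ij p0 by (metis zero_less_diff)
        then show False using nofix by blast
      qed
    qed auto
    have CW: "C \<subseteq> W" using inW by (auto simp: C_def)
    have fC: "finite C" by (simp add: C_def)
    have sC: "sum g C \<in> S"
    proof -
      have gi: "g ((\<rho> ^^ i) w) - g w \<in> S" for i
      proof (induction i)
        case (Suc i)
        have "g ((\<rho> ^^ Suc i) w) - g w = (g (\<rho> ((\<rho> ^^ i) w)) - g ((\<rho> ^^ i) w)) + (g ((\<rho> ^^ i) w) - g w)" by simp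
        then show ?case using add Suc less.prems(4)[OF inW, of i] by metis
      qed (use assms(5) in simp)
      have fin_add: "sum h A \<in> S" if "finite A" "\<And>a. a \<in> A \<Longrightarrow> h a \<in> S" for h and A :: "nat set"
        using that by (induction A) (auto intro: assms(5) add)
      have "sum g C = (\<Sum>i<p. g ((\<rho> ^^ i) w))" unfolding C_def by (subst sum.reindex[OF inj]) simp
      also have "\<dots> = (\<Sum>i<p. g ((\<rho> ^^ i) w) - g w) + (\<Sum>i<p. g w)" by (simp add: sum_subtractf)
      finally show ?thesis using add pS fin_add[of "{..<p}" "\<lambda>i. g ((\<rho> ^^ i) w) - g w"] gi by auto
    qed
    have "sum g (W - C) - sum g {v \<in> W - C. \<rho> v = v} \<in> S"
    proof (rule less.hyps)
      show "card (W - C) < card W"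
        using CW fC w p0 less.prems(1) by (intro psubset_card_mono) (auto simp: C_def intro!: image_eqI[of _ _ 0])
      fix v assume v: "v \<in> W - C"
      show "\<rho> v \<in> W - C"
      proof -
        \<comment> \<open>On \<open>W\<close> the map \<open>\<rho>\<close> has the inverse
          \<open>\<rho> ^^ (p - 1)\<close>, so the complement of an orbit is stable as well.\<close>
        have "v \<in> C" if "\<rho> v \<in> C"
        proof -
          from that obtain i where i: "\<rho> v = (\<rho> ^^ i) w" by (auto simp: C_def)
          have "v = (\<rho> ^^ (p - 1)) (\<rho> v)" using less.prems(3) v p0
            by (metis DiffD1 Suc_diff_1 comp_apply funpow_Suc_right)
          also have "\<dots> = (\<rho> ^^ ((p - 1 + i) mod p)) w" using i mod[of "p - 1 + i"] by (simp add: funpow_add)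
          finally show ?thesis using p0 by (auto simp: C_def)
        qed
        then show ?thesis using v less.prems(2) by blast
      qed
    qed (use less.prems in auto)
    moreover have "{v \<in> W - C. \<rho> v = v} = {v \<in> W. \<rho> v = v}" using nofix by (auto simp: C_def)
    moreover have "sum g W = sum g (W - C) + sum g C" using sum.subset_diff[OF CW less.prems(1)] .
    ultimately have "sum g W - sum g {v \<in> W. \<rho> v = v} = (sum g (W - C) - sum g {v \<in> W - C. \<rho> v = v}) + sum g C"
        and "sum g (W - C) - sum g {v \<in> W - C. \<rho> v = v} \<in> S"
      by simp_all
    with add[OF this(2) sC] show ?thesis by (simp only:)
  qed
qed

text \<open>The noncommutative expansion of a power. It is stated for additive operators because the
  letters will be left multiplications in the algebra, left multiplications of matrices, and
  bimodule operators.\<close>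

lemma sum_words:
  fixes f :: "'i \<Rightarrow> 'v::ab_group_add \<Rightarrow> 'v"
  assumes "finite I" "\<And>i x y. i \<in> I \<Longrightarrow> f i (x + y) = f i x + f i y"
  shows "((\<lambda>v. \<Sum>i\<in>I. f i v) ^^ n) v = (\<Sum>w\<in>{w. set w \<subseteq> I \<and> length w = n}. foldr f w v)"
proof (induction n)
  case 0
  have "{w. set w \<subseteq> I \<and> length w = 0} = {[]}" by auto
  then show ?case by simp
next
  case (Suc n)
  let ?L = "\<lambda>n. {w. set w \<subseteq> I \<and> length w = n}"
  have z: "f i 0 = 0" if "i \<in> I" for i using assms(2)[OF that, of 0 0] by simp
  have s: "f i (sum h A) = (\<Sum>a\<in>A. f i (h a))" if "i \<in> I" "finite A" for i h and A :: "'i list set"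
    using that(2) by (induction A) (auto simp: z assms(2) that(1))
  have "?L (Suc n) = (\<lambda>(i, w). i # w) ` (I \<times> ?L n)"
    by (auto simp: length_Suc_conv image_iff)
  moreover have inj: "inj_on (\<lambda>(i, w). i # w) (I \<times> ?L n)" by (auto simp: inj_on_def)
  ultimately have "(\<Sum>w\<in>?L (Suc n). foldr f w v) = (\<Sum>(i, w)\<in>I \<times> ?L n. f i (foldr f w v))"
    by (simp only: sum.reindex[OF inj]) (simp add: comp_def split_def)
  also have "\<dots> = (\<Sum>i\<in>I. \<Sum>w\<in>?L n. f i (foldr f w v))"
    by (simp add: sum.cartesian_product)
  also have "\<dots> = (\<Sum>i\<in>I. f i (\<Sum>w\<in>?L n. foldr f w v))"
    by (intro sum.cong) (auto simp: s finite_lists_length_eq[OF assms(1)])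
  finally show ?case using Suc by simp
qed

text \<open>Rotation fixes exactly the constant words; all others cancel modulo \<open>S\<close> in
  orbits of length \<open>p\<close>. The hypothesis moves a single letter from the front to the
  back, which is the form in which a trace property is available.\<close>

lemma sum_cyclic_words:
  fixes g :: "'i list \<Rightarrow> 'v::ab_group_add"
  assumes "finite I" "prime p"
    and "0 \<in> S" "\<And>x y. x \<in> S \<Longrightarrow> y \<in> S \<Longrightarrow> x + y \<in> S" "\<And>x. (\<Sum>i<p. x) \<in> S"
    and "\<And>i w. i \<in> I \<Longrightarrow> set w \<subseteq> I \<Longrightarrow> Suc (length w) = p \<Longrightarrow> g (w @ [i]) - g (i # w) \<in> S"
  shows "sum g {w. set w \<subseteq> I \<and> length w = p} - (\<Sum>i\<in>I. g (replicate p i)) \<in> S"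
proof -
  let ?W = "{w. set w \<subseteq> I \<and> length w = p}"
  have p0: "p > 0" using assms(2) prime_gt_0_nat by blast
  have "sum g ?W - sum g {w \<in> ?W. rotate1 w = w} \<in> S"
  proof (rule sum_rotation_invariant[OF _ assms(2) _ _ assms(3-5)])
    show "finite ?W" by (rule finite_lists_length_eq[OF assms(1)])
    fix w assume w: "w \<in> ?W"
    show "(rotate1 ^^ p) w = w" using w by (metis (mono_tags) mem_Collect_eq rotate_def rotate_length01 rotate_id mod_self)
    show "g (rotate1 w) - g w \<in> S" using w p0 assms(6) by (cases w) auto
  qed (auto)
  moreover have "{w \<in> ?W. rotate1 w = w} = replicate p ` I"
  proof (intro equalityI subsetI)
    fix w assume "w \<in> {w \<in> ?W. rotate1 w = w}"
    then have w: "set w \<subseteq> I" "length w = p" "rotate1 w = w" by auto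
    then obtain i where "set w = {i}" using rotate1_fixpoint_card[OF w(3)] p0 by (auto simp: card_1_singleton_iff)
    then show "w \<in> replicate p ` I" using w by (auto intro!: image_eqI[of _ _ i] replicate_eqI)
  qed (use p0 in \<open>auto simp: rotate1_replicate\<close>)
  moreover have "sum g (replicate p ` I) = (\<Sum>i\<in>I. g (replicate p i))"
    using p0 by (subst sum.reindex) (auto simp: inj_on_def replicate_eq_replicate)
  ultimately show ?thesis by simp
qed

subsection \<open>Algebras in positive characteristic\<close>

context fd_algebra
begin

abbreviation "comm \<equiv> commutator_space scale"

lemma comm_eq_span: "comm = span {a * b - b * a | a b. True}"
  by (simp add: commutator_space_def)

lemma subspace_comm: "subspace comm"
  by (simp add: comm_eq_span)

lemmas comm_0 = subspace_0[OF subspace_comm]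
  and comm_add = subspace_add[OF subspace_comm]
  and comm_diff = subspace_diff[OF subspace_comm]
  and comm_neg = subspace_neg[OF subspace_comm]
  and comm_scale = subspace_scale[OF subspace_comm]
  and comm_sum = subspace_sum[OF subspace_comm]

lemma comm_commutator: "a * b - b * a \<in> comm"
  unfolding comm_eq_span by (rule span_base) blast

lemma comm_diff_trans: "a - b \<in> comm \<Longrightarrow> b - c \<in> comm \<Longrightarrow> a - c \<in> comm"
  using comm_add by fastforce

lemma comm_diff_sym: "a - b \<in> comm \<Longrightarrow> b - a \<in> comm"
  using comm_neg by fastforce

text \<open>Scalars need no case of their own: they are absorbed into the first factor of a
  commutator.\<close>

lemma comm_induct [consumes 1, case_names zero add commutator]:
  assumes "x \<in> comm" "P 0" "\<And>x y. x \<in> comm \<Longrightarrow> y \<in> comm \<Longrightarrow> P x \<Longrightarrow> P y \<Longrightarrow> P (x + y)" "\<And>a b. P (a * b - b * a)"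
  shows "P x"
proof -
  have "x \<in> comm \<and> P x" using assms(1) unfolding comm_eq_span
  proof (induction rule: span_induct_alt)
    case (step c x y)
    then obtain a b where ab: "x = a * b - b * a" by blast
    have e: "scale c x = scale c a * b - b * scale c a"
      unfolding ab scale_right_diff_distrib scale_mult_left[of c a b] scale_mult_right[of c b a] ..
    have y: "y \<in> comm" "P y" using step(2) unfolding comm_eq_span by auto
    show ?case unfolding e comm_eq_span[symmetric]
      using y assms(3)[OF comm_commutator y(1) assms(4)] comm_add[OF comm_commutator y(1)] by blast
  qed (use assms(2) span_zero in blast)
  then show ?thesis ..
qed

lemma comm_diff_mult_central:
  assumes "z \<in> alg_center" "x \<in> comm"
  shows "z * x \<in> comm"
  using assms(2)
proof (induction rule: comm_induct)
  case (commutator a b)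
  have "z * (a * b - b * a) = (z * a) * b - b * (z * a)"
    using assms(1) unfolding alg_center_def mem_Collect_eq by (metis (no_types) mult.assoc right_diff_distrib)
  then show ?case using comm_commutator by simp
qed (simp_all add: distrib_left comm_add comm_0)

end

locale charp_algebra = fd_algebra scale for scale :: "'k::field \<Rightarrow> 'a::{ring,monoid_mult} \<Rightarrow> 'a" +
  fixes p :: nat
  assumes char: "CHAR('k) = p" "p > 0"
begin

lemma prime_p: "prime p"
  using prime_CHAR_semidom[where ?'a = 'k] char by simp

lemma sum_p_zero: "(\<Sum>i<p. x) = (0 :: 'a)"
proof -
  have "(\<Sum>i<p. x) = (\<Sum>i<p. scale 1 x)" by simp
  also have "\<dots> = scale (\<Sum>i<p. 1) x" by (rule scale_sum_left[symmetric])
  also have "(\<Sum>i<p. 1 :: 'k) = 0" using char of_nat_CHAR[where ?'a = 'k] by simp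
  finally show ?thesis by simp
qed

text \<open>Rotating a product changes it by a commutator, so of all words of length
  \<open>p\<close> only the powers of single summands survive. Hence the Frobenius map is additive
  modulo commutators (Jacobson).\<close>

lemma comm_sum_power:
  assumes "finite I"
  shows "(\<Sum>i\<in>I. x i) ^ p - (\<Sum>i\<in>I. x i ^ p) \<in> comm"
proof -
  define f where "f i v = x i * v" for i v
  have pw: "((\<lambda>v. a * v) ^^ n) 1 = a ^ n" for a :: 'a and n
    by (induction n) auto
  have fr: "foldr f w v = foldr f w 1 * v" for w v
    by (induction w) (auto simp: f_def mult.assoc)
  have "(\<Sum>i\<in>I. x i) ^ p = ((\<lambda>v. \<Sum>i\<in>I. f i v) ^^ p) 1"
    by (simp add: f_def sum_distrib_right[symmetric] pw)
  also have "\<dots> = (\<Sum>w\<in>{w. set w \<subseteq> I \<and> length w = p}. foldr f w 1)"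
    by (rule sum_words[OF assms]) (simp add: f_def distrib_left)
  finally have *: "(\<Sum>i\<in>I. x i) ^ p = \<dots>" .
  have rep: "foldr f (replicate n i) 1 = x i ^ n" for i n
    by (induction n) (simp_all add: f_def)
  have "(\<Sum>w\<in>{w. set w \<subseteq> I \<and> length w = p}. foldr f w 1) - (\<Sum>i\<in>I. foldr f (replicate p i) 1) \<in> comm"
  proof (rule sum_cyclic_words[OF assms prime_p comm_0 comm_add])
    fix i w
    have "foldr f (w @ [i]) 1 = foldr f w 1 * x i" using fr[of w "x i"] by (simp add: f_def)
    then show "foldr f (w @ [i]) 1 - foldr f (i # w) 1 \<in> comm"
      using comm_commutator by (simp add: f_def)
  qed (simp_all add: sum_p_zero comm_0)
  then show ?thesis unfolding * rep .
qed

lemma comm_add_power: "(x + y) ^ p - (x ^ p + y ^ p) \<in> comm"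
  using comm_sum_power[of UNIV "\<lambda>b. if b then x else y"] by (simp add: UNIV_bool add.commute)

lemma zero_power_p: "(0::'a) ^ p = 0"
  using char by (cases p) auto

text \<open>For one commutator the reason is that (ab)^p - (ba)^p is itself the commutator of
  \<open>a\<close> with b(ab)^(p-1); sums are reduced to this by additivity.\<close>

lemma power_comm:
  assumes "x \<in> comm"
  shows "x ^ p \<in> comm"
  using assms
proof (induction rule: comm_induct)
  case (add x y)
  then show ?case using comm_add[OF comm_add_power[of x y] comm_add[OF add(3,4)]] by simp
next
  case (commutator a b)
  obtain q where q: "p = Suc q" using char by (cases p) auto
  have ba: "b * (a * b) ^ n = (b * a) ^ n * b" for n
  proof (induction n)
    case (Suc n)
    have "b * (a * b) ^ Suc n = (b * (a * b) ^ n) * (a * b)" by (simp add: power_Suc2 mult.assoc del: power_Suc)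
    also have "\<dots> = (b * a) ^ Suc n * b" by (simp add: Suc power_Suc2 mult.assoc del: power_Suc)
    finally show ?case .
  qed simp
  have "(a * b) ^ p = a * (b * (a * b) ^ q)" "(b * a) ^ p = (b * (a * b) ^ q) * a"
    by (simp add: q mult.assoc) (simp only: q ba power_Suc2 mult.assoc)
  then have 1: "(a * b) ^ p - (b * a) ^ p \<in> comm" using comm_commutator by simp
  \<comment> \<open>Additivity applied to an element and its negative controls the sign without a
    distinction between even and odd \<open>p\<close>.\<close>
  have 2: "(b * a) ^ p + (- (b * a)) ^ p \<in> comm"
    using comm_neg[OF comm_add_power[of "b * a" "- (b * a)"]] by (simp add: zero_power_p add.commute)
  have 3: "(a * b - b * a) ^ p - ((a * b) ^ p + (- (b * a)) ^ p) \<in> comm"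
    using comm_add_power[of "a * b" "- (b * a)"] by simp
  have "(a * b - b * a) ^ p = ((a * b - b * a) ^ p - ((a * b) ^ p + (- (b * a)) ^ p))
      + ((a * b) ^ p - (b * a) ^ p) + ((b * a) ^ p + (- (b * a)) ^ p)" by simp
  then show ?case using 1 2 3 comm_add by metis
qed (use zero_power_p comm_0 in simp)

lemma power_p_cong:
  assumes "x - y \<in> comm"
  shows "x ^ p - y ^ p \<in> comm"
proof -
  have "x ^ p - (y ^ p + (x - y) ^ p) \<in> comm" using comm_add_power[of y "x - y"] by simp
  from comm_add[OF this power_comm[OF assms]] show ?thesis by (simp add: algebra_simps)
qed

end

section \<open>Finitely supported graded matrices\<close>

definition sg :: "int \<Rightarrow> 'v::ab_group_add \<Rightarrow> 'v" where
  "sg n x = (if even n then x else - x)"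

lemma sg_simps [simp]: "sg n 0 = 0" "sg 0 x = x" "sg n (sg n x) = x" "sg (- n) x = sg n x" "sg 1 x = - x"
    "sg (-1) x = - x"
  by (auto simp: sg_def)

lemma sg_add: "sg n (x + y) = sg n x + sg n y" and sg_diff: "sg n (x - y) = sg n x - sg n y"
  and sg_neg: "sg n (- x) = - sg n x" and sg_plus: "sg (m + n) x = sg m (sg n x)"
  and sg_minus: "sg (m - n) x = sg m (sg n x)" and sg_sg: "sg m (sg n x) = sg n (sg m x)"
  by (auto simp: sg_def)

lemma sg_sum: "sg n (sum f A) = (\<Sum>x\<in>A. sg n (f x))"
  by (auto simp: sg_def sum_negf)

lemma sg_mult_left: "sg n x * y = sg n (x * y :: 'r::ring)" and sg_mult_right: "x * sg n y = sg n (x * y :: 'r::ring)"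
  by (auto simp: sg_def)

lemma sg_even: "even n \<Longrightarrow> sg n x = x"
  by (simp add: sg_def)

lemma sg_eq_parity: "even (m + n) \<Longrightarrow> sg m x = sg n x"
  by (auto simp: sg_def)

lemma sg_eq_0_iff [simp]: "sg n x = 0 \<longleftrightarrow> x = 0"
  by (simp add: sg_def)

lemma sg_in: "(\<And>x. x \<in> S \<Longrightarrow> - x \<in> S) \<Longrightarrow> x \<in> S \<Longrightarrow> sg n x \<in> S"
  by (simp add: sg_def)

datatype ix = Ix (dg: int) (pos: nat)

text \<open>All complexes share the index type \<open>ix\<close>, so that matrices between any two
  of them lie in a single ring and the product is total. The ring is used without a unit; the
  idempotent of each complex replaces the identity.\<close>

typedef (overloaded) 'a imat = "{f :: ix \<Rightarrow> ix \<Rightarrow> 'a::zero. finite {w. f (fst w) (snd w) \<noteq> 0}}"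
  morphisms ent Imat
  by (rule exI[of _ "\<lambda>u v. 0"]) simp

setup_lifting type_definition_imat

lemma imat_eqI: "(\<And>u v. ent F u v = ent G u v) \<Longrightarrow> F = G"
  by (simp add: ent_inject[symmetric] fun_eq_iff)

definition idx :: "'a::zero imat \<Rightarrow> ix set" where
  "idx F = {u. \<exists>v. ent F u v \<noteq> 0 \<or> ent F v u \<noteq> 0}"

lemma finite_idx [simp]: "finite (idx F)"
proof -
  let ?A = "{w. ent F (fst w) (snd w) \<noteq> 0}"
  have "finite ?A" using ent[of F] by simp
  moreover have "idx F \<subseteq> fst ` ?A \<union> snd ` ?A"
  proof
    fix u assume "u \<in> idx F"
    then obtain v where "(u, v) \<in> ?A \<or> (v, u) \<in> ?A" by (auto simp: idx_def)
    then have "fst (u, v) \<in> fst ` ?A \<or> snd (v, u) \<in> snd ` ?A" by blast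
    then show "u \<in> fst ` ?A \<union> snd ` ?A" by simp
  qed
  ultimately show ?thesis by (meson finite_UnI finite_imageI finite_subset)
qed

lemma ent_not_idx: "u \<notin> idx F \<Longrightarrow> ent F u v = 0" "v \<notin> idx F \<Longrightarrow> ent F u v = 0"
  unfolding idx_def by blast+

lemma ent_Imat:
  assumes "finite A" "\<And>u v. f u v \<noteq> 0 \<Longrightarrow> u \<in> A \<and> v \<in> A"
  shows "ent (Imat f) = f"
proof (rule Imat_inverse)
  have "{w. f (fst w) (snd w) \<noteq> 0} \<subseteq> A \<times> A" using assms(2) by auto
  then show "f \<in> {f. finite {w. f (fst w) (snd w) \<noteq> 0}}"
    using assms(1) finite_subset by blast
qed

instantiation imat :: (ring) ring
begin

lift_definition zero_imat :: "'a imat" is "\<lambda>u v. 0" by simp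
lift_definition uminus_imat :: "'a imat \<Rightarrow> 'a imat" is "\<lambda>f u v. - f u v" by simp
lift_definition plus_imat :: "'a imat \<Rightarrow> 'a imat \<Rightarrow> 'a imat" is "\<lambda>f g u v. f u v + g u v"
  by (rule finite_subset[rotated], rule finite_UnI, assumption, assumption) auto
lift_definition minus_imat :: "'a imat \<Rightarrow> 'a imat \<Rightarrow> 'a imat" is "\<lambda>f g u v. f u v - g u v"
  by (rule finite_subset[rotated], rule finite_UnI, assumption, assumption) auto

definition times_imat :: "'a imat \<Rightarrow> 'a imat \<Rightarrow> 'a imat" where
  "F * G = Imat (\<lambda>u v. \<Sum>w\<in>idx F. ent F u w * ent G w v)"

lemma ent_times0: "ent (F * G) u v = (\<Sum>w\<in>idx F. ent F u w * ent G w v)"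
proof -
  have "ent (F * G) = (\<lambda>u v. \<Sum>w\<in>idx F. ent F u w * ent G w v)"
    unfolding times_imat_def
  proof (rule ent_Imat[of "idx F \<union> idx G"])
    fix u v assume "(\<Sum>w\<in>idx F. ent F u w * ent G w v) \<noteq> 0"
    then obtain w where "ent F u w * ent G w v \<noteq> 0" by (meson sum.neutral)
    then show "u \<in> idx F \<union> idx G \<and> v \<in> idx F \<union> idx G"
      using ent_not_idx(1)[of u F w] ent_not_idx(2)[of v G w] by fastforce
  qed simp
  then show ?thesis by simp
qed

text \<open>Products of several matrices are compared by summing over one finite set that is large
  enough for all factors.\<close>

lemma ent_times:
  assumes "finite W" "\<And>w. w \<notin> W \<Longrightarrow> ent F u w = 0 \<or> ent G w v = 0"
  shows "ent (F * G) u v = (\<Sum>w\<in>W. ent F u w * ent G w v)"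
  unfolding ent_times0
proof -
  have "(\<Sum>w\<in>idx F. ent F u w * ent G w v) = (\<Sum>w\<in>idx F \<union> W. ent F u w * ent G w v)"
    by (rule sum.mono_neutral_left) (use assms in \<open>auto simp: ent_not_idx\<close>)
  also have "\<dots> = (\<Sum>w\<in>W. ent F u w * ent G w v)"
    by (rule sum.mono_neutral_right) (use assms in fastforce)+
  finally show "(\<Sum>w\<in>idx F. ent F u w * ent G w v) = \<dots>" .
qed

lemma idx_times: "idx (F * G) \<subseteq> idx F \<union> idx G"
proof
  fix u assume "u \<in> idx (F * G)"
  then obtain v where "ent (F * G) u v \<noteq> 0 \<or> ent (F * G) v u \<noteq> 0" unfolding idx_def by blast
  then obtain w where "ent F u w * ent G w v \<noteq> 0 \<or> ent F v w * ent G w u \<noteq> 0"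
    unfolding ent_times0 by (meson sum.neutral)
  then show "u \<in> idx F \<union> idx G"
    using ent_not_idx(1)[of u F w] ent_not_idx(2)[of u G w] by fastforce
qed

instance
proof
  fix F G H :: "'a imat"
  let ?W = "idx F \<union> idx G \<union> idx H"
  have f: "finite ?W" by simp
  show "F * G * H = F * (G * H)"
  proof (rule imat_eqI)
    fix u v
    have "ent (F * G * H) u v = (\<Sum>w\<in>?W. \<Sum>x\<in>?W. ent F u x * ent G x w * ent H w v)"
      using idx_times[of F G]
      by (subst ent_times[OF f], fastforce simp: ent_not_idx)
        (subst ent_times[OF f], auto simp: ent_not_idx sum_distrib_right)
    also have "\<dots> = (\<Sum>x\<in>?W. \<Sum>w\<in>?W. ent F u x * ent G x w * ent H w v)" by (rule sum.swap)
    also have "\<dots> = ent (F * (G * H)) u v"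
      by (subst ent_times[OF f], auto simp: ent_not_idx)
        (subst ent_times[OF f], auto simp: ent_not_idx sum_distrib_left mult.assoc)
    finally show "ent (F * G * H) u v = ent (F * (G * H)) u v" .
  qed
  show "(F + G) * H = F * H + G * H"
    by (rule imat_eqI, simp add: plus_imat.rep_eq)
      (subst ent_times[OF f], auto simp: ent_not_idx plus_imat.rep_eq distrib_right sum.distrib,
       (subst ent_times[OF f], auto simp: ent_not_idx)+)
  show "F * (G + H) = F * G + F * H"
    by (rule imat_eqI, simp add: plus_imat.rep_eq)
      (subst ent_times[OF f], auto simp: ent_not_idx plus_imat.rep_eq distrib_left sum.distrib,
       (subst ent_times[OF f], auto simp: ent_not_idx)+)
qed (transfer, simp add: algebra_simps)+

end

lemmas ent_simps = zero_imat.rep_eq plus_imat.rep_eq minus_imat.rep_eq uminus_imat.rep_eq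

lemma ent_sg: "ent (sg n F) u v = sg n (ent F u v)"
  by (simp add: sg_def ent_simps)

lemma ent_sum: "ent (sum f A) u v = (\<Sum>x\<in>A. ent (f x) u v)"
  by (induction A rule: infinite_finite_induct) (auto simp: ent_simps)

lift_definition cm :: "'a \<Rightarrow> 'a imat \<Rightarrow> 'a::ring imat" is "\<lambda>z f u v. z * f u v"
  by (rule finite_subset[rotated], assumption) auto

lift_definition sgl :: "ix \<Rightarrow> ix \<Rightarrow> 'a \<Rightarrow> 'a::ring imat" is "\<lambda>u v a x y. if x = u \<and> y = v then a else 0"
  subgoal for u v a by (rule finite_subset[of _ "{(u, v)}"]) (auto split: if_splits)
  done

lemma sgl_mult: "sgl u v a * sgl x y b = (if v = x then sgl u y (a * b) else 0)"
  by (rule imat_eqI, subst ent_times[of "{v}"]) (auto simp: sgl.rep_eq ent_simps)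

lemma sgl_0 [simp]: "sgl u v 0 = 0"
  by (rule imat_eqI) (simp add: sgl.rep_eq ent_simps)

lemma sgl_add: "sgl u v (a + b) = sgl u v a + sgl u v b"
  by (rule imat_eqI) (simp add: sgl.rep_eq ent_simps)

lemma cm_sgl: "cm z (sgl u v a) = sgl u v (z * a)"
  by (rule imat_eqI) (simp add: sgl.rep_eq cm.rep_eq)

lemma imat_sum_sgl:
  assumes "finite W" "idx F \<subseteq> W"
  shows "F = (\<Sum>w\<in>W \<times> W. sgl (fst w) (snd w) (ent F (fst w) (snd w)))"
proof (rule imat_eqI)
  fix u v
  have "(\<Sum>w\<in>W \<times> W. ent (sgl (fst w) (snd w) (ent F (fst w) (snd w))) u v)
      = (\<Sum>w\<in>W \<times> W. if w = (u, v) then ent F u v else 0)"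
    by (intro sum.cong) (auto simp: sgl.rep_eq)
  also have "\<dots> = ent F u v" using assms ent_not_idx[of u F v] ent_not_idx[of v F u] by (subst sum.delta) auto
  finally show "ent F u v = ent (\<Sum>w\<in>W \<times> W. sgl (fst w) (snd w) (ent F (fst w) (snd w))) u v"
    by (simp add: ent_sum)
qed

section \<open>Homogeneous matrices (columns are sources, rows are targets) and the
  supertrace\<close>

definition hdeg :: "int \<Rightarrow> 'a::zero imat \<Rightarrow> bool" where
  "hdeg n F \<longleftrightarrow> (\<forall>u v. ent F u v \<noteq> 0 \<longrightarrow> dg u = dg v + n)"

lemma hdeg_ent: "hdeg n F \<Longrightarrow> dg u \<noteq> dg v + n \<Longrightarrow> ent F u v = 0"
  by (auto simp: hdeg_def)

lemma hdeg_0 [simp]: "hdeg n 0"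
  by (simp add: hdeg_def ent_simps)

lemma hdeg_add: "hdeg n F \<Longrightarrow> hdeg n G \<Longrightarrow> hdeg n (F + G)"
  and hdeg_diff: "hdeg n F \<Longrightarrow> hdeg n G \<Longrightarrow> hdeg n (F - G)"
  and hdeg_neg: "hdeg n F \<Longrightarrow> hdeg n (- F)"
  and hdeg_cm: "hdeg n F \<Longrightarrow> hdeg n (cm z F)"
  unfolding hdeg_def ent_simps cm.rep_eq by (metis add.right_neutral diff_zero neg_equal_0_iff_equal mult_zero_right)+

lemma hdeg_sg: "hdeg n F \<Longrightarrow> hdeg n (sg m F)"
  by (simp add: sg_def hdeg_neg)

lemma hdeg_mult:
  assumes "hdeg m F" "hdeg n G"
  shows "hdeg (m + n) (F * G)"
  unfolding hdeg_def
proof (intro allI impI)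
  fix u v assume "ent (F * G) u v \<noteq> 0"
  then obtain w where "ent F u w * ent G w v \<noteq> 0" unfolding ent_times0 by (meson sum.neutral)
  then have "ent F u w \<noteq> 0" "ent G w v \<noteq> 0" by auto
  then have "dg u = dg w + m" "dg w = dg v + n" using assms by (auto simp: hdeg_def)
  then show "dg u = dg v + (m + n)" by simp
qed

lift_definition dpart :: "int \<Rightarrow> 'a imat \<Rightarrow> 'a::zero imat" is
  "\<lambda>n f u v. if dg u = dg v + n then f u v else 0"
  by (rule finite_subset[rotated], assumption) (auto split: if_splits)

lemma hdeg_dpart: "hdeg n (dpart n F)"
  by (simp add: hdeg_def dpart.rep_eq)

definition str :: "'a::ring imat \<Rightarrow> 'a" where
  "str F = (\<Sum>u\<in>idx F. sg (dg u) (ent F u u))"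

lemma str_eq:
  assumes "finite W" "\<And>u. u \<notin> W \<Longrightarrow> ent F u u = 0"
  shows "str F = (\<Sum>u\<in>W. sg (dg u) (ent F u u))"
proof -
  have "str F = (\<Sum>u\<in>idx F \<union> W. sg (dg u) (ent F u u))"
    unfolding str_def by (rule sum.mono_neutral_left) (use assms in \<open>auto simp: ent_not_idx\<close>)
  also have "\<dots> = (\<Sum>u\<in>W. sg (dg u) (ent F u u))"
    by (rule sum.mono_neutral_right) (use assms in auto)
  finally show ?thesis .
qed

lemma str_add: "str (F + G) = str F + str G"
  and str_diff: "str (F - G) = str F - str G"
proof -
  let ?W = "idx F \<union> idx G"
  note e = str_eq[of ?W]
  show "str (F + G) = str F + str G" "str (F - G) = str F - str G"
    by (subst (1 2 3) e, auto simp: ent_simps ent_not_idx sg_add sg_diff sum.distrib sum_subtractf)+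
qed

lemma hdeg_sgl: "dg u = dg v + n \<Longrightarrow> hdeg n (sgl u v a)"
  by (simp add: hdeg_def sgl.rep_eq)

lemma str_0 [simp]: "str 0 = 0"
  by (simp add: str_def ent_simps)

lemma str_neg: "str (- F) = - str F"
  using str_diff[of 0 F] by simp

lemma str_sg: "str (sg n F) = sg n (str F)"
  by (simp add: sg_def str_neg)

lemma str_sum: "str (sum f A) = (\<Sum>x\<in>A. str (f x))"
  by (induction A rule: infinite_finite_induct) (auto simp: str_add)

lemma str_cm: "str (cm z F) = z * str F"
  by (subst str_eq[of "idx F"]) (auto simp: cm.rep_eq ent_not_idx str_def sum_distrib_left sg_mult_right)

lemma str_sgl: "str (sgl u v a) = (if u = v then sg (dg u) a else 0)"
  by (subst str_eq[of "{u}"]) (auto simp: sgl.rep_eq)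

lemma cm_mult_left: "cm z (F * G) = cm z F * G"
  by (rule imat_eqI, subst ent_times[of "idx F"])
    (auto simp: cm.rep_eq ent_times0 ent_not_idx sum_distrib_left mult.assoc)

lemma cm_mult_right:
  assumes "\<And>a. z * a = a * z"
  shows "cm z (F * G) = F * cm z G"
proof (rule imat_eqI)
  have "z * (a * b) = a * (z * b)" for a b using assms by (metis mult.assoc)
  then show "ent (cm z (F * G)) u v = ent (F * cm z G) u v" for u v
    by (simp add: cm.rep_eq ent_times0 sum_distrib_left)
qed

lemma cm_add: "cm z (F + G) = cm z F + cm z G" and cm_diff: "cm z (F - G) = cm z F - cm z G"
  and cm_neg: "cm z (- F) = - cm z F" and cm_0 [simp]: "cm z 0 = 0"
  by (rule imat_eqI, simp add: cm.rep_eq ent_simps algebra_simps)+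

lemma cm_sg: "cm z (sg n F) = sg n (cm z F)"
  by (simp add: sg_def cm_neg)

lemma cm_1 [simp]: "cm (1 :: 'a::{ring,monoid_mult}) F = F"
  by (rule imat_eqI) (simp add: cm.rep_eq)

lemma cm_cm: "cm y (cm z F) = cm (y * z) F" and cm_plus: "cm (y + z) F = cm y F + cm z F"
  by (rule imat_eqI, simp add: cm.rep_eq ent_simps algebra_simps)+

text \<open>Only one factor has to be homogeneous: if \<open>A\<close> has degree m, the part of
  \<open>B\<close> that contributes has degree -m, and its Koszul sign (-1)^(m(-m)) equals (-1)^m.
  The commutators that remain are those of the entries.\<close>

lemma (in fd_algebra) str_commute:
  assumes "hdeg m A"
  shows "str (A * B) - sg m (str (B * A)) \<in> comm"
proof -
  let ?W = "idx A \<union> idx B"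
  have f: "finite ?W" by simp
  have e: "ent (A * B) u u = (\<Sum>w\<in>?W. ent A u w * ent B w u)" "ent (B * A) u u = (\<Sum>w\<in>?W. ent B u w * ent A w u)" for u
    by (rule ent_times[OF f], auto simp: ent_not_idx)+
  have z: "ent (A * B) u u = 0 \<and> ent (B * A) u u = 0" if "u \<notin> ?W" for u
    using that by (auto simp: e ent_not_idx intro!: sum.neutral)
  have 1: "str (A * B) = (\<Sum>u\<in>?W. \<Sum>w\<in>?W. sg (dg u) (ent A u w * ent B w u))"
    by (subst str_eq[OF f]) (use z in \<open>auto simp: e sg_sum\<close>)
  have "str (B * A) = (\<Sum>w\<in>?W. \<Sum>u\<in>?W. sg (dg w) (ent B w u * ent A u w))"
    by (subst str_eq[OF f]) (use z in \<open>auto simp: e sg_sum\<close>)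
  also have "\<dots> = (\<Sum>u\<in>?W. \<Sum>w\<in>?W. sg (dg w) (ent B w u * ent A u w))" by (rule sum.swap)
  finally have "str (A * B) - sg m (str (B * A))
      = (\<Sum>u\<in>?W. \<Sum>w\<in>?W. sg (dg u) (ent A u w * ent B w u) - sg m (sg (dg w) (ent B w u * ent A u w)))"
    by (simp add: 1 sg_sum sum_subtractf)
  also have "\<dots> \<in> comm"
  proof (intro comm_sum)
    fix u w
    show "sg (dg u) (ent A u w * ent B w u) - sg m (sg (dg w) (ent B w u * ent A u w)) \<in> comm"
    proof (cases "ent A u w = 0")
      case False
      then have "dg u = m + dg w" using assms by (auto simp: hdeg_def add.commute)
      then have "sg (dg u) (ent A u w * ent B w u) - sg m (sg (dg w) (ent B w u * ent A u w))
          = sg (m + dg w) (ent A u w * ent B w u - ent B w u * ent A u w)"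
        by (simp add: sg_plus sg_diff)
      then show ?thesis using sg_in[OF comm_neg comm_commutator] by metis
    qed (simp add: comm_0)
  qed
  finally show ?thesis .
qed

subsection \<open>Complexes of matrices\<close>

text \<open>A pair \<open>(e, d)\<close> stands for the complex of projective modules that is the image of the idempotent \<open>e\<close>, with
  differential \<open>d\<close>.\<close>

type_synonym 'a mcplx = "'a imat \<times> 'a imat"

definition mcplx :: "'a::ring mcplx \<Rightarrow> bool" where
  "mcplx X \<longleftrightarrow> hdeg 0 (fst X) \<and> fst X * fst X = fst X \<and> hdeg 1 (snd X) \<and>
     fst X * snd X = snd X \<and> snd X * fst X = snd X \<and> snd X * snd X = 0"

definition hm :: "int \<Rightarrow> 'a::ring mcplx \<Rightarrow> 'a mcplx \<Rightarrow> 'a imat set" where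
  "hm n X Y = {F. hdeg n F \<and> fst Y * F = F \<and> F * fst X = F}"

text \<open>The differential of the Hom complex, that is, the graded commutator with the
  differentials. Its cocycles \<open>zc\<close> are the chain maps of degree \<open>n\<close>, and
  the elements of \<open>bd\<close> are the null-homotopic ones.\<close>

definition df :: "int \<Rightarrow> 'a::ring mcplx \<Rightarrow> 'a mcplx \<Rightarrow> 'a imat \<Rightarrow> 'a imat" where
  "df n X Y H = snd Y * H - sg n (H * snd X)"

definition zc :: "int \<Rightarrow> 'a::ring mcplx \<Rightarrow> 'a mcplx \<Rightarrow> 'a imat set" where
  "zc n X Y = {F \<in> hm n X Y. df n X Y F = 0}"

definition bd :: "int \<Rightarrow> 'a::ring mcplx \<Rightarrow> 'a mcplx \<Rightarrow> 'a imat set" where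
  "bd n X Y = df (n - 1) X Y ` hm (n - 1) X Y"

lemma hm_closed:
  assumes "F \<in> hm n X Y"
  shows "G \<in> hm n X Y \<Longrightarrow> F + G \<in> hm n X Y" "G \<in> hm n X Y \<Longrightarrow> F - G \<in> hm n X Y" "- F \<in> hm n X Y"
    "sg m F \<in> hm n X Y"
  using assms
  by (auto simp: hm_def hdeg_add hdeg_diff hdeg_neg hdeg_sg distrib_left distrib_right left_diff_distrib right_diff_distrib sg_mult_left sg_mult_right)

lemma hm_0 [simp]: "0 \<in> hm n X Y"
  by (simp add: hm_def)

lemma hm_mult: "G \<in> hm m Y Z \<Longrightarrow> F \<in> hm n X Y \<Longrightarrow> G * F \<in> hm (m + n) X Z"
  by (simp add: hm_def hdeg_mult mult.assoc) (simp add: mult.assoc[symmetric])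

lemma hm_cm: "(\<And>a. z * a = a * z) \<Longrightarrow> F \<in> hm n X Y \<Longrightarrow> cm z F \<in> hm n X Y"
  by (simp add: hm_def hdeg_cm flip: cm_mult_left cm_mult_right)

lemma df_add: "df n X Y (F + G) = df n X Y F + df n X Y G"
  and df_diff: "df n X Y (F - G) = df n X Y F - df n X Y G"
  and df_neg: "df n X Y (- F) = - df n X Y F" and df_0 [simp]: "df n X Y 0 = 0"
  and df_sg: "df n X Y (sg m F) = sg m (df n X Y F)"
  by (simp_all add: df_def algebra_simps sg_add sg_diff sg_neg sg_mult_left sg_mult_right sg_sg[of m n])

lemma df_cm: "(\<And>a. z * a = a * z) \<Longrightarrow> df n X Y (cm z F) = cm z (df n X Y F)"
  unfolding df_def cm_diff cm_sg by (simp add: cm_mult_right[of z "snd Y"] cm_mult_left[of z F])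

lemma zc_hm: "F \<in> zc n X Y \<Longrightarrow> F \<in> hm n X Y"
  by (simp add: zc_def)

lemma zc_commute: "F \<in> zc n X Y \<Longrightarrow> snd Y * F = sg n (F * snd X)"
  by (simp add: zc_def df_def)

lemma zc_closed:
  assumes "F \<in> zc n X Y"
  shows "G \<in> zc n X Y \<Longrightarrow> F + G \<in> zc n X Y" "G \<in> zc n X Y \<Longrightarrow> F - G \<in> zc n X Y" "- F \<in> zc n X Y"
    "sg m F \<in> zc n X Y"
  using assms by (auto simp: zc_def hm_closed df_add df_diff df_neg df_sg)

lemma zc_0 [simp]: "0 \<in> zc n X Y"
  by (simp add: zc_def)

lemma zc_cm: "(\<And>a. z * a = a * z) \<Longrightarrow> F \<in> zc n X Y \<Longrightarrow> cm z F \<in> zc n X Y"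
  by (simp add: zc_def hm_cm df_cm)

text \<open>Graded Leibniz rule for a factor that is a cocycle; together with
  \<open>df_mult_right\<close> it makes composition of homotopy classes well defined.\<close>

lemma df_mult_left:
  assumes "G \<in> zc m Y Z"
  shows "G * df n X Y H = sg m (df (m + n) X Z (G * H))"
proof -
  have "sg m (snd Z * G * H) = G * snd Y * H" using zc_commute[OF assms] by (simp add: sg_mult_left)
  then show ?thesis by (simp add: df_def right_diff_distrib sg_diff sg_plus mult.assoc sg_mult_right)
qed

lemma df_mult_right:
  assumes "F \<in> zc m X Y"
  shows "df n Y Z H * F = df (n + m) X Z (H * F)"
  by (simp add: df_def left_diff_distrib mult.assoc zc_commute[OF assms] sg_mult_left sg_mult_right sg_plus)

lemma zc_mult: "G \<in> zc m Y Z \<Longrightarrow> F \<in> zc n X Y \<Longrightarrow> G * F \<in> zc (m + n) X Z"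
  using df_mult_left[of G m Y Z n X F] by (auto simp: zc_def intro: hm_mult)

lemma zc_id: "mcplx X \<Longrightarrow> fst X \<in> zc 0 X X"
  by (simp add: zc_def hm_def mcplx_def df_def)

lemma zc_unit: "F \<in> zc n X Y \<Longrightarrow> fst Y * F = F" "F \<in> zc n X Y \<Longrightarrow> F * fst X = F"
  by (simp_all add: zc_def hm_def)

lemma df_hm:
  assumes "mcplx X" "mcplx Y" "H \<in> hm n X Y"
  shows "df n X Y H \<in> hm (n + 1) X Y"
proof -
  have "snd X \<in> hm 1 X X" "snd Y \<in> hm 1 Y Y" using assms by (simp_all add: hm_def mcplx_def)
  then have "snd Y * H \<in> hm (1 + n) X Y" "H * snd X \<in> hm (n + 1) X Y"
    using assms(3) hm_mult by blast+
  then show ?thesis by (simp add: df_def hm_closed add.commute)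
qed

lemma bd_zc:
  assumes "mcplx X" "mcplx Y" "F \<in> bd n X Y"
  shows "F \<in> zc n X Y"
proof -
  obtain H where H: "H \<in> hm (n - 1) X Y" "F = df (n - 1) X Y H" using assms(3) by (auto simp: bd_def)
  have dd: "snd X * snd X = 0" "snd Y * snd Y = 0" using assms by (auto simp: mcplx_def)
  have "df n X Y F = sg n (sg (n - 1) (H * (snd X * snd X))) + snd Y * snd Y * H
     - sg (n - 1) (snd Y * H * snd X) - sg n (snd Y * H * snd X)"
    by (simp add: H df_def algebra_simps sg_mult_left sg_mult_right sg_diff)
  also have "\<dots> = 0" by (simp add: dd sg_minus sg_neg)
  finally show ?thesis using df_hm[OF assms(1,2) H(1)] H(2) by (simp add: zc_def)
qed

lemma bd_0 [simp]: "0 \<in> bd n X Y"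
  by (auto simp: bd_def intro!: image_eqI[of _ _ 0])

lemma bd_closed:
  assumes "F \<in> bd n X Y"
  shows "G \<in> bd n X Y \<Longrightarrow> F + G \<in> bd n X Y" "G \<in> bd n X Y \<Longrightarrow> F - G \<in> bd n X Y" "- F \<in> bd n X Y"
    "sg m F \<in> bd n X Y"
  using assms unfolding bd_def
  by (auto simp: hm_closed simp flip: df_add df_diff df_neg df_sg)

lemma bd_cm: "(\<And>a. z * a = a * z) \<Longrightarrow> F \<in> bd n X Y \<Longrightarrow> cm z F \<in> bd n X Y"
  unfolding bd_def by (auto simp: hm_cm simp flip: df_cm)

lemma bd_mult_left:
  assumes "G \<in> zc m Y Z" "F \<in> bd n X Y"
  shows "G * F \<in> bd (m + n) X Z"
proof -
  obtain H where H: "H \<in> hm (n - 1) X Y" "F = df (n - 1) X Y H" using assms(2) by (auto simp: bd_def)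
  have "G * F = df (m + n - 1) X Z (sg m (G * H))"
    by (simp add: H(2) df_mult_left[OF assms(1)] df_sg add_diff_eq)
  moreover have "sg m (G * H) \<in> hm (m + n - 1) X Z"
    using hm_closed(4)[OF hm_mult[OF zc_hm[OF assms(1)] H(1)]] by (simp add: add_diff_eq)
  ultimately show ?thesis by (auto simp: bd_def)
qed

lemma bd_mult_right:
  assumes "G \<in> bd m Y Z" "F \<in> zc n X Y"
  shows "G * F \<in> bd (m + n) X Z"
proof -
  obtain H where H: "H \<in> hm (m - 1) Y Z" "G = df (m - 1) Y Z H" using assms(1) by (auto simp: bd_def)
  have "G * F = df (m + n - 1) X Z (H * F)"
    by (simp add: H(2) df_mult_right[OF assms(2)] algebra_simps)
  moreover have "H * F \<in> hm (m + n - 1) X Z"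
    using hm_mult[OF H(1) zc_hm[OF assms(2)]] by (simp add: algebra_simps)
  ultimately show ?thesis by (auto simp: bd_def)
qed

text \<open>A boundary of degree 0 is the supercommutator of the differential with the
  homotopy.\<close>

lemma (in fd_algebra) str_bd:
  assumes "mcplx X" "F \<in> bd 0 X X"
  shows "str F \<in> comm"
proof -
  obtain H where H: "H \<in> hm (-1) X X" "F = snd X * H + H * snd X"
    using assms(2) by (auto simp: bd_def df_def)
  have "hdeg 1 (snd X)" using assms(1) by (simp add: mcplx_def)
  from str_commute[OF this, of H] show ?thesis by (simp add: H str_add)
qed

section \<open>Powers of endomorphisms, with an idempotent as zeroth power\<close>

primrec mpow :: "'a::ring imat \<Rightarrow> 'a imat \<Rightarrow> nat \<Rightarrow> 'a imat" where
  "mpow e F 0 = e"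
| "mpow e F (Suc q) = mpow e F q * F"

lemma zc_mpow: "mcplx X \<Longrightarrow> F \<in> zc n X X \<Longrightarrow> mpow (fst X) F q \<in> zc (int q * n) X X"
proof (induction q)
  case (Suc q)
  then show ?case using zc_mult[OF Suc.IH[OF Suc.prems] Suc.prems(2)] by (simp add: algebra_simps)
qed (simp add: zc_id)

lemma mpow_add:
  assumes "F * e = F" "e * e = e"
  shows "mpow e F (m + n) = mpow e F m * mpow e F n"
proof -
  have "mpow e F m * e = mpow e F m" by (cases m) (auto simp: assms mult.assoc)
  then show ?thesis by (induction n) (auto simp: mult.assoc)
qed

lemma mpow_mpow:
  assumes "F * e = F" "e * e = e"
  shows "mpow e (mpow e F m) n = mpow e F (n * m)"
  by (induction n) (simp_all add: mpow_add[OF assms, symmetric] add.commute)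

text \<open>\<open>F\<close> is expanded into matrix units. Since all words have degree 0, the
  supertrace is invariant under their rotation modulo commutators, so only constant words remain,
  and among these only the diagonal ones. What is left is a signed sum of p-th powers of diagonal
  entries, which additivity of the Frobenius map identifies with the power of the
  supertrace.\<close>

lemma (in charp_algebra) str_mpow:
  assumes "hdeg 0 F" "F * e = F" "e * F = F"
  shows "str (mpow e F p) - str F ^ p \<in> comm"
proof -
  let ?W = "idx F"
  \<comment> \<open>The empty word needs a value. \<open>E\<close> is an identity on the support of
    \<open>F\<close>; positive powers are the same whether they start from \<open>E\<close> or from
    \<open>e\<close>.\<close>
  define E where "E = (\<Sum>u\<in>?W. sgl u u (1::'a))"
  define m where "m w = sgl (fst w) (snd w) (ent F (fst w) (snd w))" for w
  define f where "f w V = m w * V" for w V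
  have F: "F = sum m (?W \<times> ?W)" unfolding m_def by (rule imat_sum_sgl) auto
  have mE: "m w * E = m w \<and> E * m w = m w" if "w \<in> ?W \<times> ?W" for w
  proof -
    have "m w * E = (\<Sum>u\<in>?W. if u = snd w then m w else 0)" "E * m w = (\<Sum>u\<in>?W. if u = fst w then m w else 0)"
      unfolding E_def m_def sum_distrib_left sum_distrib_right by (auto intro!: sum.cong simp: sgl_mult)
    then show ?thesis using that by (simp add: sum.delta mem_Times_iff)
  qed
  have FE: "F * E = F" "E * F = F"
    by (subst (1 2) F, simp add: sum_distrib_left sum_distrib_right mE cong: sum.cong)+
  have hm: "hdeg 0 (m w)" for w
  proof (cases "ent F (fst w) (snd w) = 0")
    case False
    then show ?thesis using assms(1) hdeg_ent[of 0 F "fst w" "snd w"] by (cases "dg (fst w) = dg (snd w)") (auto simp: m_def intro!: hdeg_sgl)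
  qed (simp add: m_def)
  have "hdeg 0 (\<Sum>u\<in>A. sgl u u (1::'a))" if "finite A" for A
    using that by (induction A) (auto intro!: hdeg_add hdeg_sgl)
  then have E: "hdeg 0 E" by (simp add: E_def)
  have hf: "hdeg 0 (foldr f w E)" for w
    by (induction w) (use hdeg_mult[OF hm, where n = 0] E in \<open>auto simp: f_def\<close>)
  have fE: "foldr f w E * V = foldr f w V" if "E * V = V" for w V
    by (induction w) (use that in \<open>auto simp: f_def mult.assoc\<close>)
  have iter: "((\<lambda>V. F * V) ^^ n) E = mpow E F n" for n
  proof (induction n)
    case (Suc n)
    have "F * mpow E F k = mpow E F k * F" for k
      by (induction k) (use FE in \<open>auto simp: mult.assoc[symmetric]\<close>)
    then show ?case using Suc by simp
  qed simp
  have pos: "mpow E F (Suc n) = mpow e F (Suc n)" for n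
    by (induction n) (use FE assms in auto)
  then have pe: "mpow e F p = mpow E F p" using char by (cases p) auto
  have "mpow E F p = ((\<lambda>V. \<Sum>w\<in>?W \<times> ?W. f w V) ^^ p) E"
    unfolding f_def sum_distrib_right[symmetric] F[symmetric] iter ..
  also have "\<dots> = (\<Sum>w\<in>{w. set w \<subseteq> ?W \<times> ?W \<and> length w = p}. foldr f w E)"
    by (rule sum_words) (auto simp: f_def distrib_left)
  finally have s1: "str (mpow E F p) = (\<Sum>w\<in>{w. set w \<subseteq> ?W \<times> ?W \<and> length w = p}. str (foldr f w E))"
    by (simp add: str_sum)
  have cyc: "(\<Sum>w\<in>{w. set w \<subseteq> ?W \<times> ?W \<and> length w = p}. str (foldr f w E))
      - (\<Sum>w\<in>?W \<times> ?W. str (foldr f (replicate p w) E)) \<in> comm"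
  proof (rule sum_cyclic_words[OF _ prime_p comm_0 comm_add])
    fix i w assume "i \<in> ?W \<times> ?W"
    then have "foldr f (w @ [i]) E = foldr f w E * m i" "foldr f (i # w) E = m i * foldr f w E"
      using fE[of "m i" w] mE by (auto simp: f_def)
    then show "str (foldr f (w @ [i]) E) - str (foldr f (i # w) E) \<in> comm"
      using str_commute[OF hf, of w "m i"] by simp
  qed (auto simp: sum_p_zero comm_0)
  have "str (foldr f (replicate p w) E) = (if fst w = snd w then sg (dg (fst w)) (ent F (fst w) (fst w) ^ p) else 0)"
    if w: "w \<in> ?W \<times> ?W" for w
  proof (cases "fst w = snd w")
    case True
    have "foldr f (replicate (Suc n) w) E = sgl (fst w) (fst w) (ent F (fst w) (fst w) ^ Suc n)" for n
    proof (induction n)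
      case 0
      then show ?case using mE[OF w] True by (simp add: f_def m_def)
    next
      case (Suc n)
      have "foldr f (replicate (Suc (Suc n)) w) E = m w * foldr f (replicate (Suc n) w) E" by (simp add: f_def)
      also have "\<dots> = sgl (fst w) (fst w) (ent F (fst w) (fst w) ^ Suc (Suc n))"
        unfolding Suc using True by (simp add: m_def sgl_mult)
      finally show ?case .
    qed
    then show ?thesis using char True by (cases p) (auto simp: str_sgl simp del: power_Suc replicate_Suc)
  next
    case False
    \<comment> \<open>As p is at least 2, a constant word in an off-diagonal matrix unit contains
      the square of this unit, which is zero.\<close>
    obtain q where "p = Suc (Suc q)" using prime_p
      by (metis One_nat_def not0_implies_Suc not_prime_0 not_prime_1)
    then have "foldr f (replicate p w) E = m w * m w * foldr f (replicate q w) E" by (simp add: f_def mult.assoc)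
    also have "m w * m w = 0" using False by (simp add: m_def sgl_mult)
    finally show ?thesis using False by simp
  qed
  then have "(\<Sum>w\<in>?W \<times> ?W. str (foldr f (replicate p w) E))
      = (\<Sum>w\<in>?W \<times> ?W. if fst w = snd w then sg (dg (fst w)) (ent F (fst w) (fst w) ^ p) else 0)"
    by (intro sum.cong) auto
  also have "\<dots> = (\<Sum>u\<in>?W. \<Sum>v\<in>?W. if u = v then sg (dg u) (ent F u u ^ p) else 0)"
    by (simp only: sum.cartesian_product split_def)
  also have "\<dots> = (\<Sum>u\<in>?W. sg (dg u) (ent F u u ^ p))" by (intro sum.cong) (auto simp: sum.delta)
  finally have 1: "str (mpow E F p) - (\<Sum>u\<in>?W. sg (dg u) (ent F u u ^ p)) \<in> comm" using cyc by (simp only: s1)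
  have "(\<Sum>u\<in>?W. sg (dg u) (ent F u u ^ p)) - (\<Sum>u\<in>?W. sg (dg u) (ent F u u) ^ p) \<in> comm"
    unfolding sum_subtractf[symmetric]
  proof (rule comm_sum)
    fix u
    have "(- x) ^ p - - (x ^ p) \<in> comm" for x :: 'a
      using comm_neg[OF comm_add_power[of x "- x"]] by (simp add: zero_power_p add.commute)
    from comm_diff_sym[OF this] show "sg (dg u) (ent F u u ^ p) - sg (dg u) (ent F u u) ^ p \<in> comm"
      by (simp add: sg_def comm_0)
  qed
  moreover have "(\<Sum>u\<in>?W. sg (dg u) (ent F u u) ^ p) - str F ^ p \<in> comm"
    unfolding str_def by (rule comm_diff_sym[OF comm_sum_power]) simp
  ultimately show ?thesis unfolding pe using comm_diff_trans[OF comm_diff_trans[OF 1]] by blast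
qed

lemma (in charp_algebra) str_mpow_pp:
  assumes "hdeg 0 F" "F * e = F" "e * F = F" "e * e = e" "hdeg 0 e"
  shows "str (mpow e F (p ^ r)) - str F ^ (p ^ r) \<in> comm"
proof (induction r)
  case 0
  then show ?case using assms comm_0 by simp
next
  case (Suc r)
  let ?G = "mpow e F (p ^ r)"
  have G: "hdeg 0 (mpow e F n) \<and> mpow e F n * e = mpow e F n \<and> e * mpow e F n = mpow e F n" for n
    by (induction n) (use assms hdeg_mult[of 0 _ 0] in \<open>auto simp: mult.assoc[symmetric] , auto simp: mult.assoc\<close>)
  have "str (mpow e ?G p) - str ?G ^ p \<in> comm" using G by (intro str_mpow) auto
  moreover have "str ?G ^ p - (str F ^ (p ^ r)) ^ p \<in> comm" using power_p_cong[OF Suc] .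
  ultimately show ?case using comm_diff_trans
    by (simp add: mpow_mpow[OF assms(2,4)] mult.commute flip: power_mult)
qed

subsection \<open>Linear functionals\<close>

definition functional :: "('k::field \<Rightarrow> 'v::ab_group_add \<Rightarrow> 'v) \<Rightarrow> ('v \<Rightarrow> 'k) \<Rightarrow> bool" where
  "functional s l \<longleftrightarrow> (\<forall>x y. l (x + y) = l x + l y) \<and> (\<forall>c x. l (s c x) = c * l x)"

lemma functional_simps:
  assumes "functional s l"
  shows "l (x + y) = l x + l y" "l (s c x) = c * l x" "l 0 = 0" "l (- x) = - l x" "l (x - y) = l x - l y"
    "l (sum f A) = (\<Sum>a\<in>A. l (f a))" "l (sg n x) = sg n (l x)"
proof -
  show a: "l (x + y) = l x + l y" for x y using assms by (simp add: functional_def)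
  show "l (s c x) = c * l x" using assms by (simp add: functional_def)
  show z: "l 0 = 0" using a[of 0 0] by (metis add.right_neutral add_left_cancel)
  show n: "l (- x) = - l x" for x using a[of x "- x"] z by (simp add: eq_neg_iff_add_eq_0 add.commute)
  show "l (x - y) = l x - l y" using a[of x "- y"] n by simp
  show "l (sum f A) = (\<Sum>a\<in>A. l (f a))" by (induction A rule: infinite_finite_induct) (auto simp: a z)
  show "l (sg n x) = sg n (l x)" by (simp add: sg_def n)
qed

lemma (in vector_space) functional_separating:
  assumes "subspace S" "v \<notin> S"
  shows "\<exists>l. functional scale l \<and> (\<forall>x\<in>S. l x = 0) \<and> l v = 1"
proof -
  interpret k: vector_space "(*) :: 'a \<Rightarrow> 'a \<Rightarrow> 'a" by unfold_locales (auto simp: algebra_simps)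
  interpret vp: vector_space_pair scale "(*) :: 'a \<Rightarrow> 'a \<Rightarrow> 'a" ..
  obtain B where B: "B \<subseteq> S" "independent B" "span B = S"
    using basis_exists[of S] assms(1) by (metis span_subspace)
  have "independent (insert v B)" using B assms(2) by (simp add: independent_insertI)
  then obtain l where l: "Vector_Spaces.linear scale (*) l" "\<forall>x\<in>insert v B. l x = (if x = v then 1 else 0)"
    using vp.linear_independent_extend[of "insert v B" "\<lambda>x. if x = v then 1 else 0"] by blast
  interpret l: Vector_Spaces.linear scale "(*)" l by (rule l(1))
  have lB: "l x = 0" if "x \<in> B" for x using l(2) that B assms(2) by auto
  have "l x = 0" if "x \<in> S" for x
    using that unfolding B(3)[symmetric] by (induction rule: span_induct_alt) (auto simp: l.add l.scale l.zero lB)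
  then show ?thesis using l(2) by (intro exI[of _ l]) (auto simp: functional_def l.add l.scale)
qed

text \<open>In terms of the symmetrizing form, \<open>\<epsilon> a\<close> is $(a, 1)$.\<close>

locale symmetrized_algebra = charp_algebra scale p
  for scale :: "'k::field \<Rightarrow> 'a::{ring,monoid_mult} \<Rightarrow> 'a" and p +
  fixes \<epsilon> :: "'a \<Rightarrow> 'k"
  assumes eps: "functional scale \<epsilon>" and eps_commute: "\<epsilon> (a * b) = \<epsilon> (b * a)"
    and eps_nondegenerate: "(\<And>b. \<epsilon> (a * b) = 0) \<Longrightarrow> a = 0"

lemma (in symmetric_algebra) symmetrizing_functional:
  assumes "CHAR('k) = p" "p > 0"
  obtains \<epsilon> where "symmetrized_algebra scale p \<epsilon>"
proof -
  obtain \<beta> :: "'a \<Rightarrow> 'a \<Rightarrow> 'k" where b: "\<And>b. Vector_Spaces.linear scale (*) (\<lambda>a. \<beta> a b)"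
    "\<And>a. (\<forall>b. \<beta> a b = 0) \<Longrightarrow> a = 0" "\<And>a b c. \<beta> (a * b) c = \<beta> a (b * c)" "\<And>a b. \<beta> a b = \<beta> b a"
    using symmetrizing_form by blast
  interpret l: Vector_Spaces.linear scale "(*)" "\<lambda>a. \<beta> a 1" by (rule b(1))
  have e: "\<beta> (a * b) 1 = \<beta> a b" for a b using b(3)[of a b 1] by simp
  have "symmetrized_algebra scale p (\<lambda>a. \<beta> a 1)"
  proof unfold_locales
    show "functional scale (\<lambda>a. \<beta> a 1)" by (simp add: functional_def l.add l.scale)
    show "\<beta> (a * b) 1 = \<beta> (b * a) 1" for a b using e b(4) by simp
    show "a = 0" if "\<And>b. \<beta> (a * b) 1 = 0" for a using b(2) that by (simp add: e)
  qed (rule assms)+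
  then show ?thesis by (rule that)
qed

context symmetrized_algebra
begin

lemma eps_comm: "x \<in> comm \<Longrightarrow> \<epsilon> x = 0"
  by (induction rule: comm_induct) (auto simp: functional_simps[OF eps] eps_commute)

lemma eps_comm_eq: "x - y \<in> comm \<Longrightarrow> \<epsilon> x = \<epsilon> y"
  using eps_comm[of "x - y"] by (simp add: functional_simps[OF eps])

text \<open>Nondegeneracy makes the map from \<open>c\<close> to the functional
  \<open>\<epsilon> (c * x)\<close> of \<open>x\<close> injective, and finite dimension makes it
  surjective.\<close>

lemma eps_representation:
  assumes "functional scale l"
  obtains c where "\<And>x. l x = \<epsilon> (c * x)"
proof -
  obtain S where S: "finite S" "span S = UNIV" using finite_dim by blast
  obtain B where B: "B \<subseteq> S" "independent B" "S \<subseteq> span B" using maximal_independent_subset[of S] by blast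
  have finB: "finite B" using B S finite_subset by blast
  have sB: "span B = UNIV" using B(3) S(2) by (metis span_mono span_span top.extremum_uniqueI)
  interpret fd: finite_dimensional_vector_space scale B using finB B(2) sB by unfold_locales auto
  \<comment> \<open>\<open>T c\<close> records the functional given by \<open>c\<close> through its
    values on the basis, but as an element of the algebra itself; surjectivity is then that of an
    injective endomorphism.\<close>
  define T where "T c = (\<Sum>b\<in>B. scale (\<epsilon> (c * b)) b)" for c
  have eq: "f x = g x" if "functional scale f" "functional scale g" "\<And>b. b \<in> B \<Longrightarrow> f b = g b" for f g :: "'a \<Rightarrow> 'k" and x
  proof -
    have "x \<in> span B" using sB by simp
    then show ?thesis
      by (induction rule: span_induct_alt) (auto simp: functional_simps[OF that(1)] functional_simps[OF that(2)] that(3))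
  qed
  have fe: "functional scale (\<lambda>x. \<epsilon> (c * x))" for c
    by (simp add: functional_def distrib_left functional_simps[OF eps] flip: scale_mult_right)
  have f0: "functional scale (\<lambda>x. 0)" by (simp add: functional_def)
  have lT: "Vector_Spaces.linear scale scale T"
    by unfold_locales (auto simp: T_def distrib_right functional_simps[OF eps] scale_left_distrib sum.distrib scale_sum_right
        simp flip: scale_mult_left)
  moreover have "inj T"
  proof (rule injI)
    fix c1 c2 assume "T c1 = T c2"
    define c where "c = c1 - c2"
    have "T c = T c1 - T c2"
      by (simp add: c_def T_def left_diff_distrib functional_simps[OF eps] scale_left_diff_distrib sum_subtractf)
    then have "T c = 0" using \<open>T c1 = T c2\<close> by simp
    then have "\<epsilon> (c * b) = 0" if "b \<in> B" for b
      using independentD[OF B(2) finB subset_refl, of "\<lambda>b. \<epsilon> (c * b)"] that by (simp add: T_def)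
    then have "\<epsilon> (c * x) = 0" for x using eq[OF fe f0] by simp
    then have "c = 0" using eps_nondegenerate by blast
    then show "c1 = c2" by (simp add: c_def)
  qed
  ultimately have "surj T" by (rule fd.linear_inj_imp_surj)
  then obtain c where c: "T c = (\<Sum>b\<in>B. scale (l b) b)" by (metis surjD)
  have "(\<Sum>b\<in>B. scale (l b - \<epsilon> (c * b)) b) = 0"
    using c by (simp add: T_def scale_left_diff_distrib sum_subtractf)
  then have "l b = \<epsilon> (c * b)" if "b \<in> B" for b
    using independentD[OF B(2) finB subset_refl, of "\<lambda>b. l b - \<epsilon> (c * b)"] that by simp
  then have "l x = \<epsilon> (c * x)" for x by (rule eq[OF assms fe])
  then show ?thesis by (rule that)
qed

section \<open>Duality of morphisms under the supertrace\<close>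

definition iscale :: "'k \<Rightarrow> 'a imat \<Rightarrow> 'a imat" where "iscale c = cm (scale c 1)"

lemma scale_1_mult: "scale c 1 * x = scale c x"
  by (metis mult_1_left scale_mult_left)

lemma scale_1_central: "scale c 1 * x = x * scale c 1"
  by (metis mult_1_left mult_1_right scale_mult_left scale_mult_right)

text \<open>The form represents the functional entry by entry, which yields a matrix
  \<open>C\<close> in the opposite direction; projecting it to the right degree and between the
  idempotents does not change the pairing. Vanishing on boundaries is adjoint to being a cocycle,
  and the pairing of matrices detects zero, so the projected matrix is a cocycle on the
  nose.\<close>

lemma str_dual:
  assumes X: "mcplx X" and Y: "mcplx Y" and l: "functional iscale l"
    and bd: "\<And>F. F \<in> bd n X Y \<Longrightarrow> l F = 0"
  obtains c where "c \<in> zc (- n) Y X" "\<And>F. F \<in> hm n X Y \<Longrightarrow> l F = \<epsilon> (str (c * F))"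
proof -
  let ?W = "idx (fst X) \<union> idx (fst Y)"
  note simps = functional_simps[OF eps] functional_simps[OF l]
  have "\<exists>c. \<forall>x. l (sgl u v x) = \<epsilon> (c * x)" for u v
  proof -
    have "functional scale (\<lambda>x. l (sgl u v x))"
      by (simp add: functional_def sgl_add simps) (metis cm_sgl iscale_def scale_1_mult simps(9))
    then show ?thesis by (metis eps_representation)
  qed
  then obtain c0 where c0: "\<And>u v x. l (sgl u v x) = \<epsilon> (c0 u v * x)" by metis
  \<comment> \<open>The representing elements are transposed; the sign cancels the one in the
    supertrace.\<close>
  define C where "C = Imat (\<lambda>v u. if u \<in> ?W \<and> v \<in> ?W then sg (dg v) (c0 u v) else 0)"
  have entC: "ent C v u = (if u \<in> ?W \<and> v \<in> ?W then sg (dg v) (c0 u v) else 0)" for u v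
    unfolding C_def by (subst ent_Imat[of ?W]) (auto split: if_splits)
  have lC: "l F = \<epsilon> (str (C * F))" if F: "F \<in> hm n X Y" for F
  proof -
    have iF: "idx F \<subseteq> ?W"
    proof
      fix u assume "u \<in> idx F"
      then obtain v where "ent F u v \<noteq> 0 \<or> ent F v u \<noteq> 0" unfolding idx_def by blast
      then have "ent (fst Y * F) u v \<noteq> 0 \<or> ent (F * fst X) v u \<noteq> 0" using F by (simp add: hm_def)
      moreover have "ent (fst Y * F) u v = 0 \<and> ent (F * fst X) v u = 0" if "u \<notin> ?W"
        using that by (auto simp: ent_times0 ent_not_idx intro!: sum.neutral)
      ultimately show "u \<in> ?W" by blast
    qed
    have f: "finite ?W" by simp
    have "l F = (\<Sum>w\<in>?W \<times> ?W. \<epsilon> (c0 (fst w) (snd w) * ent F (fst w) (snd w)))"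
      by (subst imat_sum_sgl[OF f iF]) (simp add: simps c0)
    also have "\<dots> = (\<Sum>u\<in>?W. \<Sum>v\<in>?W. \<epsilon> (c0 u v * ent F u v))"
      by (simp add: sum.cartesian_product split_def)
    also have "\<dots> = (\<Sum>v\<in>?W. \<Sum>u\<in>?W. \<epsilon> (c0 u v * ent F u v))" by (rule sum.swap)
    also have "\<dots> = (\<Sum>v\<in>?W. sg (dg v) (\<epsilon> (ent (C * F) v v)))"
    proof (rule sum.cong[OF refl])
      fix v assume v: "v \<in> ?W"
      have "ent (C * F) v v = (\<Sum>u\<in>?W. ent C v u * ent F u v)"
        by (rule ent_times[OF f]) (auto simp: entC)
      also have "\<dots> = sg (dg v) (\<Sum>u\<in>?W. c0 u v * ent F u v)"
        unfolding sg_sum using v by (intro sum.cong refl) (simp add: entC sg_mult_left)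
      finally show "(\<Sum>u\<in>?W. \<epsilon> (c0 u v * ent F u v)) = sg (dg v) (\<epsilon> (ent (C * F) v v))"
        by (simp add: simps)
    qed
    also have "\<dots> = \<epsilon> (str (C * F))"
      by (subst str_eq[OF f]) (auto simp: simps ent_times0 entC intro!: sum.neutral)
    finally show ?thesis .
  qed
  \<comment> \<open>The pairing with degree \<open>n\<close> sees only the part of degree
    \<open>- n\<close>, and by cyclicity the idempotents may be moved over to \<open>F\<close>,
    where they act as identities.\<close>
  define c where "c = fst X * dpart (- n) C * fst Y"
  have e: "hdeg 0 (fst X)" "fst X * fst X = fst X" "hdeg 0 (fst Y)" "fst Y * fst Y = fst Y"
    using X Y by (auto simp: mcplx_def)
  have "hdeg (0 + (- n) + 0) c" unfolding c_def by (intro hdeg_mult hdeg_dpart e)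
  then have ch: "c \<in> hm (- n) Y X"
    using e by (simp add: hm_def c_def mult.assoc) (simp add: mult.assoc[symmetric] e)
  have dp: "str (dpart (- m) A * B) = str (A * B)" "str (B * dpart (- m) A) = str (B * A)" if "hdeg m B" for A B :: "'a imat" and m
  proof -
    have f: "finite (idx A \<union> idx B)" by simp
    have "ent (dpart (- m) A * B) u u = ent (A * B) u u" for u
      by (subst (1 2) ent_times[OF f]) (use that in \<open>auto simp: ent_not_idx dpart.rep_eq hdeg_ent intro!: sum.cong\<close>)
    then show "str (dpart (- m) A * B) = str (A * B)"
      by (subst (1 2) str_eq[OF f]) (auto simp: ent_times0 ent_not_idx intro!: sum.neutral)
    have "ent (B * dpart (- m) A) u u = ent (B * A) u u" for u
      by (subst (1 2) ent_times[OF f]) (use that in \<open>auto simp: ent_not_idx dpart.rep_eq hdeg_ent intro!: sum.cong\<close>)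
    then show "str (B * dpart (- m) A) = str (B * A)"
      by (subst (1 2) str_eq[OF f]) (auto simp: ent_times0 ent_not_idx intro!: sum.neutral)
  qed
  have eq0: "\<epsilon> (str (A * B)) = \<epsilon> (str (B * A))" if "hdeg 0 A" for A B
    using eps_comm_eq[OF str_commute[OF that, of B]] by simp
  have lc: "l F = \<epsilon> (str (c * F))" if F: "F \<in> hm n X Y" for F
  proof -
    have FF: "fst Y * F = F" "F * fst X = F" "hdeg n F" using F by (auto simp: hm_def)
    have "\<epsilon> (str (c * F)) = \<epsilon> (str (fst X * (dpart (- n) C * F)))" by (simp add: c_def mult.assoc FF)
    also have "\<dots> = \<epsilon> (str (dpart (- n) C * F))" by (subst eq0[OF e(1)]) (simp add: mult.assoc FF)
    also have "\<dots> = l F" using dp FF lC[OF F] by simp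
    finally show ?thesis ..
  qed
  \<comment> \<open>Up to sign, \<open>Q\<close> is the differential of \<open>c\<close>. The sign
    is chosen so that pairing \<open>Q\<close> with \<open>H\<close> gives the pairing of
    \<open>c\<close> with the boundary of \<open>H\<close>, which vanishes.\<close>
  define Q where "Q = c * snd Y + sg (n - 1) (snd X * c)"
  have dX: "snd X \<in> hm 1 X X" "snd Y \<in> hm 1 Y Y" using X Y by (auto simp: mcplx_def hm_def)
  have Qh: "Q \<in> hm (1 - n) Y X"
    unfolding Q_def using hm_mult[OF ch dX(2)] hm_mult[OF dX(1) ch] by (simp add: hm_closed)
  have QH: "\<epsilon> (str (Q * H)) = 0" if H: "H \<in> hm (n - 1) X Y" for H
  proof -
    have "\<epsilon> (str (c * df (n - 1) X Y H)) = 0"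
      using bd[of "df (n - 1) X Y H"] lc[of "df (n - 1) X Y H"] df_hm[OF X Y H] H by (simp add: bd_def)
    moreover have "c * df (n - 1) X Y H = c * snd Y * H - sg (n - 1) (c * H * snd X)"
      by (simp add: df_def right_diff_distrib sg_mult_right mult.assoc)
    moreover have "\<epsilon> (str (snd X * (c * H))) = - \<epsilon> (str (c * H * snd X))"
      using eps_comm_eq[OF str_commute[of 1 "snd X" "c * H"]] dX by (simp add: hm_def simps)
    ultimately show ?thesis
      by (simp add: Q_def distrib_right str_add str_diff str_sg simps sg_mult_left mult.assoc sg_neg)
  qed
  have "Q = 0"
  proof (rule imat_eqI)
    fix u v
    have "ent Q u v = 0"
    proof (rule eps_nondegenerate)
      fix a
      \<comment> \<open>Matrix units, projected into \<open>hm (n - 1) X Y\<close>, test a single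
        entry of \<open>Q\<close>.\<close>
      define H where "H = fst Y * dpart (- (1 - n)) (sgl v u a) * fst X"
      have QQ: "fst X * Q = Q" "Q * fst Y = Q" "hdeg (1 - n) Q" using Qh by (auto simp: hm_def)
      have "hdeg (0 + (- (1 - n)) + 0) H" unfolding H_def by (intro hdeg_mult hdeg_dpart e)
      then have "H \<in> hm (n - 1) X Y"
        using e by (simp add: hm_def H_def mult.assoc) (simp add: mult.assoc[symmetric] e)
      then have "0 = \<epsilon> (str (Q * H))" using QH by simp
      also have "Q * H = Q * dpart (- (1 - n)) (sgl v u a) * fst X"
        unfolding H_def mult.assoc[symmetric] QQ ..
      also have "\<epsilon> (str \<dots>) = \<epsilon> (str (Q * dpart (- (1 - n)) (sgl v u a)))"
        by (subst eq0[OF e(1), symmetric]) (simp add: mult.assoc[symmetric] QQ)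
      also have "\<dots> = \<epsilon> (str (Q * sgl v u a))" using dp(2)[OF QQ(3)] by simp
      also have "str (Q * sgl v u a) = sg (dg u) (ent Q u v * a)"
      proof -
        have "ent (Q * sgl v u a) x x = (if x = u then ent Q u v * a else 0)" for x
          by (subst ent_times[of "{v}"]) (auto simp: sgl.rep_eq)
        then show ?thesis by (subst str_eq[of "{u}"]) auto
      qed
      finally show "\<epsilon> (ent Q u v * a) = 0" by (simp add: simps)
    qed
    then show "ent Q u v = ent 0 u v" by (simp add: ent_simps)
  qed
  then have "df (- n) Y X c = 0"
    by (simp add: Q_def df_def eq_neg_iff_add_eq_0[symmetric] sg_minus sg_neg)
  then have "c \<in> zc (- n) Y X" using ch by (simp add: zc_def)
  then show ?thesis using lc that by blast
qed

lemma vector_space_iscale: "vector_space iscale"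
  by unfold_locales (auto simp: iscale_def cm_add cm_cm cm_plus scale_left_distrib scale_1_mult)

text \<open>Otherwise a functional that vanishes on the boundaries but not at \<open>A\<close> would
  be the pairing with a cocycle. Thus classes of degree \<open>n\<close> from \<open>X\<close> to
  \<open>Y\<close> are detected by classes of degree \<open>- n\<close> back, as in a Calabi-Yau
  category of dimension 0.\<close>

lemma bd_by_trace:
  assumes X: "mcplx X" and Y: "mcplx Y" and A: "A \<in> zc n X Y"
    and tr: "\<And>g. g \<in> zc (- n) Y X \<Longrightarrow> \<epsilon> (str (g * A)) = 0"
  shows "A \<in> bd n X Y"
proof (rule ccontr)
  assume nA: "A \<notin> bd n X Y"
  interpret iv: vector_space iscale by (rule vector_space_iscale)
  have "iv.subspace (bd n X Y)"
    by (rule iv.subspaceI) (auto simp: bd_closed iscale_def intro!: bd_cm scale_1_central)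
  then obtain l where l: "functional iscale l" "\<forall>x\<in>bd n X Y. l x = 0" "l A = 1"
    using iv.functional_separating[OF _ nA] by blast
  obtain c where "c \<in> zc (- n) Y X" "l A = \<epsilon> (str (c * A))"
    using str_dual[OF X Y l(1), of n] l(2) zc_hm[OF A] by metis
  then show False using tr l(3) by simp
qed

end

section \<open>Graded categories modelled by complexes of matrices\<close>

definition single :: "'w \<Rightarrow> 'v::ab_group_add \<Rightarrow> 'w \<Rightarrow> 'v" where
  "single w A = (\<lambda>w'. if w' = w then A else 0)"

lemma single_apply: "single w A w' = (if w' = w then A else 0)"
  by (simp add: single_def)

lemma single_0 [simp]: "single w 0 = 0"
  by (simp add: single_def fun_eq_iff)

lemma single_add: "single w (A + B) = single w A + single w B"
  and single_diff: "single w (A - B) = single w A - single w B"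
  and single_neg: "single w (- A) = - single w A"
  by (simp_all add: single_def fun_eq_iff)

lemma single_sg: "single w (sg n A) = sg n (single w A)"
  by (simp add: sg_def single_neg)

lemma single_sum: "single w (sum f A) = (\<Sum>x\<in>A. single w (f x))"
  by (induction A rule: infinite_finite_induct) (auto simp: single_add)

lemma sum_fun_apply: "sum f A w = (\<Sum>x\<in>A. f x w)"
  by (induction A rule: infinite_finite_induct) auto

lemma sum_single:
  assumes "finite S" "\<And>w. F w \<noteq> 0 \<Longrightarrow> w \<in> S"
  shows "F = (\<Sum>w\<in>S. single w (F w))"
proof
  fix x
  have "(\<Sum>w\<in>S. single w (F w) x) = (\<Sum>w\<in>S. if w = x then F x else 0)"
    by (intro sum.cong) (auto simp: single_def)
  also have "\<dots> = F x" using assms by (subst sum.delta) auto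
  finally show "F x = (\<Sum>w\<in>S. single w (F w)) x" by (simp add: sum_fun_apply)
qed

lemma sg_fun_apply: "sg n F w = sg n (F w)"
  by (simp add: sg_def)

text \<open>\<open>rep X Y n \<phi> F\<close> says that the morphism \<open>\<phi>\<close> of degree \<open>n\<close> is the homotopy class of the cocycle \<open>F\<close>.\<close>

locale gcat_model = symmetrized_algebra scale p \<epsilon>
  for scale :: "'k::field \<Rightarrow> 'a::{ring,monoid_mult} \<Rightarrow> 'a" and p \<epsilon> +
  fixes B :: "('o, 'f, 'k) gcat" and M :: "'o \<Rightarrow> 'a mcplx"
    and rep :: "'o \<Rightarrow> 'o \<Rightarrow> int \<Rightarrow> 'f \<Rightarrow> 'a imat \<Rightarrow> bool"
  assumes mc: "X \<in> gObj B \<Longrightarrow> mcplx (M X)"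
    and rep_dom: "\<lbrakk>X \<in> gObj B; Y \<in> gObj B; rep X Y n \<phi> F\<rbrakk> \<Longrightarrow> \<phi> \<in> carrier (gHom B X Y n) \<and> F \<in> zc n (M X) (M Y)"
    and rep_ex: "\<lbrakk>X \<in> gObj B; Y \<in> gObj B; \<phi> \<in> carrier (gHom B X Y n)\<rbrakk> \<Longrightarrow> \<exists>F. rep X Y n \<phi> F"
    and rep_onto: "\<lbrakk>X \<in> gObj B; Y \<in> gObj B; F \<in> zc n (M X) (M Y)\<rbrakk> \<Longrightarrow> \<exists>\<phi>. rep X Y n \<phi> F"
    and rep_eq: "\<lbrakk>X \<in> gObj B; Y \<in> gObj B; rep X Y n \<phi> F; rep X Y n \<psi> G\<rbrakk> \<Longrightarrow>
        \<phi> = \<psi> \<longleftrightarrow> F - G \<in> bd n (M X) (M Y)"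
    and rep_add: "\<lbrakk>X \<in> gObj B; Y \<in> gObj B; rep X Y n \<phi> F; rep X Y n \<psi> G\<rbrakk> \<Longrightarrow>
        rep X Y n (\<phi> \<oplus>\<^bsub>gHom B X Y n\<^esub> \<psi>) (F + G)"
    and rep_smult: "\<lbrakk>X \<in> gObj B; Y \<in> gObj B; rep X Y n \<phi> F\<rbrakk> \<Longrightarrow>
        rep X Y n (c \<odot>\<^bsub>gHom B X Y n\<^esub> \<phi>) (iscale c F)"
    and rep_zero: "\<lbrakk>X \<in> gObj B; Y \<in> gObj B\<rbrakk> \<Longrightarrow> rep X Y n \<zero>\<^bsub>gHom B X Y n\<^esub> 0"
    and rep_comp: "\<lbrakk>X \<in> gObj B; Y \<in> gObj B; Z \<in> gObj B; rep X Y i f F; rep Y Z j g G\<rbrakk> \<Longrightarrow>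
        rep X Z (i + j) (gCmp B X Y Z i j g f) (G * F)"
    and rep_id: "X \<in> gObj B \<Longrightarrow> rep X X 0 (gId B X) (fst (M X))"
begin

abbreviation "Ob \<equiv> gObj B"

lemma rep_eqI: "\<lbrakk>X \<in> Ob; Y \<in> Ob; rep X Y n \<phi> F; rep X Y n \<psi> G; F - G = 0\<rbrakk> \<Longrightarrow> \<phi> = \<psi>"
  using rep_eq by fastforce

lemma rep_change:
  assumes "X \<in> Ob" "Y \<in> Ob" "rep X Y n \<phi> F" "F - G \<in> bd n (M X) (M Y)"
  shows "rep X Y n \<phi> G"
proof -
  have "F - (F - G) \<in> zc n (M X) (M Y)"
    using rep_dom[OF assms(1-3)] bd_zc[OF mc mc assms(4)] assms zc_closed(2) by blast
  then obtain \<psi> where "rep X Y n \<psi> G" using rep_onto assms by fastforce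
  then show ?thesis using rep_eq[OF assms(1,2,3)] assms(4) by blast
qed

text \<open>The Hom spaces are bare records; the group laws, on which negatives and finite sums in
  them rely, are read off the matrices.\<close>

lemma abelian_group_gHom:
  assumes XY: "X \<in> Ob" "Y \<in> Ob"
  shows "abelian_group (gHom B X Y n)"
proof (rule abelian_groupI)
  note ra = rep_add[OF XY]
  let ?H = "gHom B X Y n"
  show "x \<oplus>\<^bsub>?H\<^esub> y \<in> carrier ?H" if xy: "x \<in> carrier ?H" "y \<in> carrier ?H" for x y
    using rep_ex[OF XY xy(1)] rep_ex[OF XY xy(2)] ra rep_dom[OF XY] by blast
  show "\<zero>\<^bsub>?H\<^esub> \<in> carrier ?H" using rep_dom[OF XY rep_zero[OF XY]] by blast
  show "x \<oplus>\<^bsub>?H\<^esub> y \<oplus>\<^bsub>?H\<^esub> z = x \<oplus>\<^bsub>?H\<^esub> (y \<oplus>\<^bsub>?H\<^esub> z)"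
    if xyz: "x \<in> carrier ?H" "y \<in> carrier ?H" "z \<in> carrier ?H" for x y z
  proof -
    obtain F G H where "rep X Y n x F" "rep X Y n y G" "rep X Y n z H"
      using rep_ex[OF XY xyz(1)] rep_ex[OF XY xyz(2)] rep_ex[OF XY xyz(3)] by blast
    then show ?thesis by (intro rep_eqI[OF XY, of n _ "F + G + H" _ "F + (G + H)"] ra) (auto simp: add.assoc)
  qed
  show "x \<oplus>\<^bsub>?H\<^esub> y = y \<oplus>\<^bsub>?H\<^esub> x" if xy: "x \<in> carrier ?H" "y \<in> carrier ?H" for x y
  proof -
    obtain F G where "rep X Y n x F" "rep X Y n y G"
      using rep_ex[OF XY xy(1)] rep_ex[OF XY xy(2)] by blast
    then show ?thesis by (intro rep_eqI[OF XY, of n _ "F + G" _ "G + F"] ra) (auto simp: add.commute)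
  qed
  fix x assume x: "x \<in> carrier ?H"
  then obtain F where F: "rep X Y n x F" using rep_ex[OF XY] by blast
  show "\<zero>\<^bsub>?H\<^esub> \<oplus>\<^bsub>?H\<^esub> x = x"
    using F by (intro rep_eqI[OF XY, of n _ "0 + F" _ F] ra rep_zero[OF XY]) auto
  obtain y where y: "rep X Y n y (- F)" using rep_onto[OF XY zc_closed(3)] rep_dom[OF XY F] by blast
  have "y \<oplus>\<^bsub>?H\<^esub> x = \<zero>\<^bsub>?H\<^esub>"
    using F y by (intro rep_eqI[OF XY, of n _ "- F + F" _ 0] ra rep_zero[OF XY]) auto
  then show "\<exists>y\<in>carrier ?H. y \<oplus>\<^bsub>?H\<^esub> x = \<zero>\<^bsub>?H\<^esub>" using rep_dom[OF XY y] by blast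
qed

lemma rep_neg:
  assumes XY: "X \<in> Ob" "Y \<in> Ob" and F: "rep X Y n \<phi> F"
  shows "rep X Y n (\<ominus>\<^bsub>gHom B X Y n\<^esub> \<phi>) (- F)"
proof -
  interpret abelian_group "gHom B X Y n" by (rule abelian_group_gHom[OF XY])
  obtain y where y: "rep X Y n y (- F)" using rep_onto[OF XY zc_closed(3)] rep_dom[OF XY F] by blast
  have "y \<oplus>\<^bsub>gHom B X Y n\<^esub> \<phi> = \<zero>\<^bsub>gHom B X Y n\<^esub>"
    using F y by (intro rep_eqI[OF XY, of n _ "- F + F" _ 0] rep_add[OF XY] rep_zero[OF XY]) auto
  then have "\<ominus>\<^bsub>gHom B X Y n\<^esub> \<phi> = y" using minus_equality rep_dom[OF XY y] rep_dom[OF XY F] by blast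
  then show ?thesis using y by simp
qed

lemma rep_sgn: "\<lbrakk>X \<in> Ob; Y \<in> Ob; rep X Y n \<phi> F\<rbrakk> \<Longrightarrow> rep X Y n (sgn_pow (gHom B X Y n) k \<phi>) (sg k F)"
  by (simp add: sgn_pow_def sg_def rep_neg)

lemma rep_gpow:
  assumes "X \<in> Ob" "rep X X n f F"
  shows "rep X X (int q * n) (gpow B X n f q) (mpow (fst (M X)) F q)"
proof (induction q)
  case (Suc q)
  have "int (Suc q) * n = n + int q * n" by (simp add: algebra_simps)
  then show ?case using rep_comp[OF assms(1,1,1,2) Suc] by simp
qed (simp add: rep_id assms)

subsection \<open>Families of endomorphisms\<close>

definition fam :: "('o \<times> int \<Rightarrow> 'a imat) \<Rightarrow> bool" where
  "fam F \<longleftrightarrow> (\<forall>X\<in>Ob. \<forall>n. F (X, n) \<in> zc n (M X) (M X)) \<and> (\<forall>X n. X \<notin> Ob \<longrightarrow> F (X, n) = 0) \<and> finite {w. F w \<noteq> 0}"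

definition Rep :: "('o \<times> int \<Rightarrow> 'f) \<Rightarrow> ('o \<times> int \<Rightarrow> 'a imat) \<Rightarrow> bool" where
  "Rep m F \<longleftrightarrow> m \<in> carrier (endo_sum B) \<and> fam F \<and> (\<forall>X\<in>Ob. \<forall>n. rep X X n (m (X, n)) (F (X, n)))"

text \<open>The counterpart of \<open>gbracket\<close> for matrices. Boundaries are generators
  because a morphism determines its matrix only up to a boundary. There is no clause for scalars: a
  central factor can be moved into \<open>U\<close>.\<close>

inductive_set bracket :: "('o \<times> int \<Rightarrow> 'a imat) set" where
  commutator: "\<lbrakk>X \<in> Ob; Y \<in> Ob; U \<in> zc i (M X) (M Y); F \<in> zc j (M Y) (M X)\<rbrakk> \<Longrightarrow>
    single (X, i + j) (F * U) - sg (i * j) (single (Y, i + j) (U * F)) \<in> bracket"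
| boundary: "\<lbrakk>X \<in> Ob; b \<in> bd n (M X) (M X)\<rbrakk> \<Longrightarrow> single (X, n) b \<in> bracket"
| zero: "0 \<in> bracket"
| add: "\<lbrakk>F \<in> bracket; G \<in> bracket\<rbrakk> \<Longrightarrow> F + G \<in> bracket"

lemma fam_0 [simp]: "fam 0"
  by (simp add: fam_def)

lemma fam_closed:
  assumes "fam F"
  shows "fam G \<Longrightarrow> fam (F + G)" "fam G \<Longrightarrow> fam (F - G)" "fam (- F)" "fam (sg k F)"
proof -
  show a: "fam (F + G)" if "fam G" for G
  proof -
    have "{w. (F + G) w \<noteq> 0} \<subseteq> {w. F w \<noteq> 0} \<union> {w. G w \<noteq> 0}" by auto
    moreover have "finite ({w. F w \<noteq> 0} \<union> {w. G w \<noteq> 0})" using assms that by (simp add: fam_def)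
    ultimately have "finite {w. (F + G) w \<noteq> 0}" by (rule finite_subset)
    then show ?thesis using assms that by (simp add: fam_def zc_closed)
  qed
  have n: "fam (- H)" if "fam H" for H using that by (simp add: fam_def zc_closed)
  show "fam (F - G)" if "fam G" using a[OF n[OF that]] by simp
  show "fam (- F)" "fam (sg k F)" using n assms by (auto simp: sg_def)
qed

lemma fam_cm:
  assumes "\<And>a. z * a = a * z" "fam F"
  shows "fam (\<lambda>w. cm z (F w))"
proof -
  have "{w. cm z (F w) \<noteq> 0} \<subseteq> {w. F w \<noteq> 0}" by auto
  then show ?thesis using assms finite_subset by (auto simp: fam_def zc_cm)
qed

lemma fam_single: "X \<in> Ob \<Longrightarrow> A \<in> zc n (M X) (M X) \<Longrightarrow> fam (single (X, n) A)"
  by (auto simp: fam_def single_def)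

lemma bracket_fam: "F \<in> bracket \<Longrightarrow> fam F"
proof (induction rule: bracket.induct)
  case (commutator X Y U i F j)
  then have "F * U \<in> zc (i + j) (M X) (M X)" "U * F \<in> zc (i + j) (M Y) (M Y)"
    using zc_mult by (metis add.commute)+
  then show ?case using commutator by (intro fam_closed fam_single)
next
  case (boundary X b n)
  then show ?case using fam_single bd_zc[OF mc mc] by blast
qed (blast intro: fam_closed fam_0)+

text \<open>Besides scalars this covers every central element, and so makes its action on the
  abelianization independent of representatives.\<close>

lemma bracket_scale:
  assumes z: "\<And>a. z * a = a * z" and "F \<in> bracket"
  shows "(\<lambda>w. cm z (F w)) \<in> bracket"
  using assms(2)
proof (induction rule: bracket.induct)
  case (commutator X Y U i F j)
  have "(\<lambda>w. cm z ((single (X, i + j) (F * U) - sg (i * j) (single (Y, i + j) (U * F))) w))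
      = single (X, i + j) (F * cm z U) - sg (i * j) (single (Y, i + j) (cm z U * F))"
    by (auto simp: fun_eq_iff single_def sg_fun_apply cm_diff cm_sg cm_mult_right[OF z, symmetric] cm_mult_left)
  then show ?case using bracket.commutator[OF commutator(1,2) zc_cm[OF z commutator(3)] commutator(4)] by simp
next
  case (boundary X b n)
  have "(\<lambda>w. cm z (single (X, n) b w)) = single (X, n) (cm z b)" by (auto simp: single_def)
  then show ?case using bracket.boundary[OF boundary(1) bd_cm[OF z boundary(2)]] by simp
next
  case (add F G)
  have "(\<lambda>w. cm z ((F + G) w)) = (\<lambda>w. cm z (F w)) + (\<lambda>w. cm z (G w))" by (simp add: fun_eq_iff cm_add)
  then show ?case using bracket.add[OF add(3,4)] by simp
qed (simp_all add: bracket.zero flip: zero_fun_def)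

lemma bracket_neg: "F \<in> bracket \<Longrightarrow> - F \<in> bracket"
proof -
  have "(\<lambda>w. cm (- 1) (F w)) = - F"
  proof
    show "cm (- 1) (F w) = (- F) w" for w
      by (rule imat_eqI) (simp add: cm.rep_eq ent_simps)
  qed
  then show "F \<in> bracket \<Longrightarrow> - F \<in> bracket" using bracket_scale[of "- 1" F] by simp
qed

lemma bracket_diff: "F \<in> bracket \<Longrightarrow> G \<in> bracket \<Longrightarrow> F - G \<in> bracket"
  using bracket.add[OF _ bracket_neg] by simp

lemma bracket_sum: "(\<And>x. x \<in> A \<Longrightarrow> f x \<in> bracket) \<Longrightarrow> sum f A \<in> bracket"
  by (induction A rule: infinite_finite_induct) (auto intro: bracket.zero bracket.add)

lemma bracket_componentwise:
  assumes "fam F" "\<And>X n. X \<in> Ob \<Longrightarrow> single (X, n) (F (X, n)) \<in> bracket"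
  shows "F \<in> bracket"
proof -
  have "single w (F w) \<in> bracket" if "F w \<noteq> 0" for w
    using that assms by (cases w) (metis fam_def)
  then show ?thesis
    using sum_single[of "{w. F w \<noteq> 0}" F] assms(1) bracket_sum[of "{w. F w \<noteq> 0}" "\<lambda>w. single w (F w)"]
    by (simp add: fam_def)
qed

section \<open>Comparison of families of matrices with the abelianization\<close>

lemma endo_sum_simps:
  "carrier (endo_sum B) = {m \<in> (\<Pi>\<^sub>E (X, n)\<in>Ob \<times> UNIV. carrier (gHom B X X n)).
     finite {(X, n). X \<in> Ob \<and> m (X, n) \<noteq> \<zero>\<^bsub>gHom B X X n\<^esub>}}"
  "\<zero>\<^bsub>endo_sum B\<^esub> = (\<lambda>(X, n)\<in>Ob \<times> UNIV. \<zero>\<^bsub>gHom B X X n\<^esub>)"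
  "m \<oplus>\<^bsub>endo_sum B\<^esub> m' = (\<lambda>(X, n)\<in>Ob \<times> UNIV. m (X, n) \<oplus>\<^bsub>gHom B X X n\<^esub> m' (X, n))"
  "c \<odot>\<^bsub>endo_sum B\<^esub> m = (\<lambda>(X, n)\<in>Ob \<times> UNIV. c \<odot>\<^bsub>gHom B X X n\<^esub> m (X, n))"
  by (simp_all add: endo_sum_def)

lemma rep_0_iff: "X \<in> Ob \<Longrightarrow> rep X X n \<phi> 0 \<Longrightarrow> \<phi> = \<zero>\<^bsub>gHom B X X n\<^esub>"
  by (rule rep_eqI[OF _ _ _ rep_zero]) auto

lemma RepI:
  assumes "m \<in> extensional (Ob \<times> UNIV)" "fam F" "\<And>X n. X \<in> Ob \<Longrightarrow> rep X X n (m (X, n)) (F (X, n))"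
  shows "Rep m F"
proof -
  have "{(X, n). X \<in> Ob \<and> m (X, n) \<noteq> \<zero>\<^bsub>gHom B X X n\<^esub>} \<subseteq> {w. F w \<noteq> 0}"
  proof
    fix w assume w: "w \<in> {(X, n). X \<in> Ob \<and> m (X, n) \<noteq> \<zero>\<^bsub>gHom B X X n\<^esub>}"
    then show "w \<in> {w. F w \<noteq> 0}"
      using assms(3)[of "fst w" "snd w"] rep_0_iff[of "fst w" "snd w" "m w"] by (cases w) auto
  qed
  moreover have "finite {w. F w \<noteq> 0}" using assms(2) by (simp add: fam_def)
  ultimately have "finite {(X, n). X \<in> Ob \<and> m (X, n) \<noteq> \<zero>\<^bsub>gHom B X X n\<^esub>}" by (rule finite_subset)
  moreover have "m (X, n) \<in> carrier (gHom B X X n)" if "X \<in> Ob" for X n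
    using rep_dom[OF that that assms(3)[OF that]] by blast
  ultimately show ?thesis using assms by (auto simp: Rep_def endo_sum_simps PiE_def Pi_def)
qed

lemma RepD:
  assumes "Rep m F"
  shows "m \<in> extensional (Ob \<times> UNIV)" "fam F" "X \<in> Ob \<Longrightarrow> rep X X n (m (X, n)) (F (X, n))" "m \<in> carrier (endo_sum B)"
  using assms by (auto simp: Rep_def endo_sum_simps PiE_def)

lemma Rep_ex:
  assumes "m \<in> carrier (endo_sum B)"
  obtains F where "Rep m F"
proof -
  define F where "F = (\<lambda>(X, n). if X \<in> Ob \<and> m (X, n) \<noteq> \<zero>\<^bsub>gHom B X X n\<^esub> then SOME F. rep X X n (m (X, n)) F else 0)"
  have r: "rep X X n (m (X, n)) (F (X, n))" if X: "X \<in> Ob" for X n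
  proof (cases "m (X, n) = \<zero>\<^bsub>gHom B X X n\<^esub>")
    case True
    then show ?thesis using X rep_zero[OF X X] by (simp add: F_def)
  next
    case False
    have "m (X, n) \<in> carrier (gHom B X X n)" using assms X by (auto simp: endo_sum_simps PiE_def Pi_def)
    then show ?thesis using False X rep_ex[OF X X, of "m (X, n)" n] by (auto simp: F_def intro: someI_ex)
  qed
  have "{w. F w \<noteq> 0} \<subseteq> {(X, n). X \<in> Ob \<and> m (X, n) \<noteq> \<zero>\<^bsub>gHom B X X n\<^esub>}"
    by (auto simp: F_def split: if_splits)
  moreover have "finite {(X, n). X \<in> Ob \<and> m (X, n) \<noteq> \<zero>\<^bsub>gHom B X X n\<^esub>}" using assms by (simp add: endo_sum_simps)
  ultimately have "finite {w. F w \<noteq> 0}" by (rule finite_subset)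
  moreover have "F (X, n) \<in> zc n (M X) (M X)" if "X \<in> Ob" for X n
    using rep_dom[OF that that r[OF that]] by blast
  moreover have "F (X, n) = 0" if "X \<notin> Ob" for X n using that by (simp add: F_def)
  ultimately have "fam F" by (simp add: fam_def)
  then show ?thesis using that RepI[OF _ _ r] assms by (simp add: endo_sum_simps PiE_def)
qed

lemma Rep_onto:
  assumes "fam F"
  obtains m where "Rep m F"
proof -
  define m where "m = (\<lambda>(X, n)\<in>Ob \<times> UNIV. SOME \<phi>. rep X X n \<phi> (F (X, n)))"
  have "rep X X n (m (X, n)) (F (X, n))" if X: "X \<in> Ob" for X n
    using rep_onto[OF X X, of "F (X, n)" n] assms X by (auto simp: m_def fam_def intro: someI_ex)
  then show ?thesis using that RepI[of m F] assms by (simp add: m_def)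
qed

lemma Rep_eqI:
  assumes "Rep m F" "Rep m' G" "\<And>X n. X \<in> Ob \<Longrightarrow> F (X, n) - G (X, n) \<in> bd n (M X) (M X)"
  shows "m = m'"
proof (rule extensionalityI[OF RepD(1)[OF assms(1)] RepD(1)[OF assms(2)]])
  fix w assume "w \<in> Ob \<times> (UNIV :: int set)"
  then show "m w = m' w"
    using rep_eq[OF _ _ RepD(3)[OF assms(1)] RepD(3)[OF assms(2)]] assms(3) by (cases w) auto
qed

lemma Rep_unique: "Rep m F \<Longrightarrow> Rep m' F \<Longrightarrow> m = m'"
  using Rep_eqI[of m F m' F] by simp

lemma Rep_diff_bracket:
  assumes "Rep m F" "Rep m G"
  shows "F - G \<in> bracket"
proof (rule bracket_componentwise)
  show "fam (F - G)" using fam_closed(2)[OF RepD(2)[OF assms(1)] RepD(2)[OF assms(2)]] .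
  fix X n assume X: "X \<in> Ob"
  have "(F - G) (X, n) \<in> bd n (M X) (M X)"
    using rep_eq[OF X X RepD(3)[OF assms(1) X] RepD(3)[OF assms(2) X]] by simp
  then show "single (X, n) ((F - G) (X, n)) \<in> bracket" by (rule bracket.boundary[OF X])
qed

lemma Rep_add: "Rep m F \<Longrightarrow> Rep m' G \<Longrightarrow> Rep (m \<oplus>\<^bsub>endo_sum B\<^esub> m') (F + G)"
  by (rule RepI) (auto simp: endo_sum_simps intro: rep_add RepD fam_closed)

lemma Rep_zero: "Rep \<zero>\<^bsub>endo_sum B\<^esub> 0"
  by (rule RepI) (auto simp: endo_sum_simps rep_zero)

lemma Rep_smult: "Rep m F \<Longrightarrow> Rep (c \<odot>\<^bsub>endo_sum B\<^esub> m) (\<lambda>w. iscale c (F w))"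
proof (rule RepI)
  assume m: "Rep m F"
  show "fam (\<lambda>w. iscale c (F w))" unfolding iscale_def by (rule fam_cm[OF scale_1_central RepD(2)[OF m]])
  show "rep X X n ((c \<odot>\<^bsub>endo_sum B\<^esub> m) (X, n)) (iscale c (F (X, n)))" if "X \<in> Ob" for X n
    using rep_smult[OF that that RepD(3)[OF m that]] that by (simp add: endo_sum_simps)
qed (simp add: endo_sum_simps)

text \<open>The negative in the record \<open>endo_sum\<close> is a definite description. Its
  uniqueness comes from the model: any other inverse is represented by a family that differs from
  \<open>- F\<close> by boundaries.\<close>

lemma Rep_neg:
  assumes "Rep m F"
  shows "Rep (\<ominus>\<^bsub>endo_sum B\<^esub> m) (- F)"
proof -
  obtain m' where m': "Rep m' (- F)" using Rep_onto[OF fam_closed(3)[OF RepD(2)[OF assms]]] .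
  have ab: "m \<oplus>\<^bsub>endo_sum B\<^esub> m' = \<zero>\<^bsub>endo_sum B\<^esub>" "m' \<oplus>\<^bsub>endo_sum B\<^esub> m = \<zero>\<^bsub>endo_sum B\<^esub>"
    by (rule Rep_unique[OF _ Rep_zero], use Rep_add[OF assms m'] Rep_add[OF m' assms] in simp)+
  have "(THE y. y \<in> carrier (endo_sum B) \<and> m \<oplus>\<^bsub>endo_sum B\<^esub> y = \<zero>\<^bsub>endo_sum B\<^esub> \<and> y \<oplus>\<^bsub>endo_sum B\<^esub> m = \<zero>\<^bsub>endo_sum B\<^esub>) = m'"
  proof (rule the_equality)
    show "m' \<in> carrier (endo_sum B) \<and> m \<oplus>\<^bsub>endo_sum B\<^esub> m' = \<zero>\<^bsub>endo_sum B\<^esub> \<and> m' \<oplus>\<^bsub>endo_sum B\<^esub> m = \<zero>\<^bsub>endo_sum B\<^esub>"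
      using ab RepD(4)[OF m'] by simp
    fix y assume y: "y \<in> carrier (endo_sum B) \<and> m \<oplus>\<^bsub>endo_sum B\<^esub> y = \<zero>\<^bsub>endo_sum B\<^esub> \<and> y \<oplus>\<^bsub>endo_sum B\<^esub> m = \<zero>\<^bsub>endo_sum B\<^esub>"
    then obtain G where G: "Rep y G" using Rep_ex by blast
    show "y = m'"
    proof (rule Rep_eqI[OF G m'])
      fix X n assume X: "X \<in> Ob"
      have "Rep \<zero>\<^bsub>endo_sum B\<^esub> (F + G)" using Rep_add[OF assms G] y by simp
      from rep_eq[OF X X RepD(3)[OF this X] RepD(3)[OF Rep_zero X]]
      show "G (X, n) - (- F) (X, n) \<in> bd n (M X) (M X)" by (simp add: add.commute)
    qed
  qed
  then show ?thesis using m' by (simp add: a_inv_def m_inv_def)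
qed

lemma Rep_single:
  assumes X: "X \<in> Ob" and "rep X X n f F"
  shows "Rep (endo_single B X n f) (single (X, n) F)"
proof (rule RepI)
  show "fam (single (X, n) F)" using fam_single[OF X] rep_dom[OF X X assms(2)] by blast
  show "rep Y Y k (endo_single B X n f (Y, k)) (single (X, n) F (Y, k))" if "Y \<in> Ob" for Y k
    using that assms rep_zero[OF that that] by (auto simp: endo_single_def single_def)
qed (simp add: endo_single_def)

lemma Rep_commutator:
  assumes XY: "X \<in> Ob" "Y \<in> Ob" and "rep X Y i u U" "rep Y X j f F"
  shows "Rep (endo_single B X (i + j) (gCmp B X Y X i j f u) \<ominus>\<^bsub>endo_sum B\<^esub>
    sgn_pow (endo_sum B) (i * j) (endo_single B Y (i + j) (gCmp B Y X Y j i u f)))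
    (single (X, i + j) (F * U) - sg (i * j) (single (Y, i + j) (U * F)))"
proof -
  have 1: "Rep (endo_single B X (i + j) (gCmp B X Y X i j f u)) (single (X, i + j) (F * U))"
    by (intro Rep_single rep_comp assms)
  have 2: "Rep (endo_single B Y (i + j) (gCmp B Y X Y j i u f)) (single (Y, i + j) (U * F))"
    using rep_comp[OF XY(2,1,2) assms(4,3)] by (intro Rep_single assms) (simp add: add.commute)
  have "Rep (sgn_pow (endo_sum B) (i * j) (endo_single B Y (i + j) (gCmp B Y X Y j i u f))) (sg (i * j) (single (Y, i + j) (U * F)))"
    using 2 Rep_neg[OF 2] by (simp add: sgn_pow_def sg_def)
  from Rep_add[OF 1 Rep_neg[OF this]] show ?thesis by (simp add: a_minus_def)
qed

lemma gbracket_Rep: "m \<in> gbracket B \<Longrightarrow> \<exists>F. Rep m F \<and> F \<in> bracket"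
proof (induction rule: gbracket.induct)
  case (commutator X Y u i f j)
  then obtain U F where "rep X Y i u U" "rep Y X j f F" using rep_ex by blast
  then show ?case
    using Rep_commutator[OF commutator(1,2)] bracket.commutator[OF commutator(1,2)] rep_dom commutator(1,2) by blast
next
  case (add m m')
  then show ?case using Rep_add bracket.add by blast
next
  case (smult m c)
  then show ?case using Rep_smult bracket_scale[OF scale_1_central] unfolding iscale_def by blast
qed (use Rep_zero bracket.zero in blast)

lemma bracket_gbracket: "F \<in> bracket \<Longrightarrow> Rep m F \<Longrightarrow> m \<in> gbracket B"
proof (induction arbitrary: m rule: bracket.induct)
  case (commutator X Y U i F j)
  obtain u f where uf: "rep X Y i u U" "rep Y X j f F" using rep_onto commutator(1-4) by blast
  have c: "u \<in> carrier (gHom B X Y i)" "f \<in> carrier (gHom B Y X j)"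
    using rep_dom[OF commutator(1,2) uf(1)] rep_dom[OF commutator(2,1) uf(2)] by auto
  show ?case unfolding Rep_unique[OF commutator(5) Rep_commutator[OF commutator(1,2) uf]]
    by (rule gbracket.commutator[OF commutator(1,2) c])
next
  case (boundary X b n)
  have "m = \<zero>\<^bsub>endo_sum B\<^esub>"
    by (rule Rep_eqI[OF boundary(3) Rep_zero]) (use boundary in \<open>auto simp: single_def\<close>)
  then show ?case using gbracket.zero by simp
next
  case zero
  then show ?case using Rep_unique[OF zero Rep_zero] gbracket.zero by simp
next
  case (add F G)
  obtain m1 m2 where m: "Rep m1 F" "Rep m2 G" using Rep_onto bracket_fam add(1,2) by metis
  from Rep_unique[OF add(5) Rep_add[OF this]] show ?case using gbracket.add add m by blast
qed

text \<open>Independence of the representative: two families for the same element differ by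
  boundaries, which belong to \<open>bracket\<close>.\<close>

lemma gbracket_iff: "Rep m F \<Longrightarrow> m \<in> gbracket B \<longleftrightarrow> F \<in> bracket"
proof
  assume m: "Rep m F" "m \<in> gbracket B"
  then obtain G where "Rep m G" "G \<in> bracket" using gbracket_Rep by blast
  then show "F \<in> bracket" using bracket.add[OF Rep_diff_bracket[OF m(1)]] by fastforce
qed (use bracket_gbracket in blast)

abbreviation "coset m \<equiv> gbracket B +>\<^bsub>endo_sum B\<^esub> m"

lemma coset_iff:
  assumes "Rep m F" "Rep m' G"
  shows "m' \<in> coset m \<longleftrightarrow> G - F \<in> bracket"
proof
  assume "m' \<in> coset m"
  then obtain h where h: "h \<in> gbracket B" "m' = h \<oplus>\<^bsub>endo_sum B\<^esub> m"
    by (auto simp: a_r_coset_defs)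
  then obtain H where H: "Rep h H" "H \<in> bracket" using gbracket_Rep by blast
  have "G - (H + F) \<in> bracket" using Rep_diff_bracket[OF assms(2)] Rep_add[OF H(1) assms(1)] h by simp
  from bracket.add[OF this H(2)] show "G - F \<in> bracket" by (simp add: algebra_simps)
next
  assume a: "G - F \<in> bracket"
  obtain h where h: "Rep h (G - F)" using Rep_onto[OF bracket_fam[OF a]] .
  have "m' = h \<oplus>\<^bsub>endo_sum B\<^esub> m" using Rep_unique[OF assms(2)] Rep_add[OF h assms(1)] by simp
  then show "m' \<in> coset m" using bracket_gbracket[OF a h] by (auto simp: a_r_coset_defs)
qed

lemma gbracket_carrier: "m \<in> gbracket B \<Longrightarrow> m \<in> carrier (endo_sum B)"
  using gbracket_Rep RepD(4) by blast

lemma coset_carrier: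
  assumes "Rep m F" "m' \<in> coset m"
  shows "m' \<in> carrier (endo_sum B)"
proof -
  obtain h where h: "h \<in> gbracket B" "m' = h \<oplus>\<^bsub>endo_sum B\<^esub> m"
    using assms(2) by (auto simp: a_r_coset_defs)
  then show ?thesis using gbracket_Rep Rep_add[OF _ assms(1)] RepD(4) by blast
qed

lemma coset_self: "Rep m F \<Longrightarrow> m \<in> coset m"
  using coset_iff[of m F m F] bracket.zero by simp

lemma coset_eqI:
  assumes "Rep m F" "Rep m' G" "F - G \<in> bracket"
  shows "coset m = coset m'"
proof (rule Set.set_eqI)
  fix x
  show "x \<in> coset m \<longleftrightarrow> x \<in> coset m'"
  proof (cases "x \<in> carrier (endo_sum B)")
    case True
    then obtain H where H: "Rep x H" using Rep_ex by blast
    have "H - F \<in> bracket \<longleftrightarrow> H - G \<in> bracket"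
      using bracket.add[of "H - F" "F - G"] bracket_diff[of "H - G" "F - G"] assms(3) by (auto simp: algebra_simps)
    then show ?thesis using coset_iff[OF assms(1) H] coset_iff[OF assms(2) H] by simp
  qed (use coset_carrier assms in blast)
qed

lemma coset_bracket:
  assumes m: "Rep m F" "F \<in> bracket"
  shows "coset m = gbracket B"
proof (rule Set.set_eqI)
  fix x
  show "x \<in> coset m \<longleftrightarrow> x \<in> gbracket B"
  proof (cases "x \<in> carrier (endo_sum B)")
    case True
    then obtain H where H: "Rep x H" using Rep_ex by blast
    have "H - F \<in> bracket \<longleftrightarrow> H \<in> bracket"
      using bracket.add[of "H - F" F] bracket_diff[of H F] m(2) by auto
    then show ?thesis using coset_iff[OF m(1) H] gbracket_iff[OF H] by simp
  qed (use coset_carrier m gbracket_carrier in blast)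
qed

end

section \<open>Auxiliary facts on powers and signs in characteristic p\<close>

lemma mpow_zero: "q > 0 \<Longrightarrow> mpow e 0 q = 0"
  by (cases q) auto

lemma mpow_iterate:
  assumes "F * e = F" "e * F = F"
  shows "((\<lambda>V. F * V) ^^ n) e = mpow e F n"
proof (induction n)
  case (Suc n)
  have "F * mpow e F k = mpow e F k * F" for k
    by (induction k) (auto simp: assms mult.assoc[symmetric])
  then show ?case using Suc by simp
qed simp

lemma (in charp_algebra) comm_sum_power_pp:
  assumes "finite I"
  shows "(\<Sum>i\<in>I. x i) ^ (p ^ r) - (\<Sum>i\<in>I. x i ^ (p ^ r)) \<in> comm"
proof (induction r)
  case (Suc r)
  have e: "z ^ (p ^ Suc r) = (z ^ (p ^ r)) ^ p" for z :: 'a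
    by (simp add: power_mult[symmetric] mult.commute)
  show ?case unfolding e by (rule comm_diff_trans[OF power_p_cong[OF Suc] comm_sum_power[OF assms]])
qed (simp add: comm_0)

lemma (in charp_algebra) imat_sum_p: "(\<Sum>i<p. v) = (0 :: 'a imat)"
  by (rule imat_eqI) (simp only: ent_sum sum_p_zero ent_simps)

text \<open>For odd \<open>p\<close> the exponent is even, and for \<open>p = 2\<close> a matrix
  equals its negative. Because of this the Koszul signs of rotated words disappear.\<close>

lemma (in charp_algebra) sg_mult_pred:
  assumes "Suc q = p"
  shows "sg (j * int q) (v :: 'a imat) = v"
proof (cases "even q")
  case False
  then have "even p" using assms by auto
  then have "p = 2" using prime_p by (simp add: prime_nat_iff) (metis One_nat_def numeral_eq_one_iff semiring_norm(85))
  then have "v + v = 0" using imat_sum_p[of v] by (simp add: numeral_2_eq_2)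
  then have "- v = v" by (rule minus_unique)
  then show ?thesis by (simp add: sg_def)
qed (simp add: sg_even)

context gcat_model
begin

subsection \<open>The power map\<close>

definition pw :: "('o \<times> int \<Rightarrow> 'a imat) \<Rightarrow> 'o \<times> int \<Rightarrow> 'a imat" where
  "pw F = (\<lambda>(X, k). if X \<in> Ob \<and> int p dvd k then mpow (fst (M X)) (F (X, k div int p)) p else 0)"

lemma pw_apply: "X \<in> Ob \<Longrightarrow> pw F (X, int p * n) = mpow (fst (M X)) (F (X, n)) p"
  using char by (simp add: pw_def)

lemma fam_pw:
  assumes "fam F"
  shows "fam (pw F)"
proof -
  have "{w. pw F w \<noteq> 0} \<subseteq> (\<lambda>(X, k). (X, int p * k)) ` {w. F w \<noteq> 0}"
  proof
    fix w assume w: "w \<in> {w. pw F w \<noteq> 0}"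
    obtain X k where Xk: "w = (X, k)" by (cases w)
    then have "int p dvd k" "F (X, k div int p) \<noteq> 0"
      using w by (auto simp: pw_def mpow_zero char(2) split: if_splits)
    then show "w \<in> (\<lambda>(X, k). (X, int p * k)) ` {w. F w \<noteq> 0}"
      using Xk by (intro image_eqI[of _ _ "(X, k div int p)"]) auto
  qed
  moreover have "finite ((\<lambda>(X, k). (X, int p * k)) ` {w. F w \<noteq> 0})" using assms by (simp add: fam_def)
  ultimately have "finite {w. pw F w \<noteq> 0}" by (rule finite_subset)
  moreover have "pw F (X, n) \<in> zc n (M X) (M X)" if X: "X \<in> Ob" for X n
  proof (cases "int p dvd n")
    case True
    have "F (X, n div int p) \<in> zc (n div int p) (M X) (M X)" using assms X by (simp add: fam_def)
    from zc_mpow[OF mc[OF X] this, of p] show ?thesis using True X by (simp add: pw_def)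
  qed (simp add: pw_def)
  ultimately show ?thesis by (simp add: fam_def pw_def)
qed

lemma Rep_pw:
  assumes "Rep m F"
  shows "Rep (endo_power B p m) (pw F)"
proof (rule RepI)
  show "fam (pw F)" by (rule fam_pw[OF RepD(2)[OF assms]])
  show "rep X X n (endo_power B p m (X, n)) (pw F (X, n))" if X: "X \<in> Ob" for X n
  proof (cases "int p dvd n")
    case True
    from rep_gpow[OF X RepD(3)[OF assms X], where q = p and n = "n div int p"] True X show ?thesis
      by (simp add: pw_def endo_power_def)
  qed (use X rep_zero[OF X X] in \<open>simp add: pw_def endo_power_def\<close>)
qed (simp add: endo_power_def)

lemma fam_zc: "fam F \<Longrightarrow> X \<in> Ob \<Longrightarrow> F (X, n) \<in> zc n (M X) (M X)"
  by (simp add: fam_def)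

lemma idem: "X \<in> Ob \<Longrightarrow> fst (M X) * fst (M X) = fst (M X)"
  using mc by (simp add: mcplx_def)

lemma fam_pw_iter: "fam F \<Longrightarrow> fam ((pw ^^ r) F)"
  by (induction r) (auto intro: fam_pw)

lemma pw_iter:
  assumes "fam F" "X \<in> Ob"
  shows "(pw ^^ r) F (X, int (p ^ r) * n) = mpow (fst (M X)) (F (X, n)) (p ^ r)"
proof (induction r)
  case 0
  then show ?case using zc_unit(1)[OF fam_zc[OF assms]] by simp
next
  case (Suc r)
  have "(pw ^^ Suc r) F (X, int p * (int (p ^ r) * n)) = mpow (fst (M X)) ((pw ^^ r) F (X, int (p ^ r) * n)) p"
    using pw_apply[OF assms(2)] by simp
  then show ?case unfolding Suc
    using mpow_mpow[OF zc_unit(2)[OF fam_zc[OF assms]] idem[OF assms(2)]] by (simp add: mult.assoc)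
qed

text \<open>The argument of \<open>comm_sum_power\<close> with two letters, indexed by
  \<open>bool\<close>, for endomorphisms of an object; rotation now produces a
  supercommutator.\<close>

lemma single_mpow_add:
  assumes X: "X \<in> Ob" and A: "A \<in> zc k (M X) (M X)" "A' \<in> zc k (M X) (M X)"
  shows "single (X, int p * k) (mpow (fst (M X)) (A + A') p - (mpow (fst (M X)) A p + mpow (fst (M X)) A' p)) \<in> bracket"
proof -
  let ?e = "fst (M X)"
  define a where "a i = (if i then A else A')" for i
  define f where "f i V = a i * V" for i V
  have az: "a i \<in> zc k (M X) (M X)" for i using A by (simp add: a_def)
  note au = zc_unit[OF az]
  have AA: "A + A' \<in> zc k (M X) (M X)" using A by (rule zc_closed)
  have fz: "foldr f w ?e \<in> zc (int (length w) * k) (M X) (M X)" for w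
  proof (induction w)
    case (Cons i w)
    from zc_mult[OF az this, of i] show ?case by (simp add: f_def algebra_simps)
  qed (simp add: zc_id mc X)
  have fE: "foldr f w ?e * V = foldr f w V" if "?e * V = V" for w V
    by (induction w) (use that in \<open>auto simp: f_def mult.assoc\<close>)
  have rep: "foldr f (replicate n i) ?e = mpow ?e (a i) n" for n i
  proof -
    have "foldr f (replicate n i) ?e = ((\<lambda>V. a i * V) ^^ n) ?e" by (induction n) (auto simp: f_def)
    then show ?thesis using mpow_iterate[OF au(2,1)] by simp
  qed
  have "(\<lambda>V. \<Sum>i\<in>UNIV. f i V) = (\<lambda>V. (A + A') * V)"
    by (simp add: UNIV_bool f_def a_def distrib_right add.commute fun_eq_iff)
  then have "mpow ?e (A + A') p = ((\<lambda>V. \<Sum>i\<in>UNIV. f i V) ^^ p) ?e"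
    using mpow_iterate[OF zc_unit(2,1)[OF AA]] by simp
  also have "\<dots> = (\<Sum>w\<in>{w. set w \<subseteq> UNIV \<and> length w = p}. foldr f w ?e)"
    by (rule sum_words) (auto simp: f_def distrib_left)
  finally have s: "single (X, int p * k) (mpow ?e (A + A') p)
      = (\<Sum>w\<in>{w. set w \<subseteq> UNIV \<and> length w = p}. single (X, int p * k) (foldr f w ?e))"
    by (simp only: single_sum)
  have "(\<Sum>w\<in>{w. set w \<subseteq> UNIV \<and> length w = p}. single (X, int p * k) (foldr f w ?e))
      - (\<Sum>i\<in>UNIV. single (X, int p * k) (foldr f (replicate p i) ?e)) \<in> bracket"
  proof (rule sum_cyclic_words[OF _ prime_p bracket.zero bracket.add])
    fix v :: "'o \<times> int \<Rightarrow> 'a imat"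
    have "(\<Sum>i<p. v) = 0" by (simp only: fun_eq_iff sum_fun_apply imat_sum_p zero_fun_apply) simp
    then show "(\<Sum>i<p. v) \<in> bracket" using bracket.zero by simp
  next
    fix i :: bool and w :: "bool list" assume len: "Suc (length w) = p"
    have w: "foldr f (w @ [i]) ?e = foldr f w ?e * a i" "foldr f (i # w) ?e = a i * foldr f w ?e"
      using fE[OF au(1), of w i] au(2)[of i] by (simp_all add: f_def)
    have d: "k + int (length w) * k = int p * k" using len by (simp add: algebra_simps flip: len)
    from bracket.commutator[OF X X az[of i] fz[of w]]
    have "single (X, int p * k) (foldr f w ?e * a i) - sg (k * (int (length w) * k)) (single (X, int p * k) (a i * foldr f w ?e)) \<in> bracket"
      by (simp only: d)
    \<comment> \<open>One letter of degree \<open>k\<close> passes \<open>p - 1\<close> others of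
      degree \<open>k\<close>; the resulting sign is trivial.\<close>
    moreover have "sg (k * (int (length w) * k)) (single (X, int p * k) (a i * foldr f w ?e)) = single (X, int p * k) (a i * foldr f w ?e)"
      using sg_mult_pred[OF len, of "k * k"] by (simp add: single_sg[symmetric] algebra_simps)
    ultimately show "single (X, int p * k) (foldr f (w @ [i]) ?e) - single (X, int p * k) (foldr f (i # w) ?e) \<in> bracket"
      by (simp only: w)
  qed auto
  then show ?thesis unfolding s[symmetric] rep
    by (simp add: UNIV_bool a_def single_diff single_add add.commute)
qed

lemma pw_add:
  assumes "fam F" "fam G"
  shows "pw (F + G) - (pw F + pw G) \<in> bracket"
proof (rule bracket_componentwise)
  show "fam (pw (F + G) - (pw F + pw G))" by (intro fam_closed fam_pw assms)
  show "single (X, n) ((pw (F + G) - (pw F + pw G)) (X, n)) \<in> bracket" if X: "X \<in> Ob" for X n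
  proof (cases "int p dvd n")
    case True
    then obtain k where "n = int p * k" by blast
    then show ?thesis using single_mpow_add[OF X fam_zc[OF assms(1) X] fam_zc[OF assms(2) X], of k]
      by (simp add: pw_apply[OF X])
  qed (simp add: pw_def bracket.zero)
qed

lemma pw_0 [simp]: "pw 0 = 0"
  using char by (auto simp: pw_def fun_eq_iff mpow_zero)

lemma pw_diff:
  assumes "fam F" "fam G"
  shows "pw (F - G) - (pw F - pw G) \<in> bracket"
  using bracket_neg[OF pw_add[OF fam_closed(2)[OF assms] assms(2)]] by (simp add: algebra_simps)

lemma pw_sg:
  assumes "fam F"
  shows "pw (sg n F) - sg n (pw F) \<in> bracket"
  using pw_diff[OF fam_0 assms] by (simp add: sg_def bracket.zero)

lemma pw_single: "X \<in> Ob \<Longrightarrow> pw (single (X, n) A) = single (X, int p * n) (mpow (fst (M X)) A p)"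
  using char by (auto simp: pw_def single_def fun_eq_iff mpow_zero)

text \<open>(FU)^p and (UF)^p are the two products of \<open>U\<close> with F' = (FU)^(p-1) F, so
  the power map sends a generating supercommutator to a supercommutator, up to additivity. This is
  what makes \<open>\<xi>\<close> well defined on the abelianization.\<close>

lemma bracket_pw: "G \<in> bracket \<Longrightarrow> pw G \<in> bracket"
proof (induction rule: bracket.induct)
  case (commutator X Y U i F j)
  let ?n = "i + j" let ?eX = "fst (M X)" let ?eY = "fst (M Y)"
  obtain q where q: "p = Suc q" using char by (cases p) auto
  note UF = commutator(3,4)
  have FU: "F * U \<in> zc ?n (M X) (M X)" "U * F \<in> zc ?n (M Y) (M Y)" using UF zc_mult by (metis add.commute)+
  define F' where "F' = mpow ?eX (F * U) q * F"
  have "U * mpow ?eX (F * U) k = mpow ?eY (U * F) k * U" for k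
  proof (induction k)
    case (Suc k)
    then show ?case by (simp add: mult.assoc[symmetric])
  qed (simp add: zc_unit[OF UF(1)])
  then have m: "F' * U = mpow ?eX (F * U) p" "U * F' = mpow ?eY (U * F) p"
    by (simp_all add: F'_def q mult.assoc[symmetric])
  have "F' \<in> zc (int q * ?n + j) (M Y) (M X)"
    unfolding F'_def by (rule zc_mult[OF zc_mpow[OF mc[OF commutator(1)] FU(1)] UF(2)])
  moreover have "i + (int q * ?n + j) = int p * ?n" by (simp add: q algebra_simps)
  ultimately have "single (X, int p * ?n) (F' * U) - sg (i * (int q * ?n + j)) (single (Y, int p * ?n) (U * F')) \<in> bracket"
    using bracket.commutator[OF commutator(1-3)] by metis
  \<comment> \<open>The exponent splits into i j and the multiple i (i + j) (p - 1) of
    \<open>p - 1\<close>, which contributes no sign.\<close>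
  moreover have "sg (i * (int q * ?n + j)) A = sg (i * j) A" for A :: "'a imat"
  proof -
    have "sg (i * (int q * ?n + j)) A = sg ((i * ?n) * int q) (sg (i * j) A)"
      by (simp add: sg_plus[symmetric] algebra_simps)
    then show ?thesis using sg_mult_pred[of q "i * ?n"] q by simp
  qed
  ultimately have 1: "pw (single (X, ?n) (F * U)) - sg (i * j) (pw (single (Y, ?n) (U * F))) \<in> bracket"
    using commutator(1,2) by (simp add: m pw_single single_sg[symmetric])
  have f: "fam (single (X, ?n) (F * U))" "fam (single (Y, ?n) (U * F))" using FU commutator(1,2) fam_single by auto
  let ?S = "single (X, ?n) (F * U)" let ?T = "single (Y, ?n) (U * F)"
  have "pw (?S - sg (i * j) ?T) = (pw (?S - sg (i * j) ?T) - (pw ?S - pw (sg (i * j) ?T)))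
      - (pw (sg (i * j) ?T) - sg (i * j) (pw ?T)) + (pw ?S - sg (i * j) (pw ?T))" by (simp only: diff_add_cancel diff_diff_eq2) simp
  moreover have "\<dots> \<in> bracket"
    by (intro bracket.add[OF bracket_diff 1] pw_diff pw_sg fam_closed(4) f)
  ultimately show ?case by (simp only:)
next
  case (boundary X b n)
  obtain q where q: "p = Suc q" using char by (cases p) auto
  have b: "b \<in> zc n (M X) (M X)" using boundary bd_zc mc by blast
  have "mpow (fst (M X)) b p \<in> bd (int q * n + n) (M X) (M X)"
    unfolding q mpow.simps by (rule bd_mult_left[OF zc_mpow[OF mc[OF boundary(1)] b] boundary(2)])
  moreover have "int q * n + n = int p * n" by (simp add: q algebra_simps)
  ultimately show ?case using bracket.boundary[OF boundary(1)] pw_single[OF boundary(1)] by metis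
next
  case zero
  show ?case unfolding pw_0 by (rule bracket.zero)
next
  case (add F G)
  from bracket.add[OF pw_add[OF bracket_fam[OF add(1)] bracket_fam[OF add(2)]] bracket.add[OF add(3,4)]]
  show ?case by (simp add: plus_fun_def)
qed

lemma pw_cong:
  assumes "fam F" "fam G" "F - G \<in> bracket"
  shows "pw F - pw G \<in> bracket"
  using bracket_diff[OF bracket_pw[OF assms(3)] pw_diff[OF assms(1,2)]] by simp

lemma xi_coset:
  assumes "Rep m F"
  shows "\<xi> B p (coset m) = coset (endo_power B p m)"
proof -
  have "coset (endo_power B p m') = coset (endo_power B p m)" if m': "m' \<in> coset m" for m'
  proof -
    obtain G where G: "Rep m' G" using Rep_ex coset_carrier[OF assms m'] by blast
    have "G - F \<in> bracket" using coset_iff[OF assms G] m' by blast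
    then show ?thesis
      using coset_eqI[OF Rep_pw[OF G] Rep_pw[OF assms] pw_cong] RepD(2)[OF G] RepD(2)[OF assms] by blast
  qed
  then show ?thesis unfolding \<xi>_def using coset_self[OF assms] by blast
qed

lemma xi_iter:
  assumes "Rep m F"
  shows "\<exists>m'. Rep m' ((pw ^^ r) F) \<and> (\<xi> B p ^^ r) (coset m) = coset m'"
proof (induction r)
  case (Suc r)
  then show ?case using Rep_pw xi_coset by fastforce
qed (use assms in auto)

lemma T_cat_iff:
  assumes "Rep m F"
  shows "coset m \<in> T_cat B p r \<longleftrightarrow> (pw ^^ r) F \<in> bracket"
proof -
  obtain m' where m': "Rep m' ((pw ^^ r) F)" "(\<xi> B p ^^ r) (coset m) = coset m'"
    using xi_iter[OF assms] by blast
  have "coset m \<in> abelianization B"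
    using RepD(4)[OF assms] by (auto simp: abelianization_def A_RCOSETS_def RCOSETS_def a_r_coset_def)
  moreover have "coset m' = gbracket B \<longleftrightarrow> (pw ^^ r) F \<in> bracket"
    using coset_bracket[OF m'(1)] coset_self[OF m'(1)] gbracket_iff[OF m'(1)] by blast
  ultimately show ?thesis by (simp add: T_cat_def m'(2))
qed

lemma T_cat_coset:
  assumes "C \<in> T_cat B p r"
  obtains m F where "Rep m F" "C = coset m"
proof -
  obtain m where "m \<in> carrier (endo_sum B)" "C = coset m"
    using assms by (auto simp: T_cat_def abelianization_def A_RCOSETS_def RCOSETS_def a_r_coset_def)
  then show ?thesis using that Rep_ex by blast
qed

subsection \<open>Natural families and traces\<close>

text \<open>Matrix representatives of a central element of degree \<open>m\<close>; the commutation
  rule of the center holds for them up to boundaries.\<close>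

definition nat_fam :: "int \<Rightarrow> ('o \<Rightarrow> 'a imat) \<Rightarrow> bool" where
  "nat_fam m C \<longleftrightarrow> (\<forall>X\<in>Ob. C X \<in> zc m (M X) (M X)) \<and>
     (\<forall>X\<in>Ob. \<forall>Y\<in>Ob. \<forall>j. \<forall>f\<in>zc j (M X) (M Y). C Y * f - sg (m * j) (f * C X) \<in> bd (m + j) (M X) (M Y))"

lemma nat_famD:
  assumes "nat_fam m C" "X \<in> Ob" "Y \<in> Ob"
  shows "C X \<in> zc m (M X) (M X)" "f \<in> zc j (M X) (M Y) \<Longrightarrow> C Y * f - sg (m * j) (f * C X) \<in> bd (m + j) (M X) (M Y)"
  using assms by (auto simp: nat_fam_def)

lemma nat_fam_id: "nat_fam 0 (\<lambda>X. fst (M X))"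
  by (simp add: nat_fam_def zc_id mc) (simp add: zc_unit)

lemma nat_fam_mpow:
  assumes "nat_fam m C"
  shows "nat_fam (int q * m) (\<lambda>X. mpow (fst (M X)) (C X) q)"
proof (induction q)
  case 0
  then show ?case using nat_fam_id by simp
next
  case (Suc q)
  show ?case unfolding nat_fam_def
  proof (intro conjI ballI allI)
    show "mpow (fst (M X)) (C X) (Suc q) \<in> zc (int (Suc q) * m) (M X) (M X)" if "X \<in> Ob" for X
      using zc_mpow[OF mc[OF that] nat_famD(1)[OF assms that that]] .
    fix X Y j f assume XY: "X \<in> Ob" "Y \<in> Ob" and f: "f \<in> zc j (M X) (M Y)"
    let ?P = "\<lambda>X. mpow (fst (M X)) (C X) q"
    have 1: "?P Y * (C Y * f - sg (m * j) (f * C X)) \<in> bd (int q * m + (m + j)) (M X) (M Y)"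
      by (rule bd_mult_left[OF nat_famD(1)[OF Suc XY(2,2)] nat_famD(2)[OF assms XY f]])
    have 2: "(?P Y * f - sg (int q * m * j) (f * ?P X)) * C X \<in> bd (int q * m + j + m) (M X) (M Y)"
      by (rule bd_mult_right[OF nat_famD(2)[OF Suc XY f] nat_famD(1)[OF assms XY(1,1)]])
    have "?P Y * (C Y * f - sg (m * j) (f * C X)) + sg (m * j) ((?P Y * f - sg (int q * m * j) (f * ?P X)) * C X)
       = mpow (fst (M Y)) (C Y) (Suc q) * f - sg (int (Suc q) * m * j) (f * mpow (fst (M X)) (C X) (Suc q))"
      by (simp add: algebra_simps sg_diff sg_mult_left sg_mult_right sg_plus)
    moreover have "int q * m + (m + j) = int (Suc q) * m + j" "int q * m + j + m = int (Suc q) * m + j"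
      by (simp_all add: algebra_simps)
    ultimately show "mpow (fst (M Y)) (C Y) (Suc q) * f - sg (int (Suc q) * m * j) (f * mpow (fst (M X)) (C X) (Suc q))
        \<in> bd (int (Suc q) * m + j) (M X) (M Y)"
      using 1 bd_closed(4)[OF 2, of "m * j"] bd_closed(1) by metis
  qed
qed

text \<open>Naturality moves each \<open>C X\<close> past the powers of \<open>F\<close> already
  collected. The sign depends on the degrees alone, so \<open>t\<close> is common to all
  \<open>X\<close> and \<open>F\<close>; its value is immaterial, since \<open>comm\<close> is
  closed under signs.\<close>

lemma nat_fam_mult_power:
  assumes "nat_fam m C"
  shows "\<exists>t. \<forall>X\<in>Ob. \<forall>F\<in>zc n (M X) (M X).
    mpow (fst (M X)) (C X * F) k - sg t (mpow (fst (M X)) (C X) k * mpow (fst (M X)) F k) \<in> bd (int k * (m + n)) (M X) (M X)"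
proof (induction k)
  case 0
  show ?case using idem by (intro exI[of _ 0]) simp
next
  case (Suc k)
  then obtain t where t: "\<And>X F. X \<in> Ob \<Longrightarrow> F \<in> zc n (M X) (M X) \<Longrightarrow>
    mpow (fst (M X)) (C X * F) k - sg t (mpow (fst (M X)) (C X) k * mpow (fst (M X)) F k) \<in> bd (int k * (m + n)) (M X) (M X)"
    by blast
  have "mpow (fst (M X)) (C X * F) (Suc k) - sg (t + m * (int k * n)) (mpow (fst (M X)) (C X) (Suc k) * mpow (fst (M X)) F (Suc k))
      \<in> bd (int (Suc k) * (m + n)) (M X) (M X)" if X: "X \<in> Ob" and F: "F \<in> zc n (M X) (M X)" for X F
  proof -
    let ?e = "fst (M X)"
    have C: "C X \<in> zc m (M X) (M X)" by (rule nat_famD(1)[OF assms X X])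
    have "(mpow ?e (C X * F) k - sg t (mpow ?e (C X) k * mpow ?e F k)) * (C X * F) \<in> bd (int k * (m + n) + (m + n)) (M X) (M X)"
      by (rule bd_mult_right[OF t[OF X F] zc_mult[OF C F]])
    then have 1: "(mpow ?e (C X * F) k - sg t (mpow ?e (C X) k * mpow ?e F k)) * (C X * F) \<in> bd (int (Suc k) * (m + n)) (M X) (M X)"
      by (simp add: algebra_simps)
    have "mpow ?e (C X) k * (C X * mpow ?e F k - sg (m * (int k * n)) (mpow ?e F k * C X)) * F \<in> bd (int k * m + (m + int k * n) + n) (M X) (M X)"
      by (rule bd_mult_right[OF bd_mult_left[OF zc_mpow[OF mc[OF X] C] nat_famD(2)[OF assms X X zc_mpow[OF mc[OF X] F]]] F])
    then have 2: "mpow ?e (C X) k * (C X * mpow ?e F k - sg (m * (int k * n)) (mpow ?e F k * C X)) * F \<in> bd (int (Suc k) * (m + n)) (M X) (M X)"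
      by (simp add: algebra_simps)
    from bd_closed(2)[OF 1 bd_closed(4)[OF 2, of "t + m * (int k * n)"]]
    show ?thesis by (simp add: algebra_simps sg_diff sg_mult_left sg_mult_right sg_plus)
  qed
  then show ?case by blast
qed

lemma trace_sum_indep:
  assumes "finite A" "finite A'" "\<And>X. D (X, n) \<noteq> 0 \<Longrightarrow> X \<in> A \<and> X \<in> A'"
  shows "(\<Sum>X\<in>A. str (C X * D (X, n))) = (\<Sum>X\<in>A'. str (C X * D (X, n)))"
proof -
  have "(\<Sum>X\<in>A. str (C X * D (X, n))) = (\<Sum>X\<in>A \<union> A'. str (C X * D (X, n)))"
    by (rule sum.mono_neutral_left) (use assms in force)+
  also have "\<dots> = (\<Sum>X\<in>A'. str (C X * D (X, n)))"
    by (rule sum.mono_neutral_right) (use assms in force)+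
  finally show ?thesis .
qed

text \<open>The generators have different supports, so the induction must let \<open>A\<close> vary.
  On a supercommutator, naturality replaces C_Y U by U C_X up to a boundary, and rotating the
  supertrace makes the two terms cancel modulo commutators.\<close>

lemma trace_bracket_ex:
  assumes "nat_fam (- n) C" "D \<in> bracket"
  shows "\<exists>A. finite A \<and> (\<forall>X. D (X, n) \<noteq> 0 \<longrightarrow> X \<in> A) \<and> (\<Sum>X\<in>A. str (C X * D (X, n))) \<in> comm"
  using assms(2)
proof (induction rule: bracket.induct)
  case (commutator X Y U i F j)
  let ?D = "single (X, i + j) (F * U) - sg (i * j) (single (Y, i + j) (U * F))"
  show ?case
  proof (intro exI[of _ "{X, Y}"] conjI allI impI)
    show "Z \<in> {X, Y}" if "?D (Z, n) \<noteq> 0" for Z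
      using that by (auto simp: single_def sg_fun_apply split: if_splits)
    have sgl: "(\<Sum>Z\<in>{X, Y}. str (C Z * single (W, i + j) A (Z, n))) = (if i + j = n then str (C W * A) else 0)"
      if "W \<in> {X, Y}" for W A
    proof -
      have "(\<Sum>Z\<in>{X, Y}. str (C Z * single (W, i + j) A (Z, n))) = (\<Sum>Z\<in>{X, Y}. if Z = W then (if i + j = n then str (C W * A) else 0) else 0)"
        by (intro sum.cong) (auto simp: single_def)
      then show ?thesis using that by (simp add: sum.delta)
    qed
    have "(\<Sum>Z\<in>{X, Y}. str (C Z * ?D (Z, n)))
      = (\<Sum>Z\<in>{X, Y}. str (C Z * single (X, i + j) (F * U) (Z, n))) - sg (i * j) (\<Sum>Z\<in>{X, Y}. str (C Z * single (Y, i + j) (U * F) (Z, n)))"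
      by (simp add: right_diff_distrib str_diff sum_subtractf sg_fun_apply sg_mult_right str_sg sg_sum)
    also have "\<dots> = (if i + j = n then str (C X * (F * U)) - sg (i * j) (str (C Y * (U * F))) else 0)"
      using sgl[of X "F * U"] sgl[of Y "U * F"] by simp
    also have "\<dots> \<in> comm"
    proof (cases "i + j = n")
      case True
      have "(C Y * U - sg (- n * i) (U * C X)) * F \<in> bd (- n + i + j) (M Y) (M Y)"
        by (rule bd_mult_right[OF nat_famD(2)[OF assms(1) commutator(1-3)] commutator(4)])
      then have "str ((C Y * U - sg (- n * i) (U * C X)) * F) \<in> comm"
        using str_bd[OF mc[OF commutator(2)]] True by (simp add: algebra_simps)
      then have 1: "str (C Y * (U * F)) - sg (n * i) (str (U * (C X * F))) \<in> comm"
        by (simp add: left_diff_distrib str_diff sg_mult_left str_sg mult.assoc)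
      have "hdeg i U" using commutator(3) by (simp add: zc_def hm_def)
      then have 2: "str (U * (C X * F)) - sg i (str (C X * (F * U))) \<in> comm"
        using str_commute[of i U "C X * F"] by (simp add: mult.assoc)
      note comm_sg = sg_in[of comm, OF comm_neg]
      \<comment> \<open>With i + j = n the total exponent i j + n i + i is congruent to i (i + 1)
        modulo 2.\<close>
      have s: "sg (i * j) (sg (n * i) (sg i x)) = x" for x :: 'a
      proof -
        have "even (i * j + (n * i + i))" using True by auto
        then show ?thesis by (simp add: sg_plus[symmetric] sg_even)
      qed
      have "str (C X * (F * U)) - sg (i * j) (str (C Y * (U * F)))
         = - (sg (i * j) (str (C Y * (U * F)) - sg (n * i) (str (U * (C X * F)))))
           - sg (i * j) (sg (n * i) (str (U * (C X * F)) - sg i (str (C X * (F * U)))))"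
        by (simp add: sg_diff s)
      also have "\<dots> \<in> comm"
        using comm_diff[OF comm_neg[OF comm_sg[OF _ 1, of "i * j"]] comm_sg[OF _ comm_sg[OF _ 2, of "n * i"], of "i * j"]] by simp
      finally show ?thesis using True by simp
    qed (simp add: comm_0)
    finally show "(\<Sum>Z\<in>{X, Y}. str (C Z * ?D (Z, n))) \<in> comm" .
  qed simp
next
  case (boundary X b k)
  show ?case
  proof (intro exI[of _ "{X}"] conjI allI impI)
    show "Z \<in> {X}" if "single (X, k) b (Z, n) \<noteq> 0" for Z
      using that by (auto simp: single_def split: if_splits)
    have "str (C X * b) \<in> comm" if "k = n"
      using str_bd[OF mc[OF boundary(1)]] bd_mult_left[OF nat_famD(1)[OF assms(1) boundary(1,1)] boundary(2)] that by simp
    then show "(\<Sum>Z\<in>{X}. str (C Z * single (X, k) b (Z, n))) \<in> comm"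
      by (simp add: single_def comm_0)
  qed simp
next
  case zero
  show ?case by (intro exI[of _ "{}"]) (simp add: comm_0)
next
  case (add F G)
  then obtain A A' where A: "finite A" "\<forall>X. F (X, n) \<noteq> 0 \<longrightarrow> X \<in> A" "(\<Sum>X\<in>A. str (C X * F (X, n))) \<in> comm"
    and A': "finite A'" "\<forall>X. G (X, n) \<noteq> 0 \<longrightarrow> X \<in> A'" "(\<Sum>X\<in>A'. str (C X * G (X, n))) \<in> comm" by blast
  have "(\<Sum>X\<in>A \<union> A'. str (C X * F (X, n))) \<in> comm" "(\<Sum>X\<in>A \<union> A'. str (C X * G (X, n))) \<in> comm"
    using trace_sum_indep[of A "A \<union> A'" F n C] trace_sum_indep[of A' "A \<union> A'" G n C] A A' by auto
  then have "(\<Sum>X\<in>A \<union> A'. str (C X * (F + G) (X, n))) \<in> comm"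
    by (simp add: distrib_left str_add sum.distrib comm_add)
  moreover have "\<forall>X. (F + G) (X, n) \<noteq> 0 \<longrightarrow> X \<in> A \<union> A'"
  proof (intro allI impI)
    fix X assume "(F + G) (X, n) \<noteq> 0"
    then have "F (X, n) \<noteq> 0 \<or> G (X, n) \<noteq> 0" by auto
    then show "X \<in> A \<union> A'" using A(2) A'(2) by blast
  qed
  ultimately show ?case using A(1) A'(1) by (intro exI[of _ "A \<union> A'"]) auto
qed

lemma trace_bracket:
  assumes "nat_fam (- n) C" "D \<in> bracket" "finite A" "\<And>X. D (X, n) \<noteq> 0 \<Longrightarrow> X \<in> A"
  shows "(\<Sum>X\<in>A. str (C X * D (X, n))) \<in> comm"
proof -
  obtain A' where A': "finite A'" "\<forall>X. D (X, n) \<noteq> 0 \<longrightarrow> X \<in> A'" "(\<Sum>X\<in>A'. str (C X * D (X, n))) \<in> comm"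
    using trace_bracket_ex[OF assms(1,2)] by blast
  then show ?thesis using trace_sum_indep[of A A' D n C] assms(3,4) by simp
qed

end

context gcat_model
begin

definition fscale :: "'k \<Rightarrow> ('o \<times> int \<Rightarrow> 'a imat) \<Rightarrow> 'o \<times> int \<Rightarrow> 'a imat" where
  "fscale c F = (\<lambda>w. iscale c (F w))"

lemma vector_space_fscale: "vector_space fscale"
proof -
  interpret iv: vector_space iscale by (rule vector_space_iscale)
  show ?thesis
    by unfold_locales (auto simp: fscale_def fun_eq_iff iv.scale_right_distrib iv.scale_left_distrib)
qed

text \<open>A functional that vanishes on the bracket is given in each degree by a natural family, because the trace
  pairing is nondegenerate on morphisms up to homotopy.\<close>

lemma functional_nat_fam:
  assumes l: "functional fscale l" and lb: "\<And>D. D \<in> bracket \<Longrightarrow> l D = 0"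
  obtains C where "nat_fam (- n) C" "\<And>X A. X \<in> Ob \<Longrightarrow> A \<in> zc n (M X) (M X) \<Longrightarrow> l (single (X, n) A) = \<epsilon> (str (C X * A))"
proof -
  have "\<exists>c. c \<in> zc (- n) (M X) (M X) \<and> (\<forall>A\<in>hm n (M X) (M X). l (single (X, n) A) = \<epsilon> (str (c * A)))"
    if X: "X \<in> Ob" for X
  proof -
    have "fscale c (single w A) = single w (iscale c A)" for c w A
      by (auto simp: fscale_def single_def iscale_def)
    then have "functional iscale (\<lambda>A. l (single (X, n) A))"
      using functional_simps(2)[OF l] by (simp add: functional_def single_add functional_simps(1)[OF l]) metis
    from str_dual[OF mc[OF X] mc[OF X] this, of n] show ?thesis using lb bracket.boundary[OF X] by metis
  qed
  then obtain C where C: "\<And>X. X \<in> Ob \<Longrightarrow> C X \<in> zc (- n) (M X) (M X)"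
      "\<And>X A. X \<in> Ob \<Longrightarrow> A \<in> hm n (M X) (M X) \<Longrightarrow> l (single (X, n) A) = \<epsilon> (str (C X * A))"
    by metis
  note ls = functional_simps[OF l] and es = functional_simps[OF eps]
  \<comment> \<open>By \<open>bd_by_trace\<close> it suffices to pair the defect of naturality with
    morphisms \<open>g\<close> in the opposite direction. The two pairings become values of
    \<open>l\<close> on \<open>f * g\<close> and on \<open>g * f\<close>, which agree up to sign
    because \<open>l\<close> vanishes on supercommutators.\<close>
  have "C Y * f - sg (- n * j) (f * C X) \<in> bd (- n + j) (M X) (M Y)"
    if X: "X \<in> Ob" and Y: "Y \<in> Ob" and f: "f \<in> zc j (M X) (M Y)" for X Y j f
  proof (rule bd_by_trace[OF mc[OF X] mc[OF Y]])
    have "f * C X \<in> zc (- n + j) (M X) (M Y)" using zc_mult[OF f C(1)[OF X]] by (simp add: add.commute)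
    then show "C Y * f - sg (- n * j) (f * C X) \<in> zc (- n + j) (M X) (M Y)"
      by (intro zc_closed(2) zc_mult[OF C(1)[OF Y] f] zc_closed(4))
    fix g assume "g \<in> zc (- (- n + j)) (M Y) (M X)"
    then have g: "g \<in> zc (n - j) (M Y) (M X)" by simp
    have gf: "g * f \<in> zc n (M X) (M X)" "f * g \<in> zc n (M Y) (M Y)"
      using zc_mult[OF g f] zc_mult[OF f g] by simp_all
    have hg: "hdeg (n - j) g" and hc: "hdeg (- n) (C X)" using g C(1)[OF X] by (auto simp: zc_def hm_def)
    have "\<epsilon> (str (g * (C Y * f))) = sg (n - j) (\<epsilon> (str (C Y * f * g)))"
      using eps_comm_eq[OF str_commute[OF hg]] by (simp add: es)
    also have "\<dots> = sg (n - j) (l (single (Y, n) (f * g)))"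
      using C(2)[OF Y zc_hm[OF gf(2)]] by (simp add: mult.assoc)
    finally have 1: "\<epsilon> (str (g * (C Y * f))) = \<dots>" .
    have "\<epsilon> (str (C X * (g * f))) = sg n (\<epsilon> (str (g * f * C X)))"
      using eps_comm_eq[OF str_commute[OF hc]] by (simp add: es)
    then have 2: "\<epsilon> (str (g * (f * C X))) = sg n (l (single (X, n) (g * f)))"
      using C(2)[OF X zc_hm[OF gf(1)]] by (simp add: mult.assoc)
    have "single (X, n) (g * f) - sg (j * (n - j)) (single (Y, n) (f * g)) \<in> bracket"
      using bracket.commutator[OF X Y f g] by simp
    then have 3: "l (single (X, n) (g * f)) = sg (j * (n - j)) (l (single (Y, n) (f * g)))"
      using lb ls(5,7) by fastforce
    have "\<epsilon> (str (g * (C Y * f - sg (- n * j) (f * C X))))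
        = sg (n - j) (l (single (Y, n) (f * g))) - sg (- n * j) (sg n (sg (j * (n - j)) (l (single (Y, n) (f * g)))))"
      by (simp add: right_diff_distrib sg_mult_right str_diff str_sg es 1 2 3)
    also have "sg (- n * j) (sg n (sg (j * (n - j)) x)) = sg (n - j) x" for x :: 'k
      unfolding sg_plus[symmetric] by (rule sg_eq_parity) auto
    finally show "\<epsilon> (str (g * (C Y * f - sg (- n * j) (f * C X)))) = 0" by simp
  qed
  then have "nat_fam (- n) C" using C(1) by (simp add: nat_fam_def)
  then show ?thesis using that C(2) zc_hm by blast
qed

text \<open>If z F were outside the bracket, a separating functional, given in a suitable degree by
  a natural family \<open>C\<close>, would produce T, the sum of the traces of C F over the objects,
  with \<open>\<epsilon> (z * T) \<noteq> 0\<close>. Modulo commutators T^(p^r) is up to sign the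
  trace of C^(p^r) against the iterated power of F. As C^(p^r) is natural and that power lies in the
  bracket, T^(p^r) is in \<open>comm\<close>. Then \<open>z * T \<in> comm\<close> by the choice of
  \<open>z\<close>, a contradiction.\<close>

lemma K_alg_kernel:
  assumes F: "fam F" and z: "z \<in> K_alg scale p r" and pF: "(pw ^^ r) F \<in> bracket"
  shows "(\<lambda>w. cm z (F w)) \<in> bracket"
proof (rule ccontr)
  let ?q = "p ^ r"
  assume n: "(\<lambda>w. cm z (F w)) \<notin> bracket"
  have zc: "z * a = a * z" for a using z by (simp add: K_alg_def alg_center_def)
  interpret fv: vector_space fscale by (rule vector_space_fscale)
  have "fv.subspace bracket"
    unfolding fscale_def iscale_def
    by (rule fv.subspaceI[unfolded fscale_def iscale_def]) (auto intro: bracket.zero bracket.add bracket_scale scale_1_central)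
  then obtain l where l: "functional fscale l" "\<forall>D\<in>bracket. l D = 0" "l (\<lambda>w. cm z (F w)) = 1"
    using fv.functional_separating n by blast
  note ls = functional_simps[OF l(1)]
  define S where "S = {w. F w \<noteq> 0}"
  have S: "finite S" using F by (simp add: fam_def S_def)
  let ?A = "fst ` S" let ?N = "snd ` S"
  have AOb: "X \<in> Ob" if "X \<in> ?A" for X using that F by (auto simp: S_def fam_def)
  have "(\<lambda>w. cm z (F w)) = (\<Sum>w\<in>?A \<times> ?N. single w (cm z (F w)))"
  proof (rule sum_single)
    fix w assume "cm z (F w) \<noteq> 0"
    then have "w \<in> S" by (auto simp: S_def)
    then show "w \<in> ?A \<times> ?N" by (cases w) force
  qed (use S in simp)
  then have "l (\<lambda>w. cm z (F w)) = (\<Sum>w\<in>?A \<times> ?N. l (single w (cm z (F w))))" using ls(6) by metis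
  also have "\<dots> = (\<Sum>X\<in>?A. \<Sum>n\<in>?N. l (single (X, n) (cm z (F (X, n)))))"
    by (simp only: sum.cartesian_product split_def prod.collapse)
  also have "\<dots> = (\<Sum>n\<in>?N. \<Sum>X\<in>?A. l (single (X, n) (cm z (F (X, n)))))" by (rule sum.swap)
  finally have "(\<Sum>n\<in>?N. \<Sum>X\<in>?A. l (single (X, n) (cm z (F (X, n))))) \<noteq> 0" using l(3) by simp
  \<comment> \<open>Some degree contributes to the value of the functional; only this component of
    \<open>F\<close> matters from here on.\<close>
  then obtain n where n: "(\<Sum>X\<in>?A. l (single (X, n) (cm z (F (X, n))))) \<noteq> 0" by (meson sum.neutral)
  obtain C where C: "nat_fam (- n) C" "\<And>X A. X \<in> Ob \<Longrightarrow> A \<in> zc n (M X) (M X) \<Longrightarrow> l (single (X, n) A) = \<epsilon> (str (C X * A))"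
    using functional_nat_fam[OF l(1), of n] l(2) by blast
  note Fz = fam_zc[OF F]
  define T where "T = (\<Sum>X\<in>?A. str (C X * F (X, n)))"
  have "(\<Sum>X\<in>?A. l (single (X, n) (cm z (F (X, n))))) = (\<Sum>X\<in>?A. \<epsilon> (z * str (C X * F (X, n))))"
    using C(2) zc_cm[OF zc Fz] AOb by (intro sum.cong) (auto simp: str_cm cm_mult_right[OF zc, symmetric])
  also have "\<dots> = \<epsilon> (z * T)" by (simp add: T_def sum_distrib_left functional_simps[OF eps])
  finally have nz: "\<epsilon> (z * T) \<noteq> 0" using n by simp
  obtain t where t: "\<And>X G. X \<in> Ob \<Longrightarrow> G \<in> zc n (M X) (M X) \<Longrightarrow>
    mpow (fst (M X)) (C X * G) ?q - sg t (mpow (fst (M X)) (C X) ?q * mpow (fst (M X)) G ?q) \<in> bd (int ?q * (- n + n)) (M X) (M X)"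
    using nat_fam_mult_power[OF C(1), of n ?q] by blast
  have "T ^ ?q - (\<Sum>X\<in>?A. str (C X * F (X, n)) ^ ?q) \<in> comm"
    unfolding T_def by (rule comm_sum_power_pp) (use S in simp)
  moreover have "(\<Sum>X\<in>?A. str (C X * F (X, n)) ^ ?q)
      - (\<Sum>X\<in>?A. sg t (str (mpow (fst (M X)) (C X) ?q * mpow (fst (M X)) (F (X, n)) ?q))) \<in> comm"
    unfolding sum_subtractf[symmetric]
  proof (rule comm_sum)
    fix X assume "X \<in> ?A"
    then have X: "X \<in> Ob" by (rule AOb)
    have z0: "C X * F (X, n) \<in> zc (- n + n) (M X) (M X)" by (rule zc_mult[OF nat_famD(1)[OF C(1) X X] Fz[OF X]])
    have "str (mpow (fst (M X)) (C X * F (X, n)) ?q) - str (C X * F (X, n)) ^ ?q \<in> comm"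
      by (rule str_mpow_pp) (use z0 zc_unit[OF z0] mc[OF X] in \<open>auto simp: zc_def hm_def mcplx_def\<close>)
    moreover have "str (mpow (fst (M X)) (C X * F (X, n)) ?q) - sg t (str (mpow (fst (M X)) (C X) ?q * mpow (fst (M X)) (F (X, n)) ?q)) \<in> comm"
      unfolding str_sg[symmetric] str_diff[symmetric] by (rule str_bd[OF mc[OF X]]) (use t[OF X Fz[OF X]] in simp)
    ultimately show "str (C X * F (X, n)) ^ ?q - sg t (str (mpow (fst (M X)) (C X) ?q * mpow (fst (M X)) (F (X, n)) ?q)) \<in> comm"
      using comm_diff_trans comm_diff_sym by blast
  qed
  \<comment> \<open>The degree of the iterated power family that pairs with the powers of
    \<open>C\<close> is p^r n; its component there is the p^r-th power of the component of degree
    n.\<close>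
  moreover have "(\<Sum>X\<in>?A. sg t (str (mpow (fst (M X)) (C X) ?q * mpow (fst (M X)) (F (X, n)) ?q))) \<in> comm"
  proof -
    have "nat_fam (- (int ?q * n)) (\<lambda>X. mpow (fst (M X)) (C X) ?q)"
      using nat_fam_mpow[OF C(1), of ?q] by simp
    then have "(\<Sum>X\<in>?A. str (mpow (fst (M X)) (C X) ?q * (pw ^^ r) F (X, int ?q * n))) \<in> comm"
    proof (rule trace_bracket[OF _ pF])
      show "X \<in> ?A" if a: "(pw ^^ r) F (X, int ?q * n) \<noteq> 0" for X
      proof -
        have X: "X \<in> Ob" using a fam_pw_iter[OF F, of r] by (auto simp: fam_def)
        then have "F (X, n) \<noteq> 0" using a pw_iter[OF F X, of r n] char(2) by (auto simp: mpow_zero)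
        then show ?thesis by (force simp: S_def)
      qed
    qed (use S in simp)
    then have "(\<Sum>X\<in>?A. str (mpow (fst (M X)) (C X) ?q * mpow (fst (M X)) (F (X, n)) ?q)) \<in> comm"
      using pw_iter[OF F AOb, of _ r n] by (simp cong: sum.cong)
    from comm_neg[OF this] this show ?thesis unfolding sg_sum[symmetric] by (simp add: sg_def)
  qed
  ultimately have "T ^ ?q \<in> comm" using comm_add[OF comm_diff_trans] by fastforce
  then have "z * T \<in> comm" using z by (simp add: K_alg_def)
  then show False using nz eps_comm by blast
qed

section \<open>The action of central elements of the algebra\<close>

definition central_action :: "'a \<Rightarrow> (int \<Rightarrow> 'o \<Rightarrow> 'f) \<Rightarrow> bool" where
  "central_action z a \<longleftrightarrow> z \<in> alg_center \<and> (\<forall>X\<in>Ob. rep X X 0 (a 0 X) (cm z (fst (M X)))) \<and>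
     (\<forall>X\<in>Ob. \<forall>i. i \<noteq> 0 \<longrightarrow> a i X = \<zero>\<^bsub>gHom B X X i\<^esub>) \<and> (\<forall>i. a i \<in> extensional Ob)"

lemma rep_zero_family:
  assumes XY: "X \<in> Ob" "Y \<in> Ob" and f: "f \<in> carrier (gHom B X Y j)"
  shows "rep X Y (i + j) (gCmp B X X Y i j f \<zero>\<^bsub>gHom B X X i\<^esub>) 0"
    "rep X Y (i + j) (gCmp B X Y Y j i \<zero>\<^bsub>gHom B Y Y i\<^esub> f) 0"
proof -
  obtain F where F: "rep X Y j f F" using rep_ex[OF XY f] by blast
  show "rep X Y (i + j) (gCmp B X X Y i j f \<zero>\<^bsub>gHom B X X i\<^esub>) 0"
    using rep_comp[OF XY(1,1,2) rep_zero[OF XY(1,1)] F] by simp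
  show "rep X Y (i + j) (gCmp B X Y Y j i \<zero>\<^bsub>gHom B Y Y i\<^esub> f) 0"
    using rep_comp[OF XY(1,2,2) F rep_zero[OF XY(2,2)]] by (simp add: add.commute)
qed

lemma central_action_gcenter:
  assumes a: "central_action z a"
  shows "a \<in> gcenter B"
proof -
  have z: "z * x = x * z" for x using a by (simp add: central_action_def alg_center_def)
  have a0: "rep X X 0 (a 0 X) (cm z (fst (M X)))" if "X \<in> Ob" for X using a that by (simp add: central_action_def)
  have ai: "a i X = \<zero>\<^bsub>gHom B X X i\<^esub>" if "X \<in> Ob" "i \<noteq> 0" for X i using a that by (simp add: central_action_def)
  have "a i \<in> center_component B i" for i
  proof -
    have "a i X \<in> carrier (gHom B X X i)" if X: "X \<in> Ob" for X
      using rep_dom[OF X X a0[OF X]] rep_dom[OF X X rep_zero[OF X X]] ai[OF X] by (cases "i = 0") auto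
    moreover have "gCmp B X X Y i j f (a i X) = sgn_pow (gHom B X Y (i + j)) (i * j) (gCmp B X Y Y j i (a i Y) f)"
      if XY: "X \<in> Ob" "Y \<in> Ob" and f: "f \<in> carrier (gHom B X Y j)" for X Y j f
    proof (cases "i = 0")
      case True
      obtain F where F: "rep X Y j f F" using rep_ex[OF XY f] by blast
      have Fz: "F \<in> zc j (M X) (M Y)" using rep_dom[OF XY F] by blast
      have "F * cm z (fst (M X)) = cm z F" "cm z (fst (M Y)) * F = cm z F"
        using zc_unit[OF Fz] by (simp_all add: cm_mult_left[symmetric] cm_mult_right[OF z, symmetric])
      then have "rep X Y (0 + j) (gCmp B X X Y 0 j f (a 0 X)) (cm z F)" "rep X Y (j + 0) (gCmp B X Y Y j 0 (a 0 Y) f) (cm z F)"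
        using rep_comp[OF XY(1,1,2) a0[OF XY(1)] F] rep_comp[OF XY(1,2,2) F a0[OF XY(2)]] by simp_all
      then have "gCmp B X X Y 0 j f (a 0 X) = gCmp B X Y Y j 0 (a 0 Y) f"
        using rep_eqI[OF XY, of j _ "cm z F" _ "cm z F"] by simp
      then show ?thesis by (simp add: True sgn_pow_def)
    next
      case False
      have "rep X Y (i + j) (sgn_pow (gHom B X Y (i + j)) (i * j) (gCmp B X Y Y j i (a i Y) f)) (sg (i * j) 0)"
        using rep_zero_family(2)[OF XY f, of i] ai[OF XY(2) False] by (intro rep_sgn XY) simp
      then show ?thesis
        using rep_eqI[OF XY rep_zero_family(1)[OF XY f, of i]] ai[OF XY(1) False] by simp
    qed
    moreover have "a i \<in> extensional Ob" using a by (simp add: central_action_def)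
    ultimately show ?thesis by (auto simp: center_component_def PiE_def)
  qed
  moreover have "{i. \<exists>X\<in>Ob. a i X \<noteq> \<zero>\<^bsub>gHom B X X i\<^esub>} \<subseteq> {0}" using ai by blast
  then have "finite {i. \<exists>X\<in>Ob. a i X \<noteq> \<zero>\<^bsub>gHom B X X i\<^esub>}" by (rule finite_subset) simp
  ultimately show ?thesis by (simp add: gcenter_def)
qed

text \<open>The sum runs over the degrees in which \<open>a\<close> is nonzero at \<open>X\<close>.
  Normally this is degree 0 alone, but when multiplication by \<open>z\<close> is null-homotopic on
  \<open>X\<close> the index set is empty; then \<open>cm z F\<close> is itself a boundary and
  represents the empty sum.\<close>

lemma finsum_central_action:
  assumes X: "X \<in> Ob" and a: "central_action z a" and h: "rep X X n (h 0) (cm z F)"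
    and F: "F \<in> zc n (M X) (M X)"
  shows "rep X X n (\<Oplus>\<^bsub>gHom B X X n\<^esub>i\<in>{i. a i X \<noteq> \<zero>\<^bsub>gHom B X X i\<^esub>}. h i) (cm z F)"
proof -
  interpret H: abelian_group "gHom B X X n" by (rule abelian_group_gHom[OF X X])
  have z: "z * x = x * z" for x using a by (simp add: central_action_def alg_center_def)
  have h0: "h 0 \<in> carrier (gHom B X X n)" using rep_dom[OF X X h] by blast
  have "{i. a i X \<noteq> \<zero>\<^bsub>gHom B X X i\<^esub>} \<subseteq> {0}" using X a by (auto simp: central_action_def)
  then consider "{i. a i X \<noteq> \<zero>\<^bsub>gHom B X X i\<^esub>} = {0}" | "{i. a i X \<noteq> \<zero>\<^bsub>gHom B X X i\<^esub>} = {}" by blast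
  then show ?thesis
  proof cases
    case 1
    have "(\<Oplus>\<^bsub>gHom B X X n\<^esub>i\<in>{0}. h i) = h 0"
      using h0 by (subst H.finsum_insert) auto
    then show ?thesis using h by (simp add: 1)
  next
    case 2
    then have a0: "a 0 X = \<zero>\<^bsub>gHom B X X 0\<^esub>" by blast
    have "rep X X 0 (a 0 X) (cm z (fst (M X)))" using a X by (simp add: central_action_def)
    then have "rep X X 0 \<zero>\<^bsub>gHom B X X 0\<^esub> (cm z (fst (M X)))" by (simp only: a0)
    then have "0 - cm z (fst (M X)) \<in> bd 0 (M X) (M X)" using rep_eq[OF X X rep_zero[OF X X]] by blast
    from bd_mult_right[OF this F] have "0 - cm z F \<in> bd n (M X) (M X)"
      using zc_unit(1)[OF F] by (simp add: cm_mult_left[symmetric])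
    from rep_change[OF X X rep_zero[OF X X] this] show ?thesis by (simp add: 2)
  qed
qed

lemma Rep_endo_act:
  assumes a: "central_action z a" and m: "Rep m F"
  shows "Rep (endo_left B a m) (\<lambda>w. cm z (F w))" "Rep (endo_right B m a) (\<lambda>w. cm z (F w))"
proof -
  have z: "z * x = x * z" for x using a by (simp add: central_action_def alg_center_def)
  have c: "rep X X (n - 0) (gCmp B X X X (n - 0) 0 (a 0 X) (m (X, n - 0))) (cm z (F (X, n)))"
      "rep X X (0 + (n - 0)) (gCmp B X X X 0 (n - 0) (m (X, n - 0)) (a 0 X)) (cm z (F (X, n)))" if X: "X \<in> Ob" for X n
  proof -
    note u = zc_unit[OF fam_zc[OF RepD(2)[OF m] X]]
    have a0: "rep X X 0 (a 0 X) (cm z (fst (M X)))" using a X by (simp add: central_action_def)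
    show "rep X X (n - 0) (gCmp B X X X (n - 0) 0 (a 0 X) (m (X, n - 0))) (cm z (F (X, n)))"
      using rep_comp[OF X X X RepD(3)[OF m X] a0, of n] u by (simp add: cm_mult_left[symmetric])
    show "rep X X (0 + (n - 0)) (gCmp B X X X 0 (n - 0) (m (X, n - 0)) (a 0 X)) (cm z (F (X, n)))"
      using rep_comp[OF X X X a0 RepD(3)[OF m X], of n] u by (simp add: cm_mult_right[OF z, symmetric])
  qed
  have f: "fam (\<lambda>w. cm z (F w))" by (rule fam_cm[OF z RepD(2)[OF m]])
  note Fz = fam_zc[OF RepD(2)[OF m]]
  show "Rep (endo_left B a m) (\<lambda>w. cm z (F w))"
    by (rule RepI[OF _ f])
      (use finsum_central_action[OF _ a _ Fz, where h = "\<lambda>i. gCmp B X X X (n - i) i (a i X) (m (X, n - i))" for X n] c(1)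
        in \<open>auto simp: endo_left_def\<close>)
  show "Rep (endo_right B m a) (\<lambda>w. cm z (F w))"
    by (rule RepI[OF _ f])
      (use finsum_central_action[OF _ a _ Fz, where h = "\<lambda>i. gCmp B X X X i (n - i) (m (X, n - i)) (a i X)" for X n] c(2)
        in \<open>auto simp: endo_right_def\<close>)
qed

lemma K_alg_K_cat:
  assumes z: "z \<in> K_alg scale p r" and a: "central_action z a"
  shows "a \<in> K_cat B p r"
proof -
  have zc: "z * x = x * z" for x using a by (simp add: central_action_def alg_center_def)
  have "left_act B a C = gbracket B \<and> right_act B C a = gbracket B" if C: "C \<in> T_cat B p r" for C
  proof -
    obtain m F where m: "Rep m F" "C = coset m" using T_cat_coset[OF C] .
    have "(pw ^^ r) F \<in> bracket" using T_cat_iff[OF m(1)] C m(2) by simp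
    then have zF: "(\<lambda>w. cm z (F w)) \<in> bracket" using K_alg_kernel[OF RepD(2)[OF m(1)] z] by blast
    have "coset (endo_left B a m') = gbracket B \<and> coset (endo_right B m' a) = gbracket B" if m': "m' \<in> coset m" for m'
    proof -
      obtain G where G: "Rep m' G" using Rep_ex coset_carrier[OF m(1) m'] by blast
      have "G - F \<in> bracket" using coset_iff[OF m(1) G] m' by blast
      from bracket.add[OF bracket_scale[OF zc this] zF] have "(\<lambda>w. cm z (G w)) \<in> bracket"
        by (simp add: cm_diff plus_fun_def)
      then show ?thesis using coset_bracket Rep_endo_act[OF a G] by blast
    qed
    moreover have "m \<in> coset m" by (rule coset_self[OF m(1)])
    ultimately show ?thesis unfolding left_act_def right_act_def m(2) by blast
  qed
  then show ?thesis using central_action_gcenter[OF a] by (simp add: K_cat_def)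
qed

text \<open>The model of \<open>X\<close> is the algebra placed in a single degree, so an element
  \<open>b\<close> is an endomorphism whose powers are those of \<open>b\<close>. If b^(p^r) is in
  \<open>comm\<close>, its class lies in \<open>T_cat\<close>, and the trace against the family of
  identities brings the vanishing of z times this class back to the algebra.\<close>

lemma K_cat_K_alg:
  assumes X: "X \<in> Ob" and MX: "M X = (sgl u u 1, 0)"
    and a: "central_action z a" and K: "a \<in> K_cat B p r"
  shows "z \<in> K_alg scale p r"
proof -
  have z: "z \<in> alg_center" using a by (simp add: central_action_def)
  have sz: "sgl u u b \<in> zc 0 (M X) (M X)" for b
    by (simp add: MX zc_def hm_def df_def sgl_mult hdeg_sgl)
  have mp: "mpow (fst (M X)) (sgl u u b) n = sgl u u (b ^ n)" for b n
    by (induction n) (simp_all add: MX sgl_mult power_commutes)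
  have sb: "single (X, 0) (sgl u u x) \<in> bracket" if "x \<in> comm" for x
    using that
  proof (induction rule: comm_induct)
    case zero
    show ?case unfolding sgl_0 single_0 by (rule bracket.zero)
  next
    case (add x y)
    show ?case unfolding sgl_add single_add by (rule bracket.add[OF add(3,4)])
  next
    case (commutator x y)
    have "sgl u u (x * y - y * x) = sgl u u x * sgl u u y - sgl u u y * sgl u u x"
      by (simp add: sgl_mult) (metis add_diff_cancel_right' diff_add_cancel sgl_add)
    then have "single (X, 0 :: int) (sgl u u (x * y - y * x)) = single (X, 0 + 0) (sgl u u x * sgl u u y) - sg (0 * 0) (single (X, 0 + 0) (sgl u u y * sgl u u x))"
      by (simp only: single_diff) simp
    then show ?case using bracket.commutator[OF X X sz[of y] sz[of x]] by (simp only:)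
  qed
  have "z * b \<in> comm" if b: "b ^ (p ^ r) \<in> comm" for b
  proof -
    let ?F = "single (X, 0 :: int) (sgl u u b)"
    have fF: "fam ?F" by (rule fam_single[OF X sz])
    then obtain m where m: "Rep m ?F" using Rep_onto by blast
    have "(pw ^^ n) ?F = single (X, 0) (sgl u u (b ^ (p ^ n)))" for n
    proof (induction n)
      case (Suc n)
      then show ?case using pw_single[OF X, of 0] by (simp add: mp mult.commute flip: power_mult)
    qed simp
    then have "(pw ^^ r) ?F \<in> bracket" using sb[OF b] by simp
    then have "coset m \<in> T_cat B p r" using T_cat_iff[OF m] by simp
    then have "left_act B a (coset m) = gbracket B" using K by (simp add: K_cat_def)
    moreover have "endo_left B a m \<in> left_act B a (coset m)"
      unfolding left_act_def using coset_self[OF m] coset_self[OF Rep_endo_act(1)[OF a m]] by blast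
    ultimately have "(\<lambda>w. cm z (?F w)) \<in> bracket" using gbracket_iff[OF Rep_endo_act(1)[OF a m]] by simp
    note zF = this
    have n0: "nat_fam (- 0) (\<lambda>X. fst (M X))" using nat_fam_id by simp
    have s0: "Y \<in> {X}" if "cm z (?F (Y, 0)) \<noteq> 0" for Y
      using that by (cases "Y = X") (simp_all add: single_apply)
    have f0: "finite {X}" by simp
    have "(\<Sum>Y\<in>{X}. str (fst (M Y) * cm z (?F (Y, 0)))) \<in> comm"
      by (rule trace_bracket[of 0 "\<lambda>X. fst (M X)" "\<lambda>w. cm z (?F w)" "{X}", OF n0 zF f0]) (rule s0)
    then have "str (sgl u u (z * b)) \<in> comm" by (simp add: single_def MX cm_sgl sgl_mult)
    then have "sg (dg u) (z * b) \<in> comm" by (simp add: str_sgl)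
    from sg_in[OF comm_neg this, of "dg u"] show ?thesis by simp
  qed
  then show ?thesis using z by (simp add: K_alg_def)
qed

end

section \<open>Complexes of modules\<close>

context right_module
begin

lemma smult_zero [simp]: "a \<odot> \<zero> = \<zero>"
proof -
  have "a \<odot> \<zero> \<oplus> a \<odot> \<zero> = a \<odot> \<zero>" using smult_r_distr[of \<zero> \<zero> a] by simp
  then show ?thesis using smult_closed[of \<zero> a] add.r_cancel_one' by fastforce
qed

lemma zero_smult [simp]: "x \<in> carrier M \<Longrightarrow> 0 \<odot> x = \<zero>"
proof -
  assume x: "x \<in> carrier M"
  have "0 \<odot> x \<oplus> 0 \<odot> x = 0 \<odot> x" using smult_l_distr[OF x, of 0 0] by simp
  then show ?thesis using smult_closed[OF x, of 0] add.r_cancel_one' by fastforce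
qed

lemma smult_neg: "x \<in> carrier M \<Longrightarrow> a \<odot> (\<ominus> x) = \<ominus> (a \<odot> x)"
proof -
  assume x: "x \<in> carrier M"
  then have "a \<odot> (\<ominus> x) \<oplus> a \<odot> x = \<zero>" using smult_r_distr[of "\<ominus> x" x a] by (simp add: l_neg)
  then show ?thesis using minus_equality[of "a \<odot> (\<ominus> x)" "a \<odot> x"] x smult_closed by simp
qed

lemma smult_finsum: "finite A \<Longrightarrow> (\<And>i. i \<in> A \<Longrightarrow> f i \<in> carrier M) \<Longrightarrow> a \<odot> finsum M f A = (\<Oplus>i\<in>A. a \<odot> f i)"
  by (induction A rule: finite_induct) (auto simp: Pi_def smult_closed smult_r_distr)

lemma add_interchange: "\<lbrakk>a \<in> carrier M; b \<in> carrier M; c \<in> carrier M; d \<in> carrier M\<rbrakk> \<Longrightarrow>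
    (a \<oplus> b) \<oplus> (c \<oplus> d) = (a \<oplus> c) \<oplus> (b \<oplus> d)"
  by (simp add: a_ac)

lemma sgn_closed [simp]: "x \<in> carrier M \<Longrightarrow> sgn_pow M n x \<in> carrier M"
  by (simp add: sgn_pow_def)

lemma sgn_zero [simp]: "sgn_pow M n \<zero> = \<zero>"
  by (simp add: sgn_pow_def)

lemma sgn_sgn: "x \<in> carrier M \<Longrightarrow> sgn_pow M m (sgn_pow M n x) = sgn_pow M (m + n) x"
  by (simp add: sgn_pow_def)

lemma sgn_add: "x \<in> carrier M \<Longrightarrow> y \<in> carrier M \<Longrightarrow> sgn_pow M n (x \<oplus> y) = sgn_pow M n x \<oplus> sgn_pow M n y"
  by (simp add: sgn_pow_def minus_add)

lemma sgn_smult: "x \<in> carrier M \<Longrightarrow> sgn_pow M n (a \<odot> x) = a \<odot> sgn_pow M n x"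
  by (simp add: sgn_pow_def smult_neg)

lemma sgn_twice: "x \<in> carrier M \<Longrightarrow> sgn_pow M n (sgn_pow M n x) = x"
  by (simp add: sgn_pow_def)

end

lemma rmod_homI:
  assumes "\<And>x. x \<in> carrier M \<Longrightarrow> f x \<in> carrier N"
    "\<And>x y. \<lbrakk>x \<in> carrier M; y \<in> carrier M\<rbrakk> \<Longrightarrow> f (x \<oplus>\<^bsub>M\<^esub> y) = f x \<oplus>\<^bsub>N\<^esub> f y"
    "\<And>a x. x \<in> carrier M \<Longrightarrow> f (a \<odot>\<^bsub>M\<^esub> x) = a \<odot>\<^bsub>N\<^esub> f x"
  shows "f \<in> rmod_hom M N"
  using assms by (auto simp: rmod_hom_def)

lemma rmod_homD:
  assumes "f \<in> rmod_hom M N"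
  shows "x \<in> carrier M \<Longrightarrow> f x \<in> carrier N"
    "\<lbrakk>x \<in> carrier M; y \<in> carrier M\<rbrakk> \<Longrightarrow> f (x \<oplus>\<^bsub>M\<^esub> y) = f x \<oplus>\<^bsub>N\<^esub> f y"
    "x \<in> carrier M \<Longrightarrow> f (a \<odot>\<^bsub>M\<^esub> x) = a \<odot>\<^bsub>N\<^esub> f x"
  using assms by (auto simp: rmod_hom_def)

lemma rmod_hom_zero:
  assumes "right_module M" "right_module N" "f \<in> rmod_hom M N"
  shows "f \<zero>\<^bsub>M\<^esub> = \<zero>\<^bsub>N\<^esub>"
proof -
  interpret M: right_module M by fact
  interpret N: right_module N by fact
  have "f \<zero>\<^bsub>M\<^esub> = 0 \<odot>\<^bsub>N\<^esub> f \<zero>\<^bsub>M\<^esub>" using rmod_homD(3)[OF assms(3), of "\<zero>\<^bsub>M\<^esub>" 0] by simp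
  then show ?thesis using rmod_homD(1)[OF assms(3), of "\<zero>\<^bsub>M\<^esub>"] by simp
qed

lemma rmod_hom_neg:
  assumes "right_module M" "right_module N" "f \<in> rmod_hom M N" "x \<in> carrier M"
  shows "f (\<ominus>\<^bsub>M\<^esub> x) = \<ominus>\<^bsub>N\<^esub> f x"
proof -
  interpret M: right_module M by fact
  interpret N: right_module N by fact
  note c = rmod_homD(1)[OF assms(3)]
  have "f (\<ominus>\<^bsub>M\<^esub> x) \<oplus>\<^bsub>N\<^esub> f x = \<zero>\<^bsub>N\<^esub>"
    using rmod_homD(2)[OF assms(3), of "\<ominus>\<^bsub>M\<^esub> x" x] assms(4) rmod_hom_zero[OF assms(1-3)] by (simp add: M.l_neg)
  then show ?thesis using N.minus_equality c assms(4) by simp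
qed

lemma rmod_hom_sgn:
  assumes "right_module M" "right_module N" "f \<in> rmod_hom M N" "x \<in> carrier M"
  shows "f (sgn_pow M n x) = sgn_pow N n (f x)"
  using rmod_hom_neg[OF assms] by (simp add: sgn_pow_def)

lemma rmod_hom_finsum:
  assumes "right_module M" "right_module N" "f \<in> rmod_hom M N" "finite A" "\<And>i. i \<in> A \<Longrightarrow> g i \<in> carrier M"
  shows "f (finsum M g A) = finsum N (\<lambda>i. f (g i)) A"
proof -
  interpret M: right_module M by fact
  interpret N: right_module N by fact
  show ?thesis using assms(4,5)
    by (induction A rule: finite_induct)
      (auto simp: rmod_hom_zero[OF assms(1-3)] rmod_homD[OF assms(3)] Pi_def M.finsum_closed)
qed

lemma rmod_hom_comp:
  assumes "f \<in> rmod_hom M N" "g \<in> rmod_hom N L"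
  shows "(\<lambda>x. g (f x)) \<in> rmod_hom M L"
  by (rule rmod_homI) (simp_all add: rmod_homD[OF assms(1)] rmod_homD[OF assms(2)])

lemma rmod_hom_add:
  assumes "right_module N" "f \<in> rmod_hom M N" "g \<in> rmod_hom M N"
  shows "(\<lambda>x. f x \<oplus>\<^bsub>N\<^esub> g x) \<in> rmod_hom M N"
proof -
  interpret N: right_module N by fact
  show ?thesis
    by (rule rmod_homI) (auto simp: rmod_homD[OF assms(2)] rmod_homD[OF assms(3)] N.smult_r_distr intro: N.add_interchange)
qed

lemma rmod_hom_const_zero: "right_module N \<Longrightarrow> (\<lambda>x. \<zero>\<^bsub>N\<^esub>) \<in> rmod_hom M N"
proof -
  assume "right_module N"
  then interpret N: right_module N .
  show ?thesis by (rule rmod_homI) auto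
qed

lemma rmod_hom_sgn_comp:
  assumes "right_module N" "f \<in> rmod_hom M N"
  shows "(\<lambda>x. sgn_pow N n (f x)) \<in> rmod_hom M N"
proof -
  interpret N: right_module N by fact
  show ?thesis by (rule rmod_homI) (auto simp: rmod_homD[OF assms(2)] N.sgn_add N.sgn_smult)
qed

lemma rmod_hom_central:
  assumes "right_module N" "z \<in> alg_center" "f \<in> rmod_hom M N"
  shows "(\<lambda>x. z \<odot>\<^bsub>N\<^esub> f x) \<in> rmod_hom M N"
proof -
  interpret N: right_module N by fact
  show ?thesis
    using assms(2)
    by (intro rmod_homI) (auto simp: rmod_homD[OF assms(3)] N.smult_closed N.smult_r_distr alg_center_def simp flip: N.smult_mult)
qed

abbreviation "cc X i \<equiv> carrier (cmodule X i)"
abbreviation "ca X i x y \<equiv> x \<oplus>\<^bsub>cmodule X i\<^esub> y"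
abbreviation "cz X i \<equiv> \<zero>\<^bsub>cmodule X i\<^esub>"
abbreviation "cn X i x \<equiv> \<ominus>\<^bsub>cmodule X i\<^esub> x"

lemma complexD:
  assumes "is_complex X"
  shows cmod: "right_module (cmodule X i)"
    and cdif_hom: "cdif X i \<in> rmod_hom (cmodule X i) (cmodule X (i + 1))"
    and cdif_ext: "cdif X i \<in> extensional (cc X i)"
    and cdif_cdif: "x \<in> cc X i \<Longrightarrow> cdif X (i + 1) (cdif X i x) = cz X (i + 2)"
  using assms by (auto simp: is_complex_def)

lemma cdif_hom':
  assumes "is_complex X"
  shows "cdif X (i - 1) \<in> rmod_hom (cmodule X (i - 1)) (cmodule X i)"
  using cdif_hom[OF assms, of "i - 1"] by simp

lemma cdif_cdif':
  assumes "is_complex X" "x \<in> cc X (i - 1)"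
  shows "cdif X i (cdif X (i - 1) x) = cz X (i + 1)"
proof -
  have "i - 1 + 1 = i" "i - 1 + 2 = i + 1" by simp_all
  then show ?thesis using cdif_cdif[OF assms] by metis
qed

lemma chain_mapD:
  assumes "chain_map X Y f"
  shows chain_hom: "f i \<in> rmod_hom (cmodule X i) (cmodule Y i)"
    and chain_comm: "x \<in> cc X i \<Longrightarrow> f (i + 1) (cdif X i x) = cdif Y i (f i x)"
  using assms by (auto simp: chain_map_def)

lemma chain_comm':
  assumes "chain_map X Y f" "x \<in> cc X (i - 1)"
  shows "f i (cdif X (i - 1) x) = cdif Y (i - 1) (f (i - 1) x)"
  using chain_comm[OF assms] by simp

lemma chain_map_comp:
  assumes "chain_map X Y f" "chain_map Y Z g"
  shows "chain_map X Z (\<lambda>i x. g i (f i x))"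
  unfolding chain_map_def
  by (auto intro: rmod_hom_comp chain_hom[OF assms(1)] chain_hom[OF assms(2)]
      simp: chain_comm[OF assms(1)] chain_comm[OF assms(2)] rmod_homD(1)[OF chain_hom[OF assms(1)]])

lemma chain_map_id: "chain_map X X (\<lambda>i x. x)"
  by (simp add: chain_map_def rmod_hom_def)

lemma chain_map_add:
  assumes "is_complex Y" "chain_map X Y f" "chain_map X Y g"
  shows "chain_map X Y (\<lambda>i x. ca Y i (f i x) (g i x))"
  unfolding chain_map_def using assms
  by (auto intro: rmod_hom_add cmod simp: chain_mapD rmod_homD[OF cdif_hom[OF assms(1)]] rmod_homD[OF chain_hom[OF assms(2)]]
      rmod_homD[OF chain_hom[OF assms(3)]])

lemma chain_map_zero:
  assumes "is_complex Y"
  shows "chain_map X Y (\<lambda>i x. cz Y i)"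
  unfolding chain_map_def
  using rmod_hom_zero[OF cmod[OF assms] cmod[OF assms] cdif_hom[OF assms]] rmod_hom_const_zero[OF cmod[OF assms]] by simp

lemma chain_map_central:
  assumes "is_complex Y" "z \<in> alg_center" "chain_map X Y f"
  shows "chain_map X Y (\<lambda>i x. z \<odot>\<^bsub>cmodule Y i\<^esub> f i x)"
  unfolding chain_map_def using assms
  by (auto intro: rmod_hom_central cmod simp: chain_mapD rmod_homD[OF cdif_hom[OF assms(1)]] rmod_homD[OF chain_hom[OF assms(3)]])

subsection \<open>Homotopies\<close>

lemma homotopicI:
  assumes "\<And>i. h i \<in> rmod_hom (cmodule X i) (cmodule Y (i - 1))"
    and "\<And>i x. x \<in> cc X i \<Longrightarrow> f i x = ca Y i (g i x) (ca Y i (cdif Y (i - 1) (h i x)) (h (i + 1) (cdif X i x)))"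
  shows "homotopic_maps X Y f g"
  using assms unfolding homotopic_maps_def by blast

lemma htpy_closed:
  assumes "is_complex X" "\<And>i. h i \<in> rmod_hom (cmodule X i) (cmodule Y (i - 1))" "is_complex Y" "x \<in> cc X i"
  shows "cdif Y (i - 1) (h i x) \<in> cc Y i" "h (i + 1) (cdif X i x) \<in> cc Y i"
  using rmod_homD(1)[OF cdif_hom'[OF assms(3)] rmod_homD(1)[OF assms(2,4)]]
    rmod_homD(1)[OF assms(2)[of "i + 1"] rmod_homD(1)[OF cdif_hom[OF assms(1)] assms(4)]] by simp_all

text \<open>Maps are arbitrary outside the carriers, so agreement on carriers is the most that can
  be expected; the zero homotopy turns it into a homotopy.\<close>

lemma homotopic_cong:
  assumes "is_complex X" "is_complex Y" "chain_map X Y f" "\<And>i x. x \<in> cc X i \<Longrightarrow> f i x = g i x"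
  shows "homotopic_maps X Y f g"
proof (rule homotopicI)
  fix i x assume x: "x \<in> cc X i"
  interpret right_module "cmodule Y i" by (rule cmod[OF assms(2)])
  have "f i x \<in> cc Y i" by (rule rmod_homD(1)[OF chain_hom[OF assms(3)] x])
  then show "f i x = ca Y i (g i x) (ca Y i (cdif Y (i - 1) (cz Y (i - 1))) (cz Y (i + 1 - 1)))"
    using rmod_hom_zero[OF cmod[OF assms(2)] cmod[OF assms(2)] cdif_hom'[OF assms(2)], of i] assms(4)[OF x] by simp
qed (rule rmod_hom_const_zero[OF cmod[OF assms(2)]])

lemma homotopic_refl: "is_complex X \<Longrightarrow> is_complex Y \<Longrightarrow> chain_map X Y f \<Longrightarrow> homotopic_maps X Y f f"
  by (auto intro: homotopic_cong)

lemma homotopic_sym: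
  assumes X: "is_complex X" and Y: "is_complex Y" and g: "chain_map X Y g" and h: "homotopic_maps X Y f g"
  shows "homotopic_maps X Y g f"
proof -
  obtain h where h: "\<And>i. h i \<in> rmod_hom (cmodule X i) (cmodule Y (i - 1))"
    "\<And>i x. x \<in> cc X i \<Longrightarrow> f i x = ca Y i (g i x) (ca Y i (cdif Y (i - 1) (h i x)) (h (i + 1) (cdif X i x)))"
    using h by (auto simp: homotopic_maps_def)
  show ?thesis
  proof (rule homotopicI)
    show "(\<lambda>x. sgn_pow (cmodule Y (i - 1)) 1 (h i x)) \<in> rmod_hom (cmodule X i) (cmodule Y (i - 1))" for i
      by (rule rmod_hom_sgn_comp[OF cmod[OF Y] h(1)])
    fix i x assume x: "x \<in> cc X i"
    interpret right_module "cmodule Y i" by (rule cmod[OF Y])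
    note c = htpy_closed[OF X h(1) Y x]
    have gx: "g i x \<in> cc Y i" by (rule rmod_homD(1)[OF chain_hom[OF g] x])
    have "cdif Y (i - 1) (sgn_pow (cmodule Y (i - 1)) 1 (h i x)) = cn Y i (cdif Y (i - 1) (h i x))"
      using rmod_hom_neg[OF cmod[OF Y] cmod[OF Y] cdif_hom'[OF Y] rmod_homD(1)[OF h(1) x]] by (simp add: sgn_pow_def)
    then show "g i x = ca Y i (f i x) (ca Y i (cdif Y (i - 1) (sgn_pow (cmodule Y (i - 1)) 1 (h i x)))
        (sgn_pow (cmodule Y (i + 1 - 1)) 1 (h (i + 1) (cdif X i x))))"
      using h(2)[OF x] gx c by (simp add: sgn_pow_def a_ac r_neg r_neg1 minus_add[symmetric])
  qed
qed

lemma homotopic_trans: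
  assumes X: "is_complex X" and Y: "is_complex Y" and k: "chain_map X Y k"
    and fg: "homotopic_maps X Y f g" and gk: "homotopic_maps X Y g k"
  shows "homotopic_maps X Y f k"
proof -
  obtain h where h: "\<And>i. h i \<in> rmod_hom (cmodule X i) (cmodule Y (i - 1))"
    "\<And>i x. x \<in> cc X i \<Longrightarrow> f i x = ca Y i (g i x) (ca Y i (cdif Y (i - 1) (h i x)) (h (i + 1) (cdif X i x)))"
    using fg by (auto simp: homotopic_maps_def)
  obtain h' where h': "\<And>i. h' i \<in> rmod_hom (cmodule X i) (cmodule Y (i - 1))"
    "\<And>i x. x \<in> cc X i \<Longrightarrow> g i x = ca Y i (k i x) (ca Y i (cdif Y (i - 1) (h' i x)) (h' (i + 1) (cdif X i x)))"
    using gk by (auto simp: homotopic_maps_def)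
  show ?thesis
  proof (rule homotopicI)
    show "(\<lambda>x. ca Y (i - 1) (h' i x) (h i x)) \<in> rmod_hom (cmodule X i) (cmodule Y (i - 1))" for i
      by (rule rmod_hom_add[OF cmod[OF Y] h'(1) h(1)])
    fix i x assume x: "x \<in> cc X i"
    interpret right_module "cmodule Y i" by (rule cmod[OF Y])
    note c = htpy_closed[OF X h(1) Y x] htpy_closed[OF X h'(1) Y x]
    have "k i x \<in> cc Y i" by (rule rmod_homD(1)[OF chain_hom[OF k] x])
    moreover have "cdif Y (i - 1) (ca Y (i - 1) (h' i x) (h i x)) = ca Y i (cdif Y (i - 1) (h' i x)) (cdif Y (i - 1) (h i x))"
      by (rule rmod_homD(2)[OF cdif_hom'[OF Y] rmod_homD(1)[OF h'(1) x] rmod_homD(1)[OF h(1) x]])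
    ultimately show "f i x = ca Y i (k i x) (ca Y i (cdif Y (i - 1) (ca Y (i - 1) (h' i x) (h i x)))
        (ca Y (i + 1 - 1) (h' (i + 1) (cdif X i x)) (h (i + 1) (cdif X i x))))"
      using h(2)[OF x] h'(2)[OF x] c by (simp add: a_ac)
  qed
qed

lemma homotopic_comp_left:
  assumes X: "is_complex X" and Y: "is_complex Y" and g: "chain_map X Y g" and k: "chain_map Y Z k" and fg: "homotopic_maps X Y f g"
  shows "homotopic_maps X Z (\<lambda>i x. k i (f i x)) (\<lambda>i x. k i (g i x))"
proof -
  obtain h where h: "\<And>i. h i \<in> rmod_hom (cmodule X i) (cmodule Y (i - 1))"
    "\<And>i x. x \<in> cc X i \<Longrightarrow> f i x = ca Y i (g i x) (ca Y i (cdif Y (i - 1) (h i x)) (h (i + 1) (cdif X i x)))"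
    using fg by (auto simp: homotopic_maps_def)
  show ?thesis
  proof (rule homotopicI)
    show "(\<lambda>x. k (i - 1) (h i x)) \<in> rmod_hom (cmodule X i) (cmodule Z (i - 1))" for i
      by (rule rmod_hom_comp[OF h(1) chain_hom[OF k]])
    fix i x assume x: "x \<in> cc X i"
    interpret right_module "cmodule Y i" by (rule cmod[OF Y])
    note c = htpy_closed[OF X h(1) Y x]
    have gx: "g i x \<in> cc Y i" by (rule rmod_homD(1)[OF chain_hom[OF g] x])
    note ka = rmod_homD(2)[OF chain_hom[OF k]]
    show "k i (f i x) = ca Z i (k i (g i x)) (ca Z i (cdif Z (i - 1) (k (i - 1) (h i x))) (k (i + 1 - 1) (h (i + 1) (cdif X i x))))"
      using h(2)[OF x] gx c ka chain_comm'[OF k rmod_homD(1)[OF h(1) x]] by simp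
  qed
qed

lemma homotopic_comp_right:
  assumes Y: "is_complex Y" and a: "chain_map X Y a" and fg: "homotopic_maps Y Z f g"
  shows "homotopic_maps X Z (\<lambda>i x. f i (a i x)) (\<lambda>i x. g i (a i x))"
proof -
  obtain h where h: "\<And>i. h i \<in> rmod_hom (cmodule Y i) (cmodule Z (i - 1))"
    "\<And>i x. x \<in> cc Y i \<Longrightarrow> f i x = ca Z i (g i x) (ca Z i (cdif Z (i - 1) (h i x)) (h (i + 1) (cdif Y i x)))"
    using fg by (auto simp: homotopic_maps_def)
  show ?thesis
  proof (rule homotopicI)
    show "(\<lambda>x. h i (a i x)) \<in> rmod_hom (cmodule X i) (cmodule Z (i - 1))" for i
      by (rule rmod_hom_comp[OF chain_hom[OF a] h(1)])
  qed (simp add: h(2) rmod_homD(1)[OF chain_hom[OF a]] chain_comm[OF a])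
qed

lemma homotopic_add:
  assumes X: "is_complex X" and Y: "is_complex Y" and c: "chain_map X Y g" "chain_map X Y g'"
    and fg: "homotopic_maps X Y f g" and fg': "homotopic_maps X Y f' g'"
  shows "homotopic_maps X Y (\<lambda>i x. ca Y i (f i x) (f' i x)) (\<lambda>i x. ca Y i (g i x) (g' i x))"
proof -
  obtain h where h: "\<And>i. h i \<in> rmod_hom (cmodule X i) (cmodule Y (i - 1))"
    "\<And>i x. x \<in> cc X i \<Longrightarrow> f i x = ca Y i (g i x) (ca Y i (cdif Y (i - 1) (h i x)) (h (i + 1) (cdif X i x)))"
    using fg by (auto simp: homotopic_maps_def)
  obtain h' where h': "\<And>i. h' i \<in> rmod_hom (cmodule X i) (cmodule Y (i - 1))"
    "\<And>i x. x \<in> cc X i \<Longrightarrow> f' i x = ca Y i (g' i x) (ca Y i (cdif Y (i - 1) (h' i x)) (h' (i + 1) (cdif X i x)))"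
    using fg' by (auto simp: homotopic_maps_def)
  show ?thesis
  proof (rule homotopicI)
    show "(\<lambda>x. ca Y (i - 1) (h i x) (h' i x)) \<in> rmod_hom (cmodule X i) (cmodule Y (i - 1))" for i
      by (rule rmod_hom_add[OF cmod[OF Y] h(1) h'(1)])
    fix i x assume x: "x \<in> cc X i"
    interpret right_module "cmodule Y i" by (rule cmod[OF Y])
    note cl = htpy_closed[OF X h(1) Y x] htpy_closed[OF X h'(1) Y x]
    have "g i x \<in> cc Y i" "g' i x \<in> cc Y i" using rmod_homD(1)[OF chain_hom x] c by auto
    moreover have "cdif Y (i - 1) (ca Y (i - 1) (h i x) (h' i x)) = ca Y i (cdif Y (i - 1) (h i x)) (cdif Y (i - 1) (h' i x))"
      by (rule rmod_homD(2)[OF cdif_hom'[OF Y] rmod_homD(1)[OF h(1) x] rmod_homD(1)[OF h'(1) x]])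
    ultimately show "ca Y i (f i x) (f' i x) = ca Y i (ca Y i (g i x) (g' i x)) (ca Y i (cdif Y (i - 1) (ca Y (i - 1) (h i x) (h' i x)))
        (ca Y (i + 1 - 1) (h (i + 1) (cdif X i x)) (h' (i + 1) (cdif X i x))))"
      using h(2)[OF x] h'(2)[OF x] cl by (simp add: a_ac)
  qed
qed

lemma homotopic_central:
  assumes X: "is_complex X" and Y: "is_complex Y" and g: "chain_map X Y g" and z: "z \<in> alg_center" and fg: "homotopic_maps X Y f g"
  shows "homotopic_maps X Y (\<lambda>i x. z \<odot>\<^bsub>cmodule Y i\<^esub> f i x) (\<lambda>i x. z \<odot>\<^bsub>cmodule Y i\<^esub> g i x)"
  using homotopic_comp_left[OF X Y g chain_map_central[OF Y z chain_map_id] fg] by simp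

subsection \<open>Quasi-isomorphisms\<close>

definition coh :: "('a, 'm) cplx \<Rightarrow> int \<Rightarrow> 'm \<Rightarrow> 'm \<Rightarrow> bool" where
  "coh X i x y \<longleftrightarrow> x \<in> cc X i \<and> y \<in> cc X i \<and> (\<exists>w\<in>cc X (i - 1). x = ca X i y (cdif X (i - 1) w))"

lemma coh_refl: "is_complex X \<Longrightarrow> x \<in> cc X i \<Longrightarrow> coh X i x x"
proof -
  assume X: "is_complex X" and x: "x \<in> cc X i"
  interpret right_module "cmodule X i" by (rule cmod[OF X])
  interpret P: right_module "cmodule X (i - 1)" by (rule cmod[OF X])
  show ?thesis using x rmod_hom_zero[OF cmod[OF X] cmod[OF X] cdif_hom'[OF X], of i]
    by (auto simp: coh_def intro!: bexI[of _ "cz X (i - 1)"])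
qed

lemma coh_sym: "is_complex X \<Longrightarrow> coh X i x y \<Longrightarrow> coh X i y x"
proof -
  assume X: "is_complex X" and c: "coh X i x y"
  interpret right_module "cmodule X i" by (rule cmod[OF X])
  interpret P: right_module "cmodule X (i - 1)" by (rule cmod[OF X])
  obtain w where w: "x \<in> cc X i" "y \<in> cc X i" "w \<in> cc X (i - 1)" "x = ca X i y (cdif X (i - 1) w)"
    using c by (auto simp: coh_def)
  have d: "cdif X (i - 1) w \<in> cc X i" "cdif X (i - 1) (cn X (i - 1) w) = cn X i (cdif X (i - 1) w)"
    using rmod_homD(1)[OF cdif_hom'[OF X] w(3)] rmod_hom_neg[OF cmod[OF X] cmod[OF X] cdif_hom'[OF X] w(3)] by auto
  have "y = ca X i x (cdif X (i - 1) (cn X (i - 1) w))" using w d by (simp add: a_assoc r_neg)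
  then show ?thesis using w unfolding coh_def by (metis P.a_inv_closed)
qed

lemma coh_trans: "is_complex X \<Longrightarrow> coh X i x y \<Longrightarrow> coh X i y z \<Longrightarrow> coh X i x z"
proof -
  assume X: "is_complex X" and c: "coh X i x y" "coh X i y z"
  interpret right_module "cmodule X i" by (rule cmod[OF X])
  interpret P: right_module "cmodule X (i - 1)" by (rule cmod[OF X])
  obtain w v where w: "x \<in> cc X i" "y \<in> cc X i" "z \<in> cc X i" "w \<in> cc X (i - 1)" "v \<in> cc X (i - 1)"
      "x = ca X i y (cdif X (i - 1) w)" "y = ca X i z (cdif X (i - 1) v)"
    using c by (auto simp: coh_def)
  note d = rmod_homD(1)[OF cdif_hom'[OF X]] rmod_homD(2)[OF cdif_hom'[OF X]]
  have "x = ca X i z (cdif X (i - 1) (ca X (i - 1) v w))" using w d by (simp add: a_assoc)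
  then show ?thesis using w unfolding coh_def by (metis P.a_closed)
qed

lemma cocycles_iff: "x \<in> cocycles X i \<longleftrightarrow> x \<in> cc X i \<and> cdif X i x = cz X (i + 1)"
  by (simp add: cocycles_def)

lemma coh_map:
  assumes X: "is_complex X" and f: "chain_map X Y f" and c: "coh X i x y"
  shows "coh Y i (f i x) (f i y)"
proof -
  obtain w where w: "x \<in> cc X i" "y \<in> cc X i" "w \<in> cc X (i - 1)" "x = ca X i y (cdif X (i - 1) w)"
    using c by (auto simp: coh_def)
  have "f i x = ca Y i (f i y) (cdif Y (i - 1) (f (i - 1) w))"
    using w rmod_homD(2)[OF chain_hom[OF f] w(2) rmod_homD(1)[OF cdif_hom'[OF X] w(3)]] chain_comm'[OF f w(3)] by simp
  then show ?thesis unfolding coh_def using rmod_homD(1)[OF chain_hom[OF f]] w(1-3) by blast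
qed

lemma cocycles_map:
  assumes X: "is_complex X" "is_complex Y" and f: "chain_map X Y f" and x: "x \<in> cocycles X i"
  shows "f i x \<in> cocycles Y i"
  using x chain_comm[OF f, of x i, symmetric] rmod_homD(1)[OF chain_hom[OF f]]
    rmod_hom_zero[OF cmod[OF X(1)] cmod[OF X(2)] chain_hom[OF f], of "i + 1"]
  by (simp add: cocycles_iff)

lemma coh_homotopic:
  assumes X: "is_complex X" and Y: "is_complex Y" and f: "chain_map X Y f" and g: "chain_map X Y g" and h: "homotopic_maps X Y f g"
    and x: "x \<in> cocycles X i"
  shows "coh Y i (f i x) (g i x)"
proof -
  obtain h where h: "\<And>i. h i \<in> rmod_hom (cmodule X i) (cmodule Y (i - 1))"
    "\<And>i x. x \<in> cc X i \<Longrightarrow> f i x = ca Y i (g i x) (ca Y i (cdif Y (i - 1) (h i x)) (h (i + 1) (cdif X i x)))"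
    using h by (auto simp: homotopic_maps_def)
  interpret right_module "cmodule Y i" by (rule cmod[OF Y])
  have x: "x \<in> cc X i" "cdif X i x = cz X (i + 1)" using x by (auto simp: cocycles_iff)
  have "h (i + 1) (cz X (i + 1)) = cz Y i" using rmod_hom_zero[OF cmod[OF X] cmod[OF Y] h(1)[of "i + 1"]] by simp
  then have "f i x = ca Y i (g i x) (cdif Y (i - 1) (h i x))"
    using h(2)[OF x(1)] x htpy_closed[OF X h(1) Y x(1)] by simp
  then show ?thesis using x rmod_homD(1)[OF chain_hom[OF f] x(1)] rmod_homD(1)[OF chain_hom[OF g] x(1)] rmod_homD(1)[OF h(1) x(1)]
    by (auto simp: coh_def)
qed

text \<open>Injectivity and surjectivity on cohomology, expressed with cocycles instead of
  cosets.\<close>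

definition QI :: "('a::{ring,monoid_mult}, 'm) cplx \<Rightarrow> ('a, 'm) cplx \<Rightarrow> (int \<Rightarrow> 'm \<Rightarrow> 'm) \<Rightarrow> bool" where
  "QI X Y f \<longleftrightarrow> chain_map X Y f \<and>
     (\<forall>i. \<forall>x\<in>cocycles X i. \<forall>y\<in>cocycles X i. coh Y i (f i x) (f i y) \<longrightarrow> coh X i x y) \<and>
     (\<forall>i. \<forall>y\<in>cocycles Y i. \<exists>x\<in>cocycles X i. coh Y i (f i x) y)"

lemma cohomology_class_eq: "cohomology_class X i x = {ca X i (cdif X (i - 1) w) x | w. w \<in> cc X (i - 1)}"
  by (auto simp: cohomology_class_def coboundaries_def a_r_coset_defs)

lemma cohomology_class_mem:
  assumes X: "is_complex X" and x: "x \<in> cc X i"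
  shows "y \<in> cohomology_class X i x \<longleftrightarrow> coh X i y x"
proof -
  interpret right_module "cmodule X i" by (rule cmod[OF X])
  have "cdif X (i - 1) w \<in> cc X i" if "w \<in> cc X (i - 1)" for w by (rule rmod_homD(1)[OF cdif_hom'[OF X] that])
  then show ?thesis using x unfolding cohomology_class_eq coh_def mem_Collect_eq by (metis a_closed a_comm)
qed

lemma cohomology_class_eq_iff:
  assumes X: "is_complex X" and x: "x \<in> cc X i" and y: "y \<in> cc X i"
  shows "cohomology_class X i x = cohomology_class X i y \<longleftrightarrow> coh X i x y"
proof
  assume "cohomology_class X i x = cohomology_class X i y"
  moreover have "x \<in> cohomology_class X i x" using cohomology_class_mem[OF X x] coh_refl[OF X x] by simp
  ultimately show "coh X i x y" using cohomology_class_mem[OF X y] by simp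
next
  assume c: "coh X i x y"
  show "cohomology_class X i x = cohomology_class X i y"
    using cohomology_class_mem[OF X x] cohomology_class_mem[OF X y] c coh_trans[OF X] coh_sym[OF X] by blast
qed

lemma quasi_iso_iff_QI:
  assumes X: "is_complex X" and Y: "is_complex Y"
  shows "quasi_iso X Y f \<longleftrightarrow> QI X Y f"
proof (cases "chain_map X Y f")
  case f: True
  define \<Phi> where "\<Phi> i C = (\<Union>x\<in>C. cohomology_class Y i (f i x))" for i C
  have cc: "x \<in> cc X i" if "x \<in> cocycles X i" for x i using that by (simp add: cocycles_iff)
  have fc: "f i x \<in> cc Y i" if "x \<in> cc X i" for i x by (rule rmod_homD(1)[OF chain_hom[OF f] that])
  have cY: "y \<in> cc Y i" if "y \<in> cocycles Y i" for y i using that by (simp add: cocycles_iff)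
  have \<Phi>: "\<Phi> i (cohomology_class X i x) = cohomology_class Y i (f i x)" if x: "x \<in> cocycles X i" for i x
  proof -
    have "cohomology_class Y i (f i y) = cohomology_class Y i (f i x)" if y: "y \<in> cohomology_class X i x" for y
    proof -
      have c: "coh X i y x" using cohomology_class_mem[OF X cc[OF x]] y by blast
      then have "y \<in> cc X i" by (simp add: coh_def)
      then show ?thesis using cohomology_class_eq_iff[OF Y fc fc] coh_map[OF X f c] cc[OF x] by blast
    qed
    moreover have "x \<in> cohomology_class X i x" using cohomology_class_mem[OF X cc[OF x]] coh_refl[OF X cc[OF x]] by simp
    ultimately show ?thesis unfolding \<Phi>_def by blast
  qed
  have inj: "inj_on (\<Phi> i) (cohomology X i) \<longleftrightarrow> (\<forall>x\<in>cocycles X i. \<forall>y\<in>cocycles X i. coh Y i (f i x) (f i y) \<longrightarrow> coh X i x y)" for i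
  proof
    assume j: "inj_on (\<Phi> i) (cohomology X i)"
    show "\<forall>x\<in>cocycles X i. \<forall>y\<in>cocycles X i. coh Y i (f i x) (f i y) \<longrightarrow> coh X i x y"
    proof (intro ballI impI)
      fix x y assume x: "x \<in> cocycles X i" and y: "y \<in> cocycles X i" and "coh Y i (f i x) (f i y)"
      then have "\<Phi> i (cohomology_class X i x) = \<Phi> i (cohomology_class X i y)"
        using cohomology_class_eq_iff[OF Y fc[OF cc[OF x]] fc[OF cc[OF y]]] \<Phi> by simp
      then have "cohomology_class X i x = cohomology_class X i y"
        by (rule inj_onD[OF j]) (use x y in \<open>auto simp: cohomology_def\<close>)
      then show "coh X i x y" using cohomology_class_eq_iff[OF X cc[OF x] cc[OF y]] by simp
    qed
  next
    assume a: "\<forall>x\<in>cocycles X i. \<forall>y\<in>cocycles X i. coh Y i (f i x) (f i y) \<longrightarrow> coh X i x y"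
    show "inj_on (\<Phi> i) (cohomology X i)"
    proof (rule inj_onI)
      fix C D assume "C \<in> cohomology X i" "D \<in> cohomology X i" and e: "\<Phi> i C = \<Phi> i D"
      then obtain x y where xy: "x \<in> cocycles X i" "y \<in> cocycles X i" "C = cohomology_class X i x" "D = cohomology_class X i y"
        by (auto simp: cohomology_def)
      then have "cohomology_class Y i (f i x) = cohomology_class Y i (f i y)"
        using e \<Phi>[OF xy(1)] \<Phi>[OF xy(2)] by simp
      then have "coh Y i (f i x) (f i y)"
        using cohomology_class_eq_iff[OF Y fc[OF cc[OF xy(1)]] fc[OF cc[OF xy(2)]]] by blast
      then have "coh X i x y" using a xy(1,2) by blast
      then show "C = D" using xy(3,4) cohomology_class_eq_iff[OF X cc[OF xy(1)] cc[OF xy(2)]] by blast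
    qed
  qed
  have im: "\<Phi> i ` cohomology X i = (\<lambda>x. cohomology_class Y i (f i x)) ` cocycles X i" for i
    unfolding cohomology_def image_image using \<Phi> by (intro image_cong) auto
  have surj: "\<Phi> i ` cohomology X i = cohomology Y i \<longleftrightarrow> (\<forall>y\<in>cocycles Y i. \<exists>x\<in>cocycles X i. coh Y i (f i x) y)" for i
  proof
    assume e: "\<Phi> i ` cohomology X i = cohomology Y i"
    show "\<forall>y\<in>cocycles Y i. \<exists>x\<in>cocycles X i. coh Y i (f i x) y"
    proof
      fix y assume y: "y \<in> cocycles Y i"
      then have "cohomology_class Y i y \<in> (\<lambda>x. cohomology_class Y i (f i x)) ` cocycles X i"
        by (subst im[symmetric], subst e) (simp add: cohomology_def)
      then obtain x where "x \<in> cocycles X i" "cohomology_class Y i (f i x) = cohomology_class Y i y" by auto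
      then show "\<exists>x\<in>cocycles X i. coh Y i (f i x) y"
        using cohomology_class_eq_iff[OF Y fc cY] cc y by blast
    qed
  next
    assume a: "\<forall>y\<in>cocycles Y i. \<exists>x\<in>cocycles X i. coh Y i (f i x) y"
    show "\<Phi> i ` cohomology X i = cohomology Y i"
    proof (intro equalityI subsetI)
      fix C assume "C \<in> \<Phi> i ` cohomology X i"
      then obtain x where "x \<in> cocycles X i" "C = cohomology_class Y i (f i x)" using im[of i] by auto
      then show "C \<in> cohomology Y i" using cocycles_map[OF X Y f] by (simp add: cohomology_def)
    next
      fix C assume "C \<in> cohomology Y i"
      then obtain y where y: "y \<in> cocycles Y i" "C = cohomology_class Y i y" by (auto simp: cohomology_def)
      then obtain x where x: "x \<in> cocycles X i" "coh Y i (f i x) y" using a by blast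
      then have "C = cohomology_class Y i (f i x)" using cohomology_class_eq_iff[OF Y fc cY] cc y by blast
      then show "C \<in> \<Phi> i ` cohomology X i" using x(1) im[of i] by simp
    qed
  qed
  have e: "(\<lambda>C. \<Union>x\<in>C. cohomology_class Y i (f i x)) = \<Phi> i" for i by (simp add: \<Phi>_def fun_eq_iff)
  show ?thesis unfolding quasi_iso_def QI_def bij_betw_def e inj surj by (simp only: all_conj_distrib)
qed (simp add: quasi_iso_def QI_def)

lemma QI_chain: "QI X Y f \<Longrightarrow> chain_map X Y f"
  by (simp add: QI_def)

lemma QI_id:
  assumes "is_complex X"
  shows "QI X X (\<lambda>i x. x)"
  unfolding QI_def
proof (intro conjI allI ballI impI chain_map_id)
  show "\<exists>x\<in>cocycles X i. coh X i x y" if y: "y \<in> cocycles X i" for i y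
    by (rule bexI[OF coh_refl[OF assms] y]) (use y in \<open>simp add: cocycles_iff\<close>)
qed

lemma QI_comp:
  assumes "is_complex X" "is_complex Y" "is_complex Z" "QI X Y f" "QI Y Z g"
  shows "QI X Z (\<lambda>i x. g i (f i x))"
  unfolding QI_def
proof (intro conjI allI ballI impI)
  note f = QI_chain[OF assms(4)] and g = QI_chain[OF assms(5)]
  show "chain_map X Z (\<lambda>i x. g i (f i x))" by (rule chain_map_comp[OF f g])
  show "coh X i x y" if "x \<in> cocycles X i" "y \<in> cocycles X i" "coh Z i (g i (f i x)) (g i (f i y))" for i x y
    using that assms(4,5) cocycles_map[OF assms(1,2) f] unfolding QI_def by blast
  fix i y assume y: "y \<in> cocycles Z i"
  then obtain v where v: "v \<in> cocycles Y i" "coh Z i (g i v) y" using assms(5) unfolding QI_def by blast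
  then obtain x where x: "x \<in> cocycles X i" "coh Y i (f i x) v" using assms(4) unfolding QI_def by blast
  then show "\<exists>x\<in>cocycles X i. coh Z i (g i (f i x)) y"
    using coh_trans[OF assms(3) coh_map[OF assms(2) g x(2)] v(2)] by blast
qed

lemma QI_homotopic:
  assumes X: "is_complex X" and Y: "is_complex Y" and f: "QI X Y f" and g: "chain_map X Y g" and h: "homotopic_maps X Y f g"
  shows "QI X Y g"
proof -
  note c = coh_homotopic[OF X Y QI_chain[OF f] g h] and s = coh_sym[OF Y] and t = coh_trans[OF Y]
  show ?thesis unfolding QI_def
  proof (intro conjI allI ballI impI g)
    show "coh X i x y" if "x \<in> cocycles X i" "y \<in> cocycles X i" "coh Y i (g i x) (g i y)" for i x y
      using that c t s f unfolding QI_def by meson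
    show "\<exists>x\<in>cocycles X i. coh Y i (g i x) y" if "y \<in> cocycles Y i" for i y
      using that c t s f unfolding QI_def by meson
  qed
qed

lemma QI_cancel_left:
  assumes X: "is_complex X" and Y: "is_complex Y" and f: "chain_map X Y f" and g: "QI Y Z g"
    and gf: "QI X Z (\<lambda>i x. g i (f i x))" and Z: "is_complex Z"
  shows "QI X Y f"
  unfolding QI_def
proof (intro conjI allI ballI impI f)
  show "coh X i x y" if "x \<in> cocycles X i" "y \<in> cocycles X i" "coh Y i (f i x) (f i y)" for i x y
    using that gf coh_map[OF Y QI_chain[OF g]] unfolding QI_def by blast
  fix i y assume y: "y \<in> cocycles Y i"
  then obtain x where x: "x \<in> cocycles X i" "coh Z i (g i (f i x)) (g i y)"
    using gf cocycles_map[OF Y Z QI_chain[OF g]] unfolding QI_def by blast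
  then show "\<exists>x\<in>cocycles X i. coh Y i (f i x) y" using g y cocycles_map[OF X Y f] unfolding QI_def by blast
qed

text \<open>The elementwise form of acyclicity of the mapping cone of \<open>s\<close>: injectivity
  on cohomology in degree \<open>n + 1\<close> gives a preimage of \<open>y\<close>, and
  surjectivity in degree \<open>n\<close> corrects it by a cocycle.\<close>

lemma QI_step:
  assumes W: "is_complex W" and X: "is_complex X" and s: "QI W X s"
    and y: "y \<in> cc W (n + 1)" "cdif W (n + 1) y = cz W (n + 2)" and u: "u \<in> cc X n" "s (n + 1) y = cdif X n u"
  obtains w v where "w \<in> cc W n" "v \<in> cc X (n - 1)" "cdif W n w = y" "s n w = ca X n u (cdif X (n - 1) v)"
proof -
  note sc = QI_chain[OF s]
  interpret W: right_module "cmodule W n" by (rule cmod[OF W])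
  interpret W1: right_module "cmodule W (n + 1)" by (rule cmod[OF W])
  interpret X: right_module "cmodule X n" by (rule cmod[OF X])
  interpret X1: right_module "cmodule X (n + 1)" by (rule cmod[OF X])
  have z: "cz W (n + 1) \<in> cocycles W (n + 1)" and yc: "y \<in> cocycles W (n + 1)"
    using rmod_hom_zero[OF cmod[OF W] cmod[OF W] cdif_hom[OF W], of "n + 1"] y by (simp_all add: cocycles_iff add.assoc)
  have "coh X (n + 1) (s (n + 1) y) (s (n + 1) (cz W (n + 1)))"
    using u rmod_homD(1)[OF cdif_hom[OF X] u(1)] rmod_hom_zero[OF cmod[OF W] cmod[OF X] chain_hom[OF sc], of "n + 1"]
    by (auto simp: coh_def intro!: bexI[of _ u])
  then have "coh W (n + 1) y (cz W (n + 1))" using s yc z unfolding QI_def by blast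
  then obtain w0 where w0: "w0 \<in> cc W n" "y = cdif W n w0"
    using rmod_homD(1)[OF cdif_hom[OF W, of n]] by (auto simp: coh_def)
  have sw0: "s n w0 \<in> cc X n" by (rule rmod_homD(1)[OF chain_hom[OF sc] w0(1)])
  \<comment> \<open>The difference between the prescribed \<open>u\<close> and the image of the
    first preimage is a cocycle; its class is hit by the correcting cocycle.\<close>
  define c where "c = ca X n u (cn X n (s n w0))"
  have dd: "cdif X n (s n w0) = cdif X n u" using chain_comm[OF sc w0(1)] w0 u by simp
  have "cdif X n c = cz X (n + 1)"
    using rmod_homD(2)[OF cdif_hom[OF X] u(1) X.a_inv_closed[OF sw0]] rmod_hom_neg[OF cmod[OF X] cmod[OF X] cdif_hom[OF X] sw0]
      rmod_homD(1)[OF cdif_hom[OF X] u(1)] by (simp add: c_def dd X1.r_neg)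
  then have "c \<in> cocycles X n" using u sw0 by (simp add: cocycles_iff c_def)
  then obtain v where v: "v \<in> cocycles W n" "coh X n (s n v) c" using s unfolding QI_def by blast
  then obtain x' where x': "x' \<in> cc X (n - 1)" "s n v = ca X n c (cdif X (n - 1) x')" by (auto simp: coh_def)
  have vc: "v \<in> cc W n" "cdif W n v = cz W (n + 1)" using v by (auto simp: cocycles_iff)
  have dx: "cdif X (n - 1) x' \<in> cc X n" by (rule rmod_homD(1)[OF cdif_hom'[OF X] x'(1)])
  have "s n (ca W n w0 v) = ca X n (s n w0) (ca X n c (cdif X (n - 1) x'))"
    using rmod_homD(2)[OF chain_hom[OF sc] w0(1) vc(1)] x' by simp
  also have "\<dots> = ca X n u (cdif X (n - 1) x')"
    using u sw0 dx unfolding c_def by (simp add: X.a_ac X.r_neg1 X.r_neg2) (simp add: X.a_assoc[symmetric] X.r_neg X.a_comm)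
  finally have "s n (ca W n w0 v) = \<dots>" .
  moreover have "cdif W n (ca W n w0 v) = y"
    using rmod_homD(2)[OF cdif_hom[OF W] w0(1) vc(1)] vc w0 y by simp
  ultimately show ?thesis using that[of "ca W n w0 v" x'] w0 vc x' by simp
qed

subsection \<open>Shifts\<close>

lemma cmodule_shift [simp]: "cmodule (shift n X) i = cmodule X (i + n)"
  by (simp add: shift_def)

lemma cdif_shift: "x \<in> cc X (i + n) \<Longrightarrow> cdif (shift n X) i x = sgn_pow (cmodule X (i + n + 1)) n (cdif X (i + n) x)"
  by (simp add: shift_def)

lemma shift_index: "i + 1 + n = i + n + (1 :: int)" "i + 2 + n = i + n + (2 :: int)" "i - 1 + n = i + n - (1 :: int)"
  by simp_all

lemma is_complex_shift:
  assumes X: "is_complex X"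
  shows "is_complex (shift n X)"
  unfolding is_complex_def
proof (intro allI conjI ballI)
  fix i
  interpret right_module "cmodule X (i + n + 1)" by (rule cmod[OF X])
  show "right_module (cmodule (shift n X) i)" using cmod[OF X] by simp
  have "(\<lambda>x. sgn_pow (cmodule X (i + n + 1)) n (cdif X (i + n) x)) \<in> rmod_hom (cmodule X (i + n)) (cmodule X (i + n + 1))"
    by (rule rmod_hom_sgn_comp[OF cmod[OF X] cdif_hom[OF X]])
  then have "cdif (shift n X) i \<in> rmod_hom (cmodule X (i + n)) (cmodule X (i + n + 1))"
    using right_module.smult_closed[OF cmod[OF X]] abelian_monoid.a_closed[OF abelian_group.axioms(1)[OF right_module.axioms(1)[OF cmod[OF X]]]]
    by (auto simp: rmod_hom_def cdif_shift)
  moreover have "cdif (shift n X) i \<in> extensional (cc X (i + n))" by (simp add: shift_def)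
  ultimately show "cdif (shift n X) i \<in> rmod_hom (cmodule (shift n X) i) (cmodule (shift n X) (i + 1)) \<inter> extensional (cc (shift n X) i)"
    by (simp add: shift_index)
  fix x assume x: "x \<in> cc (shift n X) i"
  then have x: "x \<in> cc X (i + n)" by simp
  have dx: "cdif X (i + n) x \<in> cc X (i + n + 1)" by (rule rmod_homD(1)[OF cdif_hom[OF X] x])
  interpret Z: right_module "cmodule X (i + n + 2)" by (rule cmod[OF X])
  have ix: "i + 1 + n = i + n + 1" "i + n + 1 + 1 = i + n + 2" by simp_all
  have "cdif (shift n X) (i + 1) (cdif (shift n X) i x) = sgn_pow (cmodule X (i + n + 2)) n (cdif X (i + n + 1) (sgn_pow (cmodule X (i + n + 1)) n (cdif X (i + n) x)))"
    unfolding cdif_shift[OF x] by (rule cdif_shift[of _ X "i + 1" n, unfolded ix]) (rule sgn_closed[OF dx])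
  also have "\<dots> = cz X (i + n + 2)"
    using rmod_hom_sgn[OF cmod[OF X] cmod[OF X] cdif_hom[OF X] dx, of n] cdif_cdif[OF X x] Z.sgn_zero by (simp add: add.assoc)
  finally show "cdif (shift n X) (i + 1) (cdif (shift n X) i x) = cz (shift n X) (i + 2)" by (simp add: shift_index)
qed

lemma shift_shift:
  assumes X: "is_complex X"
  shows "shift m (shift n X) = shift (m + n) X"
proof -
  have "cdif (shift m (shift n X)) i x = cdif (shift (m + n) X) i x" for i x
  proof (cases "x \<in> cc X (i + (m + n))")
    case True
    interpret right_module "cmodule X (i + m + n + 1)" by (rule cmod[OF X])
    have x: "x \<in> cc X (i + m + n)" using True by (simp add: add.assoc)
    have "cdif X (i + m + n) x \<in> cc X (i + m + n + 1)" by (rule rmod_homD(1)[OF cdif_hom[OF X] x])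
    then show ?thesis using x cdif_shift[of x X "i + m" n] sgn_sgn
      by (simp add: shift_def shift_index add.assoc[symmetric])
  next
    case False
    then show ?thesis by (simp add: shift_def add.assoc)
  qed
  then have "cdif (shift m (shift n X)) = cdif (shift (m + n) X)" by (simp add: fun_eq_iff)
  moreover have "cmodule (shift m (shift n X)) = cmodule (shift (m + n) X)" by (simp add: fun_eq_iff add.assoc)
  ultimately show ?thesis by (metis cplx.equality old.unit.exhaust)
qed

lemma shift_0:
  assumes X: "is_complex X"
  shows "shift 0 X = X"
proof -
  have "cdif (shift 0 X) i x = cdif X i x" for i x
    using extensional_arb[OF cdif_ext[OF X]] by (simp add: shift_def sgn_pow_def restrict_def)
  then have "cdif (shift 0 X) = cdif X" by (simp add: fun_eq_iff)
  moreover have "cmodule (shift 0 X) = cmodule X" by (simp add: fun_eq_iff)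
  ultimately show ?thesis by (metis cplx.equality old.unit.exhaust)
qed

lemma chain_map_shift:
  assumes X: "is_complex X" and Y: "is_complex Y" and f: "chain_map X Y f"
  shows "chain_map (shift n X) (shift n Y) (\<lambda>i. f (i + n))"
  unfolding chain_map_def
proof (intro allI conjI ballI)
  fix i
  show "f (i + n) \<in> rmod_hom (cmodule (shift n X) i) (cmodule (shift n Y) i)" using chain_hom[OF f] by simp
  fix x assume "x \<in> cc (shift n X) i"
  then have x: "x \<in> cc X (i + n)" by simp
  have "f (i + n + 1) (sgn_pow (cmodule X (i + n + 1)) n (cdif X (i + n) x)) = sgn_pow (cmodule Y (i + n + 1)) n (f (i + n + 1) (cdif X (i + n) x))"
    by (rule rmod_hom_sgn[OF cmod[OF X] cmod[OF Y] chain_hom[OF f] rmod_homD(1)[OF cdif_hom[OF X] x]])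
  then show "f (i + 1 + n) (cdif (shift n X) i x) = cdif (shift n Y) i (f (i + n) x)"
    using x rmod_homD(1)[OF chain_hom[OF f] x] by (simp add: cdif_shift shift_index chain_comm[OF f])
qed

text \<open>The differential of a shift carries the sign (-1)^n, so the homotopy must be given the
  same sign.\<close>

lemma homotopic_shift:
  assumes X: "is_complex X" and Y: "is_complex Y" and fg: "homotopic_maps X Y f g"
  shows "homotopic_maps (shift n X) (shift n Y) (\<lambda>i. f (i + n)) (\<lambda>i. g (i + n))"
proof -
  obtain h where h: "\<And>i. h i \<in> rmod_hom (cmodule X i) (cmodule Y (i - 1))"
    "\<And>i x. x \<in> cc X i \<Longrightarrow> f i x = ca Y i (g i x) (ca Y i (cdif Y (i - 1) (h i x)) (h (i + 1) (cdif X i x)))"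
    using fg by (auto simp: homotopic_maps_def)
  show ?thesis
  proof (rule homotopicI)
    show "(\<lambda>x. sgn_pow (cmodule Y (i + n - 1)) n (h (i + n) x)) \<in> rmod_hom (cmodule (shift n X) i) (cmodule (shift n Y) (i - 1))" for i
      using rmod_hom_sgn_comp[OF cmod[OF Y] h(1)] by (simp add: shift_index)
    fix i x assume "x \<in> cc (shift n X) i"
    then have x: "x \<in> cc X (i + n)" by simp
    interpret right_module "cmodule Y (i + n)" by (rule cmod[OF Y])
    interpret Z: right_module "cmodule Y (i + n - 1)" by (rule cmod[OF Y])
    note hx = rmod_homD(1)[OF h(1) x]
    note c = htpy_closed[OF X h(1) Y x]
    have "cdif (shift n Y) (i - 1) (sgn_pow (cmodule Y (i + n - 1)) n (h (i + n) x))
        = sgn_pow (cmodule Y (i + n)) n (cdif Y (i + n - 1) (sgn_pow (cmodule Y (i + n - 1)) n (h (i + n) x)))"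
      using cdif_shift[of "sgn_pow (cmodule Y (i + n - 1)) n (h (i + n) x)" Y "i - 1" n] hx by (simp add: shift_index)
    also have "\<dots> = cdif Y (i + n - 1) (h (i + n) x)"
      using rmod_hom_sgn[OF cmod[OF Y] cmod[OF Y] cdif_hom'[OF Y] hx] c sgn_twice by simp
    finally have 1: "cdif (shift n Y) (i - 1) (sgn_pow (cmodule Y (i + n - 1)) n (h (i + n) x)) = \<dots>" .
    have dx: "cdif X (i + n) x \<in> cc X (i + n + 1)" by (rule rmod_homD(1)[OF cdif_hom[OF X] x])
    have "h (i + n + 1) (sgn_pow (cmodule X (i + n + 1)) n (cdif X (i + n) x)) = sgn_pow (cmodule Y (i + n)) n (h (i + n + 1) (cdif X (i + n) x))"
      using rmod_hom_sgn[OF cmod[OF X] cmod[OF Y] h(1)[of "i + n + 1"] dx] by simp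
    then have 2: "sgn_pow (cmodule Y (i + 1 + n - 1)) n (h (i + 1 + n) (cdif (shift n X) i x)) = h (i + n + 1) (cdif X (i + n) x)"
      using x c sgn_twice by (simp add: cdif_shift shift_index)
    show "f (i + n) x = ca (shift n Y) i (g (i + n) x) (ca (shift n Y) i (cdif (shift n Y) (i - 1) (sgn_pow (cmodule Y (i + n - 1)) n (h (i + n) x)))
        (sgn_pow (cmodule Y (i + 1 + n - 1)) n (h (i + 1 + n) (cdif (shift n X) i x))))"
      unfolding 1 2 using h(2)[OF x] by simp
  qed
qed

lemma cocycles_shift:
  assumes X: "is_complex X"
  shows "cocycles (shift n X) i = cocycles X (i + n)"
proof -
  interpret right_module "cmodule X (i + n + 1)" by (rule cmod[OF X])
  have "sgn_pow (cmodule X (i + n + 1)) n y = cz X (i + n + 1) \<longleftrightarrow> y = cz X (i + n + 1)" if "y \<in> cc X (i + n + 1)" for y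
    using that sgn_twice[of y n] by (metis sgn_zero)
  then show ?thesis using rmod_homD(1)[OF cdif_hom[OF X, of "i + n"]]
    by (auto simp: cocycles_iff cdif_shift shift_index)
qed

lemma coh_shift:
  assumes X: "is_complex X"
  shows "coh (shift n X) i x y \<longleftrightarrow> coh X (i + n) x y"
proof -
  interpret right_module "cmodule X (i + n - 1)" by (rule cmod[OF X])
  have c: "sgn_pow (cmodule X (i + n - 1)) n w \<in> cc X (i + n - 1)" if "w \<in> cc X (i + n - 1)" for w using that by simp
  have d: "cdif (shift n X) (i - 1) w = cdif X (i + n - 1) (sgn_pow (cmodule X (i + n - 1)) n w)" if "w \<in> cc X (i + n - 1)" for w
    using cdif_shift[of w X "i - 1" n] that rmod_hom_sgn[OF cmod[OF X] cmod[OF X] cdif_hom'[OF X] that] by (simp add: shift_index)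
  show ?thesis unfolding coh_def cmodule_shift shift_index using c d sgn_twice by metis
qed

lemma QI_shift:
  assumes X: "is_complex X" and Y: "is_complex Y" and f: "QI X Y f"
  shows "QI (shift n X) (shift n Y) (\<lambda>i. f (i + n))"
  using f chain_map_shift[OF X Y QI_chain[OF f]]
  unfolding QI_def cocycles_shift[OF X] cocycles_shift[OF Y] coh_shift[OF X] coh_shift[OF Y] by simp

subsection \<open>Dual bases and lifting\<close>

text \<open>The data of the dual basis lemma: finitely many generators with coordinate homomorphisms
  to the algebra, regarded as a right module over itself. Coordinates are not unique, as the module
  is projective and not necessarily free.\<close>

definition dbasis :: "('a::{ring,monoid_mult}, 'm) module \<Rightarrow> nat \<Rightarrow> (nat \<Rightarrow> 'm) \<Rightarrow> (nat \<Rightarrow> 'm \<Rightarrow> 'a) \<Rightarrow> bool" where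
  "dbasis P n b c \<longleftrightarrow> (\<forall>j<n. b j \<in> carrier P) \<and>
     (\<forall>j<n. \<forall>x\<in>carrier P. \<forall>y\<in>carrier P. c j (x \<oplus>\<^bsub>P\<^esub> y) = c j x + c j y) \<and>
     (\<forall>j<n. \<forall>a. \<forall>x\<in>carrier P. c j (a \<odot>\<^bsub>P\<^esub> x) = c j x * a) \<and>
     (\<forall>x\<in>carrier P. x = (\<Oplus>\<^bsub>P\<^esub>j\<in>{..<n}. c j x \<odot>\<^bsub>P\<^esub> b j))"

lemma dbasisD:
  assumes "dbasis P n b c"
  shows "j < n \<Longrightarrow> b j \<in> carrier P"
    "\<lbrakk>j < n; x \<in> carrier P; y \<in> carrier P\<rbrakk> \<Longrightarrow> c j (x \<oplus>\<^bsub>P\<^esub> y) = c j x + c j y"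
    "\<lbrakk>j < n; x \<in> carrier P\<rbrakk> \<Longrightarrow> c j (a \<odot>\<^bsub>P\<^esub> x) = c j x * a"
    "x \<in> carrier P \<Longrightarrow> x = (\<Oplus>\<^bsub>P\<^esub>j\<in>{..<n}. c j x \<odot>\<^bsub>P\<^esub> b j)"
  using assms unfolding dbasis_def by blast+

lemma dbasis_hom:
  assumes P: "right_module P" and N: "right_module N" and b: "dbasis P n b c" and y: "\<And>j. j < n \<Longrightarrow> y j \<in> carrier N"
  shows "(\<lambda>x. \<Oplus>\<^bsub>N\<^esub>j\<in>{..<n}. c j x \<odot>\<^bsub>N\<^esub> y j) \<in> rmod_hom P N"
proof -
  interpret N: right_module N by (rule N)
  have cl: "(\<lambda>j. a j \<odot>\<^bsub>N\<^esub> y j) \<in> {..<n} \<rightarrow> carrier N" for a using y by (auto intro: N.smult_closed)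
  show ?thesis
  proof (rule rmod_homI)
    show "(\<Oplus>\<^bsub>N\<^esub>j\<in>{..<n}. c j (x \<oplus>\<^bsub>P\<^esub> x') \<odot>\<^bsub>N\<^esub> y j)
        = (\<Oplus>\<^bsub>N\<^esub>j\<in>{..<n}. c j x \<odot>\<^bsub>N\<^esub> y j) \<oplus>\<^bsub>N\<^esub> (\<Oplus>\<^bsub>N\<^esub>j\<in>{..<n}. c j x' \<odot>\<^bsub>N\<^esub> y j)"
      if "x \<in> carrier P" "x' \<in> carrier P" for x x'
    proof -
      have "(\<Oplus>\<^bsub>N\<^esub>j\<in>{..<n}. c j (x \<oplus>\<^bsub>P\<^esub> x') \<odot>\<^bsub>N\<^esub> y j) = (\<Oplus>\<^bsub>N\<^esub>j\<in>{..<n}. c j x \<odot>\<^bsub>N\<^esub> y j \<oplus>\<^bsub>N\<^esub> c j x' \<odot>\<^bsub>N\<^esub> y j)"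
        by (rule N.finsum_cong') (use that y dbasisD(2)[OF b] N.smult_l_distr N.smult_closed in auto)
      then show ?thesis using N.finsum_addf[OF cl cl] by simp
    qed
    show "(\<Oplus>\<^bsub>N\<^esub>j\<in>{..<n}. c j (a \<odot>\<^bsub>P\<^esub> x) \<odot>\<^bsub>N\<^esub> y j) = a \<odot>\<^bsub>N\<^esub> (\<Oplus>\<^bsub>N\<^esub>j\<in>{..<n}. c j x \<odot>\<^bsub>N\<^esub> y j)"
      if x: "x \<in> carrier P" for a x
    proof -
      have "(\<Oplus>\<^bsub>N\<^esub>j\<in>{..<n}. c j (a \<odot>\<^bsub>P\<^esub> x) \<odot>\<^bsub>N\<^esub> y j) = (\<Oplus>\<^bsub>N\<^esub>j\<in>{..<n}. a \<odot>\<^bsub>N\<^esub> (c j x \<odot>\<^bsub>N\<^esub> y j))"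
        by (rule N.finsum_cong') (use x y dbasisD(3)[OF b] N.smult_mult N.smult_closed in auto)
      then show ?thesis using N.smult_finsum[of "{..<n}" "\<lambda>j. c j x \<odot>\<^bsub>N\<^esub> y j"] y N.smult_closed by simp
    qed
  qed (rule N.finsum_closed[OF cl])
qed

lemma dbasis_expand:
  assumes P: "right_module P" and N: "right_module N" and b: "dbasis P n b c" and f: "f \<in> rmod_hom P N" and x: "x \<in> carrier P"
  shows "f x = (\<Oplus>\<^bsub>N\<^esub>j\<in>{..<n}. c j x \<odot>\<^bsub>N\<^esub> f (b j))"
proof -
  interpret P: right_module P by (rule P)
  interpret N: right_module N by (rule N)
  have "f x = f (\<Oplus>\<^bsub>P\<^esub>j\<in>{..<n}. c j x \<odot>\<^bsub>P\<^esub> b j)" using dbasisD(4)[OF b x] by simp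
  also have "\<dots> = (\<Oplus>\<^bsub>N\<^esub>j\<in>{..<n}. f (c j x \<odot>\<^bsub>P\<^esub> b j))"
    by (rule rmod_hom_finsum[OF P N f]) (auto intro: P.smult_closed dbasisD(1)[OF b])
  also have "\<dots> = (\<Oplus>\<^bsub>N\<^esub>j\<in>{..<n}. c j x \<odot>\<^bsub>N\<^esub> f (b j))"
    by (rule N.finsum_cong') (auto intro: N.smult_closed rmod_homD[OF f] dbasisD(1)[OF b])
  finally show ?thesis .
qed

text \<open>Solutions are chosen at the generators and extended by the coordinate functions. The
  equations survive because all maps in them are linear and the values of \<open>\<alpha>\<close>
  and \<open>\<gamma>\<close> are recovered from their values at the generators.\<close>

lemma dbasis_selection:
  assumes P: "right_module P" and N: "right_module N" "right_module N'" "right_module L" "right_module L'" and b: "dbasis P n b c"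
    and \<phi>: "\<phi> \<in> rmod_hom N L" and \<alpha>: "\<alpha> \<in> rmod_hom P L" and \<sigma>: "\<sigma> \<in> rmod_hom N L'" and \<gamma>: "\<gamma> \<in> rmod_hom P L'" and \<delta>: "\<delta> \<in> rmod_hom N' L'"
    and ex: "\<And>x. x \<in> carrier P \<Longrightarrow> \<exists>u\<in>carrier N. \<exists>v\<in>carrier N'. \<phi> u = \<alpha> x \<and> \<sigma> u = \<gamma> x \<oplus>\<^bsub>L'\<^esub> \<delta> v"
  shows "\<exists>u\<in>rmod_hom P N. \<exists>v\<in>rmod_hom P N'. \<forall>x\<in>carrier P. \<phi> (u x) = \<alpha> x \<and> \<sigma> (u x) = \<gamma> x \<oplus>\<^bsub>L'\<^esub> \<delta> (v x)"
proof -
  have "\<exists>u v. j < n \<longrightarrow> u \<in> carrier N \<and> v \<in> carrier N' \<and> \<phi> u = \<alpha> (b j) \<and> \<sigma> u = \<gamma> (b j) \<oplus>\<^bsub>L'\<^esub> \<delta> v" for j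
    using ex[of "b j"] dbasisD(1)[OF b, of j] by blast
  then obtain u v where uv: "\<And>j. j < n \<Longrightarrow> u j \<in> carrier N" "\<And>j. j < n \<Longrightarrow> v j \<in> carrier N'"
      "\<And>j. j < n \<Longrightarrow> \<phi> (u j) = \<alpha> (b j)" "\<And>j. j < n \<Longrightarrow> \<sigma> (u j) = \<gamma> (b j) \<oplus>\<^bsub>L'\<^esub> \<delta> (v j)"
    by metis
  let ?u = "\<lambda>x. \<Oplus>\<^bsub>N\<^esub>j\<in>{..<n}. c j x \<odot>\<^bsub>N\<^esub> u j" let ?v = "\<lambda>x. \<Oplus>\<^bsub>N'\<^esub>j\<in>{..<n}. c j x \<odot>\<^bsub>N'\<^esub> v j"
  interpret N: right_module N by (rule N)
  interpret N': right_module N' by (rule N)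
  interpret L: right_module L by (rule N)
  interpret L': right_module L' by (rule N)
  have uh: "?u \<in> rmod_hom P N" and vh: "?v \<in> rmod_hom P N'" using dbasis_hom[OF P _ b] N uv by blast+
  have push: "f (\<Oplus>\<^bsub>A\<^esub>j\<in>{..<n}. c j x \<odot>\<^bsub>A\<^esub> w j) = (\<Oplus>\<^bsub>C\<^esub>j\<in>{..<n}. c j x \<odot>\<^bsub>C\<^esub> f (w j))"
    if A: "right_module A" "right_module C" "f \<in> rmod_hom A C" "\<And>j. j < n \<Longrightarrow> w j \<in> carrier A" for A C f w x
  proof -
    interpret A: right_module A by (rule A)
    interpret C: right_module C by (rule A)
    have "f (\<Oplus>\<^bsub>A\<^esub>j\<in>{..<n}. c j x \<odot>\<^bsub>A\<^esub> w j) = (\<Oplus>\<^bsub>C\<^esub>j\<in>{..<n}. f (c j x \<odot>\<^bsub>A\<^esub> w j))"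
      by (rule rmod_hom_finsum[OF A(1-3)]) (auto intro: A.smult_closed A(4))
    also have "\<dots> = (\<Oplus>\<^bsub>C\<^esub>j\<in>{..<n}. c j x \<odot>\<^bsub>C\<^esub> f (w j))"
      by (rule C.finsum_cong') (auto intro: C.smult_closed rmod_homD[OF A(3)] A(4))
    finally show ?thesis .
  qed
  have "\<phi> (?u x) = \<alpha> x \<and> \<sigma> (?u x) = \<gamma> x \<oplus>\<^bsub>L'\<^esub> \<delta> (?v x)" if x: "x \<in> carrier P" for x
  proof
    have "\<phi> (?u x) = (\<Oplus>\<^bsub>L\<^esub>j\<in>{..<n}. c j x \<odot>\<^bsub>L\<^esub> \<phi> (u j))" by (rule push[OF N(1,3) \<phi> uv(1)])
    also have "\<dots> = (\<Oplus>\<^bsub>L\<^esub>j\<in>{..<n}. c j x \<odot>\<^bsub>L\<^esub> \<alpha> (b j))"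
      by (rule L.finsum_cong') (auto simp: uv(3) intro: L.smult_closed rmod_homD[OF \<alpha>] dbasisD(1)[OF b])
    also have "\<dots> = \<alpha> x" by (rule dbasis_expand[OF P N(3) b \<alpha> x, symmetric])
    finally show "\<phi> (?u x) = \<alpha> x" .
    have "\<sigma> (?u x) = (\<Oplus>\<^bsub>L'\<^esub>j\<in>{..<n}. c j x \<odot>\<^bsub>L'\<^esub> \<sigma> (u j))" by (rule push[OF N(1,4) \<sigma> uv(1)])
    also have "\<dots> = (\<Oplus>\<^bsub>L'\<^esub>j\<in>{..<n}. c j x \<odot>\<^bsub>L'\<^esub> \<gamma> (b j) \<oplus>\<^bsub>L'\<^esub> c j x \<odot>\<^bsub>L'\<^esub> \<delta> (v j))"
      by (rule L'.finsum_cong')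
        (auto simp: uv L'.smult_r_distr L'.smult_closed rmod_homD[OF \<gamma>] rmod_homD[OF \<delta>] dbasisD(1)[OF b])
    also have "\<dots> = (\<Oplus>\<^bsub>L'\<^esub>j\<in>{..<n}. c j x \<odot>\<^bsub>L'\<^esub> \<gamma> (b j)) \<oplus>\<^bsub>L'\<^esub> (\<Oplus>\<^bsub>L'\<^esub>j\<in>{..<n}. c j x \<odot>\<^bsub>L'\<^esub> \<delta> (v j))"
      by (rule L'.finsum_addf) (auto simp: uv rmod_homD[OF \<gamma>] rmod_homD[OF \<delta>] dbasisD(1)[OF b] intro: L'.smult_closed)
    also have "\<dots> = \<gamma> x \<oplus>\<^bsub>L'\<^esub> \<delta> (?v x)"
      using dbasis_expand[OF P N(4) b \<gamma> x] push[OF N(2,4) \<delta> uv(2)] by simp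
    finally show "\<sigma> (?u x) = \<gamma> x \<oplus>\<^bsub>L'\<^esub> \<delta> (?v x)" .
  qed
  then show ?thesis using uh vh by (intro bexI[of _ ?u] bexI[of _ ?v]) auto
qed

text \<open>Bounded above is enough for lifting; projectivity is expressed by dual bases.\<close>

definition liftable :: "('a::{ring,monoid_mult}, 'm) cplx \<Rightarrow> bool" where
  "liftable P \<longleftrightarrow> is_complex P \<and> (\<forall>i. \<exists>n b c. dbasis (cmodule P i) n b c) \<and> (\<exists>N. \<forall>i>N. cc P i = {cz P i})"

lemma liftable_complex: "liftable P \<Longrightarrow> is_complex P"
  by (simp add: liftable_def)

lemma liftable_shift:
  assumes "liftable P"
  shows "liftable (shift n P)"
proof -
  obtain N where N: "\<forall>i>N. cc P i = {cz P i}" using assms by (auto simp: liftable_def)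
  have "\<forall>i>N - n. cc (shift n P) i = {cz (shift n P) i}" using N by simp
  then show ?thesis using assms is_complex_shift by (auto simp: liftable_def)
qed

text \<open>The maps \<open>u\<close> and \<open>v\<close> are constructed by descending induction on the degree.\<close>

lemma lifting_step:
  assumes P: "is_complex P" "dbasis (cmodule P n) k b c" and W: "is_complex W" and X: "is_complex X" and s: "QI W X s"
    and \<alpha>: "\<And>n. \<alpha> n \<in> rmod_hom (cmodule P n) (cmodule W (n + 1))" and \<gamma>: "\<And>n. \<gamma> n \<in> rmod_hom (cmodule P n) (cmodule X n)"
    and u: "u \<in> rmod_hom (cmodule P (n + 1)) (cmodule W (n + 1))" and v: "v \<in> rmod_hom (cmodule P (n + 1)) (cmodule X n)"
    and y0: "\<And>x. x \<in> cc P n \<Longrightarrow> cdif W (n + 1) (ca W (n + 1) (\<alpha> n x) (u (cdif P n x))) = cz W (n + 2)"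
    and y1: "\<And>x. x \<in> cc P n \<Longrightarrow> s (n + 1) (ca W (n + 1) (\<alpha> n x) (u (cdif P n x))) = cdif X n (ca X n (\<gamma> n x) (v (cdif P n x)))"
  shows "\<exists>u'\<in>rmod_hom (cmodule P n) (cmodule W n). \<exists>v'\<in>rmod_hom (cmodule P n) (cmodule X (n - 1)). \<forall>x\<in>cc P n.
    cdif W n (u' x) = ca W (n + 1) (\<alpha> n x) (u (cdif P n x)) \<and>
    s n (u' x) = ca X n (ca X n (\<gamma> n x) (v (cdif P n x))) (cdif X (n - 1) (v' x))"
proof (rule dbasis_selection[OF cmod[OF P(1)] cmod[OF W] cmod[OF X] cmod[OF W] cmod[OF X] P(2) cdif_hom[OF W] _ chain_hom[OF QI_chain[OF s]] _ cdif_hom'[OF X]])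
  show a: "(\<lambda>x. ca W (n + 1) (\<alpha> n x) (u (cdif P n x))) \<in> rmod_hom (cmodule P n) (cmodule W (n + 1))"
    by (intro rmod_hom_add cmod W \<alpha> rmod_hom_comp[OF cdif_hom[OF P(1)] u])
  show g: "(\<lambda>x. ca X n (\<gamma> n x) (v (cdif P n x))) \<in> rmod_hom (cmodule P n) (cmodule X n)"
    by (intro rmod_hom_add cmod X \<gamma> rmod_hom_comp[OF cdif_hom[OF P(1)] v])
  fix x assume x: "x \<in> cc P n"
  from QI_step[OF W X s rmod_homD(1)[OF a x] y0[OF x] rmod_homD(1)[OF g x] y1[OF x]]
  show "\<exists>u'\<in>cc W n. \<exists>v'\<in>cc X (n - 1). cdif W n u' = ca W (n + 1) (\<alpha> n x) (u (cdif P n x)) \<and>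
    s n u' = ca X n (ca X n (\<gamma> n x) (v (cdif P n x))) (cdif X (n - 1) v')" by blast
qed

text \<open>Up to signs, \<open>\<alpha>\<close> and \<open>\<gamma>\<close> form a map from
  \<open>P\<close> to the acyclic mapping cone of \<open>s\<close>, and \<open>u\<close> and
  \<open>v\<close> contract it. Hypotheses \<open>A\<close> and \<open>C\<close> keep the problem
  solvable from one degree to the next. With \<open>\<alpha>\<close> zero this lifts a map along
  \<open>s\<close>; with \<open>\<alpha>\<close> a difference of two lifts it yields a homotopy
  between them.\<close>

lemma lifting:
  assumes P: "liftable P" and W: "is_complex W" and X: "is_complex X" and s: "QI W X s"
    and \<alpha>: "\<And>n. \<alpha> n \<in> rmod_hom (cmodule P n) (cmodule W (n + 1))" and \<gamma>: "\<And>n. \<gamma> n \<in> rmod_hom (cmodule P n) (cmodule X n)"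
    and A: "\<And>n x. x \<in> cc P n \<Longrightarrow> ca W (n + 2) (cdif W (n + 1) (\<alpha> n x)) (\<alpha> (n + 1) (cdif P n x)) = cz W (n + 2)"
    and C: "\<And>n x. x \<in> cc P n \<Longrightarrow> ca X (n + 1) (s (n + 1) (\<alpha> n x)) (\<gamma> (n + 1) (cdif P n x)) = cdif X n (\<gamma> n x)"
  shows "\<exists>u v. (\<forall>n. u n \<in> rmod_hom (cmodule P n) (cmodule W n)) \<and> (\<forall>n. v n \<in> rmod_hom (cmodule P n) (cmodule X (n - 1))) \<and>
    (\<forall>n. \<forall>x\<in>cc P n. cdif W n (u n x) = ca W (n + 1) (\<alpha> n x) (u (n + 1) (cdif P n x)) \<and>
      s n (u n x) = ca X n (ca X n (\<gamma> n x) (v (n + 1) (cdif P n x))) (cdif X (n - 1) (v n x)))"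
proof -
  note Pc = liftable_complex[OF P] and sc = QI_chain[OF s]
  obtain N where N: "\<And>i. i > N \<Longrightarrow> cc P i = {cz P i}" using P by (auto simp: liftable_def)
  \<comment> \<open>\<open>valid n\<close> is imposed on maps in degree \<open>n + 1\<close> and
    says exactly that \<open>lifting_step\<close> applies in degree \<open>n\<close>;
    \<open>step n\<close> says that the second pair solves the equations there.\<close>
  define valid where "valid n w \<longleftrightarrow> fst w \<in> rmod_hom (cmodule P (n + 1)) (cmodule W (n + 1)) \<and> snd w \<in> rmod_hom (cmodule P (n + 1)) (cmodule X n) \<and>
    (\<forall>x\<in>cc P n. cdif W (n + 1) (ca W (n + 1) (\<alpha> n x) (fst w (cdif P n x))) = cz W (n + 2) \<and>
      s (n + 1) (ca W (n + 1) (\<alpha> n x) (fst w (cdif P n x))) = cdif X n (ca X n (\<gamma> n x) (snd w (cdif P n x))))" for n and w :: "('b \<Rightarrow> 'b) \<times> ('b \<Rightarrow> 'b)"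
  define step where "step n w w' \<longleftrightarrow> (\<forall>x\<in>cc P n.
    cdif W n (fst w' x) = ca W (n + 1) (\<alpha> n x) (fst w (cdif P n x)) \<and>
    s n (fst w' x) = ca X n (ca X n (\<gamma> n x) (snd w (cdif P n x))) (cdif X (n - 1) (snd w' x)))" for n and w w' :: "('b \<Rightarrow> 'b) \<times> ('b \<Rightarrow> 'b)"
  have ex: "\<exists>w'. valid (n - 1) w' \<and> step n w w'" if w: "valid n w" for n w
  proof -
    obtain k b c where kbc: "dbasis (cmodule P n) k b c" using P unfolding liftable_def by blast
    obtain u' v' where uv: "u' \<in> rmod_hom (cmodule P n) (cmodule W n)" "v' \<in> rmod_hom (cmodule P n) (cmodule X (n - 1))"
      "\<And>x. x \<in> cc P n \<Longrightarrow> cdif W n (u' x) = ca W (n + 1) (\<alpha> n x) (fst w (cdif P n x))"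
      "\<And>x. x \<in> cc P n \<Longrightarrow> s n (u' x) = ca X n (ca X n (\<gamma> n x) (snd w (cdif P n x))) (cdif X (n - 1) (v' x))"
      using lifting_step[OF Pc kbc W X s \<alpha> \<gamma>, of "fst w" "snd w"] w by (auto simp: valid_def)
    have "valid (n - 1) (u', v')"
      unfolding valid_def
    proof (intro conjI ballI)
      fix x assume x: "x \<in> cc P (n - 1)"
      interpret W1: right_module "cmodule W (n + 1)" by (rule cmod[OF W])
      interpret X: right_module "cmodule X n" by (rule cmod[OF X])
      interpret P1: right_module "cmodule P (n + 1)" by (rule cmod[OF Pc])
      have dx: "cdif P (n - 1) x \<in> cc P n" "cdif P n (cdif P (n - 1) x) = cz P (n + 1)"
        using rmod_homD(1)[OF cdif_hom'[OF Pc] x] cdif_cdif'[OF Pc x] by auto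
      have fs0: "fst w (cz P (n + 1)) = cz W (n + 1)" "snd w (cz P (n + 1)) = cz X n"
        using w rmod_hom_zero[OF cmod[OF Pc] cmod[OF W]] rmod_hom_zero[OF cmod[OF Pc] cmod[OF X]] by (auto simp: valid_def)
      have ax: "\<alpha> (n - 1) x \<in> cc W n" "\<alpha> n (cdif P (n - 1) x) \<in> cc W (n + 1)" "\<gamma> n (cdif P (n - 1) x) \<in> cc X n" "\<gamma> (n - 1) x \<in> cc X (n - 1)"
        using rmod_homD(1)[OF \<alpha>[of "n - 1"] x] rmod_homD(1)[OF \<alpha> dx(1)] rmod_homD(1)[OF \<gamma> dx(1)] rmod_homD(1)[OF \<gamma> x] by simp_all
      have ux: "u' (cdif P (n - 1) x) \<in> cc W n" "v' (cdif P (n - 1) x) \<in> cc X (n - 1)"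
        using rmod_homD(1)[OF uv(1) dx(1)] rmod_homD(1)[OF uv(2) dx(1)] by auto
      have dv: "cdif X (n - 1) (v' (cdif P (n - 1) x)) \<in> cc X n" by (rule rmod_homD(1)[OF cdif_hom'[OF X] ux(2)])
      have idx: "n - 1 + 1 = n" "n - 1 + 2 = n + 1" by auto
      have "cdif W n (ca W n (\<alpha> (n - 1) x) (u' (cdif P (n - 1) x))) = ca W (n + 1) (cdif W n (\<alpha> (n - 1) x)) (\<alpha> n (cdif P (n - 1) x))"
        using rmod_homD(2)[OF cdif_hom[OF W] ax(1) ux(1)] uv(3)[OF dx(1)] dx fs0 ax by simp
      then show "cdif W (n - 1 + 1) (ca W (n - 1 + 1) (\<alpha> (n - 1) x) (fst (u', v') (cdif P (n - 1) x))) = cz W (n - 1 + 2)"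
        using A[OF x] by (simp add: idx)
      have "s n (ca W n (\<alpha> (n - 1) x) (u' (cdif P (n - 1) x)))
          = ca X n (s n (\<alpha> (n - 1) x)) (ca X n (\<gamma> n (cdif P (n - 1) x)) (cdif X (n - 1) (v' (cdif P (n - 1) x))))"
        using rmod_homD(2)[OF chain_hom[OF sc] ax(1) ux(1)] uv(4)[OF dx(1)] dx fs0 ax by simp
      also have "\<dots> = ca X n (ca X n (s n (\<alpha> (n - 1) x)) (\<gamma> n (cdif P (n - 1) x))) (cdif X (n - 1) (v' (cdif P (n - 1) x)))"
        using rmod_homD(1)[OF chain_hom[OF sc] ax(1)] ax dv by (simp add: X.a_assoc)
      also have "ca X n (s n (\<alpha> (n - 1) x)) (\<gamma> n (cdif P (n - 1) x)) = cdif X (n - 1) (\<gamma> (n - 1) x)"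
        using C[OF x] by (simp add: idx)
      also have "ca X n (cdif X (n - 1) (\<gamma> (n - 1) x)) (cdif X (n - 1) (v' (cdif P (n - 1) x))) = cdif X (n - 1) (ca X (n - 1) (\<gamma> (n - 1) x) (v' (cdif P (n - 1) x)))"
        by (rule rmod_homD(2)[OF cdif_hom'[OF X] ax(4) ux(2), symmetric])
      finally show "s (n - 1 + 1) (ca W (n - 1 + 1) (\<alpha> (n - 1) x) (fst (u', v') (cdif P (n - 1) x)))
          = cdif X (n - 1) (ca X (n - 1) (\<gamma> (n - 1) x) (snd (u', v') (cdif P (n - 1) x)))" by (simp add: idx)
    qed (use uv in simp_all)
    moreover have "step n w (u', v')" using uv by (simp add: step_def)
    ultimately show ?thesis by blast
  qed
  have hom0: "f (cz P n) = \<zero>\<^bsub>M\<^esub>" if "f \<in> rmod_hom (cmodule P n) M" "right_module M" for f M n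
    using rmod_hom_zero[OF cmod[OF Pc] that(2,1)] .
  let ?w0 = "\<lambda>n. (\<lambda>x. cz W (n + 1), \<lambda>x. cz X n)"
  have base: "valid n (?w0 n)" if n: "n > N" for n
    unfolding valid_def
  proof (intro conjI ballI)
    show "fst (?w0 n) \<in> rmod_hom (cmodule P (n + 1)) (cmodule W (n + 1))" using rmod_hom_const_zero[OF cmod[OF W]] by simp
    show "snd (?w0 n) \<in> rmod_hom (cmodule P (n + 1)) (cmodule X n)" using rmod_hom_const_zero[OF cmod[OF X]] by simp
    fix x assume "x \<in> cc P n"
    then have x: "x = cz P n" using N[OF n] by simp
    interpret W1: right_module "cmodule W (n + 1)" by (rule cmod[OF W])
    interpret X: right_module "cmodule X n" by (rule cmod[OF X])
    note z = hom0[OF \<alpha> cmod[OF W], of n] hom0[OF \<gamma> cmod[OF X], of n] hom0[OF cdif_hom[OF Pc] cmod[OF Pc], of n]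
      rmod_hom_zero[OF cmod[OF W] cmod[OF W] cdif_hom[OF W], of "n + 1"] rmod_hom_zero[OF cmod[OF X] cmod[OF X] cdif_hom[OF X], of n]
      rmod_hom_zero[OF cmod[OF W] cmod[OF X] chain_hom[OF sc], of "n + 1"]
    show "cdif W (n + 1) (ca W (n + 1) (\<alpha> n x) (fst (?w0 n) (cdif P n x))) = cz W (n + 2)" using z by (simp add: x add.assoc)
    show "s (n + 1) (ca W (n + 1) (\<alpha> n x) (fst (?w0 n) (cdif P n x))) = cdif X n (ca X n (\<gamma> n x) (snd (?w0 n) (cdif P n x)))"
      using z by (simp add: x)
  qed
  have "\<exists>w. \<forall>k. valid (N + 1 - int k) (w k) \<and> step (N + 1 - int k) (w k) (w (Suc k))"
  proof (rule dependent_nat_choice)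
    show "\<exists>w. valid (N + 1 - int 0) w" using base[of "N + 1"] by auto
    fix w k assume "valid (N + 1 - int k) w"
    then show "\<exists>w'. valid (N + 1 - int (Suc k)) w' \<and> step (N + 1 - int k) w w'"
      using ex[of "N + 1 - int k" w] by (simp add: algebra_simps)
  qed
  then obtain w where w: "\<And>k. valid (N + 1 - int k) (w k)" "\<And>k. step (N + 1 - int k) (w k) (w (Suc k))" by blast
  \<comment> \<open>\<open>w k\<close> consists of maps in degree \<open>N + 2 - k\<close>, hence
    the index \<open>N + 2 - n\<close> for degree \<open>n\<close>. Further up \<open>P\<close>
    vanishes and zero maps do.\<close>
  define z where "z n = (if n > N + 1 then ?w0 (n - 1) else w (nat (N + 2 - n)))" for n
  have "valid (n - 1) (z n)" for n
  proof (cases "n > N + 1")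
    case True
    then show ?thesis using base[of "n - 1"] by (simp add: z_def)
  next
    case False
    then show ?thesis using w(1)[of "nat (N + 2 - n)"] by (simp add: z_def algebra_simps)
  qed
  then have zh: "fst (z n) \<in> rmod_hom (cmodule P n) (cmodule W n)" "snd (z n) \<in> rmod_hom (cmodule P n) (cmodule X (n - 1))" for n
    by (simp_all add: valid_def)
  have "step n (z (n + 1)) (z n)" for n
  proof (cases "n > N")
    case True
    show ?thesis unfolding step_def
    proof (intro ballI)
      fix x assume "x \<in> cc P n"
      then have x: "x = cz P n" using N[OF True] by simp
      interpret W1: right_module "cmodule W (n + 1)" by (rule cmod[OF W])
      interpret X: right_module "cmodule X n" by (rule cmod[OF X])
      have v1: "snd (z (n + 1)) (cz P (n + 1)) = cz X n"
        using hom0[OF zh(2)[of "n + 1"] cmod[OF X]] by simp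
      show "cdif W n (fst (z n) x) = ca W (n + 1) (\<alpha> n x) (fst (z (n + 1)) (cdif P n x)) \<and>
          s n (fst (z n) x) = ca X n (ca X n (\<gamma> n x) (snd (z (n + 1)) (cdif P n x))) (cdif X (n - 1) (snd (z n) x))"
        using hom0[OF \<alpha> cmod[OF W], of n] hom0[OF \<gamma> cmod[OF X], of n] hom0[OF cdif_hom[OF Pc] cmod[OF Pc], of n]
          hom0[OF zh(1) cmod[OF W], of n] hom0[OF zh(1) cmod[OF W], of "n + 1"] hom0[OF zh(2) cmod[OF X], of n] v1
          rmod_hom_zero[OF cmod[OF W] cmod[OF W] cdif_hom[OF W], of n] rmod_hom_zero[OF cmod[OF X] cmod[OF X] cdif_hom'[OF X], of n]
          rmod_hom_zero[OF cmod[OF W] cmod[OF X] chain_hom[OF sc], of n] by (simp add: x)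
    qed
  next
    case False
    then have k: "N + 1 - int (nat (N + 1 - n)) = n" "nat (N + 2 - n) = Suc (nat (N + 1 - n))" "nat (N + 2 - (n + 1)) = nat (N + 1 - n)"
      by auto
    then show ?thesis using w(2)[of "nat (N + 1 - n)"] False by (simp add: z_def)
  qed
  then show ?thesis using zh unfolding step_def
    by (intro exI[of _ "\<lambda>n. fst (z n)"] exI[of _ "\<lambda>n. snd (z n)"]) simp
qed

lemma lift_map:
  assumes P: "liftable P" and W: "is_complex W" and X: "is_complex X" and s: "QI W X s" and f: "chain_map P X f"
  obtains w where "chain_map P W w" "homotopic_maps P X (\<lambda>i x. s i (w i x)) f"
proof -
  note Pc = liftable_complex[OF P]
  have z: "rmod_hom (cmodule P n) (cmodule W (n + 1)) \<noteq> {}" for n using rmod_hom_const_zero[OF cmod[OF W]] by blast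
  have "\<exists>u v. (\<forall>n. u n \<in> rmod_hom (cmodule P n) (cmodule W n)) \<and> (\<forall>n. v n \<in> rmod_hom (cmodule P n) (cmodule X (n - 1))) \<and>
    (\<forall>n. \<forall>x\<in>cc P n. cdif W n (u n x) = ca W (n + 1) ((\<lambda>n x. cz W (n + 1)) n x) (u (n + 1) (cdif P n x)) \<and>
      s n (u n x) = ca X n (ca X n (f n x) (v (n + 1) (cdif P n x))) (cdif X (n - 1) (v n x)))"
  proof (rule lifting[OF P W X s])
    show "(\<lambda>x. cz W (n + 1)) \<in> rmod_hom (cmodule P n) (cmodule W (n + 1))" for n by (rule rmod_hom_const_zero[OF cmod[OF W]])
    show "f n \<in> rmod_hom (cmodule P n) (cmodule X n)" for n by (rule chain_hom[OF f])
    fix n x assume x: "x \<in> cc P n"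
    interpret W2: right_module "cmodule W (n + 2)" by (rule cmod[OF W])
    interpret X1: right_module "cmodule X (n + 1)" by (rule cmod[OF X])
    show "ca W (n + 2) (cdif W (n + 1) (cz W (n + 1))) (cz W (n + 1 + 1)) = cz W (n + 2)"
      using rmod_hom_zero[OF cmod[OF W] cmod[OF W] cdif_hom[OF W], of "n + 1"] by (simp add: add.assoc)
    show "ca X (n + 1) (s (n + 1) (cz W (n + 1))) (f (n + 1) (cdif P n x)) = cdif X n (f n x)"
      using rmod_hom_zero[OF cmod[OF W] cmod[OF X] chain_hom[OF QI_chain[OF s]], of "n + 1"] chain_comm[OF f x]
        rmod_homD(1)[OF cdif_hom[OF X] rmod_homD(1)[OF chain_hom[OF f] x]] by simp
  qed
  then obtain u v where uv: "\<And>n. u n \<in> rmod_hom (cmodule P n) (cmodule W n)" "\<And>n. v n \<in> rmod_hom (cmodule P n) (cmodule X (n - 1))"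
    "\<And>n x. x \<in> cc P n \<Longrightarrow> cdif W n (u n x) = ca W (n + 1) (cz W (n + 1)) (u (n + 1) (cdif P n x))"
    "\<And>n x. x \<in> cc P n \<Longrightarrow> s n (u n x) = ca X n (ca X n (f n x) (v (n + 1) (cdif P n x))) (cdif X (n - 1) (v n x))" by blast
  have "chain_map P W u" unfolding chain_map_def
  proof (intro allI conjI ballI uv(1))
    fix i x assume x: "x \<in> cc P i"
    interpret right_module "cmodule W (i + 1)" by (rule cmod[OF W])
    show "u (i + 1) (cdif P i x) = cdif W i (u i x)"
      using uv(3)[OF x] rmod_homD(1)[OF uv(1)[of "i + 1"] rmod_homD(1)[OF cdif_hom[OF Pc] x]] by simp
  qed
  moreover have "homotopic_maps P X (\<lambda>i x. s i (u i x)) f"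
  proof (rule homotopicI[OF uv(2)])
    fix i x assume x: "x \<in> cc P i"
    interpret right_module "cmodule X i" by (rule cmod[OF X])
    show "s i (u i x) = ca X i (f i x) (ca X i (cdif X (i - 1) (v i x)) (v (i + 1) (cdif P i x)))"
      using uv(4)[OF x] htpy_closed[OF Pc uv(2) X x] rmod_homD(1)[OF chain_hom[OF f] x] by (simp add: a_ac)
  qed
  ultimately show ?thesis by (rule that)
qed

text \<open>Over the complexes shifted by \<open>-1\<close>, a homotopy is a solution of the same lifting problem.\<close>

lemma lift_unique:
  assumes P: "liftable P" and W: "is_complex W" and X: "is_complex X" and s: "QI W X s"
    and g: "chain_map P W g" "chain_map P W g'" and sg: "homotopic_maps P X (\<lambda>i x. s i (g i x)) (\<lambda>i x. s i (g' i x))"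
  shows "homotopic_maps P W g g'"
proof -
  note Pc = liftable_complex[OF P] and sc = QI_chain[OF s]
  obtain h where h: "\<And>i. h i \<in> rmod_hom (cmodule P i) (cmodule X (i - 1))"
    "\<And>i x. x \<in> cc P i \<Longrightarrow> s i (g i x) = ca X i (s i (g' i x)) (ca X i (cdif X (i - 1) (h i x)) (h (i + 1) (cdif P i x)))"
    using sg by (auto simp: homotopic_maps_def)
  let ?W = "shift (-1) W" let ?X = "shift (-1) X"
  have dW: "cdif ?W i x = cn W i (cdif W (i - 1) x)" if "x \<in> cc W (i - 1)" for i x
    using cdif_shift[of x W i "-1"] that by (simp add: sgn_pow_def)
  have dX: "cdif ?X i x = cn X i (cdif X (i - 1) x)" if "x \<in> cc X (i - 1)" for i x
    using cdif_shift[of x X i "-1"] that by (simp add: sgn_pow_def)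
  \<comment> \<open>The order of the difference compensates for the negative differential of the
    complexes shifted by -1.\<close>
  define \<alpha> where "\<alpha> n x = ca W n (g' n x) (cn W n (g n x))" for n x
  have neg: "(\<lambda>x. cn W n (g n x)) \<in> rmod_hom (cmodule P n) (cmodule W n)" for n
    using rmod_hom_sgn_comp[OF cmod[OF W] chain_hom[OF g(1), of n], of 1] by (simp add: sgn_pow_def)
  have \<alpha>h: "\<alpha> n \<in> rmod_hom (cmodule P n) (cmodule W n)" for n
    unfolding \<alpha>_def[abs_def] by (rule rmod_hom_add[OF cmod[OF W] chain_hom[OF g(2)] neg])
  have "\<exists>u v. (\<forall>n. u n \<in> rmod_hom (cmodule P n) (cmodule ?W n)) \<and> (\<forall>n. v n \<in> rmod_hom (cmodule P n) (cmodule ?X (n - 1))) \<and>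
    (\<forall>n. \<forall>x\<in>cc P n. cdif ?W n (u n x) = ca ?W (n + 1) (\<alpha> n x) (u (n + 1) (cdif P n x)) \<and>
      s (n + - 1) (u n x) = ca ?X n (ca ?X n (h n x) (v (n + 1) (cdif P n x))) (cdif ?X (n - 1) (v n x)))"
  proof (rule lifting[OF P is_complex_shift[OF W] is_complex_shift[OF X] QI_shift[OF W X s]])
    show "\<alpha> n \<in> rmod_hom (cmodule P n) (cmodule ?W (n + 1))" for n using \<alpha>h by simp
    show "h n \<in> rmod_hom (cmodule P n) (cmodule ?X n)" for n using h(1) by simp
    fix n x assume x: "x \<in> cc P n"
    interpret W: right_module "cmodule W n" by (rule cmod[OF W])
    interpret W1: right_module "cmodule W (n + 1)" by (rule cmod[OF W])
    interpret X: right_module "cmodule X n" by (rule cmod[OF X])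
    have gx: "g n x \<in> cc W n" "g' n x \<in> cc W n" using rmod_homD(1)[OF chain_hom x] g by auto
    note dx = rmod_homD(1)[OF cdif_hom[OF Pc] x]
    have da: "cdif W n (\<alpha> n x) = \<alpha> (n + 1) (cdif P n x)"
      using rmod_homD(2)[OF cdif_hom[OF W] gx(2) W.a_inv_closed[OF gx(1)]] rmod_hom_neg[OF cmod[OF W] cmod[OF W] cdif_hom[OF W] gx(1)]
        chain_comm[OF g(1) x] chain_comm[OF g(2) x] by (simp add: \<alpha>_def)
    have a1: "\<alpha> (n + 1) (cdif P n x) \<in> cc W (n + 1)" by (rule rmod_homD(1)[OF \<alpha>h dx])
    have ix: "n + 2 + - 1 = n + (1 :: int)" by simp
    show "ca ?W (n + 2) (cdif ?W (n + 1) (\<alpha> n x)) (\<alpha> (n + 1) (cdif P n x)) = cz ?W (n + 2)"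
      unfolding cmodule_shift ix using dW[of "\<alpha> n x" "n + 1"] rmod_homD(1)[OF \<alpha>h x] da a1 by (simp add: W1.l_neg)
    have sx: "s n (g n x) \<in> cc X n" "s n (g' n x) \<in> cc X n" using rmod_homD(1)[OF chain_hom[OF sc]] gx by auto
    note c = htpy_closed[OF Pc h(1) X x]
    have "s n (\<alpha> n x) = ca X n (s n (g' n x)) (cn X n (s n (g n x)))"
      using rmod_homD(2)[OF chain_hom[OF sc] gx(2) W.a_inv_closed[OF gx(1)]] rmod_hom_neg[OF cmod[OF W] cmod[OF X] chain_hom[OF sc] gx(1)]
      by (simp add: \<alpha>_def)
    also have "\<dots> = cn X n (ca X n (cdif X (n - 1) (h n x)) (h (n + 1) (cdif P n x)))"
      unfolding h(2)[OF x] using sx c by (simp add: X.minus_add X.a_ac X.r_neg1 X.r_neg2 X.r_neg)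
    finally have "ca X n (s n (\<alpha> n x)) (h (n + 1) (cdif P n x)) = cn X n (cdif X (n - 1) (h n x))"
      using c by (simp add: X.minus_add X.a_assoc X.l_neg)
    then show "ca ?X (n + 1) (s (n + 1 + - 1) (\<alpha> n x)) (h (n + 1) (cdif P n x)) = cdif ?X n (h n x)"
      using dX[of "h n x" n] rmod_homD(1)[OF h(1) x] by simp
  qed
  then obtain u where u: "\<And>n. u n \<in> rmod_hom (cmodule P n) (cmodule ?W n)"
    "\<And>n x. x \<in> cc P n \<Longrightarrow> cdif ?W n (u n x) = ca ?W (n + 1) (\<alpha> n x) (u (n + 1) (cdif P n x))" by blast
  then have uh: "u n \<in> rmod_hom (cmodule P n) (cmodule W (n - 1))" for n by simp
  show ?thesis
  proof (rule homotopicI[OF uh])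
    fix i x assume x: "x \<in> cc P i"
    interpret W: right_module "cmodule W i" by (rule cmod[OF W])
    have gx: "g i x \<in> cc W i" "g' i x \<in> cc W i" using rmod_homD(1)[OF chain_hom x] g by auto
    note c = htpy_closed[OF Pc uh W x]
    have e: "cn W i (cdif W (i - 1) (u i x)) = ca W i (ca W i (g' i x) (cn W i (g i x))) (u (i + 1) (cdif P i x))"
      using u(2)[OF x] dW[of "u i x" i] rmod_homD(1)[OF uh x] by (simp add: \<alpha>_def)
    have "cdif W (i - 1) (u i x) = cn W i (cn W i (cdif W (i - 1) (u i x)))" using c by simp
    also have "\<dots> = ca W i (ca W i (cn W i (g' i x)) (g i x)) (cn W i (u (i + 1) (cdif P i x)))"
      unfolding e using c gx by (simp add: W.minus_add)
    finally have "ca W i (g' i x) (ca W i (cdif W (i - 1) (u i x)) (u (i + 1) (cdif P i x))) = g i x"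
      using c gx by (simp add: W.a_assoc W.l_neg W.r_neg2)
    then show "g i x = ca W i (g' i x) (ca W i (cdif W (i - 1) (u i x)) (u (i + 1) (cdif P i x)))" by simp
  qed
qed

section \<open>The derived category\<close>

definition res :: "('a::{ring,monoid_mult}, 'm) cplx \<Rightarrow> ('a, 'm) cplx \<Rightarrow> (int \<Rightarrow> 'm \<Rightarrow> 'm) \<Rightarrow> bool" where
  "res X P q \<longleftrightarrow> is_complex X \<and> liftable P \<and> QI P X q"

definition cl :: "('a::{ring,monoid_mult}, 'm) cplx \<Rightarrow> ('a, 'm) cplx \<Rightarrow> ('a, 'm) cplx \<Rightarrow> (int \<Rightarrow> 'm \<Rightarrow> 'm) \<Rightarrow> (int \<Rightarrow> 'm \<Rightarrow> 'm) \<Rightarrow> ('a, 'm) roof set" where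
  "cl X Y P q k = roof_class X Y (P, q, k)"

lemma roofs_iff: "is_complex X \<Longrightarrow> (W, s, f) \<in> roofs X Y \<longleftrightarrow> is_complex W \<and> QI W X s \<and> chain_map W Y f"
  by (auto simp: roofs_def quasi_iso_iff_QI)

lemma roof_rel_iff:
  assumes X: "is_complex X"
  shows "((W1, s1, f1), (W2, s2, f2)) \<in> roof_rel X Y \<longleftrightarrow> (W1, s1, f1) \<in> roofs X Y \<and> (W2, s2, f2) \<in> roofs X Y \<and>
     (\<exists>W a b. is_complex W \<and> chain_map W W1 a \<and> chain_map W W2 b \<and> QI W X (\<lambda>i x. s1 i (a i x)) \<and>
        homotopic_maps W X (\<lambda>i x. s1 i (a i x)) (\<lambda>i x. s2 i (b i x)) \<and>
        homotopic_maps W Y (\<lambda>i x. f1 i (a i x)) (\<lambda>i x. f2 i (b i x)))"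
  unfolding roof_rel_def by (simp add: comp_def quasi_iso_iff_QI[OF _ X] cong: conj_cong)

lemma lift_QI:
  assumes P: "liftable P" and W: "is_complex W" and X: "is_complex X" and s: "QI W X s" and q: "QI P X q"
    and w: "chain_map P W w" "homotopic_maps P X (\<lambda>i x. s i (w i x)) q"
  shows "QI P W w"
proof -
  note Pc = liftable_complex[OF P]
  have sw: "chain_map P X (\<lambda>i x. s i (w i x))" by (rule chain_map_comp[OF w(1) QI_chain[OF s]])
  have "QI P X (\<lambda>i x. s i (w i x))"
    by (rule QI_homotopic[OF Pc X q sw homotopic_sym[OF Pc X QI_chain[OF q] w(2)]])
  then show ?thesis by (rule QI_cancel_left[OF Pc W w(1) s _ X])
qed

locale resolved =
  fixes X :: "('a::{ring,monoid_mult}, 'm) cplx" and P q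
  assumes res: "res X P q"
begin

lemma Xc: "is_complex X" and P: "liftable P" and Pc: "is_complex P" and q: "QI P X q" and qc: "chain_map P X q"
  using res liftable_complex QI_chain by (auto simp: res_def)

lemma ht:
  assumes "is_complex Y"
  shows "chain_map P Y g \<Longrightarrow> homotopic_maps P Y f g \<Longrightarrow> homotopic_maps P Y g f"
    "chain_map P Y k \<Longrightarrow> homotopic_maps P Y f g \<Longrightarrow> homotopic_maps P Y g k \<Longrightarrow> homotopic_maps P Y f k"
    "chain_map P Y f \<Longrightarrow> homotopic_maps P Y f f"
  using homotopic_sym[OF Pc assms] homotopic_trans[OF Pc assms] homotopic_refl[OF Pc assms] by blast+

lemma roof_lift:
  assumes "(W, s, f) \<in> roofs X Y"
  obtains w where "chain_map P W w" "homotopic_maps P X (\<lambda>i x. s i (w i x)) q"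
  using lift_map[OF P _ Xc _ qc] assms roofs_iff[OF Xc] by blast

text \<open>A roof is determined by its composition with a lift of \<open>q\<close>.\<close>

lemma roof_class_mem:
  assumes Y: "is_complex Y" and r: "(W, s, f) \<in> roofs X Y" and w: "chain_map P W w" "homotopic_maps P X (\<lambda>i x. s i (w i x)) q"
  shows "(W', s', f') \<in> roof_class X Y (W, s, f) \<longleftrightarrow> (W', s', f') \<in> roofs X Y \<and>
    (\<exists>w'. chain_map P W' w' \<and> homotopic_maps P X (\<lambda>i x. s' i (w' i x)) q \<and> homotopic_maps P Y (\<lambda>i x. f' i (w' i x)) (\<lambda>i x. f i (w i x)))"
proof
  have W: "is_complex W" "QI W X s" "chain_map W Y f" using r roofs_iff[OF Xc] by auto
  have fw: "chain_map P Y (\<lambda>i x. f i (w i x))" by (rule chain_map_comp[OF w(1) W(3)])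
  have sw: "chain_map P X (\<lambda>i x. s i (w i x))" by (rule chain_map_comp[OF w(1) QI_chain[OF W(2)]])
  {
    assume "(W', s', f') \<in> roof_class X Y (W, s, f)"
    then have "((W, s, f), (W', s', f')) \<in> roof_rel X Y" by (simp add: roof_class_def)
    then obtain V a b where r': "(W', s', f') \<in> roofs X Y" and V: "is_complex V" "chain_map V W a" "chain_map V W' b"
        "QI V X (\<lambda>i x. s i (a i x))" "homotopic_maps V X (\<lambda>i x. s i (a i x)) (\<lambda>i x. s' i (b i x))"
        "homotopic_maps V Y (\<lambda>i x. f i (a i x)) (\<lambda>i x. f' i (b i x))"
      unfolding roof_rel_iff[OF Xc] by blast
    have W': "is_complex W'" "QI W' X s'" "chain_map W' Y f'" using r' roofs_iff[OF Xc] by auto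
    obtain u where u: "chain_map P V u" "homotopic_maps P X (\<lambda>i x. s i (a i (u i x))) q"
      using lift_map[OF P V(1) Xc V(4) qc] by blast
    have au: "chain_map P W (\<lambda>i x. a i (u i x))" and bu: "chain_map P W' (\<lambda>i x. b i (u i x))"
      by (rule chain_map_comp[OF u(1) V(2)], rule chain_map_comp[OF u(1) V(3)])
    have sau: "chain_map P X (\<lambda>i x. s i (a i (u i x)))" by (rule chain_map_comp[OF au QI_chain[OF W(2)]])
    have wau: "homotopic_maps P W w (\<lambda>i x. a i (u i x))"
      by (rule lift_unique[OF P W(1) Xc W(2) w(1) au], rule ht(2)[OF Xc sau w(2)], rule ht(1)[OF Xc qc u(2)])
    have "homotopic_maps P X (\<lambda>i x. s' i (b i (u i x))) (\<lambda>i x. s i (a i (u i x)))"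
      by (rule ht(1)[OF Xc chain_map_comp[OF bu QI_chain[OF W'(2)]]], rule homotopic_comp_right[OF V(1) u(1) V(5)])
    then have 1: "homotopic_maps P X (\<lambda>i x. s' i (b i (u i x))) q" using ht(2)[OF Xc qc _ u(2)] by blast
    have f'bu: "chain_map P Y (\<lambda>i x. f' i (b i (u i x)))" by (rule chain_map_comp[OF bu W'(3)])
    have "homotopic_maps P Y (\<lambda>i x. f i (w i x)) (\<lambda>i x. f i (a i (u i x)))"
      by (rule homotopic_comp_left[OF Pc W(1) au W(3) wau])
    moreover have "homotopic_maps P Y (\<lambda>i x. f i (a i (u i x))) (\<lambda>i x. f' i (b i (u i x)))"
      by (rule homotopic_comp_right[OF V(1) u(1) V(6)])
    ultimately have "homotopic_maps P Y (\<lambda>i x. f' i (b i (u i x))) (\<lambda>i x. f i (w i x))"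
      using ht(1)[OF Y f'bu] ht(2)[OF Y f'bu] by blast
    then show "(W', s', f') \<in> roofs X Y \<and>
      (\<exists>w'. chain_map P W' w' \<and> homotopic_maps P X (\<lambda>i x. s' i (w' i x)) q \<and> homotopic_maps P Y (\<lambda>i x. f' i (w' i x)) (\<lambda>i x. f i (w i x)))"
      using r' bu 1 by blast
  }
  assume "(W', s', f') \<in> roofs X Y \<and>
    (\<exists>w'. chain_map P W' w' \<and> homotopic_maps P X (\<lambda>i x. s' i (w' i x)) q \<and> homotopic_maps P Y (\<lambda>i x. f' i (w' i x)) (\<lambda>i x. f i (w i x)))"
  then obtain w' where r': "(W', s', f') \<in> roofs X Y" and w': "chain_map P W' w'" "homotopic_maps P X (\<lambda>i x. s' i (w' i x)) q"
      "homotopic_maps P Y (\<lambda>i x. f' i (w' i x)) (\<lambda>i x. f i (w i x))" by blast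
  have W': "is_complex W'" "QI W' X s'" "chain_map W' Y f'" using r' roofs_iff[OF Xc] by auto
  have s'w': "chain_map P X (\<lambda>i x. s' i (w' i x))" by (rule chain_map_comp[OF w'(1) QI_chain[OF W'(2)]])
  have "homotopic_maps P X (\<lambda>i x. s i (w i x)) (\<lambda>i x. s' i (w' i x))"
    by (rule ht(2)[OF Xc s'w' w(2) ht(1)[OF Xc qc w'(2)]])
  moreover have "homotopic_maps P Y (\<lambda>i x. f i (w i x)) (\<lambda>i x. f' i (w' i x))" by (rule ht(1)[OF Y fw w'(3)])
  moreover have "QI P X (\<lambda>i x. s i (w i x))" by (rule QI_homotopic[OF Pc Xc q sw ht(1)[OF Xc qc w(2)]])
  ultimately show "(W', s', f') \<in> roof_class X Y (W, s, f)"
    unfolding roof_class_def using roof_rel_iff[OF Xc] r r' w(1) w'(1) Pc by blast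
qed

lemma cl_roof: "chain_map P Y k \<Longrightarrow> (P, q, k) \<in> roofs X Y"
  using roofs_iff[OF Xc] Pc q by blast

lemma cl_mem:
  assumes Y: "is_complex Y" and k: "chain_map P Y k"
  shows "(W, s, f) \<in> cl X Y P q k \<longleftrightarrow> (W, s, f) \<in> roofs X Y \<and>
    (\<exists>w. chain_map P W w \<and> homotopic_maps P X (\<lambda>i x. s i (w i x)) q \<and> homotopic_maps P Y (\<lambda>i x. f i (w i x)) k)"
  unfolding cl_def by (rule roof_class_mem[OF Y cl_roof[OF k] chain_map_id ht(3)[OF Xc qc]])

lemma roof_class_eq:
  assumes Y: "is_complex Y" and r: "(W, s, f) \<in> roofs X Y" and w: "chain_map P W w" "homotopic_maps P X (\<lambda>i x. s i (w i x)) q"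
  shows "roof_class X Y (W, s, f) = cl X Y P q (\<lambda>i x. f i (w i x))"
proof -
  have "chain_map P Y (\<lambda>i x. f i (w i x))" using chain_map_comp[OF w(1)] r roofs_iff[OF Xc] by blast
  from cl_mem[OF Y this] roof_class_mem[OF Y r w] show ?thesis by (auto simp: set_eq_iff)
qed

text \<open>Since a class contains its own roof, equality of classes produces a map from
  \<open>P\<close> to itself that is compatible with \<open>q\<close>; by uniqueness of lifts this
  map is homotopic to the identity.\<close>

lemma cl_eq_iff:
  assumes Y: "is_complex Y" and k: "chain_map P Y k" "chain_map P Y k'"
  shows "cl X Y P q k = cl X Y P q k' \<longleftrightarrow> homotopic_maps P Y k k'"
proof
  assume "cl X Y P q k = cl X Y P q k'"
  moreover have "(P, q, k) \<in> cl X Y P q k"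
    using cl_mem[OF Y k(1)] cl_roof[OF k(1)] chain_map_id ht(3)[OF Xc qc] ht(3)[OF Y k(1)] by blast
  ultimately obtain w where w: "chain_map P P w" "homotopic_maps P X (\<lambda>i x. q i (w i x)) q" "homotopic_maps P Y (\<lambda>i x. k i (w i x)) k'"
    using cl_mem[OF Y k(2)] by blast
  have "homotopic_maps P P w (\<lambda>i x. x)" by (rule lift_unique[OF P Pc Xc q w(1) chain_map_id w(2)])
  then have "homotopic_maps P Y (\<lambda>i x. k i (w i x)) k" using homotopic_comp_left[OF Pc Pc chain_map_id k(1)] by fastforce
  from ht(2)[OF Y k(2) ht(1)[OF Y k(1) this] w(3)] show "homotopic_maps P Y k k'" .
next
  assume h: "homotopic_maps P Y k k'"
  have "homotopic_maps P Y g k \<longleftrightarrow> homotopic_maps P Y g k'" for g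
    using ht(2)[OF Y k(2) _ h] ht(2)[OF Y k(1) _ ht(1)[OF Y k(2) h]] by blast
  then show "cl X Y P q k = cl X Y P q k'" using cl_mem[OF Y k(1)] cl_mem[OF Y k(2)] by (auto simp: set_eq_iff)
qed

lemma cl_self: "is_complex Y \<Longrightarrow> chain_map P Y k \<Longrightarrow> (P, q, k) \<in> cl X Y P q k"
  using cl_mem cl_roof chain_map_id ht(3)[OF Xc qc] ht(3) by blast

lemma derived_hom_carrier:
  assumes Y: "is_complex Y"
  shows "\<phi> \<in> carrier (derived_hom scale X Y) \<longleftrightarrow> (\<exists>k. chain_map P Y k \<and> \<phi> = cl X Y P q k)"
proof
  assume "\<phi> \<in> carrier (derived_hom scale X Y)"
  then obtain W s f where r: "(W, s, f) \<in> roofs X Y" "\<phi> = roof_class X Y (W, s, f)"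
    by (auto simp: derived_hom_def quotient_def roof_class_def)
  obtain w where w: "chain_map P W w" "homotopic_maps P X (\<lambda>i x. s i (w i x)) q" using roof_lift[OF r(1)] .
  have "chain_map P Y (\<lambda>i x. f i (w i x))" using chain_map_comp[OF w(1)] r(1) roofs_iff[OF Xc] by blast
  then show "\<exists>k. chain_map P Y k \<and> \<phi> = cl X Y P q k" using roof_class_eq[OF Y r(1) w] r(2) by blast
next
  assume "\<exists>k. chain_map P Y k \<and> \<phi> = cl X Y P q k"
  then show "\<phi> \<in> carrier (derived_hom scale X Y)"
    using cl_roof by (auto simp: derived_hom_def quotient_def roof_class_def cl_def)
qed

lemma cl_add:
  assumes Y: "is_complex Y" and k: "chain_map P Y k" "chain_map P Y k'"
  shows "cl X Y P q k \<oplus>\<^bsub>derived_hom scale X Y\<^esub> cl X Y P q k' = cl X Y P q (\<lambda>i x. ca Y i (k i x) (k' i x))"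
proof -
  have "roof_class X Y (W, s, \<lambda>i x. ca Y i (f i x) (g i x)) = cl X Y P q (\<lambda>i x. ca Y i (k i x) (k' i x))"
    if fg: "(W, s, f) \<in> cl X Y P q k" "(W, s, g) \<in> cl X Y P q k'" for W s f g
  proof -
    obtain w where w: "chain_map P W w" "homotopic_maps P X (\<lambda>i x. s i (w i x)) q" "homotopic_maps P Y (\<lambda>i x. f i (w i x)) k"
      using fg(1) cl_mem[OF Y k(1)] by blast
    obtain v where v: "chain_map P W v" "homotopic_maps P X (\<lambda>i x. s i (v i x)) q" "homotopic_maps P Y (\<lambda>i x. g i (v i x)) k'"
      using fg(2) cl_mem[OF Y k(2)] by blast
    have W: "is_complex W" "QI W X s" "chain_map W Y f" "chain_map W Y g"
      using fg cl_mem[OF Y k(1)] cl_mem[OF Y k(2)] roofs_iff[OF Xc] by blast+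
    have sv: "chain_map P X (\<lambda>i x. s i (v i x))" by (rule chain_map_comp[OF v(1) QI_chain[OF W(2)]])
    have "homotopic_maps P W w v"
      by (rule lift_unique[OF P W(1) Xc W(2) w(1) v(1)], rule ht(2)[OF Xc sv w(2)], rule ht(1)[OF Xc qc v(2)])
    then have "homotopic_maps P Y (\<lambda>i x. g i (w i x)) (\<lambda>i x. g i (v i x))" by (rule homotopic_comp_left[OF Pc W(1) v(1) W(4)])
    then have gw: "homotopic_maps P Y (\<lambda>i x. g i (w i x)) k'" using ht(2)[OF Y k(2) _ v(3)] by blast
    have fgc: "chain_map W Y (\<lambda>i x. ca Y i (f i x) (g i x))" by (rule chain_map_add[OF Y W(3,4)])
    then have r: "(W, s, \<lambda>i x. ca Y i (f i x) (g i x)) \<in> roofs X Y" using roofs_iff[OF Xc] W by blast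
    have "homotopic_maps P Y (\<lambda>i x. ca Y i (f i (w i x)) (g i (w i x))) (\<lambda>i x. ca Y i (k i x) (k' i x))"
      by (rule homotopic_add[OF Pc Y k w(3) gw])
    then show ?thesis
      using roof_class_eq[OF Y r w(1,2)] cl_eq_iff[OF Y chain_map_comp[OF w(1) fgc] chain_map_add[OF Y k]] by simp
  qed
  moreover have "(P, q, k) \<in> cl X Y P q k" "(P, q, k') \<in> cl X Y P q k'" using cl_self[OF Y] k by auto
  ultimately show ?thesis unfolding derived_hom_def by auto blast
qed

lemma cl_smult:
  assumes Y: "is_complex Y" and k: "chain_map P Y k" and z: "scale c 1 \<in> alg_center"
  shows "c \<odot>\<^bsub>derived_hom scale X Y\<^esub> cl X Y P q k = cl X Y P q (\<lambda>i x. scale c 1 \<odot>\<^bsub>cmodule Y i\<^esub> k i x)"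
proof -
  have "roof_class X Y (W, s, \<lambda>i x. scale c 1 \<odot>\<^bsub>cmodule Y i\<^esub> f i x) = cl X Y P q (\<lambda>i x. scale c 1 \<odot>\<^bsub>cmodule Y i\<^esub> k i x)"
    if f: "(W, s, f) \<in> cl X Y P q k" for W s f
  proof -
    obtain w where w: "chain_map P W w" "homotopic_maps P X (\<lambda>i x. s i (w i x)) q" "homotopic_maps P Y (\<lambda>i x. f i (w i x)) k"
      using f cl_mem[OF Y k] by blast
    have W: "is_complex W" "QI W X s" "chain_map W Y f"
      using f cl_mem[OF Y k] roofs_iff[OF Xc] by blast+
    have fgc: "chain_map W Y (\<lambda>i x. scale c 1 \<odot>\<^bsub>cmodule Y i\<^esub> f i x)" by (rule chain_map_central[OF Y z W(3)])
    then have r: "(W, s, \<lambda>i x. scale c 1 \<odot>\<^bsub>cmodule Y i\<^esub> f i x) \<in> roofs X Y" using roofs_iff[OF Xc] W by blast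
    have "homotopic_maps P Y (\<lambda>i x. scale c 1 \<odot>\<^bsub>cmodule Y i\<^esub> f i (w i x)) (\<lambda>i x. scale c 1 \<odot>\<^bsub>cmodule Y i\<^esub> k i x)"
      by (rule homotopic_central[OF Pc Y k z w(3)])
    then show ?thesis
      using roof_class_eq[OF Y r w(1,2)] cl_eq_iff[OF Y chain_map_comp[OF w(1) fgc] chain_map_central[OF Y z k]] by simp
  qed
  moreover have "(P, q, k) \<in> cl X Y P q k" using cl_self[OF Y] k by auto
  ultimately show ?thesis unfolding derived_hom_def by auto blast
qed

lemma chain_class_cl:
  assumes Y: "is_complex Y" and f: "chain_map X Y f"
  shows "chain_class X Y f = cl X Y P q (\<lambda>i x. f i (q i x))"
proof -
  have "(X, \<lambda>i x. x, f) \<in> roofs X Y" using roofs_iff[OF Xc] QI_id[OF Xc] Xc f by blast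
  from roof_class_eq[OF Y this qc ht(3)[OF Xc qc]] show ?thesis by (simp add: chain_class_def)
qed

lemma cl_zero:
  assumes Y: "is_complex Y"
  shows "\<zero>\<^bsub>derived_hom scale X Y\<^esub> = cl X Y P q (\<lambda>i x. cz Y i)"
  using chain_class_cl[OF Y chain_map_zero[OF Y]] by (simp add: derived_hom_def)

text \<open>All composite roofs give the same class, because any two lifts of a map from
  \<open>P\<close> along a quasi-isomorphism are homotopic. The left factor is only assumed to be a
  nonempty part of a class, so that the result applies directly to images under
  \<open>shift_morphism\<close>.\<close>

lemma derived_comp_cl:
  assumes Y: "res Y Q q'" and Z: "is_complex Z" and k: "chain_map P Y k" and l: "chain_map Q Z l"
    and f: "chain_map P Q f" "homotopic_maps P Y (\<lambda>i x. q' i (f i x)) k"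
    and \<psi>: "\<psi> \<subseteq> cl Y Z Q q' l" "\<psi> \<noteq> {}"
  shows "derived_comp X Y Z \<psi> (cl X Y P q k) = cl X Z P q (\<lambda>i x. l i (f i x))"
proof -
  interpret Y: resolved Y Q q' by (unfold_locales) (rule Y)
  note Yc = Y.Xc
  have lf: "chain_map P Z (\<lambda>i x. l i (f i x))" by (rule chain_map_comp[OF f(1) l])
  have piece: "roof_class X Z (U, \<lambda>i. s i \<circ> a i, \<lambda>i. g i \<circ> b i) = cl X Z P q (\<lambda>i x. l i (f i x))"
    if W: "(W, s, f0) \<in> cl X Y P q k" and V: "(V, t, g) \<in> \<psi>" and U: "is_complex U" "quasi_iso U W a" "chain_map U V b"
      "homotopic_maps U Y (\<lambda>i. f0 i \<circ> a i) (\<lambda>i. t i \<circ> b i)" for U a b W s f0 V t g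
  proof -
    obtain w where w: "chain_map P W w" "homotopic_maps P X (\<lambda>i x. s i (w i x)) q" "homotopic_maps P Y (\<lambda>i x. f0 i (w i x)) k"
      using W cl_mem[OF Yc k] by blast
    have Wc: "is_complex W" "QI W X s" "chain_map W Y f0" using W cl_mem[OF Yc k] roofs_iff[OF Xc] by blast+
    have V': "(V, t, g) \<in> cl Y Z Q q' l" using V \<psi>(1) by blast
    obtain v where v: "chain_map Q V v" "homotopic_maps Q Y (\<lambda>i x. t i (v i x)) q'" "homotopic_maps Q Z (\<lambda>i x. g i (v i x)) l"
      using V' Y.cl_mem[OF Z l] by blast
    have Vc: "is_complex V" "QI V Y t" "chain_map V Z g" using V' Y.cl_mem[OF Z l] roofs_iff[OF Yc] by blast+
    have a: "QI U W a" using U(2) quasi_iso_iff_QI[OF U(1) Wc(1)] by simp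
    have sa: "QI U X (\<lambda>i x. s i (a i x))" by (rule QI_comp[OF U(1) Wc(1) Xc a Wc(2)])
    have gb: "chain_map U Z (\<lambda>i x. g i (b i x))" by (rule chain_map_comp[OF U(3) Vc(3)])
    have r: "(U, \<lambda>i x. s i (a i x), \<lambda>i x. g i (b i x)) \<in> roofs X Z" using roofs_iff[OF Xc] U(1) sa gb by blast
    obtain u where u: "chain_map P U u" "homotopic_maps P X (\<lambda>i x. s i (a i (u i x))) q" using roof_lift[OF r] .
    have au: "chain_map P W (\<lambda>i x. a i (u i x))" by (rule chain_map_comp[OF u(1) QI_chain[OF a]])
    have bu: "chain_map P V (\<lambda>i x. b i (u i x))" by (rule chain_map_comp[OF u(1) U(3)])
    have vf: "chain_map P V (\<lambda>i x. v i (f i x))" by (rule chain_map_comp[OF f(1) v(1)])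
    have sw: "chain_map P X (\<lambda>i x. s i (w i x))" by (rule chain_map_comp[OF w(1) QI_chain[OF Wc(2)]])
    have auw: "homotopic_maps P W (\<lambda>i x. a i (u i x)) w"
      by (rule lift_unique[OF P Wc(1) Xc Wc(2) au w(1)], rule ht(2)[OF Xc sw u(2)], rule ht(1)[OF Xc qc w(2)])
    have tvf: "chain_map P Y (\<lambda>i x. t i (v i (f i x)))" by (rule chain_map_comp[OF vf QI_chain[OF Vc(2)]])
    have tbu: "chain_map P Y (\<lambda>i x. t i (b i (u i x)))" by (rule chain_map_comp[OF bu QI_chain[OF Vc(2)]])
    have "homotopic_maps P Y (\<lambda>i x. t i (v i (f i x))) (\<lambda>i x. q' i (f i x))"
      by (rule homotopic_comp_right[OF Y.Pc f(1) v(2)])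
    from ht(2)[OF Yc k this f(2)] have tv: "homotopic_maps P Y k (\<lambda>i x. t i (v i (f i x)))" by (rule ht(1)[OF Yc k])
    have "homotopic_maps P Y (\<lambda>i x. f0 i (a i (u i x))) (\<lambda>i x. t i (b i (u i x)))"
      using homotopic_comp_right[OF U(1) u(1) U(4)] by simp
    then have 1: "homotopic_maps P Y (\<lambda>i x. t i (b i (u i x))) (\<lambda>i x. f0 i (a i (u i x)))" by (rule ht(1)[OF Yc tbu])
    have 2: "homotopic_maps P Y (\<lambda>i x. f0 i (a i (u i x))) k"
      by (rule ht(2)[OF Yc k homotopic_comp_left[OF Pc Wc(1) w(1) Wc(3) auw] w(3)])
    have "homotopic_maps P V (\<lambda>i x. b i (u i x)) (\<lambda>i x. v i (f i x))"
      by (rule lift_unique[OF P Vc(1) Yc Vc(2) bu vf], rule ht(2)[OF Yc tvf ht(2)[OF Yc k 1 2] tv])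
    then have 3: "homotopic_maps P Z (\<lambda>i x. g i (b i (u i x))) (\<lambda>i x. g i (v i (f i x)))" by (rule homotopic_comp_left[OF Pc Vc(1) vf Vc(3)])
    have "homotopic_maps P Z (\<lambda>i x. g i (v i (f i x))) (\<lambda>i x. l i (f i x))" by (rule homotopic_comp_right[OF Y.Pc f(1) v(3)])
    from ht(2)[OF Z lf 3 this] have "homotopic_maps P Z (\<lambda>i x. g i (b i (u i x))) (\<lambda>i x. l i (f i x))" .
    then show ?thesis
      using roof_class_eq[OF Z r u] cl_eq_iff[OF Z chain_map_comp[OF bu Vc(3)] lf] by (simp add: comp_def)
  qed
  \<comment> \<open>The composite is a union over composite roofs, so one must be exhibited: the
    roof with \<open>U = P\<close>, using a lift of \<open>k\<close> through
    \<open>t\<close>.\<close>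
  obtain V t g where V: "(V, t, g) \<in> \<psi>" using \<psi>(2) by (metis all_not_in_conv prod_cases3)
  then have "(V, t, g) \<in> cl Y Z Q q' l" using \<psi>(1) by blast
  then have Vc: "is_complex V" "QI V Y t" using Y.cl_mem[OF Z l] roofs_iff[OF Yc] by blast+
  obtain b where b: "chain_map P V b" "homotopic_maps P Y (\<lambda>i x. t i (b i x)) k" using lift_map[OF P Vc(1) Yc Vc(2) k] .
  have qi: "quasi_iso P P (\<lambda>i x. x)" using quasi_iso_iff_QI[OF Pc Pc] QI_id[OF Pc] by simp
  have hb: "homotopic_maps P Y (\<lambda>i. k i \<circ> (\<lambda>x. x)) (\<lambda>i. t i \<circ> b i)" using ht(1)[OF Yc k b(2)] by (simp add: comp_def)
  have "\<exists>U a b W s f0 V t g. cl X Z P q (\<lambda>i x. l i (f i x)) = roof_class X Z (U, \<lambda>i. s i \<circ> a i, \<lambda>i. g i \<circ> b i) \<and>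
        (W, s, f0) \<in> cl X Y P q k \<and> (V, t, g) \<in> \<psi> \<and> is_complex U \<and> quasi_iso U W a \<and> chain_map U V b \<and>
        homotopic_maps U Y (\<lambda>i. f0 i \<circ> a i) (\<lambda>i. t i \<circ> b i)"
    by (rule exI[of _ P], rule exI[of _ "\<lambda>i x. x"], rule exI[of _ b], rule exI[of _ P], rule exI[of _ q], rule exI[of _ k],
        rule exI[of _ V], rule exI[of _ t], rule exI[of _ g])
      (simp only: piece[OF cl_self[OF Yc k] V Pc qi b(1) hb] cl_self[OF Yc k] V Pc qi b(1) hb simp_thms)
  then have "{roof_class X Z (U, \<lambda>i. s i \<circ> a i, \<lambda>i. g i \<circ> b i) | U a b W s f V t g.
        (W, s, f) \<in> cl X Y P q k \<and> (V, t, g) \<in> \<psi> \<and> is_complex U \<and> quasi_iso U W a \<and> chain_map U V b \<and>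
        homotopic_maps U Y (\<lambda>i. f i \<circ> a i) (\<lambda>i. t i \<circ> b i)} = {cl X Z P q (\<lambda>i x. l i (f i x))}" (is "?S = _")
  proof -
    assume e: "\<exists>U a b W s f0 V t g. cl X Z P q (\<lambda>i x. l i (f i x)) = roof_class X Z (U, \<lambda>i. s i \<circ> a i, \<lambda>i. g i \<circ> b i) \<and>
        (W, s, f0) \<in> cl X Y P q k \<and> (V, t, g) \<in> \<psi> \<and> is_complex U \<and> quasi_iso U W a \<and> chain_map U V b \<and>
        homotopic_maps U Y (\<lambda>i. f0 i \<circ> a i) (\<lambda>i. t i \<circ> b i)"
    then have "cl X Z P q (\<lambda>i x. l i (f i x)) \<in> ?S" unfolding mem_Collect_eq .
    moreover have "C = cl X Z P q (\<lambda>i x. l i (f i x))" if "C \<in> ?S" for C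
      using that by (elim CollectE exE conjE) (simp only: piece)
    ultimately show ?thesis by blast
  qed
  then show ?thesis unfolding derived_comp_def by simp
qed

lemma resolved_shift: "res (shift n X) (shift n P) (\<lambda>i. q (i + n))"
  unfolding res_def using is_complex_shift[OF Xc] liftable_shift[OF P] QI_shift[OF Pc Xc q] by blast

lemma shift_morphism_cl:
  assumes Y: "is_complex Y" and k: "chain_map P Y k"
  shows "shift_morphism n (cl X Y P q k) \<subseteq> cl (shift n X) (shift n Y) (shift n P) (\<lambda>i. q (i + n)) (\<lambda>i. k (i + n))"
    "shift_morphism n (cl X Y P q k) \<noteq> {}"
proof -
  interpret s: resolved "shift n X" "shift n P" "\<lambda>i. q (i + n)" by unfold_locales (rule resolved_shift)
  show "shift_morphism n (cl X Y P q k) \<noteq> {}" using cl_self[OF Y k] by (auto simp: shift_morphism_def)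
  have "(shift n W, \<lambda>i. s (i + n), \<lambda>i. f (i + n)) \<in> cl (shift n X) (shift n Y) (shift n P) (\<lambda>i. q (i + n)) (\<lambda>i. k (i + n))"
    if W: "(W, s, f) \<in> cl X Y P q k" for W s f
  proof -
    obtain w where w: "chain_map P W w" "homotopic_maps P X (\<lambda>i x. s i (w i x)) q" "homotopic_maps P Y (\<lambda>i x. f i (w i x)) k"
      using W cl_mem[OF Y k] by blast
    have Wc: "is_complex W" "QI W X s" "chain_map W Y f" using W cl_mem[OF Y k] roofs_iff[OF Xc] by blast+
    have "(shift n W, \<lambda>i. s (i + n), \<lambda>i. f (i + n)) \<in> roofs (shift n X) (shift n Y)"
      using roofs_iff[OF s.Xc] is_complex_shift[OF Wc(1)] QI_shift[OF Wc(1) Xc Wc(2)] chain_map_shift[OF Wc(1) Y Wc(3)] by blast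
    then show ?thesis
      using s.cl_mem[OF is_complex_shift[OF Y] chain_map_shift[OF Pc Y k]] chain_map_shift[OF Pc Wc(1) w(1)]
        homotopic_shift[OF Pc Xc w(2)] homotopic_shift[OF Pc Y w(3)] by blast
  qed
  then show "shift_morphism n (cl X Y P q k) \<subseteq> cl (shift n X) (shift n Y) (shift n P) (\<lambda>i. q (i + n)) (\<lambda>i. k (i + n))"
    by (auto simp: shift_morphism_def)
qed

end

subsection \<open>Perfect complexes\<close>

text \<open>\<open>cinj\<close> and \<open>csurj\<close> are the two halves of \<open>QI\<close>;
  they are separated because the two equations of an isomorphism supply one half each.\<close>

definition cinj :: "('a::{ring,monoid_mult}, 'm) cplx \<Rightarrow> ('a, 'm) cplx \<Rightarrow> (int \<Rightarrow> 'm \<Rightarrow> 'm) \<Rightarrow> bool" where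
  "cinj X Y f \<longleftrightarrow> (\<forall>i. \<forall>x\<in>cocycles X i. \<forall>y\<in>cocycles X i. coh Y i (f i x) (f i y) \<longrightarrow> coh X i x y)"

definition csurj :: "('a::{ring,monoid_mult}, 'm) cplx \<Rightarrow> ('a, 'm) cplx \<Rightarrow> (int \<Rightarrow> 'm \<Rightarrow> 'm) \<Rightarrow> bool" where
  "csurj X Y f \<longleftrightarrow> (\<forall>i. \<forall>y\<in>cocycles Y i. \<exists>x\<in>cocycles X i. coh Y i (f i x) y)"

lemma QI_iff: "QI X Y f \<longleftrightarrow> chain_map X Y f \<and> cinj X Y f \<and> csurj X Y f"
  by (simp add: QI_def cinj_def csurj_def)

lemma cinj_homotopic:
  assumes "is_complex X" "is_complex Y" "chain_map X Y f" "chain_map X Y g" "homotopic_maps X Y f g" "cinj X Y f"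
  shows "cinj X Y g"
  using assms(6) coh_homotopic[OF assms(1-5)] coh_trans[OF assms(2)] coh_sym[OF assms(2)]
  unfolding cinj_def by meson

lemma csurj_homotopic:
  assumes "is_complex X" "is_complex Y" "chain_map X Y f" "chain_map X Y g" "homotopic_maps X Y f g" "csurj X Y f"
  shows "csurj X Y g"
  using assms(6) coh_homotopic[OF assms(1-5)] coh_trans[OF assms(2)] coh_sym[OF assms(2)]
  unfolding csurj_def by meson

lemma cinj_right:
  assumes "is_complex Y" "chain_map Y Z g" "cinj X Z (\<lambda>i x. g i (f i x))"
  shows "cinj X Y f"
  using assms(3) coh_map[OF assms(1,2)] unfolding cinj_def by blast

lemma csurj_left:
  assumes "is_complex X" "is_complex Y" "chain_map X Y f" "csurj X Z (\<lambda>i x. g i (f i x))"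
  shows "csurj Y Z g"
  using assms(4) cocycles_map[OF assms(1-3)] unfolding csurj_def by blast

lemma cinj_comp:
  assumes "is_complex X" "is_complex Y" "chain_map X Y f" "cinj X Y f" "cinj Y Z g"
  shows "cinj X Z (\<lambda>i x. g i (f i x))"
  using assms(4,5) cocycles_map[OF assms(1-3)] unfolding cinj_def by blast

lemma csurj_comp:
  assumes "is_complex Y" "is_complex Z" "chain_map Y Z g" "csurj X Y f" "csurj Y Z g"
  shows "csurj X Z (\<lambda>i x. g i (f i x))"
  unfolding csurj_def
proof (intro allI ballI)
  fix i y assume "y \<in> cocycles Z i"
  then obtain v where v: "v \<in> cocycles Y i" "coh Z i (g i v) y" using assms(5) unfolding csurj_def by blast
  then obtain x where "x \<in> cocycles X i" "coh Y i (f i x) v" using assms(4) unfolding csurj_def by blast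
  then show "\<exists>x\<in>cocycles X i. coh Z i (g i (f i x)) y"
    using coh_trans[OF assms(2) coh_map[OF assms(1,3)] v(2)] by blast
qed

text \<open>The morphism from \<open>P\<close> to \<open>X\<close> is represented by an honest chain
  map \<open>k\<close>, as \<open>P\<close> is liftable. Its composite with the inverse on
  \<open>P\<close> makes \<open>k\<close> injective on cohomology, the one on \<open>X\<close> makes
  it surjective. No resolution of \<open>X\<close> is available yet, so roofs from \<open>X\<close>
  are handled as they stand.\<close>

lemma isomorphic_res:
  assumes X: "is_complex X" and P: "liftable P" and iso: "isomorphic_in (derived_category scale) X P"
  shows "\<exists>q. res X P q"
proof -
  note Pc = liftable_complex[OF P]
  interpret P: resolved P P "\<lambda>i x. x" by unfold_locales (simp add: res_def P Pc QI_id)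
  obtain \<phi> \<psi> where \<phi>: "\<phi> \<in> carrier (derived_hom scale X P)" and \<psi>: "\<psi> \<in> carrier (derived_hom scale P X)"
    and 1: "derived_comp X P X \<psi> \<phi> = chain_class X X (\<lambda>i x. x)" and 2: "derived_comp P X P \<phi> \<psi> = chain_class P P (\<lambda>i x. x)"
    using iso by (auto simp: isomorphic_in_def derived_category_def)
  obtain k where k: "chain_map P X k" "\<psi> = cl P X P (\<lambda>i x. x) k" using P.derived_hom_carrier[OF X] \<psi> by blast
  have \<phi>r: "\<rho> \<in> roofs X P" if "\<rho> \<in> \<phi>" for \<rho>
    using \<phi> that by (auto simp: derived_hom_def quotient_def roof_rel_def)
  note kmem = P.cl_mem[OF X k(1)]
  have idcl: "chain_class P P (\<lambda>i x. x) = cl P P P (\<lambda>i x. x) (\<lambda>i x. x)" by (simp add: chain_class_def cl_def)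
  have "cinj P X k"
  proof -
    have "(P, \<lambda>i x. x, \<lambda>i x. x) \<in> derived_comp P X P \<phi> \<psi>"
      unfolding 2 idcl by (rule P.cl_self[OF Pc chain_map_id])
    then obtain U a b V t g W s f where m: "(V, t, g) \<in> \<psi>" "(W, s, f) \<in> \<phi>" "is_complex U" "quasi_iso U V a" "chain_map U W b"
        "homotopic_maps U X (\<lambda>i x. g i (a i x)) (\<lambda>i x. s i (b i x))"
        "(P, \<lambda>i x. x, \<lambda>i x. x) \<in> roof_class P P (U, \<lambda>i x. t i (a i x), \<lambda>i x. f i (b i x))"
      unfolding derived_comp_def comp_def by blast
    have V: "is_complex V" "QI V P t" "chain_map V X g" using m(1) k(2) kmem roofs_iff[OF Pc] by blast+
    have W: "is_complex W" "QI W X s" "chain_map W P f" using \<phi>r[OF m(2)] roofs_iff[OF X] by blast+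
    have a: "QI U V a" using quasi_iso_iff_QI[OF m(3) V(1)] m(4) by simp
    obtain v where v: "chain_map P V v" "homotopic_maps P P (\<lambda>i x. t i (v i x)) (\<lambda>i x. x)" "homotopic_maps P X (\<lambda>i x. g i (v i x)) k"
      using m(1) k(2) kmem by blast
    have "QI U P (\<lambda>i x. t i (a i x))" by (rule QI_comp[OF m(3) V(1) Pc a V(2)])
    then have r: "(U, \<lambda>i x. t i (a i x), \<lambda>i x. f i (b i x)) \<in> roofs P P"
      using roofs_iff[OF Pc] m(3) chain_map_comp[OF m(5) W(3)] by blast
    obtain u where u: "chain_map P U u" "homotopic_maps P P (\<lambda>i x. t i (a i (u i x))) (\<lambda>i x. x)"
      using P.roof_lift[OF r] by blast
    have bu: "chain_map P W (\<lambda>i x. b i (u i x))" by (rule chain_map_comp[OF u(1) m(5)])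
    have au: "chain_map P V (\<lambda>i x. a i (u i x))" by (rule chain_map_comp[OF u(1) QI_chain[OF a]])
    have fbu: "chain_map P P (\<lambda>i x. f i (b i (u i x)))" by (rule chain_map_comp[OF bu W(3)])
    have sbu: "chain_map P X (\<lambda>i x. s i (b i (u i x)))" by (rule chain_map_comp[OF bu QI_chain[OF W(2)]])
    have gv: "chain_map P X (\<lambda>i x. g i (v i x))" by (rule chain_map_comp[OF v(1) V(3)])
    have "(P, \<lambda>i x. x, \<lambda>i x. x) \<in> cl P P P (\<lambda>i x. x) (\<lambda>i x. f i (b i (u i x)))"
      using m(7) P.roof_class_eq[OF Pc r u] by simp
    then obtain w where w: "chain_map P P w" "homotopic_maps P P w (\<lambda>i x. x)" "homotopic_maps P P w (\<lambda>i x. f i (b i (u i x)))"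
      using P.cl_mem[OF Pc fbu] by auto
    have "homotopic_maps P P (\<lambda>i x. x) (\<lambda>i x. f i (b i (u i x)))"
      by (rule P.ht(2)[OF Pc fbu P.ht(1)[OF Pc chain_map_id w(2)] w(3)])
    moreover have "cinj P P (\<lambda>i x. x)" using QI_id[OF Pc] by (simp add: QI_iff)
    \<comment> \<open>From the composite on \<open>P\<close>: b u is injective on cohomology because
      f b u is homotopic to the identity; composing with the quasi-isomorphism \<open>s\<close>
      gives a map homotopic to \<open>k\<close>.\<close>
    ultimately have "cinj P P (\<lambda>i x. f i (b i (u i x)))" using cinj_homotopic[OF Pc Pc chain_map_id fbu] by blast
    then have "cinj P W (\<lambda>i x. b i (u i x))" by (rule cinj_right[OF W(1,3)])
    then have inj: "cinj P X (\<lambda>i x. s i (b i (u i x)))" using cinj_comp[OF Pc W(1) bu] W(2) by (simp add: QI_iff)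
    have tv: "chain_map P P (\<lambda>i x. t i (v i x))" by (rule chain_map_comp[OF v(1) QI_chain[OF V(2)]])
    have auv: "homotopic_maps P V (\<lambda>i x. a i (u i x)) v"
      by (rule lift_unique[OF P V(1) Pc V(2) au v(1)], rule P.ht(2)[OF Pc tv u(2)], rule P.ht(1)[OF Pc chain_map_id v(2)])
    have 3: "homotopic_maps P X (\<lambda>i x. g i (a i (u i x))) (\<lambda>i x. g i (v i x))" by (rule homotopic_comp_left[OF Pc V(1) v(1) V(3) auv])
    have 4: "homotopic_maps P X (\<lambda>i x. s i (b i (u i x))) (\<lambda>i x. g i (a i (u i x)))"
      by (rule P.ht(1)[OF X sbu homotopic_comp_right[OF m(3) u(1) m(6)]])
    have "homotopic_maps P X (\<lambda>i x. s i (b i (u i x))) k"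
      by (rule P.ht(2)[OF X k(1) P.ht(2)[OF X gv 4 3] v(3)])
    then show ?thesis using cinj_homotopic[OF Pc X sbu k(1) _ inj] by blast
  qed
  moreover have "csurj P X k"
  proof -
    have xr: "(X, \<lambda>i x. x, \<lambda>i x. x) \<in> roofs X X" using roofs_iff[OF X] X QI_id[OF X] chain_map_id by blast
    have "(X, \<lambda>i x. x, \<lambda>i x. x) \<in> chain_class X X (\<lambda>i x. x)"
      unfolding chain_class_def roof_class_def Image_singleton_iff roof_rel_iff[OF X]
      using xr X QI_id[OF X] chain_map_id[of X] homotopic_refl[OF X X chain_map_id] by blast
    then have "(X, \<lambda>i x. x, \<lambda>i x. x) \<in> derived_comp X P X \<psi> \<phi>" by (simp add: 1)
    then obtain U a b V t g W s f where m: "(W, s, f) \<in> \<phi>" "(V, t, g) \<in> \<psi>" "is_complex U" "quasi_iso U W a" "chain_map U V b"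
        "(X, \<lambda>i x. x, \<lambda>i x. x) \<in> roof_class X X (U, \<lambda>i x. s i (a i x), \<lambda>i x. g i (b i x))"
      unfolding derived_comp_def comp_def by blast
    then obtain E a1 b1 where E: "is_complex E" "chain_map E U a1" "chain_map E X b1" "QI E X (\<lambda>i x. s i (a i (a1 i x)))"
        "homotopic_maps E X (\<lambda>i x. s i (a i (a1 i x))) b1" "homotopic_maps E X (\<lambda>i x. g i (b i (a1 i x))) b1"
      unfolding roof_class_def Image_singleton_iff roof_rel_iff[OF X] by blast
    have V: "is_complex V" "QI V P t" "chain_map V X g" using m(2) k(2) kmem roofs_iff[OF Pc] by blast+
    obtain v where v: "chain_map P V v" "homotopic_maps P P (\<lambda>i x. t i (v i x)) (\<lambda>i x. x)" "homotopic_maps P X (\<lambda>i x. g i (v i x)) k"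
      using m(2) k(2) kmem by blast
    have "QI E X b1" by (rule QI_homotopic[OF E(1) X E(4,3,5)])
    then have sb: "csurj E X b1" by (simp add: QI_iff)
    have ba: "chain_map E V (\<lambda>i x. b i (a1 i x))" by (rule chain_map_comp[OF E(2) m(5)])
    have gba: "chain_map E X (\<lambda>i x. g i (b i (a1 i x)))" by (rule chain_map_comp[OF ba V(3)])
    \<comment> \<open>From the composite on \<open>X\<close>: this map is homotopic to the
      quasi-isomorphism \<open>b1\<close> and factors through \<open>g\<close>, and \<open>k\<close>
      is homotopic to \<open>g\<close> after the quasi-isomorphism \<open>v\<close>.\<close>
    have "csurj E X (\<lambda>i x. g i (b i (a1 i x)))"
      by (rule csurj_homotopic[OF E(1) X E(3) gba homotopic_sym[OF E(1) X E(3,6)] sb])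
    then have sg: "csurj V X g" by (rule csurj_left[OF E(1) V(1) ba])
    have "QI P V v" by (rule lift_QI[OF P V(1) Pc V(2) QI_id[OF Pc] v(1,2)])
    then have "csurj P X (\<lambda>i x. g i (v i x))" using csurj_comp[OF V(1) X V(3) _ sg] by (simp add: QI_iff)
    then show ?thesis using csurj_homotopic[OF Pc X chain_map_comp[OF v(1) V(3)] k(1) v(3)] by blast
  qed
  ultimately show ?thesis using k(1) X P by (auto simp: res_def QI_iff)
qed

subsection \<open>Free modules\<close>

definition vec :: "nat \<Rightarrow> (nat \<Rightarrow> 'a::zero) set" where
  "vec n = {f. \<forall>i\<ge>n. f i = 0}"

text \<open>Vectors are encoded in \<open>'m\<close> by means of \<open>j\<close>.\<close>

definition fmod :: "((nat \<Rightarrow> 'a::{ring,monoid_mult}) \<Rightarrow> 'm) \<Rightarrow> nat \<Rightarrow> ('a, 'm) module" where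
  "fmod j n = \<lparr>carrier = j ` vec n, monoid.mult = undefined, one = undefined, zero = j (\<lambda>i. 0),
     add = \<lambda>x y. j (\<lambda>i. inv_into (vec n) j x i + inv_into (vec n) j y i),
     smult = \<lambda>a x. j (\<lambda>i. inv_into (vec n) j x i * a)\<rparr>"

lemma infinite_pairing:
  assumes "infinite (UNIV :: 'm set)"
  obtains h :: "'m \<times> 'm \<Rightarrow> 'm" where "inj h"
proof -
  obtain h :: "'m \<times> 'm \<Rightarrow> 'm" where "bij_betw h (UNIV \<times> UNIV) UNIV"
    using card_of_Times_same_infinite[OF assms, unfolded card_of_ordIso[symmetric]] by blast
  then show ?thesis using that by (auto simp: bij_betw_def)
qed

text \<open>Coordinates are added one at a time by a pairing function on the infinite type. The
  encoding places free modules of finite rank in \<open>'m\<close>, where projectivity can be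
  applied to them.\<close>

lemma vec_inj:
  assumes "infinite (UNIV :: 'm set)" "inj (\<iota> :: 'a::zero \<Rightarrow> 'm)"
  shows "\<exists>j :: (nat \<Rightarrow> 'a) \<Rightarrow> 'm. inj_on j (vec n)"
proof (induction n)
  case 0
  have "vec 0 = {\<lambda>i. 0 :: 'a}" by (auto simp: vec_def)
  then show ?case by simp
next
  case (Suc n)
  then obtain j :: "(nat \<Rightarrow> 'a) \<Rightarrow> 'm" where j: "inj_on j (vec n)" by blast
  obtain h :: "'m \<times> 'm \<Rightarrow> 'm" where h: "inj h" using infinite_pairing[OF assms(1)] .
  have "inj_on (\<lambda>f. h (j (f(n := 0)), \<iota> (f n))) (vec (Suc n))"
  proof (rule inj_onI)
    fix f g :: "nat \<Rightarrow> 'a" assume fg: "f \<in> vec (Suc n)" "g \<in> vec (Suc n)" and e: "h (j (f(n := 0)), \<iota> (f n)) = h (j (g(n := 0)), \<iota> (g n))"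
    have "f(n := 0) \<in> vec n" "g(n := 0) \<in> vec n" using fg by (auto simp: vec_def le_Suc_eq not_less_eq_eq Suc_le_eq)
    moreover have "j (f(n := 0)) = j (g(n := 0))" "f n = g n" using injD[OF h e] injD[OF assms(2)] by auto
    ultimately have "f(n := 0) = g(n := 0)" "f n = g n" using inj_onD[OF j] by blast+
    then show "f = g" by (metis fun_upd_triv fun_upd_upd)
  qed
  then show ?case by blast
qed

locale free_module =
  fixes j :: "(nat \<Rightarrow> 'a::{ring,monoid_mult}) \<Rightarrow> 'm" and n :: nat
  assumes inj: "inj_on j (vec n)"
begin

abbreviation "F \<equiv> fmod j n"
abbreviation "co x \<equiv> inv_into (vec n) j x"

lemma co_j [simp]: "f \<in> vec n \<Longrightarrow> co (j f) = f"
  by (rule inv_into_f_f[OF inj])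

lemma F_simps: "carrier F = j ` vec n" "\<zero>\<^bsub>F\<^esub> = j (\<lambda>i. 0)" "x \<oplus>\<^bsub>F\<^esub> y = j (\<lambda>i. co x i + co y i)" "a \<odot>\<^bsub>F\<^esub> x = j (\<lambda>i. co x i * a)"
  by (simp_all add: fmod_def)

lemma vec_closed:
  fixes f g :: "nat \<Rightarrow> 'a"
  shows "(\<lambda>i. 0 :: 'a) \<in> vec n" "f \<in> vec n \<Longrightarrow> g \<in> vec n \<Longrightarrow> (\<lambda>i. f i + g i) \<in> vec n"
    "f \<in> vec n \<Longrightarrow> (\<lambda>i. f i * a) \<in> vec n" "f \<in> vec n \<Longrightarrow> (\<lambda>i. - f i) \<in> vec n"
  by (auto simp: vec_def)

lemma right_module_F: "right_module F"
proof -
  have "abelian_group F"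
  proof (rule abelian_groupI)
    fix x assume "x \<in> carrier F"
    then obtain f where f: "f \<in> vec n" "x = j f" by (auto simp: F_simps)
    then have "j (\<lambda>i. - f i) \<in> carrier F \<and> j (\<lambda>i. - f i) \<oplus>\<^bsub>F\<^esub> x = \<zero>\<^bsub>F\<^esub>"
      by (simp add: F_simps vec_closed)
    then show "\<exists>y\<in>carrier F. y \<oplus>\<^bsub>F\<^esub> x = \<zero>\<^bsub>F\<^esub>" by blast
  qed (auto simp: F_simps vec_closed algebra_simps)
  then show ?thesis
    unfolding right_module_def right_module_axioms_def by (auto simp: F_simps vec_closed distrib_left distrib_right mult.assoc)
qed

definition "bv i = j (\<lambda>k. if k = i then 1 else 0)"

lemma unit_vec: "i < n \<Longrightarrow> (\<lambda>k. if k = i then 1 else 0 :: 'a) \<in> vec n"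
  by (auto simp: vec_def)

lemma co_bv: "i < n \<Longrightarrow> co (bv i) k = (if k = i then 1 else 0)"
  by (simp add: bv_def unit_vec)

lemma dbasis_F: "dbasis F n bv (\<lambda>i x. co x i)"
proof -
  interpret right_module F by (rule right_module_F)
  have fs: "(\<Oplus>\<^bsub>F\<^esub>i\<in>{..<m}. f i \<odot>\<^bsub>F\<^esub> bv i) = j (\<lambda>i. if i < m then f i else 0)" if f: "f \<in> vec n" and m: "m \<le> n" for f m
    using m
  proof (induction m)
    case 0
    then show ?case by (simp add: F_simps)
  next
    case (Suc m)
    have v: "(\<lambda>i. if i < m then f i else 0) \<in> vec n" using Suc f by (auto simp: vec_def)
    have b: "bv i \<in> carrier F" if "i < n" for i using unit_vec[OF that] by (simp add: bv_def F_simps)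
    have s: "f m \<odot>\<^bsub>F\<^esub> bv m = j (\<lambda>i. if i = m then f m else 0)"
      using Suc by (simp add: F_simps co_bv) (rule arg_cong[of _ _ j], auto)
    have v': "(\<lambda>i. if i = m then f m else 0) \<in> vec n" using Suc by (auto simp: vec_def)
    have "(\<Oplus>\<^bsub>F\<^esub>i\<in>{..<Suc m}. f i \<odot>\<^bsub>F\<^esub> bv i) = f m \<odot>\<^bsub>F\<^esub> bv m \<oplus>\<^bsub>F\<^esub> (\<Oplus>\<^bsub>F\<^esub>i\<in>{..<m}. f i \<odot>\<^bsub>F\<^esub> bv i)"
      unfolding lessThan_Suc by (rule finsum_insert) (use Suc b smult_closed in auto)
    also have "\<dots> = j (\<lambda>i. (if i = m then f m else 0) + (if i < m then f i else 0))"
      using Suc v v' unfolding s by (simp add: F_simps)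
    also have "\<dots> = j (\<lambda>i. if i < Suc m then f i else 0)"
      by (rule arg_cong[of _ _ j]) (auto simp: fun_eq_iff less_Suc_eq)
    finally show ?case .
  qed
  have "x = (\<Oplus>\<^bsub>F\<^esub>i\<in>{..<n}. co x i \<odot>\<^bsub>F\<^esub> bv i)" if x: "x \<in> carrier F" for x
  proof -
    obtain f where f: "f \<in> vec n" "x = j f" using x by (auto simp: F_simps)
    have "(\<lambda>i. if i < n then f i else 0) = f" using f(1) by (auto simp: vec_def fun_eq_iff)
    then show ?thesis using fs[OF f(1) order_refl] f by simp
  qed
  moreover have "bv i \<in> carrier F" if "i < n" for i using unit_vec[OF that] by (simp add: bv_def F_simps)
  ultimately show ?thesis unfolding dbasis_def by (auto simp: F_simps vec_closed)
qed

end

lemma dbasis_projective: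
  fixes P :: "('a::{ring,monoid_mult}, 'm) module"
  assumes P: "right_module P" and b: "dbasis P n b c"
  shows "projective P"
  unfolding projective_def
proof (intro conjI allI impI P)
  fix M N :: "('a, 'm) module" and g h
  assume a: "right_module M \<and> right_module N \<and> g \<in> rmod_hom M N \<and> g ` carrier M = carrier N \<and> h \<in> rmod_hom P N"
  then interpret M: right_module M by blast
  interpret N: right_module N using a by blast
  have g: "g \<in> rmod_hom M N" and h: "h \<in> rmod_hom P N" using a by auto
  have "\<exists>y. i < n \<longrightarrow> y \<in> carrier M \<and> g y = h (b i)" for i
    using a rmod_homD(1)[OF h] dbasisD(1)[OF b] by (metis image_iff)
  then obtain y where y: "\<And>i. i < n \<Longrightarrow> y i \<in> carrier M" "\<And>i. i < n \<Longrightarrow> g (y i) = h (b i)" by metis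
  let ?l = "\<lambda>x. \<Oplus>\<^bsub>M\<^esub>i\<in>{..<n}. c i x \<odot>\<^bsub>M\<^esub> y i"
  have l: "?l \<in> rmod_hom P M" by (rule dbasis_hom[OF P M.right_module_axioms b y(1)])
  have "g (?l x) = h x" if x: "x \<in> carrier P" for x
  proof -
    have "g (?l x) = (\<Oplus>\<^bsub>N\<^esub>i\<in>{..<n}. g (c i x \<odot>\<^bsub>M\<^esub> y i))"
      by (rule rmod_hom_finsum[OF M.right_module_axioms N.right_module_axioms g]) (auto intro: M.smult_closed y)
    also have "\<dots> = (\<Oplus>\<^bsub>N\<^esub>i\<in>{..<n}. c i x \<odot>\<^bsub>N\<^esub> h (b i))"
      by (rule N.finsum_cong') (auto simp: rmod_homD(3)[OF g] y intro: N.smult_closed rmod_homD(1)[OF h] dbasisD(1)[OF b])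
    also have "\<dots> = h x" by (rule dbasis_expand[OF P N.right_module_axioms b h x, symmetric])
    finally show ?thesis .
  qed
  then show "\<exists>l\<in>rmod_hom P M. \<forall>x\<in>carrier P. g (l x) = h x" using l by (intro bexI[of _ ?l] ballI)
qed

lemma finsum_in_submodule:
  assumes P: "right_module P" and N: "additive_subgroup N P" "\<And>a x. x \<in> N \<Longrightarrow> a \<odot>\<^bsub>P\<^esub> x \<in> N"
    and b: "finite A" "\<And>i. i \<in> A \<Longrightarrow> b i \<in> N"
  shows "(\<Oplus>\<^bsub>P\<^esub>i\<in>A. c i \<odot>\<^bsub>P\<^esub> b i) \<in> N"
proof -
  interpret right_module P by (rule P)
  interpret N: additive_subgroup N P by (rule N)
  have sub: "x \<in> carrier P" if "x \<in> N" for x using N.a_subset that by blast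
  show ?thesis using b
  proof (induction A rule: finite_induct)
    case (insert i A)
    have "(\<Oplus>\<^bsub>P\<^esub>i\<in>insert i A. c i \<odot>\<^bsub>P\<^esub> b i) = c i \<odot>\<^bsub>P\<^esub> b i \<oplus>\<^bsub>P\<^esub> (\<Oplus>\<^bsub>P\<^esub>i\<in>A. c i \<odot>\<^bsub>P\<^esub> b i)"
      by (rule finsum_insert) (use insert sub smult_closed in auto)
    then show ?case using insert N N.a_closed by simp
  qed simp
qed

lemma dbasis_fin_gen:
  assumes P: "right_module P" and b: "dbasis P n b c"
  shows "fin_gen P"
  unfolding fin_gen_def
proof (intro exI[of _ "b ` {..<n}"] conjI allI impI)
  show "b ` {..<n} \<subseteq> carrier P" using dbasisD(1)[OF b] by blast
  fix N assume N: "additive_subgroup N P \<and> (\<forall>a. \<forall>x\<in>N. a \<odot>\<^bsub>P\<^esub> x \<in> N) \<and> b ` {..<n} \<subseteq> N"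
  interpret N: additive_subgroup N P using N by blast
  have "x \<in> N" if "x \<in> carrier P" for x
    using finsum_in_submodule[OF P N.additive_subgroup_axioms, of "{..<n}" b "\<lambda>i. c i x"] dbasisD(4)[OF b that] N by auto
  then show "N = carrier P" using N.a_subset by blast
qed simp

text \<open>The map from an encoded free module onto \<open>P\<close> splits by projectivity; the
  coordinates of the section, with the images of the unit vectors, form a dual basis.\<close>

lemma projective_dbasis:
  fixes P :: "('a::{ring,monoid_mult}, 'm) module"
  assumes P: "projective P" "fin_gen P" and inj: "\<And>n. \<exists>j :: (nat \<Rightarrow> 'a) \<Rightarrow> 'm. inj_on j (vec n)"
  shows "\<exists>n b c. dbasis P n b c"
proof -
  have Pm: "right_module P" using P(1) by (simp add: projective_def)
  interpret P: right_module P by (rule Pm)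
  from P(2)[unfolded fin_gen_def] obtain S where S: "finite S" "S \<subseteq> carrier P"
    and gen: "\<forall>N. additive_subgroup N P \<and> (\<forall>a. \<forall>x\<in>N. a \<odot>\<^bsub>P\<^esub> x \<in> N) \<and> S \<subseteq> N \<longrightarrow> N = carrier P"
    by (elim exE conjE)
  obtain n and s :: "nat \<Rightarrow> 'm" where s: "S = s ` {i. i < n}" using finite_imp_nat_seg_image_inj_on[OF S(1)] by blast
  have sc: "s i \<in> carrier P" if "i < n" for i using s S(2) that by blast
  obtain j :: "(nat \<Rightarrow> 'a) \<Rightarrow> 'm" where "inj_on j (vec n)" using inj by blast
  then interpret F: free_module j n by unfold_locales
  interpret Fm: right_module F.F by (rule F.right_module_F)
  define g where "g x = (\<Oplus>\<^bsub>P\<^esub>i\<in>{..<n}. F.co x i \<odot>\<^bsub>P\<^esub> s i)" for x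
  have g: "g \<in> rmod_hom F.F P"
    unfolding g_def[abs_def] by (rule dbasis_hom[OF F.right_module_F Pm F.dbasis_F sc])
  note gd = rmod_homD[OF g]
  have gb: "g (F.bv i) = s i" if i: "i < n" for i
  proof -
    have "g (F.bv i) = (\<Oplus>\<^bsub>P\<^esub>k\<in>{..<n}. if i = k then s k else \<zero>\<^bsub>P\<^esub>)"
      unfolding g_def by (rule P.finsum_cong') (use i sc F.co_bv P.smult_one in auto)
    then show ?thesis using P.finsum_singleton[of i "{..<n}" s] i sc by auto
  qed
  have "g ` carrier F.F = carrier P"
  proof (rule gen[rule_format], intro conjI allI ballI)
    show "additive_subgroup (g ` carrier F.F) P"
    proof (rule additive_subgroup.intro, rule group.subgroupI[OF P.a_group])
      show "g ` carrier F.F \<subseteq> carrier (add_monoid P)" using gd(1) by auto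
      show "g ` carrier F.F \<noteq> {}" using Fm.zero_closed by blast
      fix x assume "x \<in> g ` carrier F.F"
      then obtain u where u: "u \<in> carrier F.F" "x = g u" by blast
      then have "\<ominus>\<^bsub>P\<^esub> x = g (\<ominus>\<^bsub>F.F\<^esub> u)" using rmod_hom_neg[OF F.right_module_F Pm g] by simp
      then show "inv\<^bsub>add_monoid P\<^esub> x \<in> g ` carrier F.F" using u unfolding a_inv_def[symmetric] by simp
      fix y assume "y \<in> g ` carrier F.F"
      then obtain v where v: "v \<in> carrier F.F" "y = g v" by blast
      show "x \<otimes>\<^bsub>add_monoid P\<^esub> y \<in> g ` carrier F.F"
        using gd(2)[OF u(1) v(1)] u v by (auto intro!: image_eqI[of _ g "u \<oplus>\<^bsub>F.F\<^esub> v"])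
    qed
    show "a \<odot>\<^bsub>P\<^esub> x \<in> g ` carrier F.F" if "x \<in> g ` carrier F.F" for a x
      using that gd(3) Fm.smult_closed by (metis (no_types, lifting) image_iff)
    show "S \<subseteq> g ` carrier F.F"
      using s gb dbasisD(1)[OF F.dbasis_F] by (auto simp: image_iff) metis
  qed
  moreover have "(\<lambda>x. x) \<in> rmod_hom P P" by (simp add: rmod_hom_def)
  ultimately obtain l where l: "l \<in> rmod_hom P F.F" "\<And>x. x \<in> carrier P \<Longrightarrow> g (l x) = x"
    using P(1) F.right_module_F Pm g unfolding projective_def by meson
  note F = dbasisD[OF F.dbasis_F]
  have "dbasis P n s (\<lambda>i x. F.co (l x) i)"
    unfolding dbasis_def using sc F(2,3) rmod_homD[OF l(1)] l(2) by (simp add: g_def)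
  then show ?thesis by blast
qed

lemma strictly_perfect_liftable:
  fixes P :: "('a::{ring,monoid_mult}, 'm) cplx"
  assumes P: "strictly_perfect P" and inj: "\<And>n. \<exists>j :: (nat \<Rightarrow> 'a) \<Rightarrow> 'm. inj_on j (vec n)"
  shows "liftable P \<and> finite {i. cc P i \<noteq> {cz P i}}"
proof -
  have f: "finite {i. cc P i \<noteq> {cz P i}}" using P by (simp add: strictly_perfect_def)
  have "cc P i = {cz P i}" if "i > Max (insert 0 {i. cc P i \<noteq> {cz P i}})" for i
    using that f Max_ge[of "insert 0 {i. cc P i \<noteq> {cz P i}}" i] by (metis (mono_tags, lifting) finite_insert insertCI linorder_not_less mem_Collect_eq)
  then show ?thesis using P f projective_dbasis[OF _ _ inj] unfolding liftable_def strictly_perfect_def by blast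
qed

section \<open>The algebra as a perfect complex in degree 0\<close>

definition unit_cplx :: "((nat \<Rightarrow> 'a::{ring,monoid_mult}) \<Rightarrow> 'm) \<Rightarrow> ('a, 'm) cplx" where
  "unit_cplx j = \<lparr>cmodule = \<lambda>i. fmod j (if i = 0 then 1 else 0),
     cdif = \<lambda>i. \<lambda>x\<in>carrier (fmod j (if i = 0 then 1 else 0)). \<zero>\<^bsub>fmod j (if i + 1 = 0 then 1 else 0)\<^esub>\<rparr>"

lemma vec_mono: "m \<le> n \<Longrightarrow> vec m \<subseteq> vec n"
  by (auto simp: vec_def)

lemma free_module_le: "inj_on j (vec n) \<Longrightarrow> m \<le> n \<Longrightarrow> free_module j m"
  by unfold_locales (meson inj_on_subset vec_mono)

lemma unit_cplx_simps: "cmodule (unit_cplx j) i = fmod j (if i = 0 then 1 else 0)"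
  by (simp add: unit_cplx_def)

lemma fmod_0_carrier: "carrier (fmod (j :: (nat \<Rightarrow> 'a::{ring,monoid_mult}) \<Rightarrow> 'm) 0) = {\<zero>\<^bsub>fmod j 0\<^esub>}"
proof -
  have "vec 0 = {\<lambda>i. 0 :: 'a}" by (auto simp: vec_def)
  then show ?thesis by (simp add: fmod_def)
qed

lemma strictly_perfect_unit_cplx:
  assumes "inj_on j (vec 1)"
  shows "strictly_perfect (unit_cplx j)"
proof -
  have fm: "free_module j (if i = 0 then 1 else 0)" for i :: int using free_module_le[OF assms, of 1] free_module_le[OF assms, of 0] by simp
  note rm = free_module.right_module_F[OF fm] and db = free_module.dbasis_F[OF fm]
  have "is_complex (unit_cplx j)"
    unfolding is_complex_def
  proof (intro allI conjI ballI)
    fix i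
    show "right_module (cmodule (unit_cplx j) i)" using rm by (simp only: unit_cplx_simps)
    have "cdif (unit_cplx j) i \<in> rmod_hom (cmodule (unit_cplx j) i) (cmodule (unit_cplx j) (i + 1))"
      unfolding unit_cplx_simps unfolding unit_cplx_def
    proof (rule rmod_homI)
      interpret A: right_module "fmod j (if i = 0 then 1 else 0)" by (rule rm)
      interpret B: right_module "fmod j (if i + 1 = 0 then 1 else 0)" by (rule rm)
      let ?A = "fmod j (if i = 0 then 1 else 0)" let ?B = "fmod j (if i + 1 = 0 then 1 else 0)"
      let ?d = "cdif \<lparr>cmodule = \<lambda>i. fmod j (if i = 0 then 1 else 0), cdif = \<lambda>i. \<lambda>x\<in>carrier (fmod j (if i = 0 then 1 else 0)). \<zero>\<^bsub>fmod j (if i + 1 = 0 then 1 else 0)\<^esub>\<rparr> i"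
      show "?d x \<in> carrier ?B" if "x \<in> carrier ?A" for x using that B.zero_closed by (simp del: if_split)
      show "?d (x \<oplus>\<^bsub>?A\<^esub> y) = ?d x \<oplus>\<^bsub>?B\<^esub> ?d y" if "x \<in> carrier ?A" "y \<in> carrier ?A" for x y
        using that A.a_closed B.l_zero[OF B.zero_closed] by (simp del: if_split)
      show "?d (a \<odot>\<^bsub>?A\<^esub> x) = a \<odot>\<^bsub>?B\<^esub> ?d x" if "x \<in> carrier ?A" for a x
        using that A.smult_closed B.smult_zero by (simp del: if_split)
    qed
    moreover have "cdif (unit_cplx j) i \<in> extensional (cc (unit_cplx j) i)" by (simp add: unit_cplx_def)
    ultimately show "cdif (unit_cplx j) i \<in> rmod_hom (cmodule (unit_cplx j) i) (cmodule (unit_cplx j) (i + 1)) \<inter> extensional (cc (unit_cplx j) i)"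
      by blast
    fix x assume x: "x \<in> cc (unit_cplx j) i"
    interpret B: right_module "fmod j (if i + 1 = 0 then 1 else 0)" by (rule rm)
    have "cdif (unit_cplx j) i x = \<zero>\<^bsub>fmod j (if i + 1 = 0 then 1 else 0)\<^esub>"
      using x unfolding unit_cplx_simps by (simp add: unit_cplx_def del: if_split)
    moreover have "cdif (unit_cplx j) (i + 1) \<zero>\<^bsub>fmod j (if i + 1 = 0 then 1 else 0)\<^esub> = \<zero>\<^bsub>fmod j (if i + 1 + 1 = 0 then 1 else 0)\<^esub>"
      using B.zero_closed by (simp add: unit_cplx_def del: if_split)
    ultimately show "cdif (unit_cplx j) (i + 1) (cdif (unit_cplx j) i x) = cz (unit_cplx j) (i + 2)"
      by (simp add: unit_cplx_simps add.assoc)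
  qed
  moreover have "{i. cc (unit_cplx j) i \<noteq> {cz (unit_cplx j) i}} \<subseteq> {0}"
    using fmod_0_carrier[of j] by (auto simp: unit_cplx_simps)
  then have "finite {i. cc (unit_cplx j) i \<noteq> {cz (unit_cplx j) i}}" by (rule finite_subset) simp
  moreover have "projective (cmodule (unit_cplx j) i) \<and> fin_gen (cmodule (unit_cplx j) i)" for i
    unfolding unit_cplx_simps using dbasis_projective[OF rm db] dbasis_fin_gen[OF rm db] by blast
  ultimately show ?thesis by (simp add: strictly_perfect_def)
qed

lemma perfect_res:
  fixes scale :: "'k::field \<Rightarrow> 'a::{ring,monoid_mult} \<Rightarrow> 'a" and X :: "('a, 'm) cplx"
  assumes inj: "\<And>n. \<exists>j :: (nat \<Rightarrow> 'a) \<Rightarrow> 'm. inj_on j (vec n)" and X: "X \<in> Obj (perfect_category scale)"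
  shows "\<exists>P q. res X P q \<and> finite {i. cc P i \<noteq> {cz P i}}"
proof -
  obtain P :: "('a, 'm) cplx" where P: "is_complex X" "strictly_perfect P" "isomorphic_in (derived_category scale) X P"
    using X by (auto simp: perfect_category_def)
  then show ?thesis using isomorphic_res[OF P(1) _ P(3)] strictly_perfect_liftable[OF P(2) inj] by blast
qed

lemma unit_cplx_perfect:
  fixes scale :: "'k::field \<Rightarrow> 'a::{ring,monoid_mult} \<Rightarrow> 'a" and j :: "(nat \<Rightarrow> 'a) \<Rightarrow> 'm"
  assumes inj: "\<And>n. \<exists>j :: (nat \<Rightarrow> 'a) \<Rightarrow> 'm. inj_on j (vec n)" and j: "inj_on j (vec 1)"
  shows "res (unit_cplx j) (unit_cplx j) (\<lambda>i x. x)" "unit_cplx j \<in> Obj (perfect_category scale)"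
proof -
  let ?X = "unit_cplx j"
  have sp: "strictly_perfect ?X" by (rule strictly_perfect_unit_cplx[OF j])
  then have X: "is_complex ?X" and l: "liftable ?X" using strictly_perfect_liftable[OF sp inj] by (auto simp: strictly_perfect_def)
  show r: "res ?X ?X (\<lambda>i x. x)" by (simp add: res_def X l QI_id)
  interpret resolved ?X ?X "\<lambda>i x. x" by unfold_locales (rule r)
  let ?I = "cl ?X ?X ?X (\<lambda>i x. x) (\<lambda>i x. x)"
  have "derived_comp ?X ?X ?X ?I ?I = ?I"
    by (rule derived_comp_cl[OF r X chain_map_id chain_map_id chain_map_id]) (use ht(3)[OF X chain_map_id] cl_self[OF X chain_map_id] in auto)
  moreover have "?I \<in> carrier (derived_hom scale ?X ?X)" using derived_hom_carrier[OF X] chain_map_id by blast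
  moreover have "chain_class ?X ?X (\<lambda>i x. x) = ?I" by (simp add: chain_class_def cl_def)
  ultimately have "isomorphic_in (derived_category scale) ?X ?X"
    by (auto simp: isomorphic_in_def derived_category_def)
  then show "?X \<in> Obj (perfect_category scale)" using X sp by (auto simp: perfect_category_def)
qed

subsection \<open>Matrices of morphisms\<close>

text \<open>Ranks, generators and coordinate functions of dual bases of the terms of a complex.\<close>

record ('a, 'm) cbas =
  crk :: "int \<Rightarrow> nat"
  cbs :: "int \<Rightarrow> nat \<Rightarrow> 'm"
  cco :: "int \<Rightarrow> nat \<Rightarrow> 'm \<Rightarrow> 'a"

definition is_cbas :: "('a::{ring,monoid_mult}, 'm) cplx \<Rightarrow> ('a, 'm) cbas \<Rightarrow> bool" where
  "is_cbas P D \<longleftrightarrow> is_complex P \<and> (\<forall>i. dbasis (cmodule P i) (crk D i) (cbs D i) (cco D i)) \<and> finite {i. crk D i \<noteq> 0}"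

definition gh :: "int \<Rightarrow> ('a::{ring,monoid_mult}, 'm) cplx \<Rightarrow> ('a, 'm) cplx \<Rightarrow> (int \<Rightarrow> 'm \<Rightarrow> 'm) set" where
  "gh n P Q = {f. \<forall>i. f i \<in> rmod_hom (cmodule P i) (cmodule Q (i + n))}"

text \<open>Columns are generators of the source and rows are coordinate functions of the target.
  Since coordinates are not unique, the identity goes to an idempotent whose image is the module,
  not to an identity matrix.\<close>

definition mt :: "('a::{ring,monoid_mult}, 'm) cbas \<Rightarrow> ('a, 'm) cbas \<Rightarrow> int \<Rightarrow> (int \<Rightarrow> 'm \<Rightarrow> 'm) \<Rightarrow> 'a imat" where
  "mt D E n f = Imat (\<lambda>u v. if dg u = dg v + n \<and> pos u < crk E (dg v + n) \<and> pos v < crk D (dg v)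
     then cco E (dg v + n) (pos u) (f (dg v) (cbs D (dg v) (pos v))) else 0)"

text \<open>A zero module admits dual bases of any rank; rank 0 is imposed on zero terms so that all
  matrices have finite support.\<close>

lemma liftable_cbas:
  assumes P: "liftable P" "finite {i. cc P i \<noteq> {cz P i}}"
  obtains D where "is_cbas P D"
proof -
  note Pc = liftable_complex[OF P(1)]
  have "\<exists>n b c. dbasis (cmodule P i) n b c \<and> (cc P i = {cz P i} \<longrightarrow> n = 0)" for i
  proof (cases "cc P i = {cz P i}")
    case True
    interpret right_module "cmodule P i" by (rule cmod[OF Pc])
    have "dbasis (cmodule P i) 0 b c" for b c using True by (simp add: dbasis_def)
    then show ?thesis by blast
  next
    case False
    from P(1) have "\<exists>n b c. dbasis (cmodule P i) n b c" by (simp add: liftable_def)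
    then show ?thesis using False by simp
  qed
  then obtain n b c where d: "\<And>i. dbasis (cmodule P i) (n i) (b i) (c i)" "\<And>i. cc P i = {cz P i} \<Longrightarrow> n i = 0"
    by metis
  have "{i. n i \<noteq> 0} \<subseteq> {i. cc P i \<noteq> {cz P i}}" by (intro subsetI CollectI notI) (simp add: d(2))
  then have "finite {i. n i \<noteq> 0}" using P(2) by (rule finite_subset)
  then have "is_cbas P \<lparr>crk = n, cbs = b, cco = c\<rparr>" using d(1) Pc by (simp add: is_cbas_def)
  then show ?thesis by (rule that)
qed

lemma ghI: "(\<And>i. f i \<in> rmod_hom (cmodule P i) (cmodule Q (i + n))) \<Longrightarrow> f \<in> gh n P Q"
  by (simp add: gh_def)

lemma ghD: "f \<in> gh n P Q \<Longrightarrow> f i \<in> rmod_hom (cmodule P i) (cmodule Q (i + n))"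
  by (simp add: gh_def)

lemma gh_comp: "f \<in> gh m P Q \<Longrightarrow> g \<in> gh n Q R \<Longrightarrow> (\<lambda>i x. g (i + m) (f i x)) \<in> gh (m + n) P R"
  unfolding gh_def using rmod_hom_comp by (fastforce simp: add.assoc)

lemma gh_id: "(\<lambda>i x. x) \<in> gh 0 P P"
  by (simp add: gh_def rmod_hom_def)

lemma gh_cdif: "is_complex P \<Longrightarrow> cdif P \<in> gh 1 P P"
  using cdif_hom by (auto simp: gh_def)

lemma gh_add: "is_complex Q \<Longrightarrow> f \<in> gh n P Q \<Longrightarrow> g \<in> gh n P Q \<Longrightarrow> (\<lambda>i x. ca Q (i + n) (f i x) (g i x)) \<in> gh n P Q"
  by (rule ghI) (rule rmod_hom_add[OF cmod ghD ghD])

lemma gh_sgn: "is_complex Q \<Longrightarrow> f \<in> gh n P Q \<Longrightarrow> (\<lambda>i x. sgn_pow (cmodule Q (i + n)) k (f i x)) \<in> gh n P Q"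
  by (rule ghI) (rule rmod_hom_sgn_comp[OF cmod ghD])

lemma gh_chain: "chain_map P (shift n Q) f \<Longrightarrow> f \<in> gh n P Q"
  using chain_hom by (fastforce simp: gh_def)

context
  fixes P Q :: "('a::{ring,monoid_mult}, 'm) cplx" and D E
  assumes D: "is_cbas P D" and E: "is_cbas Q E"
begin

lemma cb_c: "is_complex P" "is_complex Q"
  using D E by (auto simp: is_cbas_def)

lemma cb_d: "dbasis (cmodule P i) (crk D i) (cbs D i) (cco D i)" "dbasis (cmodule Q i) (crk E i) (cbs E i) (cco E i)"
  using D E by (auto simp: is_cbas_def)

lemma finite_ixs: "finite {u. pos u < crk D (dg u)}"
proof -
  have "{u. pos u < crk D (dg u)} \<subseteq> (\<lambda>(i, a). Ix i a) ` (SIGMA i:{i. crk D i \<noteq> 0}. {..<crk D i})"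
  proof
    fix u assume "u \<in> {u. pos u < crk D (dg u)}"
    then show "u \<in> (\<lambda>(i, a). Ix i a) ` (SIGMA i:{i. crk D i \<noteq> 0}. {..<crk D i})"
      by (intro image_eqI[of _ _ "(dg u, pos u)"]) auto
  qed
  moreover have "finite (SIGMA i:{i. crk D i \<noteq> 0}. {..<crk D i})" using D by (auto simp: is_cbas_def)
  ultimately show ?thesis by (meson finite_imageI finite_subset)
qed

lemma coord_finsum:
  assumes a: "a < crk D i" and A: "finite A" "\<And>k. k \<in> A \<Longrightarrow> x k \<in> cc P i"
  shows "cco D i a (finsum (cmodule P i) x A) = (\<Sum>k\<in>A. cco D i a (x k))"
proof -
  interpret right_module "cmodule P i" by (rule cmod[OF cb_c(1)])
  note d = dbasisD[OF cb_d(1)]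
  have "cco D i a (cz P i) = cco D i a (0 \<odot>\<^bsub>cmodule P i\<^esub> cz P i)" by simp
  also have "\<dots> = 0" using d(3)[OF a zero_closed, of 0] by simp
  finally have z: "cco D i a (cz P i) = 0" .
  show ?thesis using A
    by (induction A rule: finite_induct) (auto simp: z d(2)[OF a] Pi_def finsum_closed)
qed

lemma coord_comb:
  assumes a: "a < crk D i" and x: "\<And>k. k < (m :: nat) \<Longrightarrow> x k \<in> cc P i"
  shows "cco D i a (\<Oplus>\<^bsub>cmodule P i\<^esub>k\<in>{..<m}. r k \<odot>\<^bsub>cmodule P i\<^esub> x k) = (\<Sum>k<m. cco D i a (x k) * r k)"
proof -
  interpret right_module "cmodule P i" by (rule cmod[OF cb_c(1)])
  have "cco D i a (\<Oplus>\<^bsub>cmodule P i\<^esub>k\<in>{..<m}. r k \<odot>\<^bsub>cmodule P i\<^esub> x k) = (\<Sum>k<m. cco D i a (r k \<odot>\<^bsub>cmodule P i\<^esub> x k))"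
    using coord_finsum[of a i "{..<m}" "\<lambda>k. r k \<odot>\<^bsub>cmodule P i\<^esub> x k"] a by (simp add: smult_closed x)
  also have "\<dots> = (\<Sum>k<m. cco D i a (x k) * r k)" using dbasisD(3)[OF cb_d(1) a] x by (intro sum.cong) auto
  finally show ?thesis .
qed

lemma sum_ixs:
  assumes "\<And>w. g w \<noteq> 0 \<Longrightarrow> dg w = i \<and> pos w < crk D i"
  shows "(\<Sum>w\<in>{u. pos u < crk D (dg u)}. g w) = (\<Sum>k<crk D i. g (Ix i k) :: 'a)"
proof -
  have "(\<Sum>k<crk D i. g (Ix i k)) = (\<Sum>w\<in>Ix i ` {..<crk D i}. g w)" by (subst sum.reindex) (auto simp: inj_on_def)
  also have "\<dots> = (\<Sum>w\<in>{u. pos u < crk D (dg u)}. g w)"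
  proof (rule sum.mono_neutral_left[OF finite_ixs])
    show "Ix i ` {..<crk D i} \<subseteq> {u. pos u < crk D (dg u)}" by auto
    show "\<forall>w\<in>{u. pos u < crk D (dg u)} - Ix i ` {..<crk D i}. g w = 0"
    proof
      fix w assume w: "w \<in> {u. pos u < crk D (dg u)} - Ix i ` {..<crk D i}"
      show "g w = 0"
      proof (rule ccontr)
        assume "g w \<noteq> 0"
        then have "w \<in> Ix i ` {..<crk D i}" using assms[of w] by (intro image_eqI[of _ _ "pos w"]) auto
        then show False using w by blast
      qed
    qed
  qed
  finally show ?thesis ..
qed

end

context
  fixes P Q :: "('a::{ring,monoid_mult}, 'm) cplx" and D E
  assumes D: "is_cbas P D" and E: "is_cbas Q E"
begin

lemma ent_mt: "ent (mt D E n f) u v = (if dg u = dg v + n \<and> pos u < crk E (dg v + n) \<and> pos v < crk D (dg v)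
     then cco E (dg v + n) (pos u) (f (dg v) (cbs D (dg v) (pos v))) else 0)"
  unfolding mt_def
  by (subst ent_Imat[of "{u. pos u < crk D (dg u)} \<union> {u. pos u < crk E (dg u)}"])
    (auto split: if_splits intro: finite_ixs[OF D E] finite_ixs[OF E D])

lemma hdeg_mt: "hdeg n (mt D E n f)"
  by (simp add: hdeg_def ent_mt)

lemma mt_cong: "(\<And>i x. x \<in> cc P i \<Longrightarrow> f i x = g i x) \<Longrightarrow> mt D E n f = mt D E n g"
  by (rule imat_eqI) (simp add: ent_mt dbasisD(1)[OF cb_d(1)[OF D E]])

lemma gh_closed: "f \<in> gh n P Q \<Longrightarrow> x \<in> cc P i \<Longrightarrow> f i x \<in> cc Q (i + n)"
  using rmod_homD(1)[OF ghD] .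

lemma bs_closed: "pos v < crk D (dg v) \<Longrightarrow> cbs D (dg v) (pos v) \<in> cc P (dg v)"
  by (rule dbasisD(1)[OF cb_d(1)[OF D E]])

lemma mt_add:
  assumes "f \<in> gh n P Q" "g \<in> gh n P Q"
  shows "mt D E n (\<lambda>i x. ca Q (i + n) (f i x) (g i x)) = mt D E n f + mt D E n g"
proof (rule imat_eqI)
  fix u v
  have "cco E (dg v + n) (pos u) (ca Q (dg v + n) (f (dg v) y) (g (dg v) y))
    = cco E (dg v + n) (pos u) (f (dg v) y) + cco E (dg v + n) (pos u) (g (dg v) y)"
    if "pos u < crk E (dg v + n)" "y \<in> cc P (dg v)" for y
    by (rule dbasisD(2)[OF cb_d(2)[OF D E] that(1)]) (use that gh_closed assms in auto)
  then show "ent (mt D E n (\<lambda>i x. ca Q (i + n) (f i x) (g i x))) u v = ent (mt D E n f + mt D E n g) u v"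
    by (simp add: ent_mt ent_simps bs_closed)
qed

lemma coord_zero: "a < crk E i \<Longrightarrow> cco E i a (cz Q i) = 0"
proof -
  assume a: "a < crk E i"
  interpret right_module "cmodule Q i" by (rule cmod[OF cb_c(2)[OF D E]])
  have "cco E i a (finsum (cmodule Q i) (\<lambda>k. \<zero>\<^bsub>cmodule Q i\<^esub>) ({} :: nat set)) = 0"
    by (subst coord_finsum[OF E D a]) simp_all
  then show ?thesis by simp
qed

lemma mt_zero: "mt D E n (\<lambda>i x. cz Q (i + n)) = 0"
  by (rule imat_eqI) (simp add: ent_mt ent_simps coord_zero)

lemma coord_neg: "a < crk E i \<Longrightarrow> x \<in> cc Q i \<Longrightarrow> cco E i a (cn Q i x) = - cco E i a x"
proof -
  assume a: "a < crk E i" and x: "x \<in> cc Q i"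
  interpret right_module "cmodule Q i" by (rule cmod[OF cb_c(2)[OF D E]])
  have "cco E i a (cn Q i x) + cco E i a x = 0"
    using dbasisD(2)[OF cb_d(2)[OF D E] a a_inv_closed[OF x] x] coord_zero[OF a] x by (simp add: l_neg)
  then show ?thesis by (simp add: eq_neg_iff_add_eq_0)
qed

lemma mt_sgn:
  assumes "f \<in> gh n P Q"
  shows "mt D E n (\<lambda>i x. sgn_pow (cmodule Q (i + n)) k (f i x)) = sg k (mt D E n f)"
proof (rule imat_eqI)
  fix u v
  have "cco E (dg v + n) (pos u) (cn Q (dg v + n) (f (dg v) y)) = - cco E (dg v + n) (pos u) (f (dg v) y)"
    if "pos u < crk E (dg v + n)" "y \<in> cc P (dg v)" for y
    by (rule coord_neg[OF that(1) gh_closed[OF assms that(2)]])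
  then show "ent (mt D E n (\<lambda>i x. sgn_pow (cmodule Q (i + n)) k (f i x))) u v = ent (sg k (mt D E n f)) u v"
    by (simp add: ent_mt ent_sg sgn_pow_def bs_closed) (simp add: sg_def)
qed

lemma mt_central:
  assumes "z \<in> alg_center" "f \<in> gh n P Q"
  shows "mt D E n (\<lambda>i x. z \<odot>\<^bsub>cmodule Q (i + n)\<^esub> f i x) = cm z (mt D E n f)"
proof (rule imat_eqI)
  fix u v
  have "cco E (dg v + n) (pos u) (z \<odot>\<^bsub>cmodule Q (dg v + n)\<^esub> f (dg v) y) = z * cco E (dg v + n) (pos u) (f (dg v) y)"
    if "pos u < crk E (dg v + n)" "y \<in> cc P (dg v)" for y
    using dbasisD(3)[OF cb_d(2)[OF D E] that(1) gh_closed[OF assms(2) that(2)]] assms(1) by (simp add: alg_center_def)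
  then show "ent (mt D E n (\<lambda>i x. z \<odot>\<^bsub>cmodule Q (i + n)\<^esub> f i x)) u v = ent (cm z (mt D E n f)) u v"
    by (simp add: ent_mt cm.rep_eq bs_closed)
qed

lemma mt_eqD:
  assumes f: "f \<in> gh n P Q" and g: "g \<in> gh n P Q" and e: "mt D E n f = mt D E n g" and x: "x \<in> cc P i"
  shows "f i x = g i x"
proof -
  interpret Q: right_module "cmodule Q (i + n)" by (rule cmod[OF cb_c(2)[OF D E]])
  note c = cmod[OF cb_c(1)[OF D E]] cmod[OF cb_c(2)[OF D E]] and d = cb_d[OF D E]
  have "f i (cbs D i l) = g i (cbs D i l)" if l: "l < crk D i" for l
  proof -
    have b: "cbs D i l \<in> cc P i" by (rule dbasisD(1)[OF d(1) l])
    have "cco E (i + n) k (f i (cbs D i l)) = cco E (i + n) k (g i (cbs D i l))" if "k < crk E (i + n)" for k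
      using arg_cong[OF e, of "\<lambda>F. ent F (Ix (i + n) k) (Ix i l)"] l that by (simp add: ent_mt)
    then have "(\<Oplus>\<^bsub>cmodule Q (i + n)\<^esub>k\<in>{..<crk E (i + n)}. cco E (i + n) k (f i (cbs D i l)) \<odot>\<^bsub>cmodule Q (i + n)\<^esub> cbs E (i + n) k)
        = (\<Oplus>\<^bsub>cmodule Q (i + n)\<^esub>k\<in>{..<crk E (i + n)}. cco E (i + n) k (g i (cbs D i l)) \<odot>\<^bsub>cmodule Q (i + n)\<^esub> cbs E (i + n) k)"
      by (intro Q.finsum_cong') (auto intro: Q.smult_closed dbasisD(1)[OF d(2)])
    then show ?thesis using dbasisD(4)[OF d(2) gh_closed[OF f b]] dbasisD(4)[OF d(2) gh_closed[OF g b]] by simp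
  qed
  then have "(\<Oplus>\<^bsub>cmodule Q (i + n)\<^esub>l\<in>{..<crk D i}. cco D i l x \<odot>\<^bsub>cmodule Q (i + n)\<^esub> f i (cbs D i l))
      = (\<Oplus>\<^bsub>cmodule Q (i + n)\<^esub>l\<in>{..<crk D i}. cco D i l x \<odot>\<^bsub>cmodule Q (i + n)\<^esub> g i (cbs D i l))"
    by (intro Q.finsum_cong') (auto intro: Q.smult_closed gh_closed[OF g] dbasisD(1)[OF d(1)])
  then show ?thesis using dbasis_expand[OF c d(1) ghD[OF f] x] dbasis_expand[OF c d(1) ghD[OF g] x] by simp
qed

lemma mt_eq_iff:
  assumes "f \<in> gh n P Q" "g \<in> gh n P Q"
  shows "mt D E n f = mt D E n g \<longleftrightarrow> (\<forall>i. \<forall>x\<in>cc P i. f i x = g i x)"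
  using mt_eqD[OF assms] mt_cong[of f g n] by meson

end

text \<open>The value of \<open>f\<close> at a generator is expanded in the dual basis of
  \<open>Q\<close>; any system of coordinates will do for this.\<close>

lemma mt_comp:
  assumes D: "is_cbas P D" and E: "is_cbas Q E" and G: "is_cbas R G" and f: "f \<in> gh m P Q" and g: "g \<in> gh n Q R"
  shows "mt D G (m + n) (\<lambda>i x. g (i + m) (f i x)) = mt E G n g * mt D E m f"
proof (rule imat_eqI)
  fix u v
  let ?W = "{u. pos u < crk E (dg u)}"
  have t: "ent (mt E G n g * mt D E m f) u v = (\<Sum>w\<in>?W. ent (mt E G n g) u w * ent (mt D E m f) w v)"
    by (rule ent_times[OF finite_ixs[OF E D]]) (auto simp: ent_mt[OF D E])
  have s: "(\<Sum>w\<in>?W. ent (mt E G n g) u w * ent (mt D E m f) w v)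
      = (\<Sum>k<crk E (dg v + m). ent (mt E G n g) u (Ix (dg v + m) k) * ent (mt D E m f) (Ix (dg v + m) k) v)"
    by (rule sum_ixs[OF E D]) (auto simp: ent_mt[OF D E] split: if_splits)
  show "ent (mt D G (m + n) (\<lambda>i x. g (i + m) (f i x))) u v = ent (mt E G n g * mt D E m f) u v"
  proof (cases "dg u = dg v + (m + n) \<and> pos u < crk G (dg u) \<and> pos v < crk D (dg v)")
    case True
    then have u: "dg u = dg v + m + n" "pos u < crk G (dg u)" "pos v < crk D (dg v)" by auto
    let ?x = "f (dg v) (cbs D (dg v) (pos v))"
    have x: "?x \<in> cc Q (dg v + m)" by (rule gh_closed[OF D E f bs_closed[OF D E u(3)]])
    note d = cb_d(1)[OF E G]
    have "g (dg v + m) ?x = (\<Oplus>\<^bsub>cmodule R (dg u)\<^esub>k\<in>{..<crk E (dg v + m)}. cco E (dg v + m) k ?x \<odot>\<^bsub>cmodule R (dg u)\<^esub> g (dg v + m) (cbs E (dg v + m) k))"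
      unfolding u(1) by (rule dbasis_expand[OF cmod[OF cb_c(1)[OF E G]] cmod[OF cb_c(2)[OF E G]] d ghD[OF g] x])
    then have "cco G (dg u) (pos u) (g (dg v + m) ?x) = (\<Sum>k<crk E (dg v + m). cco G (dg u) (pos u) (g (dg v + m) (cbs E (dg v + m) k)) * cco E (dg v + m) k ?x)"
      using coord_comb[OF G E u(2), of "crk E (dg v + m)" "\<lambda>k. g (dg v + m) (cbs E (dg v + m) k)"] gh_closed[OF E G g dbasisD(1)[OF d]] u(1) by simp
    then show ?thesis
      unfolding t s using True u by (simp add: ent_mt[OF D G] ent_mt[OF E G] ent_mt[OF D E] add.assoc)
  next
    case False
    have "(\<Sum>k<crk E (dg v + m). ent (mt E G n g) u (Ix (dg v + m) k) * ent (mt D E m f) (Ix (dg v + m) k) v) = 0"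
      using False by (intro sum.neutral ballI) (auto simp: ent_mt[OF E G] ent_mt[OF D E])
    then show ?thesis unfolding t s using False by (auto simp: ent_mt[OF D G])
  qed
qed

definition mc :: "('a::{ring,monoid_mult}, 'm) cplx \<Rightarrow> ('a, 'm) cbas \<Rightarrow> 'a mcplx" where
  "mc P D = (mt D D 0 (\<lambda>i x. x), mt D D 1 (cdif P))"

lemma mcplx_mc:
  assumes D: "is_cbas P D"
  shows "mcplx (mc P D)"
proof -
  have P: "is_complex P" using D by (simp add: is_cbas_def)
  note c = mt_comp[OF D D D]
  let ?e = "mt D D 0 (\<lambda>i x. x)" and ?d = "mt D D 1 (cdif P)"
  have ee: "?e * ?e = ?e" using c[OF gh_id gh_id] unfolding add_0 by (rule sym)
  have ed: "?d * ?e = ?d" using c[OF gh_id gh_cdif[OF P]] unfolding add_0 add_0_right by (rule sym)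
  have de: "?e * ?d = ?d" using c[OF gh_cdif[OF P] gh_id] unfolding add_0_right by (rule sym)
  have "mt D D (1 + 1) (\<lambda>i x. cdif P (i + 1) (cdif P i x)) = mt D D (1 + 1) (\<lambda>i x. cz P (i + (1 + 1)))"
    by (rule mt_cong[OF D D]) (simp add: cdif_cdif[OF P])
  then have dd: "?d * ?d = 0" using c[OF gh_cdif[OF P] gh_cdif[OF P]] mt_zero[OF D D, of "1 + 1"] by simp
  show ?thesis unfolding mcplx_def mc_def fst_conv snd_conv by (intro conjI hdeg_mt[OF D D] ee ed de dd)
qed

lemma mt_hm:
  assumes D: "is_cbas P D" and E: "is_cbas Q E" and f: "f \<in> gh n P Q"
  shows "mt D E n f \<in> hm n (mc P D) (mc Q E)"
  unfolding hm_def mc_def fst_conv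
proof (intro CollectI conjI hdeg_mt[OF D E])
  show "mt E E 0 (\<lambda>i x. x) * mt D E n f = mt D E n f"
    using mt_comp[OF D E E f gh_id] unfolding add_0_right by (rule sym)
  show "mt D E n f * mt D D 0 (\<lambda>i x. x) = mt D E n f"
    using mt_comp[OF D D E gh_id f] unfolding add_0 add_0_right by (rule sym)
qed

text \<open>The entries of \<open>F\<close> prescribe the values at the generators. The resulting
  map has as matrix \<open>F\<close> multiplied by the idempotents on both sides, and these leave
  \<open>F\<close> unchanged.\<close>

lemma mt_onto:
  assumes D: "is_cbas P D" and E: "is_cbas Q E" and F: "F \<in> hm n (mc P D) (mc Q E)"
  obtains f where "f \<in> gh n P Q" "mt D E n f = F"
proof -
  have Ff: "hdeg n F" "mt E E 0 (\<lambda>i x. x) * F = F" "F * mt D D 0 (\<lambda>i x. x) = F" using F by (auto simp: hm_def mc_def)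
  note cQ = cmod[OF cb_c(2)[OF D E]] and cP = cmod[OF cb_c(1)[OF D E]] and d = cb_d[OF D E]
  define y where "y i l = (\<Oplus>\<^bsub>cmodule Q (i + n)\<^esub>k\<in>{..<crk E (i + n)}. ent F (Ix (i + n) k) (Ix i l) \<odot>\<^bsub>cmodule Q (i + n)\<^esub> cbs E (i + n) k)" for i l
  have yc: "y i l \<in> cc Q (i + n)" for i l
  proof -
    interpret right_module "cmodule Q (i + n)" by (rule cQ)
    show ?thesis unfolding y_def by (rule finsum_closed) (auto intro: smult_closed dbasisD(1)[OF d(2)])
  qed
  define f where "f i x = (\<Oplus>\<^bsub>cmodule Q (i + n)\<^esub>l\<in>{..<crk D i}. cco D i l x \<odot>\<^bsub>cmodule Q (i + n)\<^esub> y i l)" for i x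
  have fg: "f \<in> gh n P Q"
    by (rule ghI, unfold f_def[abs_def], rule dbasis_hom[OF cP cQ d(1) yc])
  have "mt D E n f = F"
  proof (rule imat_eqI)
    fix u v
    have F1: "ent F u w = (\<Sum>k<crk E (dg u). cco E (dg u) (pos u) (cbs E (dg u) k) * ent F (Ix (dg u) k) w)" if u: "pos u < crk E (dg u)" for w
    proof -
      have "ent F u w = (\<Sum>x\<in>{u. pos u < crk E (dg u)}. ent (mt E E 0 (\<lambda>i x. x)) u x * ent F x w)"
        by (subst Ff(2)[symmetric], rule ent_times[OF finite_ixs[OF E E]]) (simp add: ent_mt[OF E E])
      also have "\<dots> = (\<Sum>k<crk E (dg u). ent (mt E E 0 (\<lambda>i x. x)) u (Ix (dg u) k) * ent F (Ix (dg u) k) w)"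
        by (rule sum_ixs[OF E E]) (auto simp: ent_mt[OF E E] split: if_splits)
      finally show ?thesis using u by (simp add: ent_mt[OF E E])
    qed
    have F2: "ent F w v = (\<Sum>l<crk D (dg v). ent F w (Ix (dg v) l) * ent (mt D D 0 (\<lambda>i x. x)) (Ix (dg v) l) v)" for w
    proof -
      have "ent F w v = (\<Sum>x\<in>{u. pos u < crk D (dg u)}. ent F w x * ent (mt D D 0 (\<lambda>i x. x)) x v)"
        by (subst Ff(3)[symmetric], rule ent_times[OF finite_ixs[OF D D]]) (auto simp: ent_mt[OF D D])
      also have "\<dots> = (\<Sum>l<crk D (dg v). ent F w (Ix (dg v) l) * ent (mt D D 0 (\<lambda>i x. x)) (Ix (dg v) l) v)"
        by (rule sum_ixs[OF D D]) (auto simp: ent_mt[OF D D] split: if_splits)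
      finally show ?thesis .
    qed
    show "ent (mt D E n f) u v = ent F u v"
    proof (cases "dg u = dg v + n \<and> pos u < crk E (dg u) \<and> pos v < crk D (dg v)")
      case True
      then have u: "dg u = dg v + n" "pos u < crk E (dg v + n)" "pos v < crk D (dg v)" by auto
      have ye: "cco E (dg v + n) (pos u) (y (dg v) l) = ent F u (Ix (dg v) l)" for l
        unfolding y_def using coord_comb[OF E D u(2), of "crk E (dg v + n)" "cbs E (dg v + n)"] dbasisD(1)[OF d(2)] F1[of "Ix (dg v) l"] u(1,2)
        by simp
      have "cco E (dg v + n) (pos u) (f (dg v) (cbs D (dg v) (pos v)))
          = (\<Sum>l<crk D (dg v). cco E (dg v + n) (pos u) (y (dg v) l) * cco D (dg v) l (cbs D (dg v) (pos v)))"
        unfolding f_def by (rule coord_comb[OF E D u(2) yc])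
      also have "\<dots> = ent F u v" using F2[of u] u(3) by (simp add: ye ent_mt[OF D D])
      finally show ?thesis using u by (simp add: ent_mt[OF D E])
    next
      case False
      then consider "dg u \<noteq> dg v + n" | "\<not> pos u < crk E (dg u)" | "\<not> pos v < crk D (dg v)" by blast
      then have "ent F u v = 0"
      proof cases
        case 1
        then show ?thesis by (rule hdeg_ent[OF Ff(1)])
      next
        case 2
        have "ent (mt E E 0 (\<lambda>i x. x) * F) u v = 0" unfolding ent_times0 using 2 by (intro sum.neutral ballI) (auto simp: ent_mt[OF E E])
        then show ?thesis by (simp add: Ff(2))
      next
        case 3
        have "ent (F * mt D D 0 (\<lambda>i x. x)) u v = 0" unfolding ent_times0 using 3 by (intro sum.neutral ballI) (auto simp: ent_mt[OF D D])
        then show ?thesis by (simp add: Ff(3))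
      qed
      then show ?thesis using False by (auto simp: ent_mt[OF D E])
    qed
  qed
  then show ?thesis using fg that by blast
qed

text \<open>The sign in \<open>df\<close> is the sign that the shift by \<open>n\<close> puts on the
  differential of \<open>Q\<close>.\<close>

lemma chain_map_iff_zc:
  assumes D: "is_cbas P D" and E: "is_cbas Q E" and f: "f \<in> gh n P Q"
  shows "chain_map P (shift n Q) f \<longleftrightarrow> mt D E n f \<in> zc n (mc P D) (mc Q E)"
proof -
  have P: "is_complex P" and Q: "is_complex Q" using cb_c[OF D E] by auto
  let ?a = "\<lambda>i x. cdif Q (i + n) (f i x)" let ?b = "\<lambda>i x. f (i + 1) (cdif P i x)"
  have a: "?a \<in> gh (n + 1) P Q" using gh_comp[OF f gh_cdif[OF Q]] .
  have b: "?b \<in> gh (n + 1) P Q" using gh_comp[OF gh_cdif[OF P] f] by (simp add: add.commute)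
  let ?b' = "\<lambda>i x. sgn_pow (cmodule Q (i + (n + 1))) n (?b i x)"
  have b': "?b' \<in> gh (n + 1) P Q" by (rule gh_sgn[OF Q b])
  have ma: "mt D E (n + 1) ?a = snd (mc Q E) * mt D E n f" using mt_comp[OF D E E f gh_cdif[OF Q]] by (simp add: mc_def)
  have mb: "mt D E (n + 1) ?b = mt D E n f * snd (mc P D)" using mt_comp[OF D D E gh_cdif[OF P] f] by (simp add: mc_def add.commute)
  have mb': "mt D E (n + 1) ?b' = sg n (mt D E n f * snd (mc P D))" using mt_sgn[OF D E b] mb by simp
  have "mt D E n f \<in> zc n (mc P D) (mc Q E) \<longleftrightarrow> mt D E (n + 1) ?a = mt D E (n + 1) ?b'"
    using mt_hm[OF D E f] by (simp add: zc_def df_def ma mb')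
  also have "\<dots> \<longleftrightarrow> (\<forall>i. \<forall>x\<in>cc P i. ?a i x = ?b' i x)"
    by (rule mt_eq_iff[OF D E a b'])
  also have "\<dots> \<longleftrightarrow> (\<forall>i. \<forall>x\<in>cc P i. ?b i x = cdif (shift n Q) i (f i x))"
  proof (intro arg_cong[where f = All] ext ball_cong refl)
    fix i x assume x: "x \<in> cc P i"
    interpret right_module "cmodule Q (i + n + 1)" by (rule cmod[OF Q])
    have ac: "?a i x \<in> cc Q (i + n + 1)" "?b i x \<in> cc Q (i + n + 1)"
      using gh_closed[OF D E a x] gh_closed[OF D E b x] by (simp_all add: add.assoc)
    have "cdif (shift n Q) i (f i x) = sgn_pow (cmodule Q (i + n + 1)) n (?a i x)" by (rule cdif_shift[OF gh_closed[OF D E f x]])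
    moreover have "?a i x = sgn_pow (cmodule Q (i + n + 1)) n (?b i x) \<longleftrightarrow> ?b i x = sgn_pow (cmodule Q (i + n + 1)) n (?a i x)"
      using sgn_twice[OF ac(1), of n] sgn_twice[OF ac(2), of n] by metis
    ultimately show "(?a i x = ?b' i x) = (?b i x = cdif (shift n Q) i (f i x))" by (simp add: add.assoc)
  qed
  finally show ?thesis using f unfolding chain_map_def by (simp add: gh_def)
qed

lemma homotopic_iff_bd:
  assumes D: "is_cbas P D" and E: "is_cbas Q E" and f: "f \<in> gh n P Q" and g: "g \<in> gh n P Q"
  shows "homotopic_maps P (shift n Q) f g \<longleftrightarrow> mt D E n f - mt D E n g \<in> bd n (mc P D) (mc Q E)"
proof -
  have P: "is_complex P" and Q: "is_complex Q" using cb_c[OF D E] by auto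
  have ix: "i - 1 + n = i + (n - 1)" "i + (n - 1) + 1 = i + n" "i + 1 + (n - 1) = i + n" "i + (1 + (n - 1)) = i + n" "i - 1 + n + 1 = i + n" for i :: int
    by auto
  \<comment> \<open>A homotopy \<open>h\<close> corresponds to (-1)^n times its matrix: the
    differential of the shift of \<open>Q\<close> carries this sign, that of \<open>P\<close> does
    not.\<close>
  have h_iff: "(\<forall>i. \<forall>x\<in>cc P i. f i x = ca (shift n Q) i (g i x) (ca (shift n Q) i (cdif (shift n Q) (i - 1) (h i x)) (h (i + 1) (cdif P i x))))
      \<longleftrightarrow> mt D E n f - mt D E n g = df (n - 1) (mc P D) (mc Q E) (sg n (mt D E (n - 1) h))" if h: "h \<in> gh (n - 1) P Q" for h
  proof -
    let ?a = "\<lambda>i x. cdif Q (i + (n - 1)) (h i x)" let ?b = "\<lambda>i x. h (i + 1) (cdif P i x)"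
    have a: "?a \<in> gh n P Q" using gh_comp[OF h gh_cdif[OF Q]] by simp
    have b: "?b \<in> gh n P Q" using gh_comp[OF gh_cdif[OF P] h] by simp
    let ?a' = "\<lambda>i x. sgn_pow (cmodule Q (i + n)) n (?a i x)"
    have a': "?a' \<in> gh n P Q" by (rule gh_sgn[OF Q a])
    have ma: "mt D E n ?a = snd (mc Q E) * mt D E (n - 1) h" using mt_comp[OF D E E h gh_cdif[OF Q]] by (simp add: mc_def)
    have mb: "mt D E n ?b = mt D E (n - 1) h * snd (mc P D)" using mt_comp[OF D D E gh_cdif[OF P] h] by (simp add: mc_def)
    let ?c = "\<lambda>i x. ca Q (i + n) (?a' i x) (?b i x)"
    have c: "?c \<in> gh n P Q" by (rule gh_add[OF Q a' b])
    let ?r = "\<lambda>i x. ca Q (i + n) (g i x) (?c i x)"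
    have r: "?r \<in> gh n P Q" by (rule gh_add[OF Q g c])
    have mr: "mt D E n ?r = mt D E n g + (sg n (snd (mc Q E) * mt D E (n - 1) h) + mt D E (n - 1) h * snd (mc P D))"
      using mt_add[OF D E g c] mt_add[OF D E a' b] mt_sgn[OF D E a] ma mb by simp
    have "cdif (shift n Q) (i - 1) (h i x) = ?a' i x" if x: "x \<in> cc P i" for i x
    proof -
      have "h i x \<in> cc Q (i - 1 + n)" using gh_closed[OF D E h x] by (simp only: ix)
      from cdif_shift[OF this] show ?thesis by (simp only: ix)
    qed
    then have "(\<forall>i. \<forall>x\<in>cc P i. f i x = ca (shift n Q) i (g i x) (ca (shift n Q) i (cdif (shift n Q) (i - 1) (h i x)) (h (i + 1) (cdif P i x))))
        \<longleftrightarrow> (\<forall>i. \<forall>x\<in>cc P i. f i x = ?r i x)" by simp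
    also have "\<dots> \<longleftrightarrow> mt D E n f = mt D E n ?r"
      by (rule mt_eq_iff[OF D E f r, symmetric])
    also have "\<dots> \<longleftrightarrow> mt D E n f - mt D E n g = sg n (snd (mc Q E) * mt D E (n - 1) h) + mt D E (n - 1) h * snd (mc P D)"
      unfolding mr by (simp add: algebra_simps)
    also have "sg n (snd (mc Q E) * mt D E (n - 1) h) + mt D E (n - 1) h * snd (mc P D) = df (n - 1) (mc P D) (mc Q E) (sg n (mt D E (n - 1) h))"
      by (simp add: df_def sg_mult_left sg_mult_right sg_minus sg_neg)
    finally show ?thesis .
  qed
  show ?thesis
  proof
    assume "homotopic_maps P (shift n Q) f g"
    then obtain h where h: "\<And>i. h i \<in> rmod_hom (cmodule P i) (cmodule (shift n Q) (i - 1))"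
      "\<forall>i. \<forall>x\<in>cc P i. f i x = ca (shift n Q) i (g i x) (ca (shift n Q) i (cdif (shift n Q) (i - 1) (h i x)) (h (i + 1) (cdif P i x)))"
      by (auto simp: homotopic_maps_def)
    have hg: "h \<in> gh (n - 1) P Q" using h(1) by (simp add: gh_def ix)
    have "sg n (mt D E (n - 1) h) \<in> hm (n - 1) (mc P D) (mc Q E)" by (rule hm_closed(4)[OF mt_hm[OF D E hg]])
    then show "mt D E n f - mt D E n g \<in> bd n (mc P D) (mc Q E)" using h_iff[OF hg] h(2) by (auto simp: bd_def)
  next
    assume "mt D E n f - mt D E n g \<in> bd n (mc P D) (mc Q E)"
    then obtain H where H: "H \<in> hm (n - 1) (mc P D) (mc Q E)" "mt D E n f - mt D E n g = df (n - 1) (mc P D) (mc Q E) H"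
      by (auto simp: bd_def)
    obtain h where h: "h \<in> gh (n - 1) P Q" "mt D E (n - 1) h = sg n H" using mt_onto[OF D E hm_closed(4)[OF H(1)]] .
    have "\<forall>i. \<forall>x\<in>cc P i. f i x = ca (shift n Q) i (g i x) (ca (shift n Q) i (cdif (shift n Q) (i - 1) (h i x)) (h (i + 1) (cdif P i x)))"
      using h_iff[OF h(1)] H(2) h(2) by simp
    moreover have "h i \<in> rmod_hom (cmodule P i) (cmodule (shift n Q) (i - 1))" for i using ghD[OF h(1), of i] by (simp add: ix)
    ultimately show "homotopic_maps P (shift n Q) f g" unfolding homotopic_maps_def by blast
  qed
qed

subsection \<open>The matrix model of the perfect orbit category\<close>

lemma perfect_orbit_simps:
  "gObj (perfect_orbit_category scale) = Obj (perfect_category scale)"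
  "gHom (perfect_orbit_category scale) X Y n = derived_hom scale X (shift n Y)"
  "gCmp (perfect_orbit_category scale) X Y Z i j g f = derived_comp X (shift i Y) (shift (i + j) Z) (shift_morphism i g) f"
  "gId (perfect_orbit_category scale) X = chain_class X X (\<lambda>i x. x)"
  by (simp_all add: perfect_orbit_category_def orbit_category_def perfect_category_def derived_category_def)

locale perfect_resolutions = symmetrized_algebra scale p \<epsilon>
  for scale :: "'k::field \<Rightarrow> 'a::{ring,monoid_mult} \<Rightarrow> 'a" and p \<epsilon> +
  fixes P :: "('a, 'm) cplx \<Rightarrow> ('a, 'm) cplx" and q :: "('a, 'm) cplx \<Rightarrow> int \<Rightarrow> 'm \<Rightarrow> 'm" and D :: "('a, 'm) cplx \<Rightarrow> ('a, 'm) cbas"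
  assumes r: "X \<in> Obj (perfect_category scale) \<Longrightarrow> res X (P X) (q X)"
    and D: "X \<in> Obj (perfect_category scale) \<Longrightarrow> is_cbas (P X) (D X)"
begin

abbreviation "PO \<equiv> Obj (perfect_category scale) :: ('a, 'm) cplx set"

definition mor :: "('a, 'm) cplx \<Rightarrow> ('a, 'm) cplx \<Rightarrow> int \<Rightarrow> (int \<Rightarrow> 'm \<Rightarrow> 'm) \<Rightarrow> ('a, 'm) roof set" where
  "mor X Y n f = cl X (shift n Y) (P X) (q X) (\<lambda>i x. q Y (i + n) (f i x))"

text \<open>A relation and not a function, because the chain map of resolutions behind a morphism is
  determined only up to homotopy.\<close>

definition rp :: "('a, 'm) cplx \<Rightarrow> ('a, 'm) cplx \<Rightarrow> int \<Rightarrow> ('a, 'm) roof set \<Rightarrow> 'a imat \<Rightarrow> bool" where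
  "rp X Y n \<phi> F \<longleftrightarrow> (\<exists>f. chain_map (P X) (shift n (P Y)) f \<and> mt (D X) (D Y) n f = F \<and> \<phi> = mor X Y n f)"

lemma rpI: "chain_map (P X) (shift n (P Y)) f \<Longrightarrow> rp X Y n (mor X Y n f) (mt (D X) (D Y) n f)"
  by (auto simp: rp_def)

context
  fixes X assumes X: "X \<in> PO"
begin

interpretation X: resolved X "P X" "q X" by unfold_locales (rule r[OF X])

lemma PO_complex: "is_complex X" "is_complex (P X)" "liftable (P X)" "is_complex (shift n X)" "is_complex (shift n (P X))"
  using X.Xc X.Pc X.P is_complex_shift by auto

lemma q_chain: "chain_map (shift n (P X)) (shift n X) (\<lambda>i. q X (i + n))"
  by (rule chain_map_shift[OF X.Pc X.Xc X.qc])

lemma q_QI: "QI (shift n (P X)) (shift n X) (\<lambda>i. q X (i + n))"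
  by (rule QI_shift[OF X.Pc X.Xc X.q])

end

context
  fixes X Y assumes X: "X \<in> PO" and Y: "Y \<in> PO"
begin

interpretation X: resolved X "P X" "q X" by unfold_locales (rule r[OF X])
interpretation Y: resolved Y "P Y" "q Y" by unfold_locales (rule r[OF Y])

lemmas cY = PO_complex[OF Y]

lemma ql_chain: "chain_map (P X) (shift n (P Y)) f \<Longrightarrow> chain_map (P X) (shift n Y) (\<lambda>i x. q Y (i + n) (f i x))"
  using chain_map_comp[OF _ q_chain[OF Y]] by blast

lemma mor_eq_iff:
  assumes f: "chain_map (P X) (shift n (P Y)) f" "chain_map (P X) (shift n (P Y)) g"
  shows "mor X Y n f = mor X Y n g \<longleftrightarrow> mt (D X) (D Y) n f - mt (D X) (D Y) n g \<in> bd n (mc (P X) (D X)) (mc (P Y) (D Y))"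
proof -
  have "mor X Y n f = mor X Y n g \<longleftrightarrow> homotopic_maps (P X) (shift n Y) (\<lambda>i x. q Y (i + n) (f i x)) (\<lambda>i x. q Y (i + n) (g i x))"
    unfolding mor_def by (rule X.cl_eq_iff[OF cY(4) ql_chain ql_chain]) (rule f)+
  also have "\<dots> \<longleftrightarrow> homotopic_maps (P X) (shift n (P Y)) f g"
    using lift_unique[OF X.P cY(5) cY(4) q_QI[OF Y] f] homotopic_comp_left[OF X.Pc cY(5) f(2) q_chain[OF Y]] by blast
  also have "\<dots> \<longleftrightarrow> mt (D X) (D Y) n f - mt (D X) (D Y) n g \<in> bd n (mc (P X) (D X)) (mc (P Y) (D Y))"
    by (rule homotopic_iff_bd[OF D[OF X] D[OF Y] gh_chain[OF f(1)] gh_chain[OF f(2)]])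
  finally show ?thesis .
qed

lemma mor_cong:
  assumes k: "chain_map (P X) (shift n Y) k" and f: "\<And>i x. x \<in> cc (P X) i \<Longrightarrow> k i x = q Y (i + n) (f i x)"
    and fc: "chain_map (P X) (shift n (P Y)) f"
  shows "cl X (shift n Y) (P X) (q X) k = mor X Y n f"
  unfolding mor_def X.cl_eq_iff[OF cY(4) k ql_chain[OF fc]] by (rule homotopic_cong[OF X.Pc cY(4) k f])

lemma rp_dom: "rp X Y n \<phi> F \<Longrightarrow> \<phi> \<in> carrier (derived_hom scale X (shift n Y)) \<and> F \<in> zc n (mc (P X) (D X)) (mc (P Y) (D Y))"
  unfolding rp_def X.derived_hom_carrier[OF cY(4)] mor_def
  using chain_map_iff_zc[OF D[OF X] D[OF Y] gh_chain] ql_chain by blast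

lemma rp_ex:
  assumes "\<phi> \<in> carrier (derived_hom scale X (shift n Y))"
  shows "\<exists>F. rp X Y n \<phi> F"
proof -
  obtain k where k: "chain_map (P X) (shift n Y) k" "\<phi> = cl X (shift n Y) (P X) (q X) k"
    using assms X.derived_hom_carrier[OF cY(4)] by blast
  obtain w where w: "chain_map (P X) (shift n (P Y)) w" "homotopic_maps (P X) (shift n Y) (\<lambda>i x. q Y (i + n) (w i x)) k"
    using lift_map[OF X.P cY(5) cY(4) q_QI[OF Y] k(1)] .
  have "mor X Y n w = \<phi>" using X.cl_eq_iff[OF cY(4) ql_chain[OF w(1)] k(1)] w(2) k(2) by (simp add: mor_def)
  then show ?thesis using rpI[OF w(1)] by blast
qed

lemma rp_onto:
  assumes F: "F \<in> zc n (mc (P X) (D X)) (mc (P Y) (D Y))"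
  shows "\<exists>\<phi>. rp X Y n \<phi> F"
proof -
  obtain f where f: "f \<in> gh n (P X) (P Y)" "mt (D X) (D Y) n f = F" using mt_onto[OF D[OF X] D[OF Y] zc_hm[OF F]] .
  then have "chain_map (P X) (shift n (P Y)) f" using chain_map_iff_zc[OF D[OF X] D[OF Y] f(1)] F by simp
  then show ?thesis using f(2) by (auto simp: rp_def)
qed

lemma rp_eq:
  assumes "rp X Y n \<phi> F" "rp X Y n \<psi> G"
  shows "\<phi> = \<psi> \<longleftrightarrow> F - G \<in> bd n (mc (P X) (D X)) (mc (P Y) (D Y))"
  using assms mor_eq_iff by (auto simp: rp_def)

lemma rp_add:
  assumes "rp X Y n \<phi> F" "rp X Y n \<psi> G"
  shows "rp X Y n (\<phi> \<oplus>\<^bsub>derived_hom scale X (shift n Y)\<^esub> \<psi>) (F + G)"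
proof -
  obtain f g where f: "chain_map (P X) (shift n (P Y)) f" "mt (D X) (D Y) n f = F" "\<phi> = mor X Y n f"
    and g: "chain_map (P X) (shift n (P Y)) g" "mt (D X) (D Y) n g = G" "\<psi> = mor X Y n g"
    using assms unfolding rp_def by blast
  let ?h = "\<lambda>i x. ca (P Y) (i + n) (f i x) (g i x)"
  have h: "chain_map (P X) (shift n (P Y)) ?h" using chain_map_add[OF cY(5) f(1) g(1)] by simp
  have "\<phi> \<oplus>\<^bsub>derived_hom scale X (shift n Y)\<^esub> \<psi> = mor X Y n ?h"
    unfolding f(3) g(3) mor_def[of X Y n f] mor_def[of X Y n g] X.cl_add[OF cY(4) ql_chain[OF f(1)] ql_chain[OF g(1)]]
  proof (rule mor_cong[OF chain_map_add[OF cY(4) ql_chain[OF f(1)] ql_chain[OF g(1)]] _ h])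
    fix i x assume x: "x \<in> cc (P X) i"
    show "ca (shift n Y) i (q Y (i + n) (f i x)) (q Y (i + n) (g i x)) = q Y (i + n) (?h i x)"
      using rmod_homD(2)[OF chain_hom[OF q_chain[OF Y]] rmod_homD(1)[OF chain_hom[OF f(1)] x] rmod_homD(1)[OF chain_hom[OF g(1)] x]] by simp
  qed
  then show ?thesis using rpI[OF h] mt_add[OF D[OF X] D[OF Y] gh_chain[OF f(1)] gh_chain[OF g(1)]] f(2) g(2) by simp
qed

lemma rp_central:
  assumes z: "z \<in> alg_center" and f: "chain_map (P X) (shift n (P Y)) f"
  shows "rp X Y n (cl X (shift n Y) (P X) (q X) (\<lambda>i x. z \<odot>\<^bsub>cmodule (shift n Y) i\<^esub> q Y (i + n) (f i x))) (cm z (mt (D X) (D Y) n f))"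
proof -
  let ?h = "\<lambda>i x. z \<odot>\<^bsub>cmodule (P Y) (i + n)\<^esub> f i x"
  have h: "chain_map (P X) (shift n (P Y)) ?h" using chain_map_central[OF cY(5) z f] by simp
  have "cl X (shift n Y) (P X) (q X) (\<lambda>i x. z \<odot>\<^bsub>cmodule (shift n Y) i\<^esub> q Y (i + n) (f i x)) = mor X Y n ?h"
  proof (rule mor_cong[OF chain_map_central[OF cY(4) z ql_chain[OF f]] _ h])
    fix i x assume x: "x \<in> cc (P X) i"
    show "z \<odot>\<^bsub>cmodule (shift n Y) i\<^esub> q Y (i + n) (f i x) = q Y (i + n) (?h i x)"
      using rmod_homD(3)[OF chain_hom[OF q_chain[OF Y]] rmod_homD(1)[OF chain_hom[OF f] x]] by simp
  qed
  then show ?thesis using rpI[OF h] mt_central[OF D[OF X] D[OF Y] z gh_chain[OF f]] by simp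
qed

lemma rp_smult:
  assumes "rp X Y n \<phi> F"
  shows "rp X Y n (c \<odot>\<^bsub>derived_hom scale X (shift n Y)\<^esub> \<phi>) (iscale c F)"
proof -
  obtain f where f: "chain_map (P X) (shift n (P Y)) f" "mt (D X) (D Y) n f = F" "\<phi> = mor X Y n f"
    using assms unfolding rp_def by blast
  have z: "scale c 1 \<in> alg_center" by (simp add: alg_center_def scale_1_central)
  have "c \<odot>\<^bsub>derived_hom scale X (shift n Y)\<^esub> mor X Y n f = cl X (shift n Y) (P X) (q X) (\<lambda>i x. scale c 1 \<odot>\<^bsub>cmodule (shift n Y) i\<^esub> q Y (i + n) (f i x))"
    unfolding mor_def by (rule X.cl_smult[where scale = scale]) (rule cY(4) ql_chain[OF f(1)] z)+
  then show ?thesis unfolding f(3) iscale_def f(2)[symmetric] using rp_central[OF z f(1)] by simp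
qed

lemma rp_zero: "rp X Y n \<zero>\<^bsub>derived_hom scale X (shift n Y)\<^esub> 0"
proof -
  let ?h = "\<lambda>i x. cz (P Y) (i + n)"
  have h: "chain_map (P X) (shift n (P Y)) ?h" using chain_map_zero[OF cY(5)] by simp
  have "cl X (shift n Y) (P X) (q X) (\<lambda>i x. cz (shift n Y) i) = mor X Y n ?h"
  proof (rule mor_cong[OF chain_map_zero[OF cY(4)] _ h])
    fix i x show "cz (shift n Y) i = q Y (i + n) (?h i x)"
      using rmod_hom_zero[OF cmod[OF cY(2)] cmod[OF cY(1)] chain_hom[OF Y.qc]] by simp
  qed
  then show ?thesis using rpI[OF h] mt_zero[OF D[OF X] D[OF Y]] X.cl_zero[OF cY(4), of scale] by simp
qed

end

text \<open>Shifting a chain map only renumbers its components, and matrix indices carry their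
  degrees, so composition in the orbit category becomes the matrix product without a sign.\<close>

lemma rp_comp:
  assumes X: "X \<in> PO" and Y: "Y \<in> PO" and Z: "Z \<in> PO" and f: "rp X Y m \<phi> F" and g: "rp Y Z n \<psi> G"
  shows "rp X Z (m + n) (derived_comp X (shift m Y) (shift (m + n) Z) (shift_morphism m \<psi>) \<phi>) (G * F)"
proof -
  interpret X: resolved X "P X" "q X" by unfold_locales (rule r[OF X])
  interpret Y: resolved Y "P Y" "q Y" by unfold_locales (rule r[OF Y])
  note cY = PO_complex[OF Y] and cZ = PO_complex[OF Z]
  obtain f g where f: "chain_map (P X) (shift m (P Y)) f" "mt (D X) (D Y) m f = F" "\<phi> = mor X Y m f"
    and g: "chain_map (P Y) (shift n (P Z)) g" "mt (D Y) (D Z) n g = G" "\<psi> = mor Y Z n g"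
    using assms unfolding rp_def by blast
  let ?h = "\<lambda>i x. g (i + m) (f i x)"
  have sZ: "shift m (shift n Z) = shift (m + n) Z" "shift m (shift n (P Z)) = shift (m + n) (P Z)"
    using shift_shift[OF cZ(1)] shift_shift[OF cZ(2)] by auto
  have h: "chain_map (P X) (shift (m + n) (P Z)) ?h"
    using chain_map_comp[OF f(1) chain_map_shift[OF cY(2) cZ(5) g(1)]] by (simp only: sZ)
  let ?l = "\<lambda>i x. q Z (i + m + n) (g (i + m) x)"
  have l: "chain_map (shift m (P Y)) (shift (m + n) Z) ?l"
    using chain_map_shift[OF cY(2) cZ(4) ql_chain[OF Y Z g(1)], of m] by (simp only: sZ)
  have sm: "shift_morphism m \<psi> \<subseteq> cl (shift m Y) (shift (m + n) Z) (shift m (P Y)) (\<lambda>i. q Y (i + m)) ?l"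
    using Y.shift_morphism_cl[OF cZ(4) ql_chain[OF Y Z g(1)], of m] unfolding g(3) mor_def sZ by simp
  have "\<psi> \<noteq> {}" unfolding g(3) mor_def using Y.cl_self[OF cZ(4) ql_chain[OF Y Z g(1)]] by blast
  then have ne: "shift_morphism m \<psi> \<noteq> {}" by (simp add: shift_morphism_def)
  have "derived_comp X (shift m Y) (shift (m + n) Z) (shift_morphism m \<psi>) \<phi> = cl X (shift (m + n) Z) (P X) (q X) (\<lambda>i x. ?l i (f i x))"
    unfolding f(3) mor_def
    by (rule X.derived_comp_cl[OF Y.resolved_shift cZ(4) ql_chain[OF X Y f(1)] l f(1) homotopic_refl[OF X.Pc cY(4) ql_chain[OF X Y f(1)]] sm ne])
  also have "\<dots> = mor X Z (m + n) ?h" by (simp add: mor_def add.assoc)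
  finally show ?thesis
    using rpI[OF h] mt_comp[OF D[OF X] D[OF Y] D[OF Z] gh_chain[OF f(1)] gh_chain[OF g(1)]] f(2) g(2) by simp
qed

lemma rp_id:
  assumes X: "X \<in> PO"
  shows "rp X X 0 (chain_class X X (\<lambda>i x. x)) (fst (mc (P X) (D X)))"
proof -
  interpret X: resolved X "P X" "q X" by unfold_locales (rule r[OF X])
  have c: "chain_map (P X) (shift 0 (P X)) (\<lambda>i x. x)" using chain_map_id by (simp add: shift_0[OF X.Pc])
  have "chain_class X X (\<lambda>i x. x) = mor X X 0 (\<lambda>i x. x)"
    using X.chain_class_cl[OF X.Xc chain_map_id] by (simp add: mor_def shift_0[OF X.Xc])
  then show ?thesis using rpI[OF c] by (simp add: mc_def)
qed

lemma rp_chain_class_central: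
  assumes X: "X \<in> PO" and z: "z \<in> alg_center"
  shows "rp X X 0 (chain_class X X (\<lambda>i x. z \<odot>\<^bsub>cmodule X i\<^esub> x)) (cm z (fst (mc (P X) (D X))))"
proof -
  interpret X: resolved X "P X" "q X" by unfold_locales (rule r[OF X])
  have c: "chain_map (P X) (shift 0 (P X)) (\<lambda>i x. x)" using chain_map_id by (simp add: shift_0[OF X.Pc])
  have "chain_class X X (\<lambda>i x. z \<odot>\<^bsub>cmodule X i\<^esub> x) = cl X (shift 0 X) (P X) (q X) (\<lambda>i x. z \<odot>\<^bsub>cmodule (shift 0 X) i\<^esub> q X (i + 0) x)"
    using X.chain_class_cl[OF X.Xc chain_map_central[OF X.Xc z chain_map_id]] by (simp add: shift_0[OF X.Xc])
  then show ?thesis using rp_central[OF X X z c] by (simp add: mc_def)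
qed

sublocale gcat_model scale p \<epsilon> "perfect_orbit_category scale" "\<lambda>X. mc (P X) (D X)" rp
  by unfold_locales (simp_all add: perfect_orbit_simps mcplx_mc[OF D] rp_dom rp_ex rp_onto rp_eq rp_add rp_smult rp_zero rp_comp rp_id)

lemma characteristic_hom0_central: "z \<in> alg_center \<Longrightarrow> central_action z (characteristic_hom0 scale z)"
  using rp_chain_class_central by (simp add: central_action_def characteristic_hom0_def perfect_orbit_simps)

lemma HK0_eq_K_alg:
  assumes X: "X \<in> PO" "mc (P X) (D X) = (sgl u u 1, 0)"
  shows "HK0 TYPE('m) scale p r = K_alg scale p r"
proof -
  have X': "X \<in> gObj (perfect_orbit_category scale)" using X(1) by (simp add: perfect_orbit_simps)
  show ?thesis
    using K_alg_K_cat[OF _ characteristic_hom0_central] K_cat_K_alg[OF X' X(2) characteristic_hom0_central]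
    unfolding HK0_def by (auto simp: K_alg_def)
qed

end

context symmetrized_algebra
begin

lemma exists_perfect_resolutions:
  assumes "infinite (UNIV :: 'm set)" and "inj (\<iota> :: 'a \<Rightarrow> 'm)"
  obtains P q D and X :: "('a, 'm) cplx" where "perfect_resolutions scale p \<epsilon> P q D" "X \<in> Obj (perfect_category scale)"
    "mc (P X) (D X) = (sgl (Ix 0 0) (Ix 0 0) 1, 0)"
proof -
  have inj: "\<exists>j :: (nat \<Rightarrow> 'a) \<Rightarrow> 'm. inj_on j (vec n)" for n by (rule vec_inj[OF assms])
  obtain j :: "(nat \<Rightarrow> 'a) \<Rightarrow> 'm" where j: "inj_on j (vec 1)" using inj by blast
  let ?U = "unit_cplx j"
  let ?E = "\<lparr>crk = \<lambda>i. if i = 0 then 1 else 0, cbs = \<lambda>i. free_module.bv j,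
    cco = \<lambda>i k x. inv_into (vec (if i = 0 then 1 else 0)) j x k\<rparr> :: ('a, 'm) cbas"
  have fm: "free_module j (if i = 0 then 1 else 0)" for i :: int by (rule free_module_le[OF j]) simp
  have Uc: "is_complex ?U" using strictly_perfect_unit_cplx[OF j] by (simp add: strictly_perfect_def)
  have E: "is_cbas ?U ?E"
    unfolding is_cbas_def
  proof (intro conjI allI Uc)
    show "finite {i. crk ?E i \<noteq> 0}" by simp
    show "dbasis (cmodule ?U i) (crk ?E i) (cbs ?E i) (cco ?E i)" for i
      using free_module.dbasis_F[OF fm[of i]] by (simp add: unit_cplx_simps)
  qed
  have "\<exists>P q D. res X P q \<and> is_cbas P D" if X: "X \<in> Obj (perfect_category scale)" for X :: "('a, 'm) cplx"
  proof -
    obtain P q where P: "res X P q" "finite {i. cc P i \<noteq> {cz P i}}" using perfect_res[OF inj X] by blast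
    have "liftable P" using P(1) by (simp add: res_def)
    from liftable_cbas[OF this P(2)] obtain D where "is_cbas P D" .
    with P(1) show ?thesis by blast
  qed
  then obtain P q D where pqd: "\<And>X :: ('a, 'm) cplx. X \<in> Obj (perfect_category scale) \<Longrightarrow> res X (P X) (q X) \<and> is_cbas (P X) (D X)"
    by metis
  have U: "res ?U ?U (\<lambda>i x. x)" "?U \<in> Obj (perfect_category scale)" by (rule unit_cplx_perfect[OF inj j])+
  \<comment> \<open>At the algebra itself the arbitrary choices are replaced by the identity
    resolution and the standard basis, so that its model is a single diagonal unit and the
    comparison with \<open>K_alg\<close> can be made there.\<close>
  have "perfect_resolutions scale p \<epsilon> (P(?U := ?U)) (q(?U := \<lambda>i x. x)) (D(?U := ?E))"
    by unfold_locales (use U E pqd in \<open>auto\<close>)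
  moreover have "mc ?U ?E = (sgl (Ix 0 0) (Ix 0 0) 1, 0)"
  proof -
    have b: "inv_into (vec 1) j (free_module.bv j 0) 0 = (1 :: 'a)" using free_module.co_bv[OF fm[of 0], of 0 0] by simp
    have "mt ?E ?E 0 (\<lambda>i x. x) = sgl (Ix 0 0) (Ix 0 0) 1"
    proof (rule imat_eqI)
      fix u v show "ent (mt ?E ?E 0 (\<lambda>i x. x)) u v = ent (sgl (Ix 0 0) (Ix 0 0) 1) u v"
        unfolding ent_mt[OF E E] using b by (cases u; cases v) (auto simp: sgl.rep_eq)
    qed
    moreover have "mt ?E ?E 1 (cdif ?U) = 0"
    proof (rule imat_eqI)
      fix u v show "ent (mt ?E ?E 1 (cdif ?U)) u v = ent 0 u v"
        unfolding ent_mt[OF E E] by (simp add: ent_simps)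
    qed
    ultimately show ?thesis by (simp add: mc_def)
  qed
  ultimately show ?thesis using that[of "P(?U := ?U)" "q(?U := \<lambda>i x. x)" "D(?U := ?E)" ?U] U(2) by simp
qed

end

lemma (in symmetrized_algebra) HK0_eq_K_alg:
  assumes "infinite (UNIV :: 'm set)" "inj (\<iota> :: 'a \<Rightarrow> 'm)"
  shows "HK0 TYPE('m) scale p r = K_alg scale p r"
proof -
  obtain P q D and X :: "('a, 'm) cplx" where P: "perfect_resolutions scale p \<epsilon> P q D" "X \<in> Obj (perfect_category scale)"
    "mc (P X) (D X) = (sgl (Ix 0 0) (Ix 0 0) 1, 0)" using exists_perfect_resolutions[OF assms] .
  interpret perfect_resolutions scale p \<epsilon> P q D by (rule P(1))
  show ?thesis by (rule HK0_eq_K_alg[OF P(2,3)])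
qed

section \<open>The socle\<close>

subsection \<open>Bimodule operators on a simple bimodule\<close>

text \<open>The operators through which the enveloping algebra acts on the algebra; the values of
  all of them at \<open>x\<close> form the two-sided ideal generated by \<open>x\<close>.\<close>

inductive_set bimult :: "('a::ring \<Rightarrow> 'a) set" where
  mult: "(\<lambda>x. a * x * b) \<in> bimult"
| plus: "f \<in> bimult \<Longrightarrow> g \<in> bimult \<Longrightarrow> (\<lambda>x. f x + g x) \<in> bimult"

lemma bimult_add: "f \<in> bimult \<Longrightarrow> f (x + y) = f x + f y"
  by (induction rule: bimult.induct) (auto simp: algebra_simps)

lemma bimult_0: "f \<in> bimult \<Longrightarrow> f 0 = 0"
  by (induction rule: bimult.induct) auto

lemma bimult_sum: "f \<in> bimult \<Longrightarrow> f (sum h A) = (\<Sum>a\<in>A. f (h a))"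
  by (induction A rule: infinite_finite_induct) (auto simp: bimult_0 bimult_add)

lemma bimult_central:
  fixes z :: "'a::{ring,monoid_mult}"
  assumes "f \<in> bimult" "z \<in> alg_center"
  shows "f (z * x) = z * f x"
  using assms(1)
proof (induction rule: bimult.induct)
  case (mult a b)
  then show ?case using assms(2) unfolding alg_center_def mem_Collect_eq by (metis mult.assoc)
qed (simp add: distrib_left)

lemma bimult_comp:
  assumes f: "f \<in> bimult" and g: "g \<in> bimult"
  shows "(\<lambda>x. f (g x)) \<in> bimult"
  using f
proof (induction rule: bimult.induct)
  case (mult a b)
  show ?case using g
  proof (induction rule: bimult.induct)
    case (mult c d)
    show ?case using bimult.mult[of "a * c" "d * b"] by (simp add: mult.assoc)
  next
    case (plus f g)
    then show ?case using bimult.plus[OF plus.IH] by (simp add: algebra_simps)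
  qed
qed (rule bimult.plus)

lemma
  fixes b :: "'a::{ring,monoid_mult}"
  shows bimult_right: "(\<lambda>x. x * b) \<in> bimult" and bimult_left: "(\<lambda>x. b * x) \<in> bimult"
    and bimult_id: "(\<lambda>x :: 'a. x) \<in> bimult" and bimult_zero: "(\<lambda>x :: 'a. 0 :: 'a) \<in> bimult"
  using bimult.mult[of 1 b] bimult.mult[of b 1] bimult.mult[of "1 :: 'a" 1] bimult.mult[of "0 :: 'a" 0] by simp_all

lemma bimult_diff:
  fixes f g :: "'a::{ring,monoid_mult} \<Rightarrow> 'a"
  assumes "f \<in> bimult" "g \<in> bimult"
  shows "(\<lambda>x. f x - g x) \<in> bimult"
  using bimult.plus[OF assms(1) bimult_comp[OF bimult_left[of "- 1"] assms(2)]] by simp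

lemma bimult_sum_closed:
  fixes f :: "'i \<Rightarrow> 'a::{ring,monoid_mult} \<Rightarrow> 'a"
  assumes "\<And>i. i \<in> A \<Longrightarrow> f i \<in> bimult"
  shows "(\<lambda>x. \<Sum>i\<in>A. f i x) \<in> bimult"
  using assms by (induction A rule: infinite_finite_induct) (auto intro: bimult_zero bimult.plus)

lemma sum_lessThan_append:
  fixes f g :: "nat \<Rightarrow> 'a::comm_monoid_add"
  shows "(\<Sum>i<n + m. if i < n then f i else g (i - n)) = (\<Sum>i<n. f i) + (\<Sum>i<m. g i)"
  by (induction m) (simp_all add: add.assoc)

lemma bimult_sum_form:
  fixes f :: "'a::ring \<Rightarrow> 'a"
  assumes "f \<in> bimult"
  shows "\<exists>n a b. f = (\<lambda>x. \<Sum>i<(n::nat). a i * x * b i)"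
  using assms
proof (induction rule: bimult.induct)
  case (mult a b)
  show ?case by (rule exI[of _ 1]) auto
next
  case (plus f g)
  from plus.IH(1) obtain n :: nat and a b where f: "f = (\<lambda>x. \<Sum>i<n. a i * x * b i)" by blast
  from plus.IH(2) obtain m :: nat and c d where g: "g = (\<lambda>x. \<Sum>i<m. c i * x * d i)" by blast
  have "(\<lambda>x. f x + g x) = (\<lambda>x. \<Sum>i<n + m. if i < n then a i * x * b i else c (i - n) * x * d (i - n))"
  proof
    fix x show "f x + g x = (\<Sum>i<n + m. if i < n then a i * x * b i else c (i - n) * x * d (i - n))"
      using sum_lessThan_append[where n = n and m = m and f = "\<lambda>i. a i * x * b i" and g = "\<lambda>i. c i * x * d i"] by (simp add: f g)
  qed
  also have "\<dots> = (\<lambda>x. \<Sum>i<n + m. (if i < n then a i else c (i - n)) * x * (if i < n then b i else d (i - n)))"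
    by (intro ext sum.cong refl) simp
  finally have e: "(\<lambda>x. f x + g x) = \<dots>" .
  show ?case
    by (rule exI[of _ "n + m"], rule exI[of _ "\<lambda>i. if i < n then a i else c (i - n)"], rule exI[of _ "\<lambda>i. if i < n then b i else d (i - n)"]) (rule e)
qed

context fd_algebra
begin

lemma
  shows subspace_dim_less: "\<lbrakk>subspace A; subspace B; A \<subset> B\<rbrakk> \<Longrightarrow> dim A < dim B"
    and dim_le_UNIV: "dim A \<le> dim UNIV"
proof -
  obtain S where S: "finite S" "span S = UNIV" using finite_dim by blast
  obtain T where T: "T \<subseteq> S" "independent T" "S \<subseteq> span T" using maximal_independent_subset[of S] by blast
  have "finite T" using T S finite_subset by blast
  moreover have "span T = UNIV" using T S by (metis span_mono span_span top.extremum_uniqueI)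
  ultimately interpret fd: finite_dimensional_vector_space scale T using T(2) by unfold_locales auto
  show "dim A < dim B" if "subspace A" "subspace B" "A \<subset> B"
    using fd.dim_psubset[of A B] that span_eq_iff by metis
  show "dim A \<le> dim UNIV" by (rule fd.dim_subset) simp
qed

lemma bimult_scale: "f \<in> bimult \<Longrightarrow> f (scale c x) = scale c (f x)"
proof (induction rule: bimult.induct)
  case (mult a b)
  show ?case by (simp add: scale_mult_left[symmetric] scale_mult_right[symmetric])
qed (simp add: scale_right_distrib)

text \<open>Substitute for a density theorem: an operator whose kernel on the multiples of
  \<open>z\<close> has maximal dimension cannot be improved, so a construction that would enlarge
  its kernel is contradictory.\<close>

lemma bimult_max_kernel:
  fixes z :: 'a
  assumes S: "S \<noteq> {}" "S \<subseteq> bimult"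
  obtains f where "f \<in> S" "\<And>f' x. f' \<in> S \<Longrightarrow> (\<And>x. f (z * x) = 0 \<Longrightarrow> f' (z * x) = 0) \<Longrightarrow> f' (z * x) = 0 \<Longrightarrow> f (z * x) = 0"
proof -
  let ?K = "\<lambda>f. {x :: 'a. f (z * x) = (0 :: 'a)}"
  have sub: "subspace (?K f)" if "f \<in> bimult" for f
    using that by (intro subspaceI) (auto simp: bimult_0 bimult_add distrib_left bimult_scale simp flip: scale_mult_right)
  obtain f0 where "f0 \<in> S" using S by blast
  then obtain f where f: "f \<in> S" "\<And>f'. f' \<in> S \<Longrightarrow> dim (?K f') \<le> dim (?K f)"
    using ex_has_greatest_nat[of "\<lambda>f. f \<in> S" f0 "\<lambda>f. dim (?K f)" "Suc (dim UNIV)"] dim_le_UNIV by (auto simp: less_Suc_eq_le)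
  show ?thesis
  proof (rule that[OF f(1)])
    fix f' x assume a: "f' \<in> S" "\<And>x. f (z * x) = 0 \<Longrightarrow> f' (z * x) = 0" "f' (z * x) = 0"
    show "f (z * x) = 0"
    proof (rule ccontr)
      assume "f (z * x) \<noteq> 0"
      then have "?K f \<subset> ?K f'" using a(2,3) by auto
      then have "dim (?K f) < dim (?K f')" using subspace_dim_less sub S(2) f(1) a(1) by blast
      then show False using f(2)[OF a(1)] by simp
    qed
  qed
qed

end

section \<open>Central elements that generate a simple bimodule\<close>

text \<open>By \<open>irr\<close> every nonzero multiple of \<open>z\<close> generates
  \<open>z\<close>, so for nonzero \<open>z\<close> the algebra modulo the annihilator of
  \<open>z\<close> is simple. This quotient is never formed: the class of \<open>x\<close> is
  replaced by \<open>z * x\<close>.\<close>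

locale simple_central = charp_algebra scale p
  for scale :: "'k::field \<Rightarrow> 'a::{ring,monoid_mult} \<Rightarrow> 'a" and p +
  fixes z :: 'a
  assumes z: "z \<in> alg_center" and irr: "z * x \<noteq> 0 \<Longrightarrow> \<exists>f\<in>bimult. f (z * x) = z"
begin

lemma zc: "z * x = x * z"
  using z by (simp add: alg_center_def)

lemma bimult_z: "f \<in> bimult \<Longrightarrow> f (z * x) = z * f x"
  using bimult_central z by blast

lemma bimult_hits:
  assumes "z * x \<noteq> 0"
  obtains f where "f \<in> bimult" "f (z * x) = z * y"
proof -
  obtain f where f: "f \<in> bimult" "f (z * x) = z" using irr assms by blast
  show ?thesis using that[OF bimult_comp[OF bimult_right[of y] f(1)]] f(2) by simp
qed

text \<open>If the values of a fixing operator \<open>f\<close> are not all central, then its kernel can be enlarged by means of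
  a commutator with an element of the algebra, because commutators vanish at \<open>z\<close>.\<close>

lemma central_projection:
  obtains e where "e \<in> bimult" "e z = z" "\<And>x. e (z * x) \<in> alg_center"
proof -
  obtain f where f: "f \<in> {f \<in> bimult. f z = z}"
    and m: "\<And>f' x. f' \<in> {f \<in> bimult. f z = z} \<Longrightarrow> (\<And>x. f (z * x) = 0 \<Longrightarrow> f' (z * x) = 0) \<Longrightarrow> f' (z * x) = 0 \<Longrightarrow> f (z * x) = 0"
    by (rule bimult_max_kernel[of "{f \<in> bimult. f z = z}" z]) (use bimult_id in blast)+
  have fb: "f \<in> bimult" "f z = z" using f by auto
  have "a * f (z * v) = f (z * v) * a" for a v
  proof (rule ccontr)
    assume "a * f (z * v) \<noteq> f (z * v) * a"
    then have "z * (a * f v - f v * a) \<noteq> 0" using bimult_z[OF fb(1)] zc by (metis eq_iff_diff_eq_0 mult.assoc right_diff_distrib)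
    then obtain h where h: "h \<in> bimult" "h (z * (a * f v - f v * a)) = z * f v" using bimult_hits by blast
    let ?c = "\<lambda>x. a * f x - f x * a" let ?f = "\<lambda>x. f x - h (?c x)"
    have "?f \<in> bimult"
      by (intro bimult_diff fb(1) bimult_comp[OF h(1)] bimult_comp[OF bimult_left fb(1)] bimult_comp[OF bimult_right fb(1)])
    moreover have "?f z = z" using fb(2) by (simp add: zc bimult_0[OF h(1)])
    moreover have "?c (z * v) = z * ?c v" using bimult_z[OF fb(1)] zc by (metis mult.assoc right_diff_distrib)
    then have "?f (z * v) = 0" using h(2) by (simp only: bimult_z[OF fb(1)]) simp
    moreover have "?f (z * x) = 0" if "f (z * x) = 0" for x using that by (simp add: bimult_0[OF h(1)])
    ultimately have "f (z * v) = 0" using m[of ?f v] by blast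
    then show False using \<open>a * f (z * v) \<noteq> f (z * v) * a\<close> by simp
  qed
  then have "f (z * x) \<in> alg_center" for x by (simp add: alg_center_def)
  then show ?thesis using that fb by blast
qed

text \<open>The counterpart of writing an identity as a sum of operators of rank one, over the field
  of the central multiples of \<open>z\<close>. A difference between the identity and such a sum
  with maximal kernel must vanish on the multiples of \<open>z\<close>.\<close>

lemma identity_decomposition:
  assumes e: "e \<in> bimult" "e z = z"
  obtains n :: nat and h g where "\<And>i. h i \<in> bimult" "\<And>i. g i \<in> bimult" "\<And>x. (\<Sum>i<n. h i (e (g i (z * x)))) = z * x"
proof -
  define S where "S = {f. \<exists>(n::nat) h g. (\<forall>i. h i \<in> bimult \<and> g i \<in> bimult) \<and> f = (\<lambda>x. x - (\<Sum>i<n. h i (e (g i x))))}"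
  have SI: "(\<lambda>x. x - (\<Sum>i<n. h i (e (g i x)))) \<in> S" if "\<And>i. h i \<in> bimult" "\<And>i. g i \<in> bimult" for n :: nat and h g
    using that unfolding S_def by blast
  have Sb: "S \<subseteq> bimult"
    unfolding S_def by (auto intro!: bimult_diff bimult_id bimult_sum_closed intro: bimult_comp[OF _ bimult_comp[OF e(1)]])
  have "S \<noteq> {}" using SI[of "\<lambda>i x. x" "\<lambda>i x. x"] bimult_id by blast
  then obtain f where f: "f \<in> S"
    and m: "\<And>f' x. f' \<in> S \<Longrightarrow> (\<And>x. f (z * x) = 0 \<Longrightarrow> f' (z * x) = 0) \<Longrightarrow> f' (z * x) = 0 \<Longrightarrow> f (z * x) = 0"
    using bimult_max_kernel[of S z] Sb by metis
  obtain n :: nat and h g where hg: "\<And>i. h i \<in> bimult" "\<And>i. g i \<in> bimult" and fe: "f = (\<lambda>x. x - (\<Sum>i<n. h i (e (g i x))))"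
    using f unfolding S_def by blast
  have fb: "f \<in> bimult" using f Sb by blast
  have "f (z * v) = 0" for v
  proof (rule ccontr)
    assume nz: "f (z * v) \<noteq> 0"
    then obtain k where k: "k \<in> bimult" "k (z * f v) = z" using irr bimult_z[OF fb] by metis
    \<comment> \<open>The additional term agrees with \<open>f\<close> at \<open>z * v\<close>:
      \<open>k\<close> takes \<open>f (z * v)\<close> to \<open>z\<close>, \<open>e\<close> fixes
      \<open>z\<close>, and multiplication by \<open>f v\<close> returns
      \<open>f (z * v)\<close>.\<close>
    let ?h = "h(n := \<lambda>x. x * f v)" and ?g = "g(n := \<lambda>x. k (f x))"
    let ?f = "\<lambda>x. x - (\<Sum>i<Suc n. ?h i (e (?g i x)))"
    have fe': "?f x = f x - e (k (f x)) * f v" for x by (simp add: fe)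
    have S': "?f \<in> S" by (rule SI) (use hg bimult_right bimult_comp[OF k(1) fb] in auto)
    have "?f (z * v) = 0" unfolding fe' bimult_z[OF fb] k(2) e(2) by simp
    moreover have "?f (z * x) = 0" if "f (z * x) = 0" for x unfolding fe' that by (simp add: bimult_0[OF k(1)] bimult_0[OF e(1)])
    ultimately show False using m[OF S'] nz by blast
  qed
  then have "(\<Sum>i<n. h i (e (g i (z * x)))) = z * x" for x by (simp add: fe)
  with hg show ?thesis by (rule that)
qed

text \<open>Operators of the form \<open>e w\<close> multiply \<open>z\<close> by central elements, so they commute at \<open>z\<close>; hence
  $f \mapsto \sum_i e g_i f h_i z$ is a trace, whose value at the idempotent \<open>e\<close> is \<open>z\<close>.\<close>

lemma exists_power_not_commutator:
  assumes z0: "z \<noteq> 0"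
  shows "\<exists>x. \<forall>c\<in>comm. z * x ^ p \<noteq> z * c"
proof (rule ccontr)
  assume "\<not> ?thesis"
  then have all: "\<exists>c\<in>comm. z * x ^ p = z * c" for x by blast
  obtain e where e: "e \<in> bimult" "e z = z" and ec: "\<And>x. e (z * x) \<in> alg_center" using central_projection by metis
  obtain n :: nat and h g where h: "\<And>i. h i \<in> bimult" and g: "\<And>i. g i \<in> bimult"
    and one: "\<And>x. (\<Sum>i<n. h i (e (g i (z * x)))) = z * x" using identity_decomposition[OF e] by metis
  have fz: "f z = z * f 1" if "f \<in> bimult" for f using bimult_z[OF that, of 1] by simp
  \<comment> \<open>Both \<open>e (v z)\<close> and \<open>e (w z)\<close> are central multiples of
    \<open>z\<close>, and bimodule operators commute with central factors.\<close>
  have swap: "e (v (e (w z))) = e (w (e (v z)))" if v: "v \<in> bimult" and w: "w \<in> bimult" for v w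
  proof -
    have k: "e (f z) = z * e (f 1)" "z * e (f 1) \<in> alg_center" "e (f x) = x * e (f 1)"
      if "f \<in> bimult" "x \<in> alg_center" for f x
      using ec[of "f 1"] bimult_z[OF e(1)] fz[OF that(1)] bimult_central[OF bimult_comp[OF e(1) that(1)] that(2), of 1] by simp_all
    have "e (v (e (w z))) = z * e (w 1) * e (v 1)" using k(3)[OF v k(2)[OF w z]] k(1)[OF w z] by simp
    also have "\<dots> = z * e (v 1) * e (w 1)"
      using k(2)[OF w z] k(2)[OF v z] zc unfolding alg_center_def mem_Collect_eq by (metis mult.assoc)
    also have "\<dots> = e (w (e (v z)))" using k(3)[OF w k(2)[OF v z]] k(1)[OF v z] by simp
    finally show ?thesis .
  qed
  define t where "t f = (\<Sum>i<n. e (g i (f (h i z))))" for f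
  have eg_sum: "e (g i (sum f A)) = (\<Sum>a\<in>A. e (g i (f a)))" for f and A :: "'x set" and i
    by (simp add: bimult_sum[OF g] bimult_sum[OF e(1)])
  have t_sum: "t (\<lambda>x. \<Sum>a\<in>A. f a x) = (\<Sum>a\<in>A. t (f a))" for f and A :: "'x set"
    unfolding t_def by (simp add: eg_sum) (rule sum.swap)
  have t_cong: "t f = t f'" if "\<And>x. f (z * x) = f' (z * x)" for f f'
    unfolding t_def fz[OF h] that ..
  have t_swap: "t (\<lambda>x. f (f' x)) = t (\<lambda>x. f' (f x))" if f: "f \<in> bimult" "f' \<in> bimult" for f f'
  proof -
    have ins: "f z = (\<Sum>j<n. h j (e (g j (f z))))" if "f \<in> bimult" for f using one[of "f 1"] fz[OF that] by simp
    have "t (\<lambda>x. f (f' x)) = (\<Sum>i<n. \<Sum>j<n. e (g i (f (h j (e (g j (f' (h i z))))))))"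
      unfolding t_def
    proof (rule sum.cong[OF refl])
      fix i
      show "e (g i (f (f' (h i z)))) = (\<Sum>j<n. e (g i (f (h j (e (g j (f' (h i z))))))))"
        by (subst ins[OF bimult_comp[OF f(2) h], of i]) (simp add: bimult_sum[OF f(1)] eg_sum)
    qed
    also have "\<dots> = (\<Sum>i<n. \<Sum>j<n. e (g j (f' (h i (e (g i (f (h j z))))))))"
      using swap[OF bimult_comp[OF g bimult_comp[OF f(1) h]] bimult_comp[OF g bimult_comp[OF f(2) h]]] by simp
    also have "\<dots> = (\<Sum>j<n. \<Sum>i<n. e (g j (f' (h i (e (g i (f (h j z))))))))" by (rule sum.swap)
    also have "\<dots> = t (\<lambda>x. f' (f x))"
      unfolding t_def
    proof (rule sum.cong[OF refl])
      fix i
      show "(\<Sum>j<n. e (g i (f' (h j (e (g j (f (h i z)))))))) = e (g i (f' (f (h i z))))"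
        by (subst (2) ins[OF bimult_comp[OF f(1) h], of i]) (simp add: bimult_sum[OF f(2)] eg_sum)
    qed
    finally show ?thesis .
  qed
  \<comment> \<open>Exchanging the factors in each summand turns \<open>t e\<close> into
    \<open>e\<close> applied to the decomposition of the identity at \<open>z\<close>.\<close>
  have te: "t e = z"
  proof -
    have "t e = (\<Sum>i<n. e (h i (e (g i z))))" unfolding t_def using swap[OF g h] by simp
    also have "\<dots> = e (\<Sum>i<n. h i (e (g i (z * 1))))" by (simp add: bimult_sum[OF e(1)])
    also have "\<dots> = z" unfolding one by (simp add: e(2))
    finally show ?thesis .
  qed
  have t_comm: "t (\<lambda>x. c * x * b) = 0" if "c \<in> comm" for c b
    using that
  proof (induction rule: comm_induct)
    case zero
    show ?case by (simp add: t_def bimult_0[OF g] bimult_0[OF e(1)])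
  next
    case (add x y)
    have "t (\<lambda>v. (x + y) * v * b) = t (\<lambda>v. x * v * b) + t (\<lambda>v. y * v * b)"
      by (simp add: t_def distrib_right bimult_add[OF g] bimult_add[OF e(1)] sum.distrib)
    then show ?case using add by simp
  next
    case (commutator x y)
    have "t (\<lambda>v. (x * y - y * x) * v * b) + t (\<lambda>v. y * (x * v) * b) = t (\<lambda>v. x * (y * v * b))"
      by (simp add: t_def algebra_simps flip: bimult_add[OF g] bimult_add[OF e(1)] sum.distrib)
    then show ?case using t_swap[OF bimult_left[of x] bimult.mult[of y b]] by simp
  qed
  obtain m :: nat and a b where eF: "e = (\<lambda>x. \<Sum>i<m. a i * x * b i)" using bimult_sum_form[OF e(1)] by blast
  define F where "F i x = a i * x * b i" for i x
  have Fb: "F i \<in> bimult" for i unfolding F_def[abs_def] by (rule bimult.mult)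
  have foldr_b: "foldr F w \<in> bimult" for w
    by (induction w) (use bimult_id bimult_comp[OF Fb] in \<open>auto simp: id_def comp_def\<close>)
  have idem: "e (e (z * x)) = e (z * x)" for x
    using bimult_central[OF e(1) ec, of x 1] bimult_z[OF e(1)] e(2) fz[OF e(1)] zc by (metis mult.assoc mult_1_right)
  have epow: "(e ^^ Suc k) (z * x) = e (z * x)" for k x
    by (induction k) (simp_all add: idem)
  have "z = t (e ^^ p)"
    using te t_cong[of e "e ^^ p"] epow[of "p - 1"] char(2) by (simp del: funpow.simps)
  also have "e ^^ p = (\<lambda>x. \<Sum>w\<in>{w. set w \<subseteq> {..<m} \<and> length w = p}. foldr F w x)"
  proof
    fix x
    have "e = (\<lambda>v. \<Sum>i\<in>{..<m}. F i v)" by (simp add: eF F_def)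
    then show "(e ^^ p) x = (\<Sum>w\<in>{w. set w \<subseteq> {..<m} \<and> length w = p}. foldr F w x)"
      using sum_words[of "{..<m}" F p x] bimult_add[OF Fb] by simp
  qed
  also have "t \<dots> = (\<Sum>w\<in>{w. set w \<subseteq> {..<m} \<and> length w = p}. t (foldr F w))" by (rule t_sum)
  also have "\<dots> = (\<Sum>i<m. t (foldr F (replicate p i)))"
  proof -
    have "t (foldr F (w @ [i])) = t (foldr F (i # w))" for i w
    proof -
      have "foldr F (w @ [i]) = (\<lambda>x. foldr F w (F i x))" by (simp add: fun_eq_iff)
      then show ?thesis using t_swap[OF foldr_b[of w] Fb[of i]] by (simp add: comp_def)
    qed
    then have "(\<Sum>w\<in>{w. set w \<subseteq> {..<m} \<and> length w = p}. t (foldr F w)) - (\<Sum>i<m. t (foldr F (replicate p i))) \<in> {0}"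
      by (intro sum_cyclic_words prime_p) (auto simp: sum_p_zero)
    then show ?thesis by simp
  qed
  \<comment> \<open>A constant word multiplies by the p-th power of \<open>a i\<close> on the left
    and of \<open>b i\<close> on the right. By assumption the left power acts on the multiples of
    \<open>z\<close> like an element of \<open>comm\<close>, and \<open>t\<close> kills such
    operators.\<close>
  also have "\<dots> = 0"
  proof (rule sum.neutral, rule ballI)
    fix i
    have fr: "foldr F (replicate k i) x = a i ^ k * x * b i ^ k" for k x
      by (induction k) (simp_all add: F_def mult.assoc power_commutes)
    obtain c where c: "c \<in> comm" "z * a i ^ p = z * c" using all by blast
    have "t (foldr F (replicate p i)) = t (\<lambda>x. c * x * b i ^ p)"
    proof (rule t_cong)
      fix x
      have "a i ^ p * (z * x) = c * (z * x)" using c(2) zc by (metis mult.assoc)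
      then show "foldr F (replicate p i) (z * x) = c * (z * x) * b i ^ p" unfolding fr by simp
    qed
    then show "t (foldr F (replicate p i)) = 0" using t_comm[OF c(1)] by simp
  qed
  finally show False using z0 by simp
qed

end

text \<open>A central multiple of \<open>z\<close> acts like a scalar modulo commutators: its factor
  \<open>c\<close> is absorbed into one entry of each commutator.\<close>

lemma (in simple_central) comm_quasi_central:
  assumes c: "z * c \<in> alg_center" and m: "m \<in> comm"
  shows "\<exists>m'\<in>comm. z * c * m = z * m'"
  using m
proof (induction rule: comm_induct)
  case zero
  then show ?case using comm_0 by (intro bexI[of _ 0]) auto
next
  case (add x y)
  then obtain u v where "u \<in> comm" "z * c * x = z * u" "v \<in> comm" "z * c * y = z * v" by blast
  then show ?case by (intro bexI[of _ "u + v"]) (auto simp: distrib_left comm_add)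
next
  case (commutator x y)
  have "z * c * (y * x) = z * (y * (c * x))"
    using c zc unfolding alg_center_def mem_Collect_eq by (metis mult.assoc)
  then have "z * c * (x * y - y * x) = z * ((c * x) * y - y * (c * x))"
    by (simp add: right_diff_distrib mult.assoc)
  then show ?case using comm_commutator by blast
qed

context symmetrized_algebra
begin

text \<open>The elements orthogonal to \<open>comm\<close> are central. Through this, functionals
  that vanish on commutators turn into central elements.\<close>

lemma central_iff_eps_comm:
  assumes "\<And>c. c \<in> comm \<Longrightarrow> \<epsilon> (v * c) = 0"
  shows "v \<in> alg_center"
proof -
  have "v * a - a * v = 0" for a
  proof (rule eps_nondegenerate)
    fix b
    have "\<epsilon> ((v * a - a * v) * b) = \<epsilon> (v * (a * b - b * a))"
      using eps_commute[of a "v * b"] by (simp add: algebra_simps functional_simps[OF eps])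
    then show "\<epsilon> ((v * a - a * v) * b) = 0" using assms[OF comm_commutator] by simp
  qed
  then show ?thesis by (simp add: alg_center_def)
qed

lemma subspace_mult: "subspace S \<Longrightarrow> subspace ((*) z ` S)"
proof (rule subspaceI)
  assume S: "subspace S"
  show "0 \<in> (*) z ` S" using subspace_0[OF S] by force
  show "x + y \<in> (*) z ` S" if "x \<in> (*) z ` S" "y \<in> (*) z ` S" for x y
    using that subspace_add[OF S] by (auto simp flip: distrib_left)
  show "scale c x \<in> (*) z ` S" if "x \<in> (*) z ` S" for c x
    using that subspace_scale[OF S] by (auto simp: scale_mult_right)
qed

text \<open>The Frobenius map is semilinear on the quotient by the commutators, which is one-dimensional over the
  field of the central elements of \<open>z\<close> times the algebra; being nonzero, it is injective.\<close>

lemma simple_central_frobenius: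
  assumes sc: "simple_central scale p z" and c0: "c0 \<in> comm" "z * b ^ p = z * c0"
  shows "\<exists>c\<in>comm. z * b = z * c"
proof (rule ccontr)
  assume nb: "\<not> ?thesis"
  interpret simple_central scale p z by (rule sc)
  have z0: "z \<noteq> 0" using nb comm_0 by auto
  have zl: "z * (x * y) = x * (z * y)" for x y using zc by (metis mult.assoc)
  have "z * b \<notin> (*) z ` comm" using nb by blast
  then obtain l where l: "functional scale l" "\<forall>x\<in>(*) z ` comm. l x = 0" "l (z * b) = 1"
    using functional_separating[OF subspace_mult[OF subspace_comm]] by blast
  obtain w where w: "\<And>x. l x = \<epsilon> (w * x)" using eps_representation[OF l(1)] by metis
  have wc: "z * w \<in> alg_center" by (rule central_iff_eps_comm) (use l(2) w zl in \<open>auto simp: mult.assoc\<close>)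
  \<comment> \<open>Modulo commutators every multiple of \<open>z\<close> is a central multiple of
    \<open>z * b\<close>. Otherwise a functional that vanishes on all of these gives a nonzero
    central \<open>z * v\<close>, which simplicity inverts.\<close>
  have "\<exists>c m. z * c \<in> alg_center \<and> m \<in> comm \<and> z * x = z * (c * b + m)" for x
  proof (rule ccontr)
    assume nx: "\<not> ?thesis"
    define S where "S = {c * b + m | c m. z * c \<in> alg_center \<and> m \<in> comm}"
    have SI: "z * c \<in> alg_center \<Longrightarrow> m \<in> comm \<Longrightarrow> c * b + m \<in> S" for c m unfolding S_def by blast
    have "subspace S"
    proof (rule subspaceI)
      show "0 \<in> S" using SI[of 0 0] comm_0 by (simp add: alg_center_def)
    next
      fix x y assume "x \<in> S" "y \<in> S"
      then obtain c m d n where x: "x = c * b + m" "z * c \<in> alg_center" "m \<in> comm"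
        and y: "y = d * b + n" "z * d \<in> alg_center" "n \<in> comm" unfolding S_def by blast
      have "z * (c + d) \<in> alg_center" using x(2) y(2) by (simp add: alg_center_def distrib_left distrib_right)
      from SI[OF this comm_add[OF x(3) y(3)]] show "x + y \<in> S" by (simp add: x(1) y(1) algebra_simps)
    next
      fix k x assume "x \<in> S"
      then obtain c m where x: "x = c * b + m" "z * c \<in> alg_center" "m \<in> comm" unfolding S_def by blast
      have "z * scale k c \<in> alg_center"
        using x(2) by (simp add: alg_center_def flip: scale_mult_right) (simp flip: scale_mult_left)
      from SI[OF this comm_scale[OF x(3)]] show "scale k x \<in> S" by (simp add: x(1) scale_right_distrib scale_mult_left)
    qed
    then have "subspace ((*) z ` S)" by (rule subspace_mult)
    moreover have "z * x \<notin> (*) z ` S" using nx unfolding S_def by blast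
    ultimately obtain l' where l': "functional scale l'" "\<forall>x\<in>(*) z ` S. l' x = 0" "l' (z * x) = 1"
      using functional_separating by blast
    obtain v where v: "\<And>x. l' x = \<epsilon> (v * x)" using eps_representation[OF l'(1)] by metis
    have v0: "\<epsilon> (z * v * s) = 0" if "s \<in> S" for s using l'(2) v that zl[of v s] by (auto simp: mult.assoc)
    have vc: "z * v \<in> alg_center"
    proof (rule central_iff_eps_comm)
      fix c assume "c \<in> comm"
      then show "\<epsilon> (z * v * c) = 0" using v0 SI[of 0 c] by (simp add: alg_center_def)
    qed
    have "z * v \<noteq> 0"
    proof
      assume "z * v = 0"
      then have "v * (z * x) = 0" using zl[of v x] by (metis mult.assoc mult_zero_left)
      then show False using l'(3) v by (simp add: functional_simps[OF eps])
    qed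
    then obtain f where f: "f \<in> bimult" "f (z * v) = z" using irr by blast
    define d where "d = f 1"
    have zd: "z * v * d = z" using bimult_central[OF f(1) vc, of 1] f(2) by (simp add: d_def)
    \<comment> \<open>\<open>z * v\<close> annihilates the commutators of \<open>d\<close>; if one
      of them had a nonzero multiple by \<open>z\<close>, that multiple would generate
      \<open>z\<close>, and \<open>z * v\<close> would be zero.\<close>
    have dc: "z * d \<in> alg_center"
    proof -
      have "z * (d * a - a * d) = 0" for a
      proof (rule ccontr)
        assume "z * (d * a - a * d) \<noteq> 0"
        then obtain h where h: "h \<in> bimult" "h (z * (d * a - a * d)) = z" using irr by blast
        have "z * v * (d * a) = z * a" using zd by (metis mult.assoc)
        moreover have "z * v * (a * d) = a * (z * v * d)" using vc unfolding alg_center_def mem_Collect_eq by (metis mult.assoc)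
        ultimately have "z * v * (d * a - a * d) = 0" using zd zc by (simp add: right_diff_distrib)
        then have "z * v * h (d * a - a * d) = 0" using bimult_central[OF h(1) vc, of "d * a - a * d"] bimult_0[OF h(1)] by simp
        moreover have "z * h (d * a - a * d) = z" using h bimult_z by metis
        then have "z * v * h (d * a - a * d) = z * v" using zl zc by (metis mult.assoc)
        ultimately show False using \<open>z * v \<noteq> 0\<close> by simp
      qed
      then have "z * d * a = a * (z * d)" for a using zl[of a d] by (simp add: right_diff_distrib mult.assoc)
      then show ?thesis by (simp add: alg_center_def)
    qed
    \<comment> \<open>\<open>d * w * b\<close> belongs to \<open>S\<close>, so its pairing with
      \<open>z * v\<close> vanishes; but \<open>d\<close> cancels \<open>v\<close>, and the pairing
      is \<open>l (z * b) = 1\<close>.\<close>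
    have "z * (d * w) * a = a * (z * (d * w))" for a
      using dc wc zc unfolding alg_center_def mem_Collect_eq by (metis mult.assoc)
    then have "z * (d * w) \<in> alg_center" by (simp add: alg_center_def)
    from v0[OF SI[OF this comm_0]] have "\<epsilon> (z * v * (d * w * b)) = 0" by simp
    moreover have "z * v * (d * w * b) = w * (z * b)" using zd zl[of w b] by (metis mult.assoc)
    ultimately show False using l(3) w by simp
  qed
  \<comment> \<open>Semilinearity: the power of c b + m is congruent to c^p b^p + m^p. If b^p is a
    commutator up to the annihilator of \<open>z\<close>, then so is every p-th power, against
    \<open>exists_power_not_commutator\<close>.\<close>
  moreover have "\<exists>c'\<in>comm. z * x ^ p = z * c'" if c: "z * c \<in> alg_center" and m: "m \<in> comm" and x: "z * x = z * (c * b + m)" for x c m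
  proof -
    have pw: "z * y ^ k = z * y' ^ k" if "z * y = z * y'" for y y' k
    proof (induction k)
      case (Suc k)
      have "z * y ^ Suc k = z * y * y ^ k" by (simp add: mult.assoc)
      also have "\<dots> = y' * (z * y ^ k)" using that zl by (simp add: mult.assoc)
      also have "\<dots> = z * y' ^ Suc k" using Suc zl by simp
      finally show ?case .
    qed simp
    have ck: "z * c ^ k \<in> alg_center \<and> z * (c * b) ^ k = z * c ^ k * b ^ k" for k
    proof (induction k)
      case 0
      then show ?case using z by simp
    next
      case (Suc k)
      have "z * c ^ Suc k * a = a * (z * c ^ Suc k)" for a
        using Suc c zc unfolding alg_center_def mem_Collect_eq power_Suc by (metis mult.assoc)
      moreover have "z * (c * b) ^ Suc k = z * c * b * (c * b) ^ k" by (simp add: mult.assoc)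
      moreover have "\<dots> = c * (b * (z * (c * b) ^ k))" using zl by (simp add: mult.assoc)
      moreover have "b * (z * c ^ k * b ^ k) = z * c ^ k * (b * b ^ k)"
        using Suc unfolding alg_center_def mem_Collect_eq by (metis mult.assoc)
      ultimately show ?case using Suc zl by (simp add: alg_center_def mult.assoc)
    qed
    have "z * (c * b) ^ p = c ^ p * (z * b ^ p)" using ck zl by (simp add: mult.assoc)
    also have "\<dots> = z * c ^ p * c0" using c0(2) zl by (simp add: mult.assoc)
    finally obtain m' where m': "m' \<in> comm" "z * (c * b) ^ p = z * m'" using comm_quasi_central[of "c ^ p" c0] ck c0(1) by metis
    have "z * x ^ p = z * (c * b + m) ^ p" by (rule pw[OF x])
    also have "\<dots> = z * (((c * b + m) ^ p - ((c * b) ^ p + m ^ p)) + m ^ p) + z * (c * b) ^ p" by (simp add: algebra_simps)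
    also have "\<dots> = z * (((c * b + m) ^ p - ((c * b) ^ p + m ^ p)) + m ^ p + m')" by (simp add: m'(2) algebra_simps)
    finally show ?thesis using comm_add[OF comm_add[OF comm_add_power power_comm[OF m]] m'(1)] by blast
  qed
  ultimately show False using exists_power_not_commutator[OF z0] by metis
qed

text \<open>The iteration keeps the weaker relation that \<open>z * b\<close> lies in z times
  \<open>comm\<close>, which is what the injectivity of the Frobenius map reproduces.\<close>

lemma simple_central_mult_comm:
  assumes sc: "simple_central scale p z" and b: "b ^ (p ^ r) \<in> comm"
  shows "z * b \<in> comm"
proof -
  interpret simple_central scale p z by (rule sc)
  have "\<exists>c\<in>comm. z * b = z * c" if "\<exists>c\<in>comm. z * b ^ (p ^ r) = z * c" for b
    using that
  proof (induction r arbitrary: b)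
    case (Suc r)
    have "b ^ (p ^ Suc r) = (b ^ p) ^ (p ^ r)" by (simp add: power_mult)
    then have "\<exists>c\<in>comm. z * b ^ p = z * c" using Suc by metis
    then show ?case using simple_central_frobenius[OF sc] by blast
  qed simp
  then show ?thesis using b comm_diff_mult_central[OF z] by metis
qed

end

subsection \<open>Right ideals and the socle\<close>

lemma right_idealD:
  assumes "right_ideal I"
  shows "0 \<in> I" "x \<in> I \<Longrightarrow> y \<in> I \<Longrightarrow> x - y \<in> I" "x \<in> I \<Longrightarrow> x * a \<in> I" "x \<in> I \<Longrightarrow> y \<in> I \<Longrightarrow> x + y \<in> I"
proof -
  show 0: "0 \<in> I" and d: "x \<in> I \<Longrightarrow> y \<in> I \<Longrightarrow> x - y \<in> I" and "x \<in> I \<Longrightarrow> x * a \<in> I" for x y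
    using assms by (auto simp: right_ideal_def)
  show "x + y \<in> I" if "x \<in> I" "y \<in> I" using d[OF that(1) d[OF 0 that(2)]] by simp
qed

lemma right_ideal_sum:
  assumes "right_ideal I" "right_ideal J"
  shows "right_ideal {x + y | x y. x \<in> I \<and> y \<in> J}"
  unfolding right_ideal_def
proof (intro conjI ballI allI)
  let ?S = "{x + y | x y. x \<in> I \<and> y \<in> J}"
  note I = right_idealD[OF assms(1)] and J = right_idealD[OF assms(2)]
  have S: "x \<in> I \<Longrightarrow> y \<in> J \<Longrightarrow> x + y \<in> ?S" for x y by blast
  show "0 \<in> ?S" using S[OF I(1) J(1)] by simp
  fix u assume "u \<in> ?S"
  then obtain x y where u: "x \<in> I" "y \<in> J" "u = x + y" by blast
  show "u * a \<in> ?S" for a using S[OF I(3)[OF u(1)] J(3)[OF u(2)]] by (simp add: u(3) distrib_right)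
  fix v assume "v \<in> ?S"
  then obtain x' y' where v: "x' \<in> I" "y' \<in> J" "v = x' + y'" by blast
  show "u - v \<in> ?S" using S[OF I(2)[OF u(1) v(1)] J(2)[OF u(2) v(2)]] by (simp add: u(3) v(3) algebra_simps)
qed

context fd_algebra
begin

abbreviation "soc \<equiv> alg_socle scale"

lemma subspace_right_ideal:
  assumes "right_ideal I"
  shows "subspace I"
proof (rule subspaceI)
  note I = right_idealD[OF assms]
  show "0 \<in> I" by (rule I(1))
  show "x + y \<in> I" if "x \<in> I" "y \<in> I" for x y by (rule I(4)[OF that])
  show "scale c x \<in> I" if "x \<in> I" for c x using I(3)[OF that, of "scale c 1"] by (simp flip: scale_mult_right)
qed

lemma subspace_socle: "subspace soc"
  by (simp add: alg_socle_def)

lemma socle_mult: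
  assumes "x \<in> soc"
  shows "x * a \<in> soc"
  using assms unfolding alg_socle_def
proof (induction rule: span_induct_alt)
  case base
  show ?case by (simp add: span_zero)
next
  case (step c x y)
  then obtain I where I: "minimal_right_ideal I" "x \<in> I" by blast
  then have "x * a \<in> I" using right_idealD(3) by (auto simp: minimal_right_ideal_def)
  then have "x * a \<in> span (\<Union>{I. minimal_right_ideal I})" using I(1) by (intro span_base) blast
  then have "scale c (x * a) + y * a \<in> span (\<Union>{I. minimal_right_ideal I})" using step by (intro span_add span_scale)
  then show ?case by (simp add: distrib_right scale_mult_left)
qed

text \<open>\<open>J\<close> has maximal dimension among the right ideals that meet \<open>I\<close>
  trivially. A minimal right ideal outside the sum of \<open>I\<close> and \<open>J\<close> would
  meet this sum in 0 and could be added to \<open>J\<close>.\<close>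

lemma socle_complement:
  assumes I: "right_ideal I"
  obtains J where "right_ideal J" "I \<inter> J = {0}" "\<And>x. x \<in> soc \<Longrightarrow> \<exists>y\<in>I. x - y \<in> J"
proof -
  let ?P = "\<lambda>J. right_ideal J \<and> I \<inter> J = {0}"
  have "?P {0}" using right_idealD(1)[OF I] by (auto simp: right_ideal_def)
  then obtain J where J: "right_ideal J" "I \<inter> J = {0}" and m: "\<And>J'. ?P J' \<Longrightarrow> dim J' \<le> dim J"
    using ex_has_greatest_nat[of ?P "{0}" dim "Suc (dim UNIV)"] dim_le_UNIV by (auto simp: less_Suc_eq_le)
  let ?W = "{x + y | x y. x \<in> I \<and> y \<in> J}"
  have W: "right_ideal ?W" by (rule right_ideal_sum[OF I J(1)])
  have JW: "J \<subseteq> ?W" using right_idealD(1)[OF I] by force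
  have "S \<subseteq> ?W" if S: "minimal_right_ideal S" for S
  proof (rule ccontr)
    assume n: "\<not> S \<subseteq> ?W"
    have Sr: "right_ideal S" using S by (simp add: minimal_right_ideal_def)
    have "right_ideal (S \<inter> ?W)" using right_idealD[OF Sr] right_idealD[OF W] by (simp add: right_ideal_def)
    then have "S \<inter> ?W = {0} \<or> S \<inter> ?W = S" using S unfolding minimal_right_ideal_def by blast
    then have SW: "S \<inter> ?W = {0}" using n by blast
    define J1 where "J1 = {x + y | x y. x \<in> J \<and> y \<in> S}"
    have J': "right_ideal J1" unfolding J1_def by (rule right_ideal_sum[OF J(1) Sr])
    have "I \<inter> J1 \<subseteq> {0}"
    proof
      fix x assume "x \<in> I \<inter> J1"
      then obtain y s where x: "x \<in> I" "y \<in> J" "s \<in> S" "x = y + s" unfolding J1_def by blast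
      have "s = x + (0 - y)" using x(4) by simp
      then have "s \<in> ?W" using x(1) right_idealD(2)[OF J(1) right_idealD(1)[OF J(1)] x(2)] by blast
      then have "s = 0" using SW x(3) by blast
      then show "x \<in> {0}" using x J(2) by auto
    qed
    then have "?P J1" using J' right_idealD(1)[OF I] right_idealD(1)[OF J'] by blast
    then have le: "dim J1 \<le> dim J" by (rule m)
    have "J \<subseteq> J1" unfolding J1_def using right_idealD(1)[OF Sr] by force
    moreover have "S \<subseteq> J1" unfolding J1_def using right_idealD(1)[OF J(1)] by force
    moreover obtain s where s: "s \<in> S" "s \<notin> ?W" using n by (meson subsetI)
    moreover have "s \<notin> J" using s(2) JW by (meson subsetD)
    ultimately have "J \<subset> J1" by blast
    then show False using subspace_dim_less[OF subspace_right_ideal[OF J(1)] subspace_right_ideal[OF J']] le by simp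
  qed
  then have "soc \<subseteq> ?W" unfolding alg_socle_def by (intro span_minimal subspace_right_ideal[OF W]) blast
  then have "\<exists>y\<in>I. x - y \<in> J" if "x \<in> soc" for x using that by (force simp: subset_iff)
  then show ?thesis using that J by blast
qed

lemma exists_minimal_right_ideal:
  fixes T :: "'a set"
  assumes T: "right_ideal T" "T \<noteq> {0}"
  obtains S where "minimal_right_ideal S" "S \<subseteq> T"
proof -
  let ?P = "\<lambda>S. right_ideal S \<and> S \<subseteq> T \<and> S \<noteq> {0}"
  obtain S where S: "right_ideal S" "S \<subseteq> T" "S \<noteq> {0}" and m: "\<And>S'. ?P S' \<Longrightarrow> dim S \<le> dim S'"
    using ex_has_least_nat[of ?P T dim] T by auto
  have "J = S" if J: "right_ideal J" "J \<subseteq> S" "J \<noteq> {0}" for J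
  proof (rule ccontr)
    assume "J \<noteq> S"
    then have "dim J < dim S" using subspace_dim_less subspace_right_ideal J S(1) by blast
    then show False using m[of J] J S(2) by auto
  qed
  then have "minimal_right_ideal S" using S by (auto simp: minimal_right_ideal_def)
  then show ?thesis using that S(2) by blast
qed

text \<open>The kernels of left multiplication by the powers of \<open>w\<close> stabilize at some
  k. If w^k were nonzero, its right ideal would contain a minimal one; an element w^k x of that is
  killed by \<open>w\<close>, so \<open>x\<close> is in the next kernel, hence in the k-th, and w^k
  x is zero.\<close>

lemma socle_annihilator_nilpotent:
  assumes w: "\<And>s. s \<in> soc \<Longrightarrow> w * s = 0"
  shows "\<exists>n. w ^ n = 0"
proof -
  let ?K = "\<lambda>k. {x. w ^ k * x = 0}"
  have K: "subspace (?K k)" for k by (rule subspaceI) (auto simp: distrib_left simp flip: scale_mult_right)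
  obtain k where k: "\<And>j. dim (?K j) \<le> dim (?K k)"
    using ex_has_greatest_nat[of "\<lambda>_. True" 0 "\<lambda>k. dim (?K k)" "Suc (dim UNIV)"] dim_le_UNIV by (auto simp: less_Suc_eq_le)
  have "?K k \<subseteq> ?K (Suc k)" by (auto simp: mult.assoc)
  then have eq: "?K (Suc k) = ?K k" using subspace_dim_less[OF K K, of k "Suc k"] k[of "Suc k"] by auto
  have T: "right_ideal (range ((*) (w ^ k)))"
    unfolding right_ideal_def
  proof (intro conjI ballI allI)
    show "0 \<in> range ((*) (w ^ k))" by (rule range_eqI[of _ _ 0]) simp
    fix x assume "x \<in> range ((*) (w ^ k))"
    then obtain x' where x: "x = w ^ k * x'" by blast
    show "x * a \<in> range ((*) (w ^ k))" for a by (rule range_eqI[of _ _ "x' * a"]) (simp add: x mult.assoc)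
    fix y assume "y \<in> range ((*) (w ^ k))"
    then obtain y' where "y = w ^ k * y'" by blast
    then show "x - y \<in> range ((*) (w ^ k))" by (intro range_eqI[of _ _ "x' - y'"]) (simp add: x right_diff_distrib)
  qed
  have "range ((*) (w ^ k)) = {0}"
  proof (rule ccontr)
    assume "range ((*) (w ^ k)) \<noteq> {0}"
    then obtain S where S: "minimal_right_ideal S" "S \<subseteq> range ((*) (w ^ k))" using exists_minimal_right_ideal[OF T] by blast
    have "0 \<in> S" "S \<noteq> {0}" using S(1) right_idealD(1) by (auto simp: minimal_right_ideal_def)
    then obtain s where s: "s \<in> S" "s \<noteq> 0" by blast
    then obtain x where x: "s = w ^ k * x" using S(2) by blast
    have "s \<in> soc" unfolding alg_socle_def using S(1) s(1) by (intro span_base) blast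
    then have "x \<in> ?K (Suc k)" using w[of s] by (simp add: x mult.assoc)
    then have "x \<in> ?K k" by (rule eq[THEN equalityD1, THEN subsetD])
    then show False using s(2) x by simp
  qed
  then have "w ^ k * 1 = 0" by blast
  then show ?thesis by auto
qed

text \<open>A complement, as a right ideal, of the bimodule \<open>I\<close> generated by \<open>z * x\<close> splits \<open>z\<close> into \<open>z * e\<close> and
  \<open>z * (1 - e)\<close>. If \<open>z * y \<in> I\<close>, then \<open>z * y * (1 - e)\<close> generates a right ideal that has square zero modulo
  the annihilator of \<open>z\<close>, so it vanishes because \<open>z\<close> is in the socle; therefore \<open>z * e\<close> is central.\<close>

lemma socle_split:
  assumes z: "z \<in> soc" "z \<in> alg_center" and x: "z * x \<noteq> 0" "\<And>f. f \<in> bimult \<Longrightarrow> f (z * x) \<noteq> z"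
  obtains e where "z * e \<in> alg_center" "z \<notin> range ((*) (z * e))" "z \<notin> range ((*) (z * (1 - e)))"
proof -
  have zc: "z * y = y * z" for y using z(2) by (simp add: alg_center_def)
  have zl: "z * (a * b) = a * (z * b)" for a b using zc by (metis mult.assoc)
  define I where "I = {f (z * x) | f. f \<in> bimult}"
  have II: "f \<in> bimult \<Longrightarrow> f (z * x) \<in> I" for f by (auto simp: I_def)
  have I: "right_ideal I"
    unfolding right_ideal_def
  proof (intro conjI ballI allI)
    show "0 \<in> I" using II[OF bimult_zero] .
    fix u assume "u \<in> I"
    then obtain f where f: "f \<in> bimult" "u = f (z * x)" by (auto simp: I_def)
    show "u * a \<in> I" for a using II[OF bimult_comp[OF bimult_right f(1)]] f(2) by simp
    fix v assume "v \<in> I"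
    then obtain g where g: "g \<in> bimult" "v = g (z * x)" by (auto simp: I_def)
    show "u - v \<in> I" using II[OF bimult_diff[OF f(1) g(1)]] f(2) g(2) by simp
  qed
  have Il: "a * u \<in> I" if u: "u \<in> I" for a u
  proof -
    obtain f where f: "f \<in> bimult" "u = f (z * x)" using u by (auto simp: I_def)
    show ?thesis using II[OF bimult_comp[OF bimult_left f(1)]] f(2) by simp
  qed
  obtain J where J: "right_ideal J" "I \<inter> J = {0}" "\<And>x. x \<in> soc \<Longrightarrow> \<exists>y\<in>I. x - y \<in> J" using socle_complement[OF I] by metis
  obtain f where f: "f \<in> bimult" "z - f (z * x) \<in> J" using J(3)[OF z(1)] by (auto simp: I_def)
  define e where "e = f x"
  have ze: "z * e = f (z * x)" unfolding e_def using bimult_central[OF f(1) z(2)] by simp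
  then have eI: "z * e \<in> I" using II[OF f(1)] by simp
  have eJ: "z * (1 - e) \<in> J" using f(2) ze by (simp add: right_diff_distrib)
  have l: "z * ((1 - e) * y) = 0" if "z * y \<in> I" for y
  proof -
    have "z * ((1 - e) * y) \<in> J" using right_idealD(3)[OF J(1) eJ, of y] by (simp add: mult.assoc)
    moreover have "z * ((1 - e) * y) \<in> I" using Il[OF that, of "1 - e"] zl by simp
    ultimately show ?thesis using J(2) by blast
  qed
  have r: "z * (y * (1 - e)) = 0" if y: "z * y \<in> I" for y
  proof -
    define t where "t = y * (1 - e)"
    have T: "right_ideal (range ((*) (z * t)))"
      unfolding right_ideal_def
    proof (intro conjI ballI allI)
      show "0 \<in> range ((*) (z * t))" by (rule range_eqI[of _ _ 0]) simp
      fix u assume "u \<in> range ((*) (z * t))"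
      then obtain u' where u: "u = z * t * u'" by blast
      show "u * a \<in> range ((*) (z * t))" for a by (rule range_eqI[of _ _ "u' * a"]) (simp add: u mult.assoc)
      fix v assume "v \<in> range ((*) (z * t))"
      then obtain v' where "v = z * t * v'" by blast
      then show "u - v \<in> range ((*) (z * t))" by (intro range_eqI[of _ _ "u' - v'"]) (simp add: u right_diff_distrib)
    qed
    obtain J' where J': "right_ideal J'" "range ((*) (z * t)) \<inter> J' = {0}" "\<And>x. x \<in> soc \<Longrightarrow> \<exists>y\<in>range ((*) (z * t)). x - y \<in> J'"
      using socle_complement[OF T] by metis
    obtain a where a: "z - z * t * a \<in> J'" using J'(3)[OF z(1)] by blast
    have "z * (a * y) \<in> I" using Il[OF y, of a] zl by simp
    then have "y * (z * ((1 - e) * (a * y))) * (1 - e) = 0" using l by simp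
    then have "z * t * a * t = 0" unfolding t_def using zl by (simp add: mult.assoc)
    then have "z * t \<in> J'" using right_idealD(3)[OF J'(1) a, of t] by (simp add: left_diff_distrib)
    moreover have "z * t \<in> range ((*) (z * t))" by (rule range_eqI[of _ _ 1]) simp
    ultimately show ?thesis using J'(2) unfolding t_def by blast
  qed
  \<comment> \<open>For \<open>w\<close>, the commutator of \<open>e\<close> and \<open>a\<close>,
    the products of \<open>z * w\<close> with 1 - e and with \<open>e\<close> both vanish, by
    \<open>r\<close> and \<open>l\<close>; so \<open>z * w\<close> is zero.\<close>
  have "z * e * a = a * (z * e)" for a
  proof -
    define w where "w = e * a - a * e"
    have ea: "z * (a * e) \<in> I" using Il[OF eI, of a] zl by simp
    have "z * w \<in> I"
      using right_idealD(2)[OF I right_idealD(3)[OF I eI, of a] ea] by (simp add: w_def right_diff_distrib mult.assoc)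
    then have 1: "z * (w * (1 - e)) = 0" by (rule r)
    have "w = a * (1 - e) - (1 - e) * a" by (simp add: w_def algebra_simps)
    then have "z * (w * e) = a * (z * ((1 - e) * e)) - z * ((1 - e) * (a * e))"
      using zl by (simp add: left_diff_distrib right_diff_distrib mult.assoc)
    then have "z * (w * e) = 0" using l[OF eI] l[OF ea] by simp
    then have "z * w = 0" using 1 by (simp add: right_diff_distrib)
    then show ?thesis using zl[of a e] by (simp add: w_def right_diff_distrib mult.assoc)
  qed
  then have "z * e \<in> alg_center" by (simp add: alg_center_def)
  moreover have "z \<notin> range ((*) (z * e))"
  proof
    assume "z \<in> range ((*) (z * e))"
    then obtain d where "z = z * e * d" by blast
    then have "z \<in> I" using right_idealD(3)[OF I eI, of d] by simp
    then obtain h where "h \<in> bimult" "z = h (z * x)" unfolding I_def by blast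
    then show False using x(2)[of h] by simp
  qed
  moreover have "z \<notin> range ((*) (z * (1 - e)))"
  proof
    assume "z \<in> range ((*) (z * (1 - e)))"
    then obtain d where d: "z = z * (1 - e) * d" by blast
    have "z * x \<in> I" using II[OF bimult_id] .
    then have "z * (d * x) \<in> I" using Il[of _ d] zl by simp
    then have "z * (1 - e) * d * x = 0" using l[of "d * x"] by (simp add: mult.assoc)
    then show False using d x(1) by simp
  qed
  ultimately show ?thesis by (rule that)
qed

end

context symmetrized_algebra
begin

text \<open>Unless \<open>z\<close> generates a simple bimodule, \<open>socle_split\<close> writes
  it as a sum of two central elements of the socle. Neither of their ideals contains
  \<open>z\<close>, so both have smaller dimension.\<close>

lemma socle_mult_comm:
  assumes "z \<in> soc" "z \<in> alg_center" "b ^ (p ^ r) \<in> comm"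
  shows "z * b \<in> comm"
  using assms(1,2)
proof (induction "dim (range ((*) z))" arbitrary: z rule: less_induct)
  case less
  show ?case
  proof (cases "\<forall>x. z * x \<noteq> 0 \<longrightarrow> (\<exists>f\<in>bimult. f (z * x) = z)")
    case True
    then have "simple_central scale p z" using less.prems(2) by unfold_locales auto
    then show ?thesis by (rule simple_central_mult_comm[OF _ assms(3)])
  next
    case False
    then obtain x where x: "z * x \<noteq> 0" "\<And>f. f \<in> bimult \<Longrightarrow> f (z * x) \<noteq> z" by blast
    obtain e where e: "z * e \<in> alg_center" "z \<notin> range ((*) (z * e))" "z \<notin> range ((*) (z * (1 - e)))"
      by (rule socle_split[OF less.prems x(1)]) (use x(2) in blast)+
    have e': "z * (1 - e) \<in> alg_center"
      using less.prems(2) e(1) by (simp add: alg_center_def right_diff_distrib left_diff_distrib)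
    have lt: "dim (range ((*) (z * c))) < dim (range ((*) z))" if "z \<notin> range ((*) (z * c))" for c
    proof (rule subspace_dim_less)
      show "subspace (range ((*) (z * c)))" "subspace (range ((*) z))" by (rule subspace_mult[OF subspace_UNIV])+
      have "range ((*) (z * c)) \<subseteq> range ((*) z)" by (auto simp: mult.assoc)
      moreover have "z \<in> range ((*) z)" by (rule range_eqI[of _ _ 1]) simp
      ultimately show "range ((*) (z * c)) \<subset> range ((*) z)" using that by blast
    qed
    have "z * e * b \<in> comm" by (rule less.hyps[OF lt[OF e(2)] socle_mult[OF less.prems(1)] e(1)])
    moreover have "z * (1 - e) * b \<in> comm" by (rule less.hyps[OF lt[OF e(3)] socle_mult[OF less.prems(1)] e'])
    ultimately have "z * e * b + z * (1 - e) * b \<in> comm" by (rule comm_add)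
    then show ?thesis by (simp add: algebra_simps)
  qed
qed

lemma R_alg_eq_socle: "R_alg scale p = soc \<inter> alg_center"
proof (intro equalityI subsetI)
  fix z assume z: "z \<in> soc \<inter> alg_center"
  then show "z \<in> R_alg scale p" using socle_mult_comm by (simp add: R_alg_def K_alg_def)
next
  fix z assume z: "z \<in> R_alg scale p"
  then have zk: "z * b \<in> comm" if "b ^ (p ^ r) \<in> comm" for b r using that by (simp add: R_alg_def K_alg_def)
  have "z \<in> soc"
  proof (rule ccontr)
    assume "z \<notin> soc"
    then obtain l where l: "functional scale l" "\<forall>x\<in>soc. l x = 0" "l z = 1"
      using functional_separating[OF subspace_socle] by blast
    obtain w where w: "\<And>x. l x = \<epsilon> (w * x)" using eps_representation[OF l(1)] by metis
    have "w * s = 0" if "s \<in> soc" for s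
    proof (rule eps_nondegenerate)
      fix b show "\<epsilon> (w * s * b) = 0" using l(2) socle_mult[OF that, of b] w by (simp add: mult.assoc)
    qed
    then obtain n where n: "w ^ n = 0" using socle_annihilator_nilpotent by blast
    \<comment> \<open>A nilpotency exponent \<open>n\<close> is below p^n, so r = n is a suitable
      choice in the definition of \<open>R_alg\<close>.\<close>
    have "n < p ^ n" using prime_p prime_gt_1_nat by (intro power_gt_expt) auto
    then have "w ^ (p ^ n) = w ^ n * w ^ (p ^ n - n)" by (simp flip: power_add)
    then have "w ^ (p ^ n) \<in> comm" using n comm_0 by simp
    then have "\<epsilon> (z * w) = 0" by (intro eps_comm zk)
    then show False using l(3) w eps_commute[of z w] by simp
  qed
  then show "z \<in> soc \<inter> alg_center" using z by (simp add: R_alg_def K_alg_def)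
qed

end

text \<open>Elements of \<open>R_alg\<close> are central by definition, whereas the sum of the
  minimal right ideals need not be central (for a matrix algebra it is everything); hence the socle
  is intersected with the center.\<close>

theorem corollary6p10:
  fixes scale :: "'k::field \<Rightarrow> 'a::{ring,monoid_mult} \<Rightarrow> 'a" and p :: nat
  assumes char: "CHAR('k) = p" "p > 0"
    and symmetric: "symmetric_algebra scale"
    and universe: "infinite (UNIV :: 'm set)" "\<exists>\<iota> :: 'a \<Rightarrow> 'm. inj \<iota>"
  shows "(\<forall>r. HK0 TYPE('m) scale p r = K_alg scale p r) \<and>
    HR0 TYPE('m) scale p = R_alg scale p \<and>
    R_alg scale p = alg_socle scale \<inter> alg_center"
proof -
  interpret symmetric_algebra scale by (rule symmetric)
  obtain \<epsilon> where "symmetrized_algebra scale p \<epsilon>" using symmetrizing_functional[OF char] .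
  then interpret symmetrized_algebra scale p \<epsilon> .
  have HK: "HK0 TYPE('m) scale p r = K_alg scale p r" for r
    using universe(2) HK0_eq_K_alg[OF universe(1)] by blast
  have "HR0 TYPE('m) scale p = (\<Inter>r. HK0 TYPE('m) scale p r)"
    by (auto simp: HR0_def HK0_def R_cat_def)
  then have "HR0 TYPE('m) scale p = R_alg scale p" by (simp add: HK R_alg_def)
  then show ?thesis using HK R_alg_eq_socle by blast
qed

end
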